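(* Let $p\in(1,+\infty)$, and let $C_p>0$ be a constant such that for every $f\in B_b(0,T;C_0^\infty(\mathbb{R}^N))$ the unique solution $u$ of $\partial_tu=L^{\mathrm{ou}}u+f$ on $(0,T)\times\mathbb{R}^N$, $u(0,\cdot)=0$, satisfies $$\|u\|_{\dot W^{2,p}_\alpha}\le C_p\,\|f\|_{L^p((0,T)\times\mathbb{R}^N)} .$$ Let $t\mapsto S(t)$, $t\in[0,T]$, be a continuous map with values in the symmetric non-negative definite $N\times N$ real matrices. Then for every $f\in B_b(0,T;C_0^\infty(\mathbb{R}^N))$ the unique solution $u_S$ of $$\partial_tu_S(t,z)=L^{\mathrm{ou},S}_tu_S(t,z)+f(t,z)\ \text{ on }(0,T)\times\mathbb{R}^N,\qquad u_S(0,z)=0\ \text{ on }\mathbb{R}^N,$$ satisfies, with the same constant $C_p$, $$\|u_S\|_{\dot W^{2,p}_\alpha}\le C_p\,\|f\|_{L^p((0,T)\times\mathbb{R}^N)} .$$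
   Context: Fix $T>0$ and $\mathbb{R}^N=\mathbb{R}^{d_0}\times\mathbb{R}^{d_1}$, $d_0+d_1=N$, with $d_1=\sum_{i=1}^k\mathfrak{d}_i$ for positive integers $\mathfrak{d}_1,\dots,\mathfrak{d}_k$, and $\mathfrak{d}_0=d_0\ge1$. Write $z=(x,y)=(x,y_1,\dots,y_k)$ with $x\in\mathbb{R}^{d_0}$, $y_i\in\mathbb{R}^{\mathfrak{d}_i}$. Let $B=\begin{pmatrix}B_0&0\\0&0\end{pmatrix}\in\mathbb{R}^{N\times N}$, where $B_0$ is a symmetric $d_0\times d_0$ matrix with $\nu|\xi|^2\le\langle B_0\xi,\xi\rangle\le\nu^{-1}|\xi|^2$ for all $\xi\in\mathbb{R}^{d_0}$, for some $\nu>0$. Let $A\in\mathbb{R}^{N\times N}$ be the matrix which, in the block decomposition $\mathbb{R}^N=\mathbb{R}^{\mathfrak{d}_0}\times\mathbb{R}^{\mathfrak{d}_1}\times\dots\times\mathbb{R}^{\mathfrak{d}_k}$, has only subdiagonal blocks: $$A=\begin{pmatrix}0&0&\cdots&\cdots&0\\ \mathscr{A}^1&0&\ddots&&\vdots\\ 0&\mathscr{A}^2&0&\ddots&\vdots\\ \vdots&\ddots&\ddots&\ddots&0\\ 0&\cdots&0&\mathscr{A}^k&0\end{pmatrix},$$ where $\mathscr{A}^i$ is a $\mathfrak{d}_i\times\mathfrak{d}_{i-1}$ matrix of rank $\mathfrak{d}_i$ for $i=1,\dots,k$ (so that $A,B$ satisfy the Kalman condition $\mathrm{Rank}[B,AB,\dots,A^kB]=N$).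 Operators: $$L^{\mathrm{ou}}f(z)=\mathrm{Tr}(BD^2f(z))+\langle Az,Df(z)\rangle,\qquad L_t^{\mathrm{ou},S}f(z)=L^{\mathrm{ou}}f(z)+\mathrm{Tr}(S(t)D^2f(z)),$$ with $D^2$ the full spatial Hessian. $B_b(0,T;C_0^\infty(\mathbb{R}^N))$ is the space of bounded Borel functions $\phi:[0,T]\times\mathbb{R}^N\to\mathbb{R}$ such that: $\phi(t,\cdot)$ is smooth with compact support for every $t$; for each $n\in\mathbb{N}$ the $C^n(\mathbb{R}^N)$-norms of $\phi(t,\cdot)$ are bounded uniformly in $t$; the supports of all $\phi(t,\cdot)$ lie in one common ball; and for every $z$ the map $t\mapsto\phi(t,z)$ is continuous except at finitely many points of $[0,T]$. Notion of solution: a solution of $\partial_tv=\mathcal{L}_tv+f$, $v(0,\cdot)=0$, is a bounded continuous function $v:[0,T]\times\mathbb{R}^N\to\mathbb{R}$ with $v(t,\cdot)\in C^2(\mathbb{R}^N)$ for every $t\in[0,T]$ and $v(t,z)=\int_0^t\big(f(s,z)+\mathcal{L}_sv(s,z)\big)ds$ for all $(t,z)\in[0,T]\times\mathbb{R}^N$. For $i\in\{1,\dots,k\}$ let $E_i:\mathbb{R}^{\mathfrak{d}_i}\to\mathbb{R}^N$ be the canonical embedding in the component $y_i$ (adjoint of $z\mapsto y_i$), and for $\beta\in(0,1)$ set $$\Delta_{y_i}^\beta\phi(z)=\mathrm{p.v.}\int_{\mathbb{R}^{\mathfrak{d}_i}}[\phi(z+E_iw)-\phi(z)]\frac{dw}{|w|^{\mathfrak{d}_i+2\beta}}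 .$$ For functions of $(t,z)$ it acts on $z$ at fixed $t$. Put $\alpha_i=\frac1{1+2i}$, $\alpha=(\alpha_1,\dots,\alpha_k)$, and $$\|\varphi\|_{\dot W^{2,p}_\alpha}^p=\|\Delta_x\varphi\|_{L^p((0,T)\times\mathbb{R}^N)}^p+\sum_{i=1}^k\|\Delta_{y_i}^{\alpha_i}\varphi\|_{L^p((0,T)\times\mathbb{R}^N)}^p,$$ where $\Delta_x$ is the Laplacian in $x$ and the $L^p$ norms are with respect to Lebesgue measure. A finite constant $C_p=C_p(\nu,A,d_0,d_1)$ with the property assumed for the unperturbed problem is known to exist. *)

theory Defs
  imports "HOL-Analysis.Analysis"
begin

text \<open>
  The space of dimension \<open>N\<close> is \<open>real ^ 'n\<close>. Its splitting into the components
  \<open>x = y\<^sub>0, y\<^sub>1, \<dots>, y\<^sub>k\<close> is given by a labelling \<open>b\<close> of the coordinates: coordinate \<open>j\<close>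
  belongs to component \<open>b j\<close>. Surjectivity of \<open>b\<close> onto \<open>{0..k}\<close> says that all
  component dimensions are positive; they are otherwise arbitrary.
\<close>

definition block_decomposition :: "nat \<Rightarrow> ('n::finite \<Rightarrow> nat) \<Rightarrow> bool" where
  "block_decomposition k b \<longleftrightarrow> range b = {0..k}"

definition block :: "('n::finite \<Rightarrow> nat) \<Rightarrow> nat \<Rightarrow> 'n set" where
  "block b i = {j. b j = i}"

definition block_dim :: "('n::finite \<Rightarrow> nat) \<Rightarrow> nat \<Rightarrow> nat" where
  "block_dim b i = card (block b i)"

text \<open>The embedding \<open>E\<^sub>i\<close>; a vector of the \<open>i\<close>-th component is a function on \<open>block b i\<close>.\<close>

definition block_embed :: "('n::finite \<Rightarrow> nat) \<Rightarrow> nat \<Rightarrow> ('n \<Rightarrow> real) \<Rightarrow> real ^ 'n" where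
  "block_embed b i w = (\<chi> j. if j \<in> block b i then w j else 0)"

text \<open>The \<open>(i,l)\<close> block of a matrix, padded with zeros to full size, which does not affect its rank.\<close>

definition matrix_block ::
    "('n::finite \<Rightarrow> nat) \<Rightarrow> nat \<Rightarrow> nat \<Rightarrow> real ^ 'n ^ 'n \<Rightarrow> real ^ 'n ^ 'n" where
  "matrix_block b i l M = (\<chi> r c. if r \<in> block b i \<and> c \<in> block b l then M $ r $ c else 0)"

definition drift_matrix :: "nat \<Rightarrow> ('n::finite \<Rightarrow> nat) \<Rightarrow> real ^ 'n ^ 'n \<Rightarrow> bool" where
  "drift_matrix k b A \<longleftrightarrow>
     (\<forall>r c. b r \<noteq> b c + 1 \<longrightarrow> A $ r $ c = 0) \<and>
     (\<forall>i\<in>{1..k}. rank (matrix_block b i (i - 1) A) = block_dim b i)"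

definition diffusion_matrix :: "real \<Rightarrow> ('n::finite \<Rightarrow> nat) \<Rightarrow> real ^ 'n ^ 'n \<Rightarrow> bool" where
  "diffusion_matrix \<nu> b B \<longleftrightarrow>
     (\<forall>r c. \<not> (b r = 0 \<and> b c = 0) \<longrightarrow> B $ r $ c = 0) \<and>
     transpose B = B \<and>
     (\<forall>\<xi>\<in>range (block_embed b 0).
        \<nu> * (norm \<xi>)\<^sup>2 \<le> (B *v \<xi>) \<bullet> \<xi> \<and> (B *v \<xi>) \<bullet> \<xi> \<le> inverse \<nu> * (norm \<xi>)\<^sup>2)"

definition sym_nonneg_matrix :: "real ^ 'n ^ 'n::finite \<Rightarrow> bool" where
  "sym_nonneg_matrix M \<longleftrightarrow> transpose M = M \<and> (\<forall>\<xi>. 0 \<le> (M *v \<xi>) \<bullet> \<xi>)"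


definition pderiv_at :: "'n::finite \<Rightarrow> (real ^ 'n \<Rightarrow> real) \<Rightarrow> real ^ 'n \<Rightarrow> real" where
  "pderiv_at j g z = frechet_derivative g (at z) (axis j 1)"

definition iter_pderiv :: "'n::finite list \<Rightarrow> (real ^ 'n \<Rightarrow> real) \<Rightarrow> real ^ 'n \<Rightarrow> real" where
  "iter_pderiv js g = foldr pderiv_at js g"

definition C_class :: "nat \<Rightarrow> (real ^ 'n::finite \<Rightarrow> real) \<Rightarrow> bool" where
  "C_class m g \<longleftrightarrow>
     (\<forall>js. length js < m \<longrightarrow> (\<forall>z. iter_pderiv js g differentiable (at z))) \<and>
     (\<forall>js. length js \<le> m \<longrightarrow> continuous_on UNIV (iter_pderiv js g))"

definition gradient :: "(real ^ 'n::finite \<Rightarrow> real) \<Rightarrow> real ^ 'n \<Rightarrow> real ^ 'n" where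
  "gradient g z = (\<chi> j. pderiv_at j g z)"

definition hessian :: "(real ^ 'n::finite \<Rightarrow> real) \<Rightarrow> real ^ 'n \<Rightarrow> real ^ 'n ^ 'n" where
  "hessian g z = (\<chi> i j. pderiv_at i (pderiv_at j g) z)"

definition L_ou ::
    "real ^ 'n ^ 'n \<Rightarrow> real ^ 'n ^ 'n \<Rightarrow> (real ^ 'n::finite \<Rightarrow> real) \<Rightarrow> real ^ 'n \<Rightarrow> real" where
  "L_ou A B g z = trace (B ** hessian g z) + (A *v z) \<bullet> gradient g z"

definition L_ou_S ::
    "real ^ 'n ^ 'n \<Rightarrow> real ^ 'n ^ 'n \<Rightarrow> (real \<Rightarrow> real ^ 'n ^ 'n) \<Rightarrow>
     real \<Rightarrow> (real ^ 'n::finite \<Rightarrow> real) \<Rightarrow> real ^ 'n \<Rightarrow> real" where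
  "L_ou_S A B S t g z = L_ou A B g z + trace (S t ** hessian g z)"


text \<open>
  Functions on \<open>[0,T] \<times> real ^ 'n\<close> are total functions of which only the values with
  \<open>t \<in> {0..T}\<close> are ever used.
\<close>

definition Bb_space :: "real \<Rightarrow> (real \<Rightarrow> real ^ 'n::finite \<Rightarrow> real) set" where
  "Bb_space T = {\<phi>.
     bounded ((\<lambda>(t, z). \<phi> t z) ` ({0..T} \<times> UNIV)) \<and>
     (\<lambda>(t, z). \<phi> t z) \<in> borel_measurable (restrict_space borel ({0..T} \<times> UNIV)) \<and>
     (\<forall>t\<in>{0..T}. (\<forall>m. C_class m (\<phi> t)) \<and> compact (closure {z. \<phi> t z \<noteq> 0})) \<and>
     (\<forall>m. \<exists>M. \<forall>t\<in>{0..T}. \<forall>js. length js \<le> m \<longrightarrow> (\<forall>z. \<bar>iter_pderiv js (\<phi> t) z\<bar> \<le> M)) \<and>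
     (\<exists>R. \<forall>t\<in>{0..T}. closure {z. \<phi> t z \<noteq> 0} \<subseteq> cball 0 R) \<and>
     (\<forall>z. \<exists>F. finite F \<and> (\<forall>t\<in>{0..T} - F. continuous (at t within {0..T}) (\<lambda>s. \<phi> s z)))}"

text \<open>
  The integrability clause makes the integral meaningful: the Lebesgue integral of a
  non-integrable function is \<open>0\<close> by convention. The initial condition is the case \<open>t = 0\<close>.
\<close>

definition is_solution ::
    "real \<Rightarrow> (real \<Rightarrow> (real ^ 'n::finite \<Rightarrow> real) \<Rightarrow> real ^ 'n \<Rightarrow> real) \<Rightarrow>
     (real \<Rightarrow> real ^ 'n \<Rightarrow> real) \<Rightarrow> (real \<Rightarrow> real ^ 'n \<Rightarrow> real) \<Rightarrow> bool" where
  "is_solution T L f v \<longleftrightarrow>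
     bounded ((\<lambda>(t, z). v t z) ` ({0..T} \<times> UNIV)) \<and>
     continuous_on ({0..T} \<times> UNIV) (\<lambda>(t, z). v t z) \<and>
     (\<forall>t\<in>{0..T}. C_class 2 (v t)) \<and>
     (\<forall>t\<in>{0..T}. \<forall>z.
        set_integrable lborel {0..t} (\<lambda>s. f s z + L s (v s) z) \<and>
        v t z = (LINT s:{0..t}|lborel. f s z + L s (v s) z))"

definition is_unique_solution ::
    "real \<Rightarrow> (real \<Rightarrow> (real ^ 'n::finite \<Rightarrow> real) \<Rightarrow> real ^ 'n \<Rightarrow> real) \<Rightarrow>
     (real \<Rightarrow> real ^ 'n \<Rightarrow> real) \<Rightarrow> (real \<Rightarrow> real ^ 'n \<Rightarrow> real) \<Rightarrow> bool" where
  "is_unique_solution T L f u \<longleftrightarrow>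
     is_solution T L f u \<and>
     (\<forall>v. is_solution T L f v \<longrightarrow> (\<forall>t\<in>{0..T}. \<forall>z. v t z = u t z))"


definition laplacian_x :: "('n::finite \<Rightarrow> nat) \<Rightarrow> (real ^ 'n \<Rightarrow> real) \<Rightarrow> real ^ 'n \<Rightarrow> real" where
  "laplacian_x b g z = (\<Sum>j\<in>block b 0. pderiv_at j (pderiv_at j g) z)"

text \<open>
  The integral is over the \<open>i\<close>-th component, with product Lebesgue measure on \<open>block b i\<close>;
  the principal value is the limit of the integrals over \<open>\<epsilon> < |w|\<close>.
\<close>

definition frac_laplacian ::
    "('n::finite \<Rightarrow> nat) \<Rightarrow> nat \<Rightarrow> real \<Rightarrow> (real ^ 'n \<Rightarrow> real) \<Rightarrow> real ^ 'n \<Rightarrow> real" where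
  "frac_laplacian b i \<beta> g z =
     Lim (at_right 0) (\<lambda>\<epsilon>.
       LINT w:{w. \<epsilon> < norm (block_embed b i w)}|(Pi\<^sub>M (block b i) (\<lambda>_. lborel)).
         (g (z + block_embed b i w) - g z)
           / norm (block_embed b i w) powr (real (block_dim b i) + 2 * \<beta>))"

text \<open>Norms take values in \<open>ennreal\<close>, so that an upper bound by a finite value includes finiteness.\<close>

definition ennreal_root :: "real \<Rightarrow> ennreal \<Rightarrow> ennreal" where
  "ennreal_root p a = (if a = \<infinity> then \<infinity> else ennreal (enn2real a powr (1 / p)))"

definition Lp_integral :: "real \<Rightarrow> real \<Rightarrow> (real \<Rightarrow> real ^ 'n::finite \<Rightarrow> real) \<Rightarrow> ennreal" where
  "Lp_integral T p g =
     (\<integral>\<^sup>+ tz. ennreal (\<bar>g (fst tz) (snd tz)\<bar> powr p) * indicator ({0<..<T} \<times> UNIV) tz \<partial>lborel)"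

definition Lp_norm :: "real \<Rightarrow> real \<Rightarrow> (real \<Rightarrow> real ^ 'n::finite \<Rightarrow> real) \<Rightarrow> ennreal" where
  "Lp_norm T p g = ennreal_root p (Lp_integral T p g)"

definition W_norm ::
    "real \<Rightarrow> real \<Rightarrow> nat \<Rightarrow> ('n::finite \<Rightarrow> nat) \<Rightarrow> (real \<Rightarrow> real ^ 'n \<Rightarrow> real) \<Rightarrow> ennreal" where
  "W_norm T p k b \<phi> =
     ennreal_root p
       (Lp_integral T p (\<lambda>t. laplacian_x b (\<phi> t)) +
        (\<Sum>i=1..k. Lp_integral T p (\<lambda>t. frac_laplacian b i (1 / (1 + 2 * real i)) (\<phi> t))))"

end

theory Submission
  imports Defs "HOL-Probability.Probability"
begin

text \<open>
  Let \<open>E t\<close> be the transposed exponential of the drift. In Fourier variables a solution is a superposition of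
  plane waves indexed by \<open>x = (s, \<xi>)\<close>, with amplitude \<open>kernel t x * F x\<close>, where \<open>F\<close> is the spatial
  Fourier transform of the source, and the operators \<open>\<Delta>\<^sub>x\<close>, \<open>\<Delta>\<^bsub>y\<^sub>i\<^esub>\<close> act as multipliers. The matrix \<open>S\<close>
  multiplies the kernel by \<open>exp (- \<integral>\<^sub>s\<^sup>t \<langle>S r \<eta> r, \<eta> r\<rangle> dr)\<close> with \<open>\<eta> r = E r (E (- s) \<xi>)\<close>.
  This factor is the characteristic function of a Gaussian increment, and the Gaussian can be replaced by
  finitely many coin tosses: a deterministic jump by \<open>v\<close> at time \<open>\<tau>\<close>, carried along the drift, is a translation of
  the source and of the solution that changes neither \<open>L\<^sup>p\<close> norm, and averaging over \<open>v\<close> and \<open>- v\<close>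
  produces the factor \<open>cos (v \<bullet> E (- s) \<xi>)\<close> if \<open>s < \<tau> \<le> t\<close> and preserves the estimate because the
  \<open>p\<close>-th power is convex. Products of such cosines converge to the Gaussian factor, and Fatou's lemma
  preserves the estimate in the limit, without changing the constant. A translated source is only admissible if it
  is piecewise continuous in time at each point, so \<open>f\<close> is first frozen on a time grid: then the translates jump
  only at finitely many times.

  Uniqueness: solutions are merely bounded with \<open>C\<^sup>2\<close> slices and absolutely continuous in time, so a parabolic
  maximum principle is obtained in the manner of Alexandrov, Bakelman and Pucci, by measuring the set of pairs
  (slope \<open>p\<close>, level \<open>h\<close>) at which the running maximum of \<open>w - p \<bullet> z\<close> increases:
  it contains a ball if \<open>w\<close> is positive somewhere, and is negligible because the time derivative is nonpositive
  at points of contact.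
\<close>

section \<open>Outer measure of Lipschitz images\<close>

text \<open>The obstacle to uniqueness: the integrated equation gives a time derivative only for
  almost every time, with an exceptional set that depends on \<open>z\<close>, and nothing controls
  second derivatives from one time to the next. At a maximum point the equation may therefore fail.
  What survives is a statement at fixed \<open>z\<close> for almost every level; Fubini's theorem
  assembles these in (point, level) space, and a Lipschitz map, whose constant comes from a
  semiconvexity bound, carries the null set to (slope, level) space. Uniqueness is needed twice: the
  hypothesis speaks of unique solutions, so it applies to an explicit Fourier solution only once
  that one is known to be unique, and the conclusion asserts uniqueness as well.

  Why translation requires freezing: a jump carried along the drift moves the point of evaluation
  along a curve. A source continuous in time off a finite set that depends on the point can meet
  infinitely many exceptional times along such a curve; a source frozen on a grid has exceptional
  times independent of the point.\<close>

text \<open>Each small cube of a cover of \<open>S\<close> is replaced by a cube around one image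
  point. The image itself need not be measurable, hence the enclosing set \<open>V\<close>.\<close>

lemma lipschitz_image_outer_measure:
  fixes f :: "'a::euclidean_space \<Rightarrow> 'a"
  assumes S: "S \<in> lmeasurable" "bounded S" and L: "0 \<le> L"
    and lip: "\<And>x y. x \<in> S \<Longrightarrow> y \<in> S \<Longrightarrow> norm (f x - f y) \<le> L * norm (x - y)"
    and e: "0 < e"
  shows "\<exists>V. f ` S \<subseteq> V \<and> V \<in> lmeasurable \<and>
           measure lebesgue V \<le> (2 * L * DIM('a)) ^ DIM('a) * (measure lebesgue S + e)"
proof -
  obtain K0 where K0: "\<And>x. x \<in> S \<Longrightarrow> norm x \<le> K0"
    using S(2) bounded_iff by blast
  define K where "K = max 1 K0"
  have K: "0 < K" "\<And>x. x \<in> S \<Longrightarrow> norm x \<le> K" using K0 by (force simp: K_def)+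
  \<comment> \<open>A cube centred at the origin makes every dyadic cell of the cover a cube, with
    the same side \<open>s\<close> in all directions, so the volume of an image box can be compared
    with that of its cell.\<close>
  define a b :: 'a where "a = - K *\<^sub>R One" and "b = K *\<^sub>R One"
  have ab: "b \<bullet> i = K" "a \<bullet> i = - K" if "i \<in> Basis" for i
    using that by (auto simp: a_def b_def)
  have SS: "S \<subseteq> cbox a b"
  proof
    fix x assume "x \<in> S"
    then show "x \<in> cbox a b" using K(2)[of x]
      by (auto simp: mem_box ab) (smt (verit, best) Basis_le_norm)+
  qed
  obtain D where D: "countable D"
     "\<And>k. k \<in> D \<Longrightarrow> k \<subseteq> cbox a b \<and> k \<noteq> {} \<and> (\<exists>c d. k = cbox c d)"
     "pairwise (\<lambda>A B. interior A \<inter> interior B = {}) D"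
     "\<And>u v. cbox u v \<in> D \<Longrightarrow> \<exists>n. \<forall>i \<in> Basis. v \<bullet> i - u \<bullet> i = (b \<bullet> i - a \<bullet> i)/2^n"
     "S \<subseteq> \<Union>D" "\<Union>D \<in> lmeasurable" "measure lebesgue (\<Union>D) \<le> measure lebesgue S + e"
    using measurable_outer_intervals_bounded[OF S(1) SS e] by metis
  define c where "c = (2 * L * DIM('a)) ^ DIM('a)"
  have c0: "0 \<le> c" using L by (simp add: c_def)
  have "\<exists>V. f ` (S \<inter> k) \<subseteq> V \<and> V \<in> lmeasurable \<and> measure lebesgue V \<le> c * measure lebesgue k"
    if k: "k \<in> D" for k
  proof (cases "S \<inter> k = {}")
    case True
    then show ?thesis by (intro exI[of _ "{}"]) (auto intro!: mult_nonneg_nonneg c0)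
  next
    case False
    then obtain x0 where x0: "x0 \<in> S" "x0 \<in> k" by auto
    obtain u v where kuv: "k = cbox u v" using D(2)[OF k] by auto
    obtain n where n: "\<And>i. i \<in> Basis \<Longrightarrow> v \<bullet> i - u \<bullet> i = (b \<bullet> i - a \<bullet> i)/2^n"
      using D(4) k kuv by metis
    define s where "s = 2 * K / 2^n"
    have s: "0 < s" "\<And>i. i \<in> Basis \<Longrightarrow> v \<bullet> i - u \<bullet> i = s"
      using n K(1) by (auto simp: s_def ab)
    have meask: "measure lebesgue k = s ^ DIM('a)"
    proof -
      have "\<forall>i\<in>Basis. u \<bullet> i \<le> v \<bullet> i" using s by (metis diff_ge_0_iff_ge less_imp_le)
      then show ?thesis using kuv s by (simp add: measure_lborel_cbox_eq inner_diff_left)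
    qed
    \<comment> \<open>Points of a cell of side \<open>s\<close> differ by at most
      \<open>DIM('a) * s\<close> in norm, by summing coordinates. The image cube has side
      \<open>2 * r\<close>, which produces the factor
      \<open>(2 * L * DIM('a)) ^ DIM('a)\<close>.\<close>
    define r where "r = L * DIM('a) * s"
    have r0: "0 \<le> r" using L s by (simp add: r_def)
    define V where "V = cbox (f x0 - r *\<^sub>R One) (f x0 + r *\<^sub>R One)"
    have "f ` (S \<inter> k) \<subseteq> V"
    proof clarify
      fix y assume y: "y \<in> S" "y \<in> k"
      have "\<bar>(y - x0) \<bullet> i\<bar> \<le> s" if "i \<in> Basis" for i
        using y x0 that s(2)[OF that] unfolding kuv mem_box inner_diff_left
        by (smt (verit, best))
      then have "norm (y - x0) \<le> DIM('a) * s"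
        using norm_le_l1[of "y - x0"] sum_mono[of Basis "\<lambda>i. \<bar>(y - x0) \<bullet> i\<bar>" "\<lambda>_. s"]
        by simp
      then have "norm (f y - f x0) \<le> r"
        using lip[OF y(1) x0(1)] L mult_left_mono[of "norm (y - x0)" "DIM('a) * s" L]
        by (simp add: r_def mult.assoc)
      then have *: "\<bar>(f y - f x0) \<bullet> i\<bar> \<le> r" if "i \<in> Basis" for i
        using Basis_le_norm[OF that] order_trans by blast
      show "f y \<in> V"
        unfolding V_def mem_box
      proof
        fix i :: 'a assume i: "i \<in> Basis"
        show "(f x0 - r *\<^sub>R One) \<bullet> i \<le> f y \<bullet> i \<and> f y \<bullet> i \<le> (f x0 + r *\<^sub>R One) \<bullet> i"
          using *[OF i] i by (simp add: inner_diff_left inner_add_left) linarith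
      qed
    qed
    moreover have "measure lebesgue V = (2 * r) ^ DIM('a)"
      using r0 by (simp add: V_def measure_lborel_cbox_eq inner_diff_left inner_add_left)
    then have "measure lebesgue V = c * measure lebesgue k"
      by (simp add: c_def meask r_def power_mult_distrib mult_ac)
    ultimately show ?thesis
      by (intro exI[of _ V]) (auto simp: V_def)
  qed
  then obtain V where V: "\<And>k. k \<in> D \<Longrightarrow> f ` (S \<inter> k) \<subseteq> V k"
     "\<And>k. k \<in> D \<Longrightarrow> V k \<in> lmeasurable" "\<And>k. k \<in> D \<Longrightarrow> measure lebesgue (V k) \<le> c * measure lebesgue k"
    by metis
  have cbD: "k \<in> lmeasurable" if "k \<in> D" for k using D(2)[OF that] by auto
  \<comment> \<open>A bound uniform over finite subfamilies passes to the countable union, both for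
    finiteness of the measure and for its value.\<close>
  have bnd: "measure lebesgue (\<Union>k\<in>I. V k) \<le> c * (measure lebesgue S + e)"
    if I: "I \<subseteq> D" "finite I" for I
  proof -
    have "measure lebesgue (\<Union>k\<in>I. V k) \<le> (\<Sum>k\<in>I. measure lebesgue (V k))"
      using I V(2) by (intro measure_UNION_le) (auto intro: fmeasurableD)
    also have "\<dots> \<le> (\<Sum>k\<in>I. c * measure lebesgue k)"
      using I V(3) by (intro sum_mono) auto
    also have "\<dots> = c * (\<Sum>k\<in>I. measure lebesgue k)" by (simp add: sum_distrib_left)
    also have "(\<Sum>k\<in>I. measure lebesgue k) = measure lebesgue (\<Union>I)"
    proof (rule measure_negligible_finite_Union[symmetric])
      show "finite I" by fact
      show "S \<in> lmeasurable" if "S \<in> I" for S using I cbD that by blast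
      show "pairwise (\<lambda>S T. negligible (S \<inter> T)) I"
      proof (rule pairwiseI)
        fix A B assume AB: "A \<in> I" "B \<in> I" "A \<noteq> B"
        then obtain u v u' v' where uv: "A = cbox u v" "B = cbox u' v'" using I D(2) by (meson subset_iff)
        obtain p q where pq: "A \<inter> B = cbox p q" unfolding uv using Int_interval by blast
        have "interior A \<inter> interior B = {}"
          using D(3) I AB by (auto simp: pairwise_def)
        then have "box p q = {}" using pq by (metis interior_Int interior_cbox)
        then show "negligible (A \<inter> B)" unfolding pq by (simp add: negligible_interval)
      qed
    qed
    also have "measure lebesgue (\<Union>I) \<le> measure lebesgue (\<Union>D)"
      using I cbD D(6) by (intro measure_mono_fmeasurable fmeasurableD) (auto intro!: fmeasurable.finite_Union)
    also have "\<dots> \<le> measure lebesgue S + e" by fact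
    finally show ?thesis using c0 by (simp add: mult_left_mono)
  qed
  have "f ` S \<subseteq> (\<Union>k\<in>D. V k)"
  proof
    fix y assume "y \<in> f ` S"
    then obtain x where x: "x \<in> S" "y = f x" by auto
    then obtain k where k: "k \<in> D" "x \<in> k" using D(5) by auto
    then have "y \<in> V k" using V(1)[OF k(1)] x by auto
    then show "y \<in> (\<Union>k\<in>D. V k)" using k(1) by auto
  qed
  moreover have "(\<Union>k\<in>D. V k) \<in> lmeasurable"
    by (rule fmeasurable_UN_bound[OF D(1) V(2) bnd])
  moreover have "measure lebesgue (\<Union>k\<in>D. V k) \<le> c * (measure lebesgue S + e)"
    by (rule measure_UN_bound[OF D(1) V(2) bnd])
  ultimately show ?thesis unfolding c_def by blast
qed

text \<open>Between two points of \<open>E\<close> inside one interval the increment of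
  \<open>\<phi>\<close> is nonnegative, by the running-maximum property, and at most the integral of
  the positive part of \<open>g\<close>. That positive part vanishes on \<open>E\<close>, so
  intervals that cover its zero set with little excess carry little of its integral.\<close>

lemma negligible_image_running_maximum:
  fixes \<phi> g :: "real \<Rightarrow> real"
  assumes g: "g absolutely_integrable_on {0..T}"
    and \<phi>: "\<And>t. t \<in> {0..T} \<Longrightarrow> \<phi> t = \<phi> 0 + integral {0..t} g"
    and E: "E \<subseteq> {0..T}" "\<And>t s. t \<in> E \<Longrightarrow> 0 \<le> s \<Longrightarrow> s \<le> t \<Longrightarrow> \<phi> s \<le> \<phi> t" "\<And>t. t \<in> E \<Longrightarrow> g t \<le> 0"
  shows "negligible (\<phi> ` E)"
proof -
  have gint: "g integrable_on {0..T}" using g absolutely_integrable_on_def by blast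
  define gp where "gp = (\<lambda>s. max 0 (g s))"
  have gp: "gp absolutely_integrable_on {0..T}"
    unfolding gp_def using absolutely_integrable_max_1[OF _ g] by simp
  have gpi: "gp integrable_on {0..T}" using gp absolutely_integrable_on_def by blast
  have gp0: "0 \<le> gp s" for s by (simp add: gp_def)
  \<comment> \<open>Unlike \<open>E\<close>, the zero set of the positive part is known to be
    measurable, so it is the set to be covered.\<close>
  define E' where "E' = {s\<in>{0..T}. gp s \<le> 0}"
  have gm: "gp \<in> borel_measurable (lebesgue_on {0..T})"
    using gpi integrable_imp_measurable by blast
  have E'm: "E' \<in> lmeasurable"
  proof -
    have "{x \<in> space (lebesgue_on {0..T}). gp x \<le> 0} \<in> sets (lebesgue_on {0..T})"
      using gm by measurable
    then have "E' \<in> sets lebesgue" unfolding E'_def by (auto simp: sets_restrict_space_iff)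
    moreover have "E' \<subseteq> {0..T}" by (auto simp: E'_def)
    ultimately show ?thesis by (metis bounded_closed_interval bounded_set_imp_lmeasurable bounded_subset)
  qed
  have EE': "E \<subseteq> E'" using E by (auto simp: E'_def gp_def)
  have gsub: "gp absolutely_integrable_on X" if "X \<in> sets lebesgue" "X \<subseteq> {0..T}" for X
    using set_integrable_subset[OF gp that] .
  show ?thesis
    unfolding negligible_outer_le
  proof (intro allI impI)
    fix e :: real assume e: "0 < e"
    \<comment> \<open>Absolute continuity of the integral by truncation: over a set \<open>X\<close>
      the function \<open>gp\<close> integrates to at most the integral of its excess over
      \<open>n\<close>, plus \<open>n\<close> times the measure of \<open>X\<close>.\<close>
    have "\<exists>n::nat. integral {0..T} (\<lambda>s. max 0 (gp s - n)) < e/4"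
    proof -
      have "(\<lambda>n::nat. integral {0..T} (\<lambda>s. max 0 (gp s - n))) \<longlonglongrightarrow> integral {0..T} (\<lambda>s. 0::real)"
      proof (rule dominated_convergence(2)[where h=gp])
        show "(\<lambda>s. max 0 (gp s - real n)) integrable_on {0..T}" for n
        proof -
          have "(\<lambda>s. gp s - real n) absolutely_integrable_on {0..T}"
            by (intro set_integral_diff gp) (auto intro!: absolutely_integrable_on_const)
          from absolutely_integrable_max_1[OF _ this, of "\<lambda>_. 0"] show ?thesis
            using absolutely_integrable_on_def by fastforce
        qed
        show "(\<lambda>n. max 0 (gp x - real n)) \<longlonglongrightarrow> 0" if "x \<in> {0..T}" for x
        proof (rule tendsto_eventually)
          show "\<forall>\<^sub>F n in sequentially. max 0 (gp x - real n) = 0"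
            using eventually_ge_at_top[of "nat \<lceil>gp x\<rceil>"]
            by eventually_elim linarith
        qed
      qed (use gpi gp0 in \<open>auto simp: max_def\<close>)
      then have "\<forall>\<^sub>F n in sequentially. integral {0..T} (\<lambda>s. max 0 (gp s - real n)) < e/4"
        using e by (intro order_tendstoD(2)) auto
      then show ?thesis by (meson eventually_sequentially order_refl)
    qed
    then obtain n :: nat where n: "integral {0..T} (\<lambda>s. max 0 (gp s - n)) < e/4" by blast
    define d where "d = e / (4 * (real n + 1))"
    have d: "0 < d" "real n * d \<le> e/4" using e by (auto simp: d_def field_simps)
    have tr: "(\<lambda>s. max 0 (gp s - n)) absolutely_integrable_on {0..T}"
    proof -
      have "(\<lambda>s. gp s - real n) absolutely_integrable_on {0..T}"
        by (intro set_integral_diff gp) (auto intro!: absolutely_integrable_on_const)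
      from absolutely_integrable_max_1[OF _ this, of "\<lambda>_. 0"] show ?thesis by simp
    qed
    have small: "integral X gp \<le> e/2" if X: "X \<in> lmeasurable" "X \<subseteq> {0..T}" "measure lebesgue X \<le> d" for X
    proof -
      have "integral X gp \<le> integral X (\<lambda>s. max 0 (gp s - n) + real n)"
      proof (rule integral_le)
        show "gp integrable_on X" using gsub X by (auto simp: absolutely_integrable_on_def fmeasurableD)
        show "(\<lambda>s. max 0 (gp s - n) + real n) integrable_on X"
          using set_integrable_subset[OF tr] X
          by (intro integrable_add) (auto simp: absolutely_integrable_on_def fmeasurableD integrable_on_const)
      qed auto
      also have "\<dots> = integral X (\<lambda>s. max 0 (gp s - n)) + integral X (\<lambda>s. real n)"
        using set_integrable_subset[OF tr] X
          by (intro integral_add) (auto simp: absolutely_integrable_on_def fmeasurableD integrable_on_const)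
      also have "integral X (\<lambda>s. real n) = measure lebesgue X * n"
        using X integral_mult_left[of X "\<lambda>_. 1::real" "real n"] by (simp add: lmeasure_integral)
      also have "integral X (\<lambda>s. max 0 (gp s - n)) \<le> integral {0..T} (\<lambda>s. max 0 (gp s - n))"
        using set_integrable_subset[OF tr] X tr
        by (intro integral_subset_le) (auto simp: absolutely_integrable_on_def fmeasurableD)
      finally show ?thesis using n d X(3) mult_right_mono[OF X(3), of n] by (simp add: mult.commute)
    qed
    have E'sub: "E' \<subseteq> cbox 0 T" by (auto simp: E'_def)
    obtain D where D: "countable D"
     "\<And>k. k \<in> D \<Longrightarrow> k \<subseteq> cbox 0 T \<and> k \<noteq> {} \<and> (\<exists>c d. k = cbox c d)"
     "pairwise (\<lambda>A B. interior A \<inter> interior B = {}) D"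
     "E' \<subseteq> \<Union>D" "\<Union>D \<in> lmeasurable" "measure lebesgue (\<Union>D) \<le> measure lebesgue E' + d"
      using measurable_outer_intervals_bounded[OF E'm E'sub d(1)] by metis
    have DT: "\<Union>D \<subseteq> {0..T}" using D(2) by fastforce
    have "integral (\<Union>D) gp = integral (\<Union>D - E') gp"
      using D(4) E'm by (intro integral_spike_set) (auto simp: E'_def gp0 order_antisym intro!: negligible_subset[of "{}"])
    also have "\<dots> \<le> e/2"
      using D DT E'm by (intro small) (auto simp: fmeasurable.Diff measurable_measure_Diff fmeasurableD)
    finally have Dsmall: "integral (\<Union>D) gp \<le> e/2" .
    have kk: "\<exists>u v. k = {u..v} \<and> u \<le> v \<and> 0 \<le> u \<and> v \<le> T" if "k \<in> D" for k
      
    proof -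
      have kD: "k \<in> D" by fact
      obtain u v where "k = {u..v}" using D(2)[OF kD] by auto
      then show ?thesis using D(2)[OF that] by auto
    qed
    have kmeas: "k \<in> sets lebesgue" if "k \<in> D" for k using kk[OF that] by auto
    have kint: "gp integrable_on k" if "k \<in> D" for k
      using kk[OF that] integrable_subinterval_real[OF gpi] by auto
    \<comment> \<open>The interval around one image point has length twice the integral of
      \<open>gp\<close> over the cell; the total is at most \<open>e\<close> because the integral
      over the whole cover is at most \<open>e/2\<close>.\<close>
    define V where "V k = (if E \<inter> k = {} then {} else cball (\<phi> (SOME t. t \<in> E \<inter> k)) (integral k gp))" for k
    have Vsub: "\<phi> ` (E \<inter> k) \<subseteq> V k" if k: "k \<in> D" for k
    proof (cases "E \<inter> k = {}")
      case False
      define t0 where "t0 = (SOME t. t \<in> E \<inter> k)"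
      have t0: "t0 \<in> E \<inter> k" unfolding t0_def using False by (meson ex_in_conv someI_ex)
      obtain u v where uv: "k = {u..v}" "u \<le> v" "0 \<le> u" "v \<le> T" using kk[OF k] by auto
      have *: "\<bar>\<phi> t - \<phi> s\<bar> \<le> integral k gp" if st: "s \<in> E \<inter> k" "t \<in> E \<inter> k" "s \<le> t" for s t
      proof -
        have le: "\<phi> s \<le> \<phi> t" using E(1,2) st by force
        have "t \<in> {0..T}" "s \<in> {0..T}" using st E(1) by auto
        then have "\<phi> t - \<phi> s = integral {0..t} g - integral {0..s} g"
          using \<phi>[of t] \<phi>[of s] by linarith
        also have "\<dots> = integral {s..t} g"
          using Henstock_Kurzweil_Integration.integral_combine[where a=0 and c=s and b=t and f=g] st(3)
            \<open>t \<in> {0..T}\<close> \<open>s \<in> {0..T}\<close> integrable_subinterval_real[OF gint, of 0 t] by auto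
        also have "\<dots> \<le> integral {s..t} gp"
        proof (rule integral_le)
          show "g integrable_on {s..t}" "gp integrable_on {s..t}" 
            using \<open>t \<in> {0..T}\<close> \<open>s \<in> {0..T}\<close>
            by (auto intro!: integrable_subinterval_real[OF gint] integrable_subinterval_real[OF gpi])
        qed (simp add: gp_def)
        also have "\<dots> \<le> integral k gp"
          using st uv gp0 kint[OF k] E(1)
          by (intro integral_subset_le) (auto intro!: integrable_subinterval_real[OF gpi])
        finally show ?thesis using le by simp
      qed
      have "dist (\<phi> t0) (\<phi> t) \<le> integral k gp" if "t \<in> E \<inter> k" for t
        using *[of t t0] *[of t0 t] that t0 by (cases "t \<le> t0") (auto simp: dist_real_def abs_minus_commute)
      then have "\<phi> ` (E \<inter> k) \<subseteq> cball (\<phi> t0) (integral k gp)" by auto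
      then show ?thesis using False by (simp add: V_def t0_def)
    qed (auto simp: V_def)
    have Vm: "V k \<in> lmeasurable" for k by (simp add: V_def)
    have Vmeas: "measure lebesgue (V k) \<le> 2 * integral k gp" if "k \<in> D" for k
    proof -
      have "0 \<le> integral k gp" using kint[OF that] gp0 by (intro integral_nonneg) auto
      then show ?thesis by (simp add: V_def cball_eq_atLeastAtMost)
    qed
    have bnd: "measure lebesgue (\<Union>k\<in>I. V k) \<le> e" if I: "I \<subseteq> D" "finite I" for I
    proof -
      have div: "I division_of \<Union>I"
        using I D(2,3) by (intro division_ofI) (auto simp: pairwise_def subset_iff)
      have "\<Union>I \<in> sets lebesgue" using I kmeas by (intro sets.finite_Union) auto
      then have iI: "gp integrable_on \<Union>I" using gsub[of "\<Union>I"] I DT by (auto simp: absolutely_integrable_on_def)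
      have "measure lebesgue (\<Union>k\<in>I. V k) \<le> (\<Sum>k\<in>I. measure lebesgue (V k))"
        using I Vm by (intro measure_UNION_le) (auto intro: fmeasurableD)
      also have "\<dots> \<le> (\<Sum>k\<in>I. 2 * integral k gp)"
        using I Vmeas by (intro sum_mono) auto
      also have "\<dots> = 2 * integral (\<Union>I) gp" 
        using integral_combine_division_topdown[OF iI div] by (simp add: sum_distrib_left)
      also have "integral (\<Union>I) gp \<le> integral (\<Union>D) gp"
        using I gsub[of "\<Union>D"] DT D(5) gp0 iI
        by (intro integral_subset_le) (auto simp: absolutely_integrable_on_def fmeasurableD)
      finally show ?thesis using Dsmall by simp
    qed
    have "\<phi> ` E \<subseteq> (\<Union>k\<in>D. V k)"
    proof
      fix y assume "y \<in> \<phi> ` E"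
      then obtain x where x: "x \<in> E" "y = \<phi> x" by auto
      then obtain k where k: "k \<in> D" "x \<in> k" using D(4) EE' by auto
      then have "y \<in> V k" using Vsub[OF k(1)] x by auto
      then show "y \<in> (\<Union>k\<in>D. V k)" using k(1) by auto
    qed
    moreover have "(\<Union>k\<in>D. V k) \<in> lmeasurable"
      by (rule fmeasurable_UN_bound[OF D(1) Vm bnd])
    moreover have "measure lebesgue (\<Union>k\<in>D. V k) \<le> e"
      by (rule measure_UN_bound[OF D(1) Vm bnd])
    ultimately show "\<exists>X. \<phi> ` E \<subseteq> X \<and> X \<in> lmeasurable \<and> measure lebesgue X \<le> e" by blast
  qed
qed

section \<open>A maximum principle through contact sets\<close>

text \<open>Abstract setting of the contact argument. \<open>far\<close> and \<open>init\<close>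
  leave room for tilting by slopes up to \<open>\<rho>\<close>: a tilted function has no positive
  value far away or at time 0. The constant in \<open>semi\<close> may depend on \<open>t\<close>
  without control, and \<open>contact\<close> gives the sign of \<open>g\<close> only where an
  affine function touches a slice from above at a positive value.\<close>

locale excursion =
  fixes T R \<rho> :: real and w g :: "real \<Rightarrow> 'a::euclidean_space \<Rightarrow> real"
  assumes T: "0 < T" and R: "0 < R" and \<rho>: "0 < \<rho>"
    and cont: "continuous_on UNIV (\<lambda>(t, z). w t z)"
    and far: "\<And>t z. 0 \<le> t \<Longrightarrow> t \<le> T \<Longrightarrow> R \<le> norm z \<Longrightarrow> w t z + \<rho> * norm z \<le> 0"
    and init: "\<And>z. w 0 z + \<rho> * norm z \<le> 0"
    and semi: "\<And>t. 0 \<le> t \<Longrightarrow> t \<le> T \<Longrightarrow> \<exists>M. \<forall>z h. norm z \<le> R \<longrightarrow> norm h \<le> 2 * R \<longrightarrow>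
                 - M * (norm h)\<^sup>2 \<le> w t (z + h) + w t (z - h) - 2 * w t z"
    and g_int: "\<And>z. (\<lambda>s. g s z) absolutely_integrable_on {0..T}"
    and w_int: "\<And>t z. t \<in> {0..T} \<Longrightarrow> w t z = w 0 z + integral {0..t} (\<lambda>s. g s z)"
    and contact: "\<And>t z p. t \<in> {0..T} \<Longrightarrow> 0 < w t z \<Longrightarrow> norm p \<le> \<rho> \<Longrightarrow>
                 (\<And>y. w t y \<le> w t z + p \<bullet> (y - z)) \<Longrightarrow> g t z \<le> 0"
begin

lemma cw [continuous_intros]:
  "continuous_on S f \<Longrightarrow> continuous_on S h \<Longrightarrow> continuous_on S (\<lambda>x. w (f x) (h x))"
  using continuous_on_compose2[OF cont, of S "\<lambda>x. (f x, h x)"] by (auto intro: continuous_on_Pair)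

section \<open>Contact points and the dependence of the slope on the point\<close>

text \<open>Times whose slice has semiconvexity constant \<open>M\<close>. These sets increase to
  all of \<open>{0..T}\<close> as \<open>M\<close> grows, and each is compact because the
  inequalities are closed conditions on a continuous function; this replaces a constant uniform in
  time.\<close>

definition K :: "real \<Rightarrow> real set" where
  "K M = {t \<in> {0..T}. \<forall>z h. norm z \<le> R \<longrightarrow> norm h \<le> 2 * R \<longrightarrow>
            - M * (norm h)\<^sup>2 \<le> w t (z + h) + w t (z - h) - 2 * w t z}"

lemma closed_K: "closed (K M)"
proof -
  have "K M = {0..T} \<inter> (\<Inter>z\<in>cball 0 R. \<Inter>h\<in>cball 0 (2 * R).
           {t. - M * (norm h)\<^sup>2 \<le> w t (z + h) + w t (z - h) - 2 * w t z})"
    by (auto simp: K_def)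
  also have "closed \<dots>"
    by (intro closed_Int closed_INT ballI closed_Collect_le continuous_intros closed_atLeastAtMost)
  finally show ?thesis .
qed

lemma K_sub: "K M \<subseteq> {0..T}" by (auto simp: K_def)

lemma compact_K: "compact (K M)"
  using closed_K K_sub by (metis compact_Icc compact_Int_closed inf.absorb_iff2)

text \<open>The plane of slope \<open>p\<close> must lie above every slice in \<open>K M\<close> up
  to time \<open>b\<close>, not only above the slice of its own contact time. This makes contacts at
  different times comparable.\<close>

definition touching :: "real \<Rightarrow> real \<Rightarrow> real \<Rightarrow> real \<Rightarrow> 'a \<Rightarrow> 'a \<Rightarrow> bool" where
  "touching M r b \<tau> p z \<longleftrightarrow> \<tau> \<in> K M \<and> \<tau> \<le> b \<and> norm p \<le> r \<and> norm z \<le> R \<and>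
     (\<forall>s\<in>K M. s \<le> b \<longrightarrow> (\<forall>y. w s y \<le> w \<tau> z + p \<bullet> (y - z)))"

text \<open>Near \<open>z1\<close> the slice at \<open>\<tau>1\<close> lies above its plane minus a
  parabola and below plane 2, while the height of plane 2 at \<open>z1\<close> is tied to the first
  contact value by semiconvexity of the slice at \<open>\<tau>2\<close>. Comparing along the
  direction \<open>p1 - p2\<close> bounds the slope difference. For equal points it shows that the
  slope is a function of the point.\<close>

lemma touching_lipschitz:
  assumes 1: "touching M r b \<tau>1 p1 z1" and 2: "touching M r b \<tau>2 p2 z2"
  shows "norm (p1 - p2) \<le> 2 * M * norm (z1 - z2)"
proof (cases "p1 = p2")
  case True
  show ?thesis
  proof (cases "z1 = z2")
    case False
    \<comment> \<open>With equal slopes the claim reduces to \<open>0 \<le> M\<close>, which holds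
      because a slice below a plane through its contact point has a nonpositive second difference
      there.\<close>
    define h where "h = z1 - z2"
    have "norm h \<le> 2 * R" using 1 2 norm_triangle_ineq4[of z1 z2] by (auto simp: h_def touching_def)
    then have "- M * (norm h)\<^sup>2 \<le> w \<tau>1 (z1 + h) + w \<tau>1 (z1 - h) - 2 * w \<tau>1 z1"
      using 1 by (auto simp: touching_def K_def)
    moreover have "w \<tau>1 (z1 + h) \<le> w \<tau>1 z1 + p1 \<bullet> h" "w \<tau>1 (z1 - h) \<le> w \<tau>1 z1 - p1 \<bullet> h"
      using 1 unfolding touching_def by (metis add_diff_cancel_left')
        (use 1 in \<open>auto simp: touching_def dest!: bspec[of _ _ \<tau>1] spec[of _ "z1 - h"]\<close>)
    ultimately have "0 \<le> M * (norm h)\<^sup>2" by simp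
    moreover have "0 < (norm h)\<^sup>2" using False by (simp add: h_def)
    ultimately have "0 \<le> M" using zero_le_mult_iff by force
    then show ?thesis using True by simp
  qed (use True in simp)
next
  case False
  define q where "q = p1 - p2"
  define d where "d = norm (z1 - z2)"
  have q0: "0 < norm q" using False by (simp add: q_def)
  have d2R: "d \<le> 2 * R" using 1 2 norm_triangle_ineq4[of z1 z2] by (auto simp: d_def touching_def)
  have T1: "\<And>y. w \<tau>1 y \<le> w \<tau>1 z1 + p1 \<bullet> (y - z1)" "\<And>y. w \<tau>2 y \<le> w \<tau>1 z1 + p1 \<bullet> (y - z1)"
    using 1 2 by (auto simp: touching_def)
  have T2: "\<And>y. w \<tau>1 y \<le> w \<tau>2 z2 + p2 \<bullet> (y - z2)" "\<And>y. w \<tau>2 y \<le> w \<tau>2 z2 + p2 \<bullet> (y - z2)"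
    using 1 2 by (auto simp: touching_def)
  have S1: "w \<tau>1 z1 + p1 \<bullet> h - M * (norm h)\<^sup>2 \<le> w \<tau>1 (z1 + h)" if "norm h \<le> 2 * R" for h
  proof -
    have "- M * (norm h)\<^sup>2 \<le> w \<tau>1 (z1 + h) + w \<tau>1 (z1 - h) - 2 * w \<tau>1 z1"
      using 1 that by (auto simp: touching_def K_def)
    then show ?thesis using T1(1)[of "z1 - h"] by (simp add: algebra_simps)
  qed
  have S2: "w \<tau>2 z2 + p2 \<bullet> h - M * (norm h)\<^sup>2 \<le> w \<tau>2 (z2 + h)" if "norm h \<le> 2 * R" for h
  proof -
    have "- M * (norm h)\<^sup>2 \<le> w \<tau>2 (z2 + h) + w \<tau>2 (z2 - h) - 2 * w \<tau>2 z2"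
      using 2 that by (auto simp: touching_def K_def)
    then show ?thesis using T2(2)[of "z2 - h"] by (simp add: algebra_simps)
  qed
  have main: "(p1 - p2) \<bullet> h \<le> M * (d\<^sup>2 + (norm h)\<^sup>2)" if h: "norm h \<le> 2 * R" for h
  proof -
    have "w \<tau>2 z2 + p2 \<bullet> (z1 - z2) - M * d\<^sup>2 \<le> w \<tau>1 z1"
      using S2[of "z1 - z2"] d2R T1(2)[of z1] by (simp add: d_def)
    moreover have "w \<tau>1 z1 + p1 \<bullet> h - M * (norm h)\<^sup>2 \<le> w \<tau>2 z2 + p2 \<bullet> (z1 + h - z2)"
      using S1[OF h] T2(1)[of "z1 + h"] by linarith
    ultimately show ?thesis by (simp add: algebra_simps)
  qed
  \<comment> \<open>The increment points along \<open>q\<close> with length \<open>d\<close>, so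
    that both quadratic errors in \<open>main\<close> have the same size.\<close>
  have hn: "norm ((d / norm q) *\<^sub>R q) = d" using q0 by (simp add: d_def)
  have "(p1 - p2) \<bullet> ((d / norm q) *\<^sub>R q) \<le> M * (d\<^sup>2 + d\<^sup>2)"
    using main[of "(d / norm q) *\<^sub>R q"] hn d2R by simp
  moreover have "(p1 - p2) \<bullet> ((d / norm q) *\<^sub>R q) = d * norm q"
    using q0 by (simp add: q_def[symmetric] power2_norm_eq_inner[symmetric] power2_eq_square)
  ultimately have *: "d * norm q \<le> 2 * M * d\<^sup>2" by simp
  show ?thesis
  proof (cases "d = 0")
    case False
    then have "0 < d" by (simp add: d_def)
    then have "d * norm q \<le> d * (2 * M * d)" using * by (simp add: power2_eq_square mult_ac)
    then show ?thesis using \<open>0 < d\<close> by (simp add: q_def d_def)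
  next
    case True
    \<comment> \<open>For coinciding points \<open>main\<close> bounds \<open>norm q\<close> by
      \<open>M\<close> times the length of the increment; a length this small contradicts
      \<open>p1 \<noteq> p2\<close>.\<close>
    define e where "e = min (2 * R) (norm q / (\<bar>M\<bar> + 1) / 2)"
    have e: "0 < e" "e \<le> 2 * R" using q0 R by (auto simp: e_def)
    have "e \<le> norm q / (\<bar>M\<bar> + 1) / 2" by (simp add: e_def)
    then have e3: "e * (\<bar>M\<bar> + 1) \<le> norm q / 2" by (simp add: field_simps)
    have hn: "norm ((e / norm q) *\<^sub>R q) = e" using q0 e by simp
    have "(p1 - p2) \<bullet> ((e / norm q) *\<^sub>R q) \<le> M * e\<^sup>2"
      using main[of "(e / norm q) *\<^sub>R q"] hn e True by simp
    moreover have "(p1 - p2) \<bullet> ((e / norm q) *\<^sub>R q) = e * norm q"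
      using q0 by (simp add: q_def[symmetric] power2_norm_eq_inner[symmetric] power2_eq_square)
    ultimately have "e * norm q \<le> e * (M * e)" by (simp add: power2_eq_square mult_ac)
    then have "norm q \<le> M * e" using e(1) by simp
    also have "\<dots> \<le> e * (\<bar>M\<bar> + 1)" using e(1) by (simp add: mult.commute mult_right_mono)
    finally show ?thesis using e3 q0 by simp
  qed
qed

section \<open>Regions of points and levels\<close>

text \<open>At the fixed point \<open>z\<close> the level \<open>c\<close> is not yet reached up to
  time \<open>a\<close>, and it is reached at a contact time up to \<open>b\<close>. In (point,
  level) space sections at fixed \<open>z\<close> are available, and fixed \<open>z\<close> is where
  the integrated equation can be used.\<close>

definition region :: "real \<Rightarrow> real \<Rightarrow> real \<Rightarrow> real \<Rightarrow> real \<Rightarrow> ('a \<times> real) set" where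
  "region M r l a b = {(z, c). l \<le> c \<and> (\<forall>s\<in>{0..a}. w s z < c) \<and>
      (\<exists>\<tau> p. a \<le> \<tau> \<and> c \<le> w \<tau> z \<and> touching M r b \<tau> p z)}"

lemma bound_w: "\<exists>B>0. \<forall>t\<in>{0..T}. \<forall>z\<in>cball 0 R. \<bar>w t z\<bar> \<le> B"
proof -
  have "compact ((\<lambda>x. w (fst x) (snd x)) ` ({0..T} \<times> cball 0 R))"
    by (intro compact_continuous_image compact_Times continuous_intros) auto
  then obtain B where "0 < B" "\<And>x. x \<in> {0..T} \<times> cball 0 R \<Longrightarrow> norm (w (fst x) (snd x)) \<le> B"
    using compact_imp_bounded bounded_pos by (smt (verit, ccfv_threshold) imageI)
  then show ?thesis by (intro exI[of _ B]) force
qed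

lemma bounded_region: "\<exists>B. \<forall>M r l a b. 0 \<le> l \<longrightarrow> region M r l a b \<subseteq> cball 0 R \<times> {0..B}"
proof -
  obtain B where B: "0 < B" "\<And>t z. t \<in> {0..T} \<Longrightarrow> z \<in> cball 0 R \<Longrightarrow> \<bar>w t z\<bar> \<le> B"
    using bound_w by metis
  have "region M r l a b \<subseteq> cball 0 R \<times> {0..B}" if l: "0 \<le> l" for M r l a b
  proof
    fix x assume "x \<in> region M r l a b"
    then obtain z c \<tau> p where x: "x = (z, c)" "l \<le> c" "c \<le> w \<tau> z" "touching M r b \<tau> p z"
      by (auto simp: region_def)
    then have "norm z \<le> R" "\<tau> \<in> {0..T}" using K_sub[of M] by (auto simp: touching_def)
    then show "x \<in> cball 0 R \<times> {0..B}" using B(2)[of \<tau> z] x l by auto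
  qed
  then show ?thesis by blast
qed

text \<open>A difference of two projections of compact sets: \<open>D\<close> records a contact time
  and slope that witness membership, \<open>D2\<close> an earlier time at which the level is already
  attained.\<close>

lemma region_borel: "region M r l a b \<in> sets borel"
proof -
  obtain B where B: "0 < B" "\<And>t z. t \<in> {0..T} \<Longrightarrow> z \<in> cball 0 R \<Longrightarrow> \<bar>w t z\<bar> \<le> B"
    using bound_w by metis
  define D where "D = (K M \<times> cball 0 r \<times> cball 0 R \<times> {l..B}) \<inter>
      {x. a \<le> fst x} \<inter> {x. fst x \<le> b} \<inter> {x. snd (snd (snd x)) \<le> w (fst x) (fst (snd (snd x)))} \<inter>
      (\<Inter>s\<in>K M \<inter> {..b}. \<Inter>y. {x. w s y \<le> w (fst x) (fst (snd (snd x))) + fst (snd x) \<bullet> (y - fst (snd (snd x)))})"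
  have "compact D" unfolding D_def
    by (intro compact_Int_closed compact_Times compact_K compact_cball compact_Icc closed_INT ballI
          closed_Collect_le continuous_intros)
  then have cC: "compact ((\<lambda>x. snd (snd x)) ` D)"
    by (intro compact_continuous_image continuous_intros)
  define D2 where "D2 = ({0..a} \<times> cball 0 R \<times> {l..B}) \<inter> {x. snd (snd x) \<le> w (fst x) (fst (snd x))}"
  have "compact D2" unfolding D2_def
    by (intro compact_Int_closed compact_Times compact_cball compact_Icc closed_Collect_le continuous_intros)
  then have cC2: "compact (snd ` D2)"
    by (intro compact_continuous_image continuous_intros)
  have "region M r l a b = ((\<lambda>x. snd (snd x)) ` D) - (snd ` D2)"
  proof (intro set_eqI iffI)
    fix x assume "x \<in> region M r l a b"
    then obtain z c \<tau> p where x: "x = (z, c)" "l \<le> c" "\<forall>s\<in>{0..a}. w s z < c" "a \<le> \<tau>" "c \<le> w \<tau> z"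
       "touching M r b \<tau> p z"
      by (auto simp: region_def)
    have zt: "norm z \<le> R" "\<tau> \<in> {0..T}" "\<tau> \<in> K M" "\<tau> \<le> b" "norm p \<le> r"
      "\<And>s y. s \<in> K M \<Longrightarrow> s \<le> b \<Longrightarrow> w s y \<le> w \<tau> z + p \<bullet> (y - z)" 
      using x(6) K_sub[of M] by (auto simp: touching_def)
    have "c \<le> B" using B(2)[of \<tau> z] zt x(5) by auto
    then have "(\<tau>, p, z, c) \<in> D" using x zt by (auto simp: D_def)
    moreover have "x \<notin> snd ` D2" using x by (force simp: D2_def)
    ultimately show "x \<in> ((\<lambda>x. snd (snd x)) ` D) - (snd ` D2)" using x(1) by force
  next
    fix x assume x: "x \<in> ((\<lambda>x. snd (snd x)) ` D) - (snd ` D2)"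
    obtain z c where xz: "x = (z, c)" by force
    then obtain \<tau> p where D: "(\<tau>, p, z, c) \<in> D" using x by auto
    then have "touching M r b \<tau> p z" "a \<le> \<tau>" "c \<le> w \<tau> z" "l \<le> c" by (auto simp: D_def touching_def)
    moreover have "w s z < c" if "s \<in> {0..a}" for s
    proof (rule ccontr)
      assume "\<not> w s z < c"
      then have "(s, z, c) \<in> D2" using D that by (auto simp: D2_def D_def)
      then show False using x xz by force
    qed
    ultimately show "x \<in> region M r l a b" using xz by (auto simp: region_def)
  qed
  then show ?thesis using cC cC2 by (auto intro: borel_compact)
qed

lemma region_disjoint: "b \<le> a' \<Longrightarrow> region M r l a b \<inter> region M r l a' b' = {}"
proof (rule ccontr)
  assume b: "b \<le> a'" and "region M r l a b \<inter> region M r l a' b' \<noteq> {}"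
  then obtain z c \<tau> p where x: "c \<le> w \<tau> z" "touching M r b \<tau> p z" "\<forall>s\<in>{0..a'}. w s z < c"
    by (auto simp: region_def)
  then have "\<tau> \<in> {0..a'}" using K_sub[of M] b by (force simp: touching_def)
  then show False using x by force
qed

lemma region_lmeasurable: assumes "0 \<le> l" shows "region M r l a b \<in> lmeasurable" "bounded (region M r l a b)"
proof -
  obtain B where "region M r l a b \<subseteq> cball 0 R \<times> {0..B}" using bounded_region assms by metis
  then show b: "bounded (region M r l a b)"
    using bounded_subset[OF bounded_Times[OF bounded_cball bounded_closed_interval]] by blast
  show "region M r l a b \<in> lmeasurable"
    using b region_borel by (intro bounded_set_imp_lmeasurable) auto
qed

text \<open>Levels \<open>h\<close> of the tilted functions \<open>w - p \<bullet> z\<close> that are first reached in \<open>K M \<inter> {a<..b}\<close>.\<close>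

definition levels :: "real \<Rightarrow> real \<Rightarrow> real \<Rightarrow> real \<Rightarrow> real \<Rightarrow> ('a \<times> real) set" where
  "levels M r l a b = {(p, h). norm p \<le> r \<and> l \<le> h \<and> (\<exists>t\<in>K M. a < t \<and> t \<le> b \<and>
      (\<exists>z. h + p \<bullet> z \<le> w t z) \<and> (\<forall>s y. 0 \<le> s \<longrightarrow> s < t \<longrightarrow> w s y < h + p \<bullet> y))}"

text \<open>For each \<open>(p, h)\<close> the tilted functions are maximised over the times of
  \<open>K M\<close> up to \<open>b\<close>; the maximiser \<open>z\<close> is a contact point of
  slope \<open>p\<close>, and \<open>(p, h)\<close> is recovered from \<open>z\<close> and
  \<open>c = h + p \<bullet> z\<close> as \<open>(P z, c - P z \<bullet> z)\<close>. This map is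
  Lipschitz since \<open>P\<close> is, by \<open>touching_lipschitz\<close>, and both slopes and
  points are bounded. The level drops from \<open>2 * l\<close> to \<open>l\<close> because the tilt
  may cost \<open>r * R \<le> l\<close>.\<close>

lemma levels_image:
  assumes r: "r \<le> \<rho>" "r * R \<le> l" and l: "0 < l" and M: "0 \<le> M" and r0: "0 \<le> r"
  shows "\<exists>\<psi>. levels M r (2 * l) a b \<subseteq> \<psi> ` region M r l a b \<and>
     (\<forall>x\<in>region M r l a b. \<forall>y\<in>region M r l a b. norm (\<psi> x - \<psi> y) \<le> (1 + r + 2 * M * (1 + R)) * norm (x - y))"
proof -
  \<comment> \<open>The choice is harmless: \<open>Peq\<close> shows that the contact slope at a
    point is unique.\<close>
  define P where "P z = (SOME p. \<exists>\<tau>. touching M r b \<tau> p z)" for z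
  define \<psi> where "\<psi> x = (P (fst x), snd x - P (fst x) \<bullet> fst x)" for x :: "'a \<times> real"
  have P: "\<exists>\<tau>. touching M r b \<tau> (P z) z" if "touching M r b \<tau> p z" for \<tau> p z
    unfolding P_def using that by (intro someI_ex[of "\<lambda>p. \<exists>\<tau>. touching M r b \<tau> p z"]) blast
  have Peq: "P z = p" if tt: "touching M r b \<tau> p z" for \<tau> p z
  proof -
    obtain \<tau>' where "touching M r b \<tau>' (P z) z" using P[OF tt] by blast
    from touching_lipschitz[OF this tt] show ?thesis by simp
  qed
  have "levels M r (2 * l) a b \<subseteq> \<psi> ` region M r l a b"
  proof
    fix x assume "x \<in> levels M r (2 * l) a b"
    then obtain p h t z0 where x: "x = (p, h)" "norm p \<le> r" "2 * l \<le> h" "t \<in> K M" "a < t" "t \<le> b"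
      "h + p \<bullet> z0 \<le> w t z0" "\<And>s y. 0 \<le> s \<Longrightarrow> s < t \<Longrightarrow> w s y < h + p \<bullet> y"
      by (auto simp: levels_def)
    have h0: "0 < h" using x l by simp
    \<comment> \<open>Outside the ball the tilted function is nonpositive, hence below the level
      \<open>h\<close>, so the maximum may be sought over a compact set.\<close>
    have out: "w s y - p \<bullet> y \<le> 0" if "s \<in> {0..T}" "R \<le> norm y" for s y
    proof -
      have "- (p \<bullet> y) \<le> norm p * norm y" using Cauchy_Schwarz_ineq2[of p y] by linarith
      also have "\<dots> \<le> \<rho> * norm y" using x(2) r by (intro mult_right_mono) auto
      finally show ?thesis using far[of s y] that by auto
    qed
    have tT: "t \<in> {0..T}" using x(4) K_sub[of M] by blast
    have z0: "norm z0 \<le> R" using out[OF tT, of z0] x(7) h0 by linarith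
    define Z where "Z = (K M \<inter> {..b}) \<times> cball (0::'a) R"
    have "compact Z" "(t, z0) \<in> Z" unfolding Z_def using x z0
      by (auto intro!: compact_Times compact_Int_closed compact_K)
    moreover have Zc: "continuous_on Z (\<lambda>y. w (fst y) (snd y) - p \<bullet> snd y)"
      by (intro continuous_intros)
    ultimately obtain m where m: "m \<in> Z" "\<And>y. y \<in> Z \<Longrightarrow> w (fst y) (snd y) - p \<bullet> snd y \<le> w (fst m) (snd m) - p \<bullet> snd m"
      using continuous_attains_sup[of Z "\<lambda>y. w (fst y) (snd y) - p \<bullet> snd y", OF _ _ Zc] by blast
    obtain \<tau> z where mz: "m = (\<tau>, z)" by force
    have \<tau>: "\<tau> \<in> K M" "\<tau> \<le> b" "norm z \<le> R" using m(1) mz by (auto simp: Z_def)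
    have hm: "h \<le> w \<tau> z - p \<bullet> z" using m(2)[OF \<open>(t, z0) \<in> Z\<close>] mz x(7) by simp
    have "touching M r b \<tau> p z"
      unfolding touching_def
    proof (intro conjI ballI impI allI)
      fix s y assume s: "s \<in> K M" "s \<le> b"
      show "w s y \<le> w \<tau> z + p \<bullet> (y - z)"
      proof (cases "norm y \<le> R")
        case True
        then show ?thesis using m(2)[of "(s, y)"] mz s by (simp add: Z_def inner_diff_right)
      next
        case False
        then show ?thesis using out[of s y] s K_sub[of M] hm h0 by (force simp: inner_diff_right)
      qed
    qed (use \<tau> x in auto)
    moreover have "a \<le> \<tau>"
    proof (rule ccontr)
      assume "\<not> a \<le> \<tau>"
      then have "w \<tau> z < h + p \<bullet> z" using x(5) x(8)[of \<tau> z] \<tau>(1) K_sub[of M] by auto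
      then show False using hm by simp
    qed
    moreover have "l \<le> h + p \<bullet> z"
    proof -
      have "\<bar>p \<bullet> z\<bar> \<le> r * R" using Cauchy_Schwarz_ineq2[of p z] mult_mono[OF x(2) \<tau>(3) r0 norm_ge_zero] by linarith
      then show ?thesis using r x(3) by linarith
    qed
    moreover have "\<forall>s\<in>{0..a}. w s z < h + p \<bullet> z" using x(5,8) by auto
    ultimately have "(z, h + p \<bullet> z) \<in> region M r l a b" using hm by (auto simp: region_def)
    moreover have "\<psi> (z, h + p \<bullet> z) = x" using Peq \<open>touching M r b \<tau> p z\<close> by (simp add: \<psi>_def x(1))
    ultimately show "x \<in> \<psi> ` region M r l a b" by (metis imageI)
  qed
  moreover have "norm (\<psi> x - \<psi> y) \<le> (1 + r + 2 * M * (1 + R)) * norm (x - y)"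
    if xy: "x \<in> region M r l a b" "y \<in> region M r l a b" for x y
  proof -
    obtain z1 c1 z2 c2 where e: "x = (z1, c1)" "y = (z2, c2)" by force
    obtain \<tau>1 \<tau>2 where t: "touching M r b \<tau>1 (P z1) z1" "touching M r b \<tau>2 (P z2) z2"
      using xy e P by (fastforce simp: region_def)
    have n: "norm (z1 - z2) \<le> norm (x - y)" "\<bar>c1 - c2\<bar> \<le> norm (x - y)"
      using e norm_fst_le[of "z1 - z2" "c1 - c2"] norm_snd_le[of "c1 - c2" "z1 - z2"] by auto
    have p: "norm (P z1 - P z2) \<le> 2 * M * norm (z1 - z2)" using touching_lipschitz[OF t] .
    have "c1 - P z1 \<bullet> z1 - (c2 - P z2 \<bullet> z2) = (c1 - c2) - P z1 \<bullet> (z1 - z2) - (P z1 - P z2) \<bullet> z2"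
      by (simp add: inner_diff_left inner_diff_right)
    also have "\<bar>\<dots>\<bar> \<le> \<bar>c1 - c2\<bar> + norm (P z1) * norm (z1 - z2) + norm (P z1 - P z2) * norm z2"
      using Cauchy_Schwarz_ineq2[of "P z1" "z1 - z2"] Cauchy_Schwarz_ineq2[of "P z1 - P z2" z2] by linarith
    also have "\<dots> \<le> norm (x - y) + r * norm (x - y) + (2 * M * norm (x - y)) * R"
    proof (intro add_mono n mult_mono)
      show "norm (P z1 - P z2) \<le> 2 * M * norm (x - y)"
        using p mult_left_mono[OF n(1), of "2 * M"] M by simp
    qed (use t r0 M in \<open>auto simp: touching_def\<close>)
    finally have s: "\<bar>c1 - P z1 \<bullet> z1 - (c2 - P z2 \<bullet> z2)\<bar> \<le> norm (x - y) + r * norm (x - y) + (2 * M * norm (x - y)) * R" .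
    have "norm (\<psi> x - \<psi> y) \<le> norm (P z1 - P z2) + \<bar>c1 - P z1 \<bullet> z1 - (c2 - P z2 \<bullet> z2)\<bar>"
      using norm_Pair_le[of "P z1 - P z2" "c1 - P z1 \<bullet> z1 - (c2 - P z2 \<bullet> z2)"] by (simp add: \<psi>_def e)
    also have "\<dots> \<le> 2 * M * norm (x - y) + (norm (x - y) + r * norm (x - y) + (2 * M * norm (x - y)) * R)"
      using s p mult_left_mono[OF n(1), of "2 * M"] M by simp
    finally show ?thesis by (simp add: algebra_simps)
  qed
  ultimately show ?thesis by blast
qed

section \<open>Thin slabs in time and the null set of levels\<close>

definition slabs :: "real \<Rightarrow> real \<Rightarrow> real \<Rightarrow> nat \<Rightarrow> ('a \<times> real) set" where
  "slabs M r l n = (\<Union>j<Suc n. region M r l (T * real j / Suc n) (T * real (Suc j) / Suc n))"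

text \<open>Membership in infinitely many slabs yields contact times and slopes that accumulate, by
  compactness of \<open>K M\<close> and of the ball of slopes. As the width of the slabs tends to 0,
  the level is first reached exactly at the limit time, which is therefore a running maximum at
  fixed \<open>z\<close>; the limit plane still touches the limit slice, so \<open>contact\<close>
  applies.\<close>

lemma limsup_slabs:
  assumes l: "0 < l" and r: "r \<le> \<rho>" and inf: "\<exists>\<^sub>\<infinity>n. (z, c) \<in> slabs M r l n"
  shows "\<exists>t\<in>{0..T}. c = w t z \<and> (\<forall>s. 0 \<le> s \<longrightarrow> s \<le> t \<longrightarrow> w s z \<le> w t z) \<and> g t z \<le> 0"
proof -
  define I where "I = {n. (z, c) \<in> slabs M r l n}"
  have I: "infinite I" using inf by (simp add: I_def frequently_cofinite)
  define e where "e = enumerate I"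
  have e: "strict_mono e" "\<And>n. e n \<in> I" unfolding e_def
    using I by (auto intro: strict_mono_enumerate enumerate_in_set)
  have "\<exists>\<tau> p. \<tau> \<in> K M \<and> norm p \<le> r \<and> c \<le> w \<tau> z \<and> (\<forall>s. 0 \<le> s \<longrightarrow> s < \<tau> - T / Suc (e n) \<longrightarrow> w s z < c) \<and>
          (\<forall>y. w \<tau> y \<le> w \<tau> z + p \<bullet> (y - z))" for n
  proof -
    have "(z, c) \<in> slabs M r l (e n)" using e(2) by (simp add: I_def)
    then obtain j where j: "j < Suc (e n)"
      "(z, c) \<in> region M r l (T * real j / Suc (e n)) (T * real (Suc j) / Suc (e n))"
      by (auto simp: slabs_def)
    then obtain \<tau> p where tp: "\<forall>s\<in>{0..T * real j / Suc (e n)}. w s z < c" "c \<le> w \<tau> z"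
       "touching M r (T * real (Suc j) / Suc (e n)) \<tau> p z" by (auto simp: region_def)
    have "\<tau> - T / Suc (e n) \<le> T * real j / Suc (e n)"
    proof -
      have "\<tau> \<le> T * real (Suc j) / Suc (e n)" using tp(3) by (simp add: touching_def)
      also have "\<dots> = T * real j / Suc (e n) + T / Suc (e n)" by (simp add: distrib_left add_divide_distrib)
      finally show ?thesis by simp
    qed
    then show ?thesis using tp by (intro exI[of _ \<tau>] exI[of _ p]) (auto simp: touching_def)
  qed
  then obtain \<tau> p where tp: "\<And>n. \<tau> n \<in> K M" "\<And>n. norm (p n) \<le> r" "\<And>n. c \<le> w (\<tau> n) z"
    "\<And>n s. 0 \<le> s \<Longrightarrow> s < \<tau> n - T / Suc (e n) \<Longrightarrow> w s z < c"
    "\<And>n y. w (\<tau> n) y \<le> w (\<tau> n) z + p n \<bullet> (y - z)" by metis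
  have "compact (K M \<times> cball (0::'a) r)" by (intro compact_Times compact_K compact_cball)
  moreover have "\<forall>n. (\<tau> n, p n) \<in> K M \<times> cball 0 r" using tp by auto
  ultimately obtain x f where xf: "x \<in> K M \<times> cball (0::'a) r" "strict_mono (f::nat\<Rightarrow>nat)" "((\<lambda>n. (\<tau> n, p n)) \<circ> f) \<longlonglongrightarrow> x"
    unfolding compact_def by meson
  obtain t q where x: "x = (t, q)" by force
  have t: "t \<in> {0..T}" "norm q \<le> r" using xf x K_sub[of M] by auto
  have lim: "(\<lambda>n. \<tau> (f n)) \<longlonglongrightarrow> t" "(\<lambda>n. p (f n)) \<longlonglongrightarrow> q"
    using tendsto_fst[OF xf(3)] tendsto_snd[OF xf(3)] by (auto simp: x o_def)
  have wl: "(\<lambda>n. w (\<tau> (f n)) y) \<longlonglongrightarrow> w t y" for y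
  proof -
    have "isCont (\<lambda>s. w s y) t" 
      using cw[of UNIV "\<lambda>s. s" "\<lambda>s. y"] by (simp add: continuous_on_eq_continuous_at)
    then show ?thesis using lim(1) by (rule isCont_tendsto_compose)
  qed
  have ct: "c \<le> w t z" using LIMSEQ_le_const[OF wl] tp(3) by blast
  have touch: "w t y \<le> w t z + q \<bullet> (y - z)" for y
  proof (rule LIMSEQ_le[OF wl])
    show "(\<lambda>n. w (\<tau> (f n)) z + p (f n) \<bullet> (y - z)) \<longlonglongrightarrow> w t z + q \<bullet> (y - z)"
      by (intro tendsto_intros wl lim)
  qed (use tp(5) in auto)
  have c0: "l \<le> c" using e(2)[of 0] by (auto simp: I_def slabs_def region_def)
  \<comment> \<open>Excluding time 0 allows an approach to \<open>t\<close> from the left, which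
    gives \<open>w t z \<le> c\<close> below.\<close>
  have t0: "t \<noteq> 0"
  proof
    assume "t = 0"
    moreover have "w 0 z \<le> 0" using init[of z] mult_nonneg_nonneg[OF less_imp_le[OF \<rho>] norm_ge_zero[of z]] by linarith
    ultimately show False using c0 l ct by simp
  qed
  have lt: "w s z < c" if s: "0 \<le> s" "s < t" for s
  proof -
    have "(\<lambda>n. T / Suc n) \<longlonglongrightarrow> 0" by (rule LIMSEQ_Suc) (rule lim_const_over_n)
    then have "(\<lambda>n. T / Suc ((e \<circ> f) n)) \<longlonglongrightarrow> 0"
      using LIMSEQ_subseq_LIMSEQ[OF _ strict_mono_o[OF e(1) xf(2)], of "\<lambda>n. T / Suc n" 0] by (simp add: o_def)
    then have "(\<lambda>n. \<tau> (f n) - T / Suc ((e \<circ> f) n)) \<longlonglongrightarrow> t - 0" by (intro tendsto_diff lim)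
    then have "\<forall>\<^sub>F n in sequentially. s < \<tau> (f n) - T / Suc ((e \<circ> f) n)"
      using s by (intro order_tendstoD) auto
    then obtain n where "s < \<tau> (f n) - T / Suc ((e \<circ> f) n)" by (meson eventually_sequentially order_refl)
    then show ?thesis using tp(4)[OF s(1), of "f n"] by simp
  qed
  have ct': "w t z \<le> c"
  proof -
    have "((\<lambda>s. w s z) \<longlongrightarrow> w t z) (at_left t)"
      using cw[of UNIV "\<lambda>s. s" "\<lambda>s. z"] by (auto simp: continuous_on_def intro: tendsto_within_subset)
    moreover have "\<forall>\<^sub>F s in at_left t. w s z \<le> c"
      using eventually_at_left_real[of 0 t] t0 t by (auto elim!: eventually_mono simp: less_imp_le lt)
    ultimately show ?thesis by (intro tendsto_upperbound) auto
  qed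
  have eq: "c = w t z" using ct ct' by simp
  moreover have "g t z \<le> 0" by (rule contact[of t z q]) (use t touch eq c0 l r in auto)
  moreover have "w s z \<le> w t z" if "0 \<le> s" "s \<le> t" for s
    using lt[of s] that eq by (cases "s = t") auto
  ultimately show ?thesis using t by blast
qed

text \<open>Continuity from above reduces the claim to the limsup of the slabs being null, and
  Tonelli's theorem reduces that to fixed \<open>z\<close>. There \<open>limsup_slabs\<close> places
  the section inside the image of the running-maximum times with nonpositive \<open>g\<close>, which
  is negligible.\<close>

lemma slabs_small:
  assumes l: "0 < l" and r: "r \<le> \<rho>" and e: "0 < e"
  shows "\<exists>n. measure lebesgue (slabs M r l n) < e"
proof -
  define X where "X n = (\<Union>m\<in>{n..}. slabs M r l m)" for n
  have sb: "slabs M r l m \<in> sets borel" for m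
    unfolding slabs_def by (intro sets.finite_UN) (auto simp: region_borel)
  have Xb: "X n \<in> sets borel" for n unfolding X_def using sb by (intro sets.countable_UN') auto
  obtain B where B: "\<And>M r a b. region M r l a b \<subseteq> cball 0 R \<times> {0..B}" using bounded_region l by (meson less_imp_le)
  have XB: "X n \<subseteq> cball 0 R \<times> {0..B}" for n using B by (fastforce simp: X_def slabs_def)
  have fin: "emeasure lborel (X n) < \<infinity>" for n
    by (intro emeasure_bounded_finite bounded_subset[OF _ XB] bounded_Times bounded_cball bounded_closed_interval)
  have "emeasure lborel (\<Inter>n. X n) = 0"
  proof -
    have IX: "(\<Inter>n. X n) \<in> sets borel" using Xb by auto
    have sec: "emeasure lborel (Pair z -` (\<Inter>n. X n)) = 0" for z
    proof -
      have secb: "Pair z -` (\<Inter>n. X n) \<in> sets borel"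
        using IX by (intro measurable_sets_borel[of "Pair z" borel]) (auto simp: borel_prod[symmetric])
      define E where "E = {t\<in>{0..T}. (\<forall>s. 0 \<le> s \<longrightarrow> s \<le> t \<longrightarrow> w s z \<le> w t z) \<and> g t z \<le> 0}"
      have "Pair z -` (\<Inter>n. X n) \<subseteq> (\<lambda>t. w t z) ` E"
      proof
        fix c assume "c \<in> Pair z -` (\<Inter>n. X n)"
        then have "\<exists>\<^sub>\<infinity>n. (z, c) \<in> slabs M r l n"
          by (auto simp: X_def INFM_nat_le)
        from limsup_slabs[OF l r this] show "c \<in> (\<lambda>t. w t z) ` E" by (auto simp: E_def)
      qed
      moreover have "negligible ((\<lambda>t. w t z) ` E)"
        by (rule negligible_image_running_maximum[OF g_int w_int]) (auto simp: E_def)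
      ultimately have "negligible (Pair z -` (\<Inter>n. X n))" by (rule negligible_subset[rotated])
      then show ?thesis using secb
        by (simp add: negligible_iff_emeasure0)
    qed
    have "emeasure lborel (\<Inter>n. X n) = emeasure (lborel \<Otimes>\<^sub>M lborel) (\<Inter>n. X n)" by (simp add: lborel_prod)
    also have "\<dots> = (\<integral>\<^sup>+z. emeasure lborel (Pair z -` (\<Inter>n. X n)) \<partial>lborel)"
      using IX by (intro lborel.emeasure_pair_measure_alt) (simp only: sets_lborel lborel_prod)
    finally show ?thesis by (simp add: sec)
  qed
  moreover have "(\<lambda>n. emeasure lborel (X n)) \<longlonglongrightarrow> emeasure lborel (\<Inter>n. X n)"
  proof (rule Lim_emeasure_decseq)
    show "decseq X" unfolding decseq_def X_def by (intro allI impI UN_mono) auto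
  qed (use Xb fin in \<open>auto simp: less_top\<close>)
  ultimately have "\<forall>\<^sub>F n in sequentially. emeasure lborel (X n) < ennreal e"
    using e by (intro order_tendstoD) auto
  then obtain n where n: "emeasure lborel (X n) < ennreal e" by (meson eventually_sequentially order_refl)
  have "emeasure lborel (slabs M r l n) \<le> emeasure lborel (X n)"
    using Xb by (intro emeasure_mono) (auto simp: X_def)
  then have "emeasure lborel (slabs M r l n) < ennreal e" using n by simp
  then have "measure lborel (slabs M r l n) < e"
    by (metis e emeasure_eq_ennreal_measure ennreal_less_iff measure_nonneg top.not_eq_extremum ennreal_less_top order.strict_trans)
  then show ?thesis using sb by (metis measure_completion sets_lborel)
qed

text \<open>The same Lipschitz constant \<open>L\<close> serves every slab, so the outer measure of
  the levels is at most a fixed multiple of the total measure of the regions, up to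
  \<open>e / 2\<close>. The regions are disjoint, hence their total is the measure of
  \<open>slabs\<close>, which can be made arbitrarily small.\<close>

lemma negligible_levels:
  assumes r: "r \<le> \<rho>" "r * R \<le> l" and l: "0 < l" and M: "0 \<le> M" and r0: "0 \<le> r"
  shows "negligible (levels M r (2 * l) 0 T)"
  unfolding negligible_outer_le
proof (intro allI impI)
  fix e :: real assume e: "0 < e"
  define d where "d = DIM('a \<times> real)"
  define L where "L = 1 + r + 2 * M * (1 + R)"
  have L: "0 \<le> L" using r0 M R by (auto simp: L_def)
  define C where "C = (2 * L * d) ^ d + 1"
  have C: "0 < C" using L by (simp add: C_def add_nonneg_pos)
  obtain n where n: "measure lebesgue (slabs M r l n) < e / (2 * C)"
    using slabs_small[OF l r(1), of "e / (2 * C)"] e C by auto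
  define a where "a j = T * real j / Suc n" for j
  have ab: "a (Suc j) = T * real (Suc j) / Suc n" for j by (simp add: a_def)
  have "\<exists>V. levels M r (2 * l) (a j) (a (Suc j)) \<subseteq> V \<and> V \<in> lmeasurable \<and>
      measure lebesgue V \<le> C * (measure lebesgue (region M r l (a j) (a (Suc j))) + e / (2 * C * Suc n))" for j
  proof -
    obtain \<psi> where \<psi>: "levels M r (2 * l) (a j) (a (Suc j)) \<subseteq> \<psi> ` region M r l (a j) (a (Suc j))"
      "\<And>x y. x\<in>region M r l (a j) (a (Suc j)) \<Longrightarrow> y\<in>region M r l (a j) (a (Suc j)) \<Longrightarrow> norm (\<psi> x - \<psi> y) \<le> L * norm (x - y)"
      using levels_image[OF r l M r0] unfolding L_def by metis
    have "0 < e / (2 * C * Suc n)" using e C by simp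
    from lipschitz_image_outer_measure[OF region_lmeasurable L \<psi>(2) this] l
    obtain V where V: "\<psi> ` region M r l (a j) (a (Suc j)) \<subseteq> V" "V \<in> lmeasurable"
      "measure lebesgue V \<le> (2 * L * d) ^ d * (measure lebesgue (region M r l (a j) (a (Suc j))) + e / (2 * C * Suc n))"
      unfolding d_def by (metis less_imp_le)
    have "measure lebesgue V \<le> C * (measure lebesgue (region M r l (a j) (a (Suc j))) + e / (2 * C * Suc n))"
      using V(3) by (rule order_trans) (use e C in \<open>auto intro!: mult_right_mono add_nonneg_nonneg simp: C_def\<close>)
    then show ?thesis using V \<psi> by (intro exI[of _ V]) auto
  qed
  then obtain V where V: "\<And>j. levels M r (2 * l) (a j) (a (Suc j)) \<subseteq> V j" "\<And>j. V j \<in> lmeasurable"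
    "\<And>j. measure lebesgue (V j) \<le> C * (measure lebesgue (region M r l (a j) (a (Suc j))) + e / (2 * C * Suc n))"
    by metis
  have "levels M r (2 * l) 0 T \<subseteq> (\<Union>j<Suc n. V j)"
  proof
    fix x assume "x \<in> levels M r (2 * l) 0 T"
    then obtain p h t where x: "x = (p, h)" "norm p \<le> r" "2 * l \<le> h" "t \<in> K M" "0 < t" "t \<le> T"
       "(\<exists>z. h + p \<bullet> z \<le> w t z) \<and> (\<forall>s y. 0 \<le> s \<longrightarrow> s < t \<longrightarrow> w s y < h + p \<bullet> y)"
      by (auto simp: levels_def)
    \<comment> \<open>The cells are open on the left and closed on the right, hence the ceiling
      minus one.\<close>
    define j where "j = nat (\<lceil>t * Suc n / T\<rceil> - 1)"
    have c1: "1 \<le> \<lceil>t * Suc n / T\<rceil>" using x T by (simp add: one_le_ceiling)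
    have jr: "real j = real_of_int \<lceil>t * Suc n / T\<rceil> - 1" using c1 by (simp add: j_def)
    have "real j < t * Suc n / T" using jr by linarith
    moreover have "t * Suc n / T \<le> real j + 1" using jr le_of_int_ceiling[of "t * Suc n / T"] by linarith
    ultimately have t: "a j < t" "t \<le> a (Suc j)" using T by (auto simp: a_def field_simps)
    have "a j < T" using t x by simp
    then have "T * real j < T * real (Suc n)" using T by (simp add: a_def field_simps)
    then have "j < Suc n" using T by (simp only: mult_less_cancel_left_pos of_nat_less_iff)
    moreover have "x \<in> levels M r (2 * l) (a j) (a (Suc j))" using x t by (auto simp: levels_def)
    ultimately show "x \<in> (\<Union>j<Suc n. V j)" using V(1) by blast
  qed
  moreover have "(\<Union>j<Suc n. V j) \<in> lmeasurable" using V(2) by (intro fmeasurable.finite_UN) auto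
  moreover have "measure lebesgue (\<Union>j<Suc n. V j) \<le> e"
  proof -
    have "measure lebesgue (\<Union>j<Suc n. V j) \<le> (\<Sum>j<Suc n. measure lebesgue (V j))"
      using V(2) by (intro measure_UNION_le) (auto intro: fmeasurableD)
    also have "\<dots> \<le> (\<Sum>j<Suc n. C * (measure lebesgue (region M r l (a j) (a (Suc j))) + e / (2 * C * Suc n)))"
      by (intro sum_mono V)
    also have "\<dots> = C * (\<Sum>j<Suc n. measure lebesgue (region M r l (a j) (a (Suc j)))) + C * (real (Suc n) * (e / (2 * C * Suc n)))"
      unfolding sum_distrib_left[symmetric] sum.distrib distrib_left by simp
    also have "C * (real (Suc n) * (e / (2 * C * Suc n))) = e / 2" using C by simp
    also have "(\<Sum>j<Suc n. measure lebesgue (region M r l (a j) (a (Suc j)))) = measure lebesgue (slabs M r l n)"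
      unfolding slabs_def a_def
    proof (rule measure_finite_Union[symmetric])
      show "disjoint_family_on (\<lambda>j. region M r l (T * real j / real (Suc n)) (T * real (Suc j) / real (Suc n))) {..<Suc n}"
        unfolding disjoint_family_on_def
      proof (intro ballI impI)
        fix i j :: nat assume "i \<noteq> j"
        have le: "T * real (Suc i) / real (Suc n) \<le> T * real j / real (Suc n)" if "i < j" for i j
          using T that by (intro divide_right_mono mult_left_mono) auto
        show "region M r l (T * real i / real (Suc n)) (T * real (Suc i) / real (Suc n)) \<inter>
              region M r l (T * real j / real (Suc n)) (T * real (Suc j) / real (Suc n)) = {}"
          using region_disjoint[OF le, of i j] region_disjoint[OF le, of j i] \<open>i \<noteq> j\<close>
          by (metis inf_commute nat_neq_iff)
      qed
    next
      fix j show "emeasure lebesgue (region M r l (T * real j / real (Suc n)) (T * real (Suc j) / real (Suc n))) \<noteq> \<infinity>"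
        unfolding infinity_ennreal_def by (rule fmeasurableD2[OF region_lmeasurable(1)[OF less_imp_le[OF l]]])
    qed (use region_lmeasurable(1)[OF less_imp_le[OF l]] in \<open>auto intro: fmeasurableD\<close>)
    also have "C * measure lebesgue (slabs M r l n) \<le> e / 2" using n C by (simp add: field_simps)
    finally show ?thesis by simp
  qed
  ultimately show "\<exists>X. levels M r (2 * l) 0 T \<subseteq> X \<and> X \<in> lmeasurable \<and> measure lebesgue X \<le> e" by blast
qed

text \<open>If \<open>w\<close> were positive somewhere, every slope in a small ball and every level
  in an interval below that value would have a first time at which it is reached, and that time lies
  in some \<open>K M\<close>. A set with nonempty interior would then be covered by countably many
  negligible sets.\<close>

theorem nonpos: assumes "0 \<le> t" "t \<le> T" shows "w t z \<le> 0"
proof (rule ccontr)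
  assume "\<not> w t z \<le> 0"
  define \<omega> where "\<omega> = w t z"
  have om: "0 < \<omega>" using \<open>\<not> w t z \<le> 0\<close> by (simp add: \<omega>_def)
  have zR: "norm z \<le> R" using far[OF assms, of z] om mult_nonneg_nonneg[OF less_imp_le[OF \<rho>] norm_ge_zero[of z]]
    unfolding \<omega>_def by linarith
  \<comment> \<open>The tilt changes \<open>w\<close> by at most a quarter of
    \<open>\<omega>\<close> inside the ball, so levels between \<open>\<omega> / 2\<close> and
    \<open>3 * \<omega> / 4\<close> are all reached; the lower end has the shape
    \<open>2 * l\<close> required by \<open>negligible_levels\<close>.\<close>
  define r where "r = min \<rho> (\<omega> / (4 * R))"
  have r: "0 < r" "r \<le> \<rho>" "r * R \<le> \<omega> / 4"
    using \<rho> om R by (auto simp: r_def min_def field_simps)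
  define Q where "Q = cball (0::'a) r \<times> {2 * (\<omega> / 4)..3 * (\<omega> / 4)}"
  have "Q \<subseteq> (\<Union>M::nat. levels (real M) r (2 * (\<omega> / 4)) 0 T)"
  proof
    fix x assume "x \<in> Q"
    then obtain p h where x: "x = (p, h)" "norm p \<le> r" "2 * (\<omega> / 4) \<le> h" "h \<le> 3 * (\<omega> / 4)" by (auto simp: Q_def)
    \<comment> \<open>Compactness of this set of times provides the first time at which the tilted
      level is attained.\<close>
    define A where "A = {s\<in>{0..T}. \<exists>y. h + p \<bullet> y \<le> w s y}"
    have py: "\<bar>p \<bullet> y\<bar> \<le> \<rho> * norm y" for y
      using Cauchy_Schwarz_ineq2[of p y] mult_right_mono[of "norm p" \<rho> "norm y"] x(2) r(2) by force
    have yR: "norm y \<le> R" if "s \<in> {0..T}" "h + p \<bullet> y \<le> w s y" for s y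
      using far[of s y] py[of y] that x(3) om by (force simp: not_le)
    have "A = fst ` (({0..T} \<times> cball 0 R) \<inter> {x. h + p \<bullet> snd x \<le> w (fst x) (snd x)})"
      using yR by (force simp: A_def image_iff)
    also have "compact \<dots>"
      by (intro compact_continuous_image compact_Int_closed compact_Times closed_Collect_le continuous_intros compact_cball compact_Icc)
    finally have cA: "compact A" .
    have "t \<in> A"
    proof -
      have "\<bar>p \<bullet> z\<bar> \<le> r * R" using Cauchy_Schwarz_ineq2[of p z] mult_mono[OF x(2) zR] r(1) by force
      then have "h + p \<bullet> z \<le> w t z" using r(3) x(4) by (simp add: \<omega>_def)
      then show ?thesis using assms by (auto simp: A_def)
    qed
    then obtain t1 where t1: "t1 \<in> A" "\<And>s. s \<in> A \<Longrightarrow> t1 \<le> s"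
      using compact_attains_inf[OF cA] by auto
    have "t1 \<noteq> 0"
    proof
      assume "t1 = 0"
      then obtain y where "h + p \<bullet> y \<le> w 0 y" using t1 by (auto simp: A_def)
      then show False using init[of y] py[of y] x(3) om by linarith
    qed
    then have t1p: "0 < t1" "t1 \<le> T" using t1 by (auto simp: A_def)
    have bef: "w s y < h + p \<bullet> y" if "0 \<le> s" "s < t1" for s y
    proof (rule ccontr)
      assume "\<not> w s y < h + p \<bullet> y"
      then have "s \<in> A" using that t1p by (auto simp: A_def not_less)
      then show False using t1(2)[of s] that by simp
    qed
    obtain M0 where M0: "\<forall>z h. norm z \<le> R \<longrightarrow> norm h \<le> 2 * R \<longrightarrow>
                 - M0 * (norm h)\<^sup>2 \<le> w t1 (z + h) + w t1 (z - h) - 2 * w t1 z"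
      using semi[of t1] t1p by auto
    obtain M :: nat where M: "M0 \<le> real M" using real_arch_simple by blast
    have "t1 \<in> K (real M)"
      unfolding K_def
    proof (intro CollectI conjI allI impI)
      fix z h :: 'a assume "norm z \<le> R" "norm h \<le> 2 * R"
      then have "- M0 * (norm h)\<^sup>2 \<le> w t1 (z + h) + w t1 (z - h) - 2 * w t1 z" using M0 by blast
      moreover have "- real M * (norm h)\<^sup>2 \<le> - M0 * (norm h)\<^sup>2" using M by (intro mult_right_mono) auto
      ultimately show "- real M * (norm h)\<^sup>2 \<le> w t1 (z + h) + w t1 (z - h) - 2 * w t1 z" by linarith
    qed (use t1p in auto)
    then have "x \<in> levels (real M) r (2 * (\<omega> / 4)) 0 T"
      using x t1 t1p bef by (auto simp: levels_def A_def)
    then show "x \<in> (\<Union>M::nat. levels (real M) r (2 * (\<omega> / 4)) 0 T)" by blast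
  qed
  moreover have "negligible (\<Union>M::nat. levels (real M) r (2 * (\<omega> / 4)) 0 T)"
    using negligible_levels[of r "\<omega> / 4"] r om by (intro negligible_Union_nat) auto
  ultimately have "negligible Q" using negligible_subset by blast
  moreover have "ball (0::'a) r \<times> {2 * (\<omega> / 4)<..<3 * (\<omega> / 4)} \<subseteq> Q" by (auto simp: Q_def)
  ultimately have "negligible (ball (0::'a) r \<times> {2 * (\<omega> / 4)<..<3 * (\<omega> / 4)})" using negligible_subset by blast
  moreover have "open (ball (0::'a) r \<times> {2 * (\<omega> / 4)<..<3 * (\<omega> / 4)})" by (intro open_Times) auto
  ultimately have "ball (0::'a) r \<times> {2 * (\<omega> / 4)<..<3 * (\<omega> / 4)} = {}" using open_not_negligible by blast
  moreover have "(0, 5 * \<omega> / 8) \<in> ball (0::'a) r \<times> {2 * (\<omega> / 4)<..<3 * (\<omega> / 4)}" using r om by auto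
  ultimately show False by blast
qed

end

section \<open>Uniqueness of solutions\<close>

text \<open>One step of Cholesky elimination: subtracting the outer product of the scaled column
  \<open>k\<close> completes the square and clears row \<open>k\<close>, and rows that are already
  zero stay zero. If the pivot vanishes, nonnegativity forces the whole row to vanish and nothing is
  subtracted.\<close>

lemma psd_remove_coordinate:
  fixes M :: "real ^ 'n::finite ^ 'n"
  assumes M: "sym_nonneg_matrix M"
  shows "\<exists>v. sym_nonneg_matrix (M - (\<chi> i j. v $ i * v $ j)) \<and>
     (\<forall>j. (M - (\<chi> i j. v $ i * v $ j)) $ k $ j = 0) \<and>
     (\<forall>i. (\<forall>j. M $ i $ j = 0) \<longrightarrow> (\<forall>j. (M - (\<chi> i j. v $ i * v $ j)) $ i $ j = 0))"
proof -
  have sym: "M $ i $ j = M $ j $ i" for i j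
  proof -
    have "transpose M $ i $ j = M $ i $ j" using M by (simp add: sym_nonneg_matrix_def)
    then show ?thesis by (simp add: transpose_def)
  qed
  have pos: "0 \<le> (M *v x) \<bullet> x" for x using M by (simp add: sym_nonneg_matrix_def)
  have sym2: "(M *v x) \<bullet> y = (M *v y) \<bullet> x" for x y
    using M by (metis dot_lmul_matrix inner_commute sym_nonneg_matrix_def transpose_matrix_vector)
  have Mk: "(M *v axis k 1) = column k M" by (simp add: matrix_vector_mult_basis)
  have row: "(M *v axis k 1) \<bullet> x = (M *v x) $ k" for x
    using sym2[of "axis k 1" x] by (simp add: inner_axis)
  have kk: "(M *v axis k 1) $ k = M $ k $ k" by (simp add: Mk column_def)
  have expand: "(M *v (x + c *\<^sub>R axis k 1)) \<bullet> (x + c *\<^sub>R axis k 1) =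
      (M *v x) \<bullet> x + 2 * c * (M *v x) $ k + c\<^sup>2 * M $ k $ k" for x c
    using row[of x] kk row[of "axis k 1"]
    by (simp add: matrix_vector_right_distrib inner_add_left inner_add_right inner_axis matrix_vector_mult_scaleR
        power2_eq_square algebra_simps)
  show ?thesis
  proof (cases "M $ k $ k = 0")
    case True
    have "(M *v x) $ k = 0" for x
    proof (rule ccontr)
      assume ne: "(M *v x) $ k \<noteq> 0"
      define a where "a = (M *v x) $ k"
      \<comment> \<open>With a zero pivot the form is affine along the basis vector
        \<open>k\<close>; this multiple would give it the value \<open>- 1\<close>.\<close>
      define c where "c = - ((M *v x) \<bullet> x + 1) / (2 * a)"
      have "0 \<le> (M *v x) \<bullet> x + 2 * c * a" using pos[of "x + c *\<^sub>R axis k 1"] expand[of x c] True by (simp add: a_def)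
      moreover have "2 * c * a = - ((M *v x) \<bullet> x + 1)" using ne by (simp add: c_def a_def)
      ultimately show False by linarith
    qed
    then have "M $ k $ j = 0" for j using matrix_vector_mult_basis[of M j] by (metis column_def vec_lambda_beta)
    then show ?thesis using M by (intro exI[of _ 0]) (simp add: zero_vec_def[symmetric])
  next
    case False
    have Mkk: "0 < M $ k $ k"
      using pos[of "axis k 1"] row[of "axis k 1"] kk False by (simp add: order_less_le)
    define v where "v = (1 / sqrt (M $ k $ k)) *\<^sub>R column k M"
    define N where "N = M - (\<chi> i j. v $ i * v $ j)"
    have vv: "v $ i * v $ j = M $ i $ k * M $ j $ k / M $ k $ k" for i j
      using Mkk by (simp add: v_def column_def)
    have Nij: "N $ i $ j = M $ i $ j - M $ i $ k * M $ j $ k / M $ k $ k" for i j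
      by (simp add: N_def vv)
    have out: "((\<chi> i j. v $ i * v $ j) *v x) = (v \<bullet> x) *\<^sub>R v" for x
      by (simp add: vec_eq_iff matrix_vector_mult_def inner_vec_def sum_distrib_left mult_ac)
    have vx: "v \<bullet> x = (M *v x) $ k / sqrt (M $ k $ k)" for x
      using row[of x] by (simp add: v_def Mk)
    have "0 \<le> (N *v x) \<bullet> x" for x
    proof -
      define a where "a = (M *v x) $ k"
      have "(N *v x) \<bullet> x = (M *v x) \<bullet> x - (v \<bullet> x)\<^sup>2"
        by (simp add: N_def matrix_vector_mult_diff_rdistrib out inner_diff_left power2_eq_square)
      also have "(v \<bullet> x)\<^sup>2 = a\<^sup>2 / M $ k $ k" using Mkk by (simp add: vx a_def power_divide)
      also have "(M *v x) \<bullet> x - a\<^sup>2 / M $ k $ k =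
        (M *v (x + (- a / M $ k $ k) *\<^sub>R axis k 1)) \<bullet> (x + (- a / M $ k $ k) *\<^sub>R axis k 1)"
        unfolding expand using Mkk by (simp add: a_def[symmetric] power2_eq_square field_simps)
      finally show ?thesis using pos by simp
    qed
    moreover have "transpose N = N"
      by (simp add: vec_eq_iff transpose_def Nij) (metis sym mult.commute)
    ultimately have "sym_nonneg_matrix N" by (simp add: sym_nonneg_matrix_def)
    moreover have "N $ k $ j = 0" for j using Mkk sym[of k j] by (simp add: Nij)
    moreover have "N $ i $ j = 0" if "\<forall>j. M $ i $ j = 0" for i j using that by (simp add: Nij)
    ultimately show ?thesis unfolding N_def by blast
  qed
qed

text \<open>Elimination over a growing set \<open>J\<close> of coordinates leaves the zero matrix in
  the end. The decomposition serves the trace inequality and, later, the splitting of a Gaussian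
  increment into one-dimensional jumps.\<close>

lemma psd_sum_of_squares:
  fixes M :: "real ^ 'n::finite ^ 'n"
  assumes M: "sym_nonneg_matrix M"
  shows "\<exists>\<sigma> :: 'n \<Rightarrow> real ^ 'n. \<forall>i j. M $ i $ j = (\<Sum>k\<in>UNIV. \<sigma> k $ i * \<sigma> k $ j)"
proof -
  have "\<exists>\<sigma> :: 'n \<Rightarrow> real ^ 'n. sym_nonneg_matrix (M - (\<chi> i j. \<Sum>k\<in>J. \<sigma> k $ i * \<sigma> k $ j)) \<and>
      (\<forall>i\<in>J. \<forall>j. (M - (\<chi> i j. \<Sum>k\<in>J. \<sigma> k $ i * \<sigma> k $ j)) $ i $ j = 0)" for J :: "'n set"
    using finite[of J]
  proof (induction J)
    case empty
    have "M - (\<chi> i j. 0) = M" by (simp add: vec_eq_iff)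
    then show ?case using M by simp
  next
    case (insert k J)
    then obtain \<sigma> :: "'n \<Rightarrow> real ^ 'n" where \<sigma>: "sym_nonneg_matrix (M - (\<chi> i j. \<Sum>k\<in>J. \<sigma> k $ i * \<sigma> k $ j))"
      "\<forall>i\<in>J. \<forall>j. (M - (\<chi> i j. \<Sum>k\<in>J. \<sigma> k $ i * \<sigma> k $ j)) $ i $ j = 0" by blast
    define N where "N = M - (\<chi> i j. \<Sum>k\<in>J. \<sigma> k $ i * \<sigma> k $ j)"
    obtain v where v: "sym_nonneg_matrix (N - (\<chi> i j. v $ i * v $ j))"
     "\<And>j. (N - (\<chi> i j. v $ i * v $ j)) $ k $ j = 0"
     "\<And>i j. (\<forall>j. N $ i $ j = 0) \<Longrightarrow> (N - (\<chi> i j. v $ i * v $ j)) $ i $ j = 0"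
      using psd_remove_coordinate[OF \<sigma>(1), of k] unfolding N_def[symmetric] by blast
    have eq: "M - (\<chi> i j. \<Sum>l\<in>insert k J. (\<sigma>(k := v)) l $ i * (\<sigma>(k := v)) l $ j) = N - (\<chi> i j. v $ i * v $ j)"
    proof -
      have "(\<Sum>l\<in>J. (\<sigma>(k := v)) l $ i * (\<sigma>(k := v)) l $ j) = (\<Sum>l\<in>J. \<sigma> l $ i * \<sigma> l $ j)" for i j
        using insert by (intro sum.cong) auto
      then show ?thesis using insert by (simp add: vec_eq_iff N_def)
    qed
    show ?case
      by (rule exI[of _ "\<sigma>(k := v)"], unfold eq) (use v \<sigma>(2) in \<open>auto simp: N_def[symmetric]\<close>)
  qed
  from this[of UNIV] show ?thesis by (auto simp: vec_eq_iff)
qed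

text \<open>With \<open>Q\<close> a sum of squares the trace is a sum of values of the quadratic
  form of \<open>H\<close>, which is the information that derivatives along lines provide.\<close>

lemma trace_mult_nonpos:
  fixes Q H :: "real ^ 'n::finite ^ 'n"
  assumes "sym_nonneg_matrix Q" and H: "\<And>v. (H *v v) \<bullet> v \<le> 0"
  shows "trace (Q ** H) \<le> 0"
proof -
  obtain \<sigma> :: "'n \<Rightarrow> real ^ 'n" where \<sigma>: "\<And>i j. Q $ i $ j = (\<Sum>k\<in>UNIV. \<sigma> k $ i * \<sigma> k $ j)"
    using psd_sum_of_squares[OF assms(1)] by blast
  have "trace (Q ** H) = (\<Sum>i\<in>UNIV. \<Sum>j\<in>UNIV. \<Sum>k\<in>UNIV. \<sigma> k $ i * \<sigma> k $ j * H $ j $ i)"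
    by (simp add: trace_def matrix_matrix_mult_def \<sigma> sum_distrib_right)
  also have "\<dots> = (\<Sum>k\<in>UNIV. \<Sum>j\<in>UNIV. \<Sum>i\<in>UNIV. \<sigma> k $ i * \<sigma> k $ j * H $ j $ i)"
    by (subst sum.swap, subst (2) sum.swap, subst sum.swap) (rule refl)
  also have "\<dots> = (\<Sum>k\<in>UNIV. (H *v \<sigma> k) \<bullet> \<sigma> k)"
    by (simp add: inner_vec_def matrix_vector_mult_def sum_distrib_right sum_distrib_left mult_ac)
  also have "\<dots> \<le> 0" by (intro sum_nonpos H)
  finally show ?thesis .
qed

section \<open>Second-order calculus along lines\<close>

text \<open>Differentiability is recorded along lines because contact and second differences are
  tested along lines, and in this form it passes directly to the difference of two solutions minus a
  barrier.\<close>

definition twice_diff :: "(real ^ 'n::finite \<Rightarrow> real) \<Rightarrow> (real ^ 'n \<Rightarrow> real ^ 'n) \<Rightarrow> (real ^ 'n \<Rightarrow> real ^ 'n ^ 'n) \<Rightarrow> bool" where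
  "twice_diff g G H \<longleftrightarrow> (\<forall>z h s.
     ((\<lambda>s. g (z + s *\<^sub>R h)) has_real_derivative (G (z + s *\<^sub>R h) \<bullet> h)) (at s) \<and>
     ((\<lambda>s. G (z + s *\<^sub>R h) \<bullet> h) has_real_derivative ((H (z + s *\<^sub>R h) *v h) \<bullet> h)) (at s))"

lemma frechet_pderiv_sum:
  fixes g :: "real ^ 'n::finite \<Rightarrow> real"
  assumes "g differentiable (at z)"
  shows "frechet_derivative g (at z) h = (\<Sum>j\<in>UNIV. h $ j * pderiv_at j g z)"
proof -
  have lin: "linear (frechet_derivative g (at z))" using assms by (rule linear_frechet_derivative)
  have "frechet_derivative g (at z) h = frechet_derivative g (at z) (\<Sum>j\<in>UNIV. h $ j *\<^sub>R axis j 1)"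
    using basis_expansion[of h] by (simp add: scalar_mult_eq_scaleR)
  also have "\<dots> = (\<Sum>j\<in>UNIV. h $ j * pderiv_at j g z)"
    using lin by (simp add: linear_sum linear_cmul pderiv_at_def)
  finally show ?thesis .
qed

lemma line_deriv:
  fixes g :: "real ^ 'n::finite \<Rightarrow> real"
  assumes "\<And>z. g differentiable (at z)"
  shows "((\<lambda>s. g (z + s *\<^sub>R h)) has_real_derivative (\<Sum>j\<in>UNIV. h $ j * pderiv_at j g (z + s *\<^sub>R h))) (at s)"
proof -
  have "(g has_derivative frechet_derivative g (at (z + s *\<^sub>R h))) (at (z + s *\<^sub>R h))"
    using assms frechet_derivative_works by blast
  moreover have "((\<lambda>s. z + s *\<^sub>R h) has_derivative (\<lambda>r. r *\<^sub>R h)) (at s)"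
    by (auto intro!: derivative_eq_intros)
  ultimately have "((\<lambda>s. g (z + s *\<^sub>R h)) has_derivative (\<lambda>r. frechet_derivative g (at (z + s *\<^sub>R h)) (r *\<^sub>R h))) (at s)"
    using has_derivative_compose[of "\<lambda>s. z + s *\<^sub>R h" "\<lambda>r. r *\<^sub>R h" s UNIV g] by simp
  then show ?thesis
    unfolding has_field_derivative_def
    by (rule has_derivative_eq_rhs) (auto simp: frechet_pderiv_sum[OF assms] fun_eq_iff sum_distrib_left mult_ac)
qed

lemma C2_D:
  fixes g :: "real ^ 'n::finite \<Rightarrow> real"
  assumes "C_class 2 g"
  shows "g differentiable (at z)" "pderiv_at j g differentiable (at z)"
    "continuous_on UNIV (pderiv_at i (pderiv_at j g))"
proof -
  have d: "\<And>js z. length js < 2 \<Longrightarrow> iter_pderiv js g differentiable (at z)"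
    and c: "\<And>js. length js \<le> 2 \<Longrightarrow> continuous_on UNIV (iter_pderiv js g)"
    using assms by (auto simp: C_class_def)
  show "g differentiable (at z)" using d[of "[]"] by (simp add: iter_pderiv_def)
  show "pderiv_at j g differentiable (at z)" using d[of "[j]"] by (simp add: iter_pderiv_def)
  show "continuous_on UNIV (pderiv_at i (pderiv_at j g))" using c[of "[i,j]"] by (simp add: iter_pderiv_def)
qed

lemma C2_twice_diff:
  fixes g :: "real ^ 'n::finite \<Rightarrow> real"
  assumes "C_class 2 g" shows "twice_diff g (gradient g) (hessian g)"
  unfolding twice_diff_def
proof (intro allI conjI)
  fix z h :: "real ^ 'n" and s :: real
  show "((\<lambda>s. g (z + s *\<^sub>R h)) has_real_derivative (gradient g (z + s *\<^sub>R h) \<bullet> h)) (at s)"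
    using line_deriv[OF C2_D(1)[OF assms], of z h s] by (simp add: gradient_def inner_vec_def mult.commute)
  have "((\<lambda>s. \<Sum>j\<in>UNIV. pderiv_at j g (z + s *\<^sub>R h) * h $ j) has_real_derivative
      (\<Sum>j\<in>UNIV. (\<Sum>i\<in>UNIV. h $ i * pderiv_at i (pderiv_at j g) (z + s *\<^sub>R h)) * h $ j)) (at s)"
    by (intro DERIV_sum DERIV_cmult_right line_deriv C2_D(2)[OF assms])
  also have "(\<lambda>s. \<Sum>j\<in>UNIV. pderiv_at j g (z + s *\<^sub>R h) * h $ j) = (\<lambda>s. gradient g (z + s *\<^sub>R h) \<bullet> h)"
    by (simp add: gradient_def inner_vec_def)
  also have "(\<Sum>j\<in>UNIV. (\<Sum>i\<in>UNIV. h $ i * pderiv_at i (pderiv_at j g) (z + s *\<^sub>R h)) * h $ j)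
     = (hessian g (z + s *\<^sub>R h) *v h) \<bullet> h"
    unfolding hessian_def inner_vec_def matrix_vector_mult_def
    by (simp add: sum_distrib_right) (subst sum.swap, simp add: mult_ac)
  finally show "((\<lambda>s. gradient g (z + s *\<^sub>R h) \<bullet> h) has_real_derivative ((hessian g (z + s *\<^sub>R h) *v h) \<bullet> h)) (at s)" .
qed

lemma twice_diff_diff:
  "twice_diff g1 G1 H1 \<Longrightarrow> twice_diff g2 G2 H2 \<Longrightarrow>
   twice_diff (\<lambda>z. g1 z - g2 z) (\<lambda>z. G1 z - G2 z) (\<lambda>z. H1 z - H2 z)"
  unfolding twice_diff_def by (simp add: inner_diff_left matrix_vector_mult_diff_rdistrib DERIV_diff)

lemma twice_diff_quadratic:
  "twice_diff (\<lambda>z. c * (1 + (norm z)\<^sup>2)) (\<lambda>z. (2 * c) *\<^sub>R z) (\<lambda>z. mat (2 * c))"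
proof -
  have eq: "mat (2 * c) *v h = (2 * c) *\<^sub>R h" for h :: "real ^ 'n"
    by (simp add: vec_eq_iff mat_def matrix_vector_mult_def if_distrib[of "\<lambda>x. x * _"] cong: if_cong)
  have s: "(z + s *\<^sub>R h) \<bullet> (z + s *\<^sub>R h) = z \<bullet> z + 2 * s * (z \<bullet> h) + s\<^sup>2 * (h \<bullet> h)" for z h :: "real ^ 'n" and s
    by (simp add: inner_add_left inner_add_right inner_commute power2_eq_square algebra_simps)
  show ?thesis
    unfolding twice_diff_def power2_norm_eq_inner eq s
    by (auto intro!: derivative_eq_intros simp: inner_add_left algebra_simps)
qed

lemma set_lebesgue_integral_Icc_0: "(LINT s:{0..0::real}|lborel. h s) = (0::real)"
  unfolding set_lebesgue_integral_def
proof (rule integral_eq_zero_AE)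
  show "AE s in lborel. indicator {0..0::real} s *\<^sub>R h s = 0"
    using AE_lborel_singleton[of "0::real"] by eventually_elim (auto simp: indicator_def)
qed

lemma solution_start:
  assumes "is_solution T L f v" "0 \<le> T" shows "v 0 z = 0"
proof -
  have "\<forall>t\<in>{0..T}. \<forall>z. set_integrable lborel {0..t} (\<lambda>s. f s z + L s (v s) z) \<and>
        v t z = (LINT s:{0..t}|lborel. f s z + L s (v s) z)"
    using assms(1) unfolding is_solution_def by blast
  then have "v 0 z = (LINT s:{0..0}|lborel. f s z + L s (v s) z)" using assms(2) by auto
  then show ?thesis by (simp only: set_lebesgue_integral_Icc_0)
qed

lemma touching_plane:
  fixes g :: "real ^ 'n::finite \<Rightarrow> real"
  assumes g: "twice_diff g G H" and t: "\<And>y. g y \<le> g z + p \<bullet> (y - z)"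
  shows "G z = p" "(H z *v v) \<bullet> v \<le> 0"
proof -
  define \<phi> where "\<phi> h s = g (z + s *\<^sub>R h) - s * (p \<bullet> h)" for h s
  have d1: "(\<phi> h has_real_derivative (G (z + s *\<^sub>R h) - p) \<bullet> h) (at s)" for h s
    using g unfolding twice_diff_def \<phi>_def inner_diff_left by (auto intro!: derivative_eq_intros)
  have d2: "((\<lambda>s. (G (z + s *\<^sub>R h) - p) \<bullet> h) has_real_derivative ((H (z + s *\<^sub>R h) *v h) \<bullet> h)) (at s)" for h s
    using g unfolding twice_diff_def inner_diff_left by (auto intro!: derivative_eq_intros)
  have max: "\<phi> h s \<le> \<phi> h 0" for h s using t[of "z + s *\<^sub>R h"] by (simp add: \<phi>_def)
  have z: "(G z - p) \<bullet> h = 0" for h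
    using DERIV_local_max[OF d1[of h 0] zero_less_one] max by simp
  then show "G z = p" by (metis eq_iff_diff_eq_0 inner_eq_zero_iff)
  show "(H z *v v) \<bullet> v \<le> 0"
  proof (rule ccontr)
    assume "\<not> ?thesis"
    then have "0 < (H (z + 0 *\<^sub>R v) *v v) \<bullet> v" by simp
    from DERIV_pos_inc_right[OF d2 this] obtain d where d: "0 < d"
      "\<And>h. 0 < h \<Longrightarrow> h < d \<Longrightarrow> 0 < (G (z + h *\<^sub>R v) - p) \<bullet> v" using z by auto
    have "\<phi> v 0 < \<phi> v (d/2)"
    proof (rule DERIV_pos_imp_increasing_open[where f="\<phi> v"])
      show "\<exists>y. (\<phi> v has_real_derivative y) (at x) \<and> 0 < y" if "0 < x" "x < d/2" for x
        using d1[of v x] d that by auto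
      show "continuous_on {0..d/2} (\<phi> v)"
        using d1 by (meson DERIV_isCont continuous_at_imp_continuous_on)
    qed (use d in auto)
    then show False using max[of v "d/2"] by simp
  qed
qed

text \<open>The mean value theorem is applied to \<open>\<phi> s + \<phi> (- s)\<close> and then to
  its derivative; this leaves a factor \<open>2 * s\<close> with \<open>s < 1\<close>, which the
  sign of \<open>M\<close> allows to be replaced by 2.\<close>

lemma second_difference_bound:
  assumes g: "twice_diff g G H" and M: "0 \<le> M" and b: "\<And>s. \<bar>s\<bar> \<le> 1 \<Longrightarrow> - M * (norm h)\<^sup>2 \<le> (H (z + s *\<^sub>R h) *v h) \<bullet> h"
  shows "- (2 * M) * (norm h)\<^sup>2 \<le> g (z + h) + g (z - h) - 2 * g z"
proof -
  define \<phi> where "\<phi> = (\<lambda>s. g (z + s *\<^sub>R h))"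
  define \<phi>' where "\<phi>' = (\<lambda>s. G (z + s *\<^sub>R h) \<bullet> h)"
  have d1: "(\<phi> has_real_derivative \<phi>' s) (at s)" for s using g by (simp add: twice_diff_def \<phi>_def \<phi>'_def)
  have d2: "(\<phi>' has_real_derivative ((H (z + s *\<^sub>R h) *v h) \<bullet> h)) (at s)" for s
    using g unfolding twice_diff_def \<phi>'_def by blast
  have d3: "((\<lambda>s. \<phi> s + \<phi> (- s)) has_real_derivative (\<phi>' s - \<phi>' (- s))) (at s)" for s
    using DERIV_add[OF d1[of s] DERIV_chain2[OF d1[of "- s"] DERIV_minus[OF DERIV_ident]]] by simp
  obtain s where s: "0 < s" "s < 1" "\<phi> 1 + \<phi> (- 1) - (\<phi> 0 + \<phi> (- 0)) = (1 - 0) * (\<phi>' s - \<phi>' (- s))"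
    using MVT2[of 0 1 "\<lambda>s. \<phi> s + \<phi> (- s)" "\<lambda>s. \<phi>' s - \<phi>' (- s)"] d3 by auto
  obtain r where r: "- s < r" "r < s" "\<phi>' s - \<phi>' (- s) = (s - - s) * ((H (z + r *\<^sub>R h) *v h) \<bullet> h)"
    using MVT2[of "- s" s \<phi>' "\<lambda>r. (H (z + r *\<^sub>R h) *v h) \<bullet> h"] d2 s by auto
  have *: "- M * (norm h)\<^sup>2 \<le> (H (z + r *\<^sub>R h) *v h) \<bullet> h" using r s by (intro b) auto
  have A: "(2 * s) * (- M * (norm h)\<^sup>2) \<le> \<phi> 1 + \<phi> (- 1) - 2 * \<phi> 0"
  proof -
    have "\<phi> 1 + \<phi> (- 1) - 2 * \<phi> 0 = (2 * s) * ((H (z + r *\<^sub>R h) *v h) \<bullet> h)" using s(3) r(3) by simp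
    then show ?thesis using s mult_left_mono[OF *, of "2 * s"] by simp
  qed
  show ?thesis
  proof -
    have "s * (M * (norm h)\<^sup>2) \<le> M * (norm h)\<^sup>2" using s M by (intro mult_left_le_one_le) auto
    then have "- (2 * M) * (norm h)\<^sup>2 \<le> (2 * s) * (- M * (norm h)\<^sup>2)" by simp
    also note A
    finally show ?thesis by (simp add: \<phi>_def)
  qed
qed

section \<open>Comparison of two solutions\<close>

text \<open>Common form of both operators: \<open>Q\<close> is constantly \<open>B\<close> for the
  unperturbed problem and \<open>B + S t\<close> for the perturbed one.\<close>

definition diffusion_op :: "real ^ 'n ^ 'n \<Rightarrow> (real \<Rightarrow> real ^ 'n ^ 'n) \<Rightarrow> real \<Rightarrow> (real ^ 'n::finite \<Rightarrow> real) \<Rightarrow> real ^ 'n \<Rightarrow> real" where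
  "diffusion_op A Q t g z = trace (Q t ** hessian g z) + (A *v z) \<bullet> gradient g z"

lemma trace_mult_diff: "trace (Q ** (H1 - H2)) = trace (Q ** H1) - trace (Q ** (H2 :: real ^ 'n ^ 'n::finite))"
  by (simp add: trace_def matrix_matrix_mult_def right_diff_distrib sum_subtractf)

lemma trace_mult_mat: "trace (Q ** mat c) = c * trace (Q :: real ^ 'n ^ 'n::finite)"
  by (simp add: trace_def matrix_matrix_mult_def mat_def if_distrib[of "\<lambda>x. _ * x"] sum_distrib_left mult.commute cong: if_cong)

lemma matrix_form_bound:
  fixes H :: "real ^ 'n::finite ^ 'n"
  assumes "norm H \<le> b" shows "- (b * real CARD('n)) * (norm h)\<^sup>2 \<le> (H *v h) \<bullet> h"
proof -
  have "\<bar>(H *v h) \<bullet> h\<bar> \<le> norm (H *v h) * norm h" by (rule Cauchy_Schwarz_ineq2)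
  also have "norm (H *v h) \<le> (\<Sum>i\<in>UNIV. \<bar>(H *v h) $ i\<bar>)" by (rule norm_le_l1_cart)
  also have "\<dots> \<le> (\<Sum>i\<in>(UNIV::'n set). b * norm h)"
  proof (rule sum_mono)
    fix i
    have "\<bar>(H *v h) $ i\<bar> = \<bar>H $ i \<bullet> h\<bar>" by (simp add: matrix_vector_mul_component)
    also have "\<dots> \<le> norm (H $ i) * norm h" by (rule Cauchy_Schwarz_ineq2)
    also have "\<dots> \<le> b * norm h" using Finite_Cartesian_Product.norm_nth_le[of H i] assms by (intro mult_right_mono) auto
    finally show "\<bar>(H *v h) $ i\<bar> \<le> b * norm h" .
  qed
  finally have "\<bar>(H *v h) \<bullet> h\<bar> \<le> (b * real CARD('n)) * (norm h)\<^sup>2"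
    by (simp add: mult_right_mono power2_eq_square mult_ac)
  then show ?thesis by (simp add: abs_le_iff)
qed

lemma continuous_hessian:
  fixes g :: "real ^ 'n::finite \<Rightarrow> real"
  assumes "C_class 2 g" shows "continuous_on UNIV (hessian g)"
  unfolding hessian_def by (intro continuous_intros continuous_on_vec_lambda C2_D(3)[OF assms])

text \<open>The contact argument is applied to the difference of the solutions minus the barrier
  \<open>c t * (1 + (norm z)\<^sup>2)\<close>. The barrier forces decay at infinity, and its
  exponential growth in time outweighs what the second-order and drift terms produce on it.\<close>

lemma solution_le:
  fixes v1 v2 f :: "real \<Rightarrow> real ^ 'n::finite \<Rightarrow> real"
  assumes T: "0 < T" and Q: "continuous_on {0..T} Q" "\<And>t. t \<in> {0..T} \<Longrightarrow> sym_nonneg_matrix (Q t)"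
    and v1: "is_solution T (diffusion_op A Q) f v1" and v2: "is_solution T (diffusion_op A Q) f v2"
    and t0: "t0 \<in> {0..T}"
  shows "v1 t0 z0 \<le> v2 t0 z0"
proof (rule ccontr)
  assume neg: "\<not> v1 t0 z0 \<le> v2 t0 z0"
  have C1: "\<And>t. t \<in> {0..T} \<Longrightarrow> C_class 2 (v1 t)" and C2: "\<And>t. t \<in> {0..T} \<Longrightarrow> C_class 2 (v2 t)"
    using v1 v2 by (auto simp: is_solution_def)
  have B1: "bounded ((\<lambda>(t, z). v1 t z) ` ({0..T} \<times> UNIV))" and B2: "bounded ((\<lambda>(t, z). v2 t z) ` ({0..T} \<times> UNIV))"
    using v1 v2 by (auto simp: is_solution_def)
  obtain V1 where V1: "\<And>t z. t \<in> {0..T} \<Longrightarrow> \<bar>v1 t z\<bar> \<le> V1"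
    using B1 unfolding bounded_iff by force
  obtain V2 where V2: "\<And>t z. t \<in> {0..T} \<Longrightarrow> \<bar>v2 t z\<bar> \<le> V2"
    using B2 unfolding bounded_iff by force
  define V where "V = V1 + V2"
  have V: "v1 t z - v2 t z \<le> V" if "t \<in> {0..T}" for t z
    using V1[OF that, of z] V2[OF that, of z] by (simp add: V_def)
  have V0: "0 \<le> V" using V1[of 0 0] V2[of 0 0] T by (simp add: V_def)
  have "bounded ((\<lambda>t. trace (Q t)) ` {0..T})"
    unfolding trace_def
    by (intro compact_imp_bounded compact_continuous_image continuous_on_sum continuous_on_component Q(1)) auto
  then obtain q where q: "0 < q" "\<And>t. t \<in> {0..T} \<Longrightarrow> \<bar>trace (Q t)\<bar> \<le> q"
    unfolding bounded_pos by auto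
  obtain a where a: "0 < a" "\<And>z. norm (A *v z) \<le> a * norm z"
    using bounded_linear.pos_bounded[OF matrix_vector_mul_bounded_linear[of A]] by (metis mult.commute)
  \<comment> \<open>At a contact point \<open>2 * q\<close> pays for the trace term of the barrier,
    \<open>2 * a\<close> for the drift acting on the quadratic, and 1 for the drift paired with the
    contact slope.\<close>
  define \<kappa> where "\<kappa> = 2 * q + 2 * a + 1"
  have lam: "0 < \<kappa>" using q a by (simp add: \<kappa>_def)
  define X where "X = exp (\<kappa> * t0) * (1 + (norm z0)\<^sup>2)"
  have X: "0 < X" by (simp add: X_def add_pos_nonneg)
  \<comment> \<open>With this choice the barrier uses up half of the supposed gap at
    \<open>(t0, z0)\<close>, and the other half stays positive.\<close>
  define \<epsilon> where "\<epsilon> = (v1 t0 z0 - v2 t0 z0) / (2 * X)"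
  have eps: "0 < \<epsilon>" using neg X by (simp add: \<epsilon>_def)
  define c where "c t = \<epsilon> * exp (\<kappa> * t)" for t
  have cpos: "0 < c t" for t using eps by (simp add: c_def)
  have cge: "\<epsilon> \<le> c t" if "0 \<le> t" for t using eps lam that by (simp add: c_def)
  \<comment> \<open>Clamping the time makes \<open>w\<close> continuous for all real times, as the
    locale demands.\<close>
  define cl where "cl t = max 0 (min T t)" for t :: real
  have cl: "cl t \<in> {0..T}" "t \<in> {0..T} \<Longrightarrow> cl t = t" for t using T by (auto simp: cl_def)
  define w where "w t z = v1 (cl t) z - v2 (cl t) z - c (cl t) * (1 + (norm z)\<^sup>2)" for t z
  define g where "g t z = diffusion_op A Q t (v1 t) z - diffusion_op A Q t (v2 t) z - \<kappa> * c t * (1 + (norm z)\<^sup>2)" for t z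
  \<comment> \<open>Outside this radius the quadratic barrier dominates both
    \<open>2 * norm z\<close> and \<open>2 * V\<close>.\<close>
  define R where "R = 1 + 2 / \<epsilon> + 2 * V / \<epsilon>"
  have R: "1 \<le> R" "2 / \<epsilon> \<le> R" "2 * V / \<epsilon> \<le> R" using eps V0 by (auto simp: R_def)
  \<comment> \<open>The bound 1 serves the decay at infinity, \<open>\<epsilon>\<close> the initial
    time, and \<open>\<epsilon> / (a * R)\<close> keeps the drift paired with the contact slope
    below \<open>c t\<close> inside the ball.\<close>
  define \<rho> where "\<rho> = min 1 (min \<epsilon> (\<epsilon> / (a * R)))"
  have rho: "0 < \<rho>" "\<rho> \<le> 1" "\<rho> \<le> \<epsilon>" using eps a R by (auto simp: \<rho>_def)
  have "\<rho> \<le> \<epsilon> / (a * R)" by (simp add: \<rho>_def)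
  then have rho4: "\<rho> * (a * R) \<le> \<epsilon>" using a R by (simp add: pos_le_divide_eq)
  have sq: "norm z \<le> 1 + (norm z)\<^sup>2" for z :: "real ^ 'n"
    using sum_squares_ge_zero[of "norm z - 1" 0] by (simp add: power2_eq_square algebra_simps) (smt (verit) mult_nonneg_nonneg norm_ge_zero)
  have W: "twice_diff (w t) (\<lambda>z. gradient (v1 t) z - gradient (v2 t) z - (2 * c t) *\<^sub>R z)
      (\<lambda>z. hessian (v1 t) z - hessian (v2 t) z - mat (2 * c t))" if "t \<in> {0..T}" for t
  proof -
    have "w t = (\<lambda>z. v1 t z - v2 t z - c t * (1 + (norm z)\<^sup>2))" using cl(2)[OF that] by (simp add: w_def fun_eq_iff)
    then show ?thesis using C1[OF that] C2[OF that]
      by (simp only:) (intro twice_diff_diff twice_diff_quadratic C2_twice_diff)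
  qed
  interpret excursion T R \<rho> w g
  proof
    show "0 < T" "0 < R" "0 < \<rho>" using T R rho by auto
  next
    have c1: "continuous_on ({0..T} \<times> UNIV) (\<lambda>(t, z). v1 t z)" and c2: "continuous_on ({0..T} \<times> UNIV) (\<lambda>(t, z). v2 t z)"
      using v1 v2 by (auto simp: is_solution_def)
    have ccl: "continuous_on UNIV (\<lambda>x::real \<times> (real ^ 'n). (cl (fst x), snd x))"
      unfolding cl_def by (intro continuous_intros)
    have rng: "range (\<lambda>x::real \<times> (real ^ 'n). (cl (fst x), snd x)) \<subseteq> {0..T} \<times> UNIV" using cl(1) by auto
    have "continuous_on UNIV (\<lambda>x. v1 (cl (fst x)) (snd x))" "continuous_on UNIV (\<lambda>x. v2 (cl (fst x)) (snd x))"
      using continuous_on_compose2[OF c1 ccl rng] continuous_on_compose2[OF c2 ccl rng] by auto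
    moreover have "continuous_on UNIV (\<lambda>x::real \<times> (real ^ 'n). c (cl (fst x)) * (1 + (norm (snd x))\<^sup>2))"
      unfolding c_def cl_def by (intro continuous_intros)
    ultimately show "continuous_on UNIV (\<lambda>(t, z). w t z)"
      unfolding w_def split_beta by (intro continuous_on_diff)
  next
    fix t :: real and z :: "real ^ 'n" assume t: "0 \<le> t" "t \<le> T" and z: "R \<le> norm z"
    have R2: "R * norm z \<le> (norm z)\<^sup>2" using z R by (simp add: power2_eq_square mult_right_mono)
    have "2 / \<epsilon> * norm z \<le> (norm z)\<^sup>2" using R2 R(2) mult_right_mono[OF R(2) norm_ge_zero[of z]] by linarith
    then have 1: "2 * norm z \<le> \<epsilon> * (norm z)\<^sup>2" using eps by (simp add: field_simps)
    have "R * 1 \<le> R * norm z" using R z by (intro mult_left_mono) auto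
    then have "2 * V / \<epsilon> \<le> (norm z)\<^sup>2" using R2 R(3) by linarith
    then have 2: "2 * V \<le> \<epsilon> * (norm z)\<^sup>2" using eps by (simp add: field_simps)
    have "w t z \<le> V - c t * (1 + (norm z)\<^sup>2)" using V[of t z] t cl(2)[of t] by (simp add: w_def)
    also have "\<dots> \<le> V - \<epsilon> * (norm z)\<^sup>2"
      using cge[OF t(1)] eps mult_mono[of \<epsilon> "c t" "(norm z)\<^sup>2" "1 + (norm z)\<^sup>2"] cpos[of t] by simp
    moreover have "\<rho> * norm z \<le> norm z" using rho by (simp add: mult_left_le_one_le)
    ultimately show "w t z + \<rho> * norm z \<le> 0" using 1 2 by linarith
  next
    fix z :: "real ^ 'n"
    have "v1 0 z = 0" "v2 0 z = 0" using solution_start[OF v1] solution_start[OF v2] T by auto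
    then have "w 0 z = - \<epsilon> * (1 + (norm z)\<^sup>2)" using T by (simp add: w_def cl_def c_def)
    moreover have "\<rho> * norm z \<le> \<epsilon> * (1 + (norm z)\<^sup>2)" using rho sq[of z] by (intro mult_mono) auto
    ultimately show "w 0 z + \<rho> * norm z \<le> 0" by simp
  next
    fix t assume t: "0 \<le> t" "t \<le> T"
    define H where "H z = hessian (v1 t) z - hessian (v2 t) z - mat (2 * c t)" for z
    have "compact (H ` cball 0 (3 * R))"
      unfolding H_def using t
      by (intro compact_continuous_image continuous_intros continuous_on_subset[OF continuous_hessian[OF C1]]
          continuous_on_subset[OF continuous_hessian[OF C2]]) auto
    then obtain b where b: "0 < b" "\<And>z. z \<in> cball 0 (3 * R) \<Longrightarrow> norm (H z) \<le> b"
      using compact_imp_bounded bounded_pos by (metis imageI)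
    show "\<exists>M. \<forall>z h. norm z \<le> R \<longrightarrow> norm h \<le> 2 * R \<longrightarrow>
                 - M * (norm h)\<^sup>2 \<le> w t (z + h) + w t (z - h) - 2 * w t z"
    proof (intro exI[of _ "2 * (b * real CARD('n))"] allI impI)
      fix z h :: "real ^ 'n" assume zh: "norm z \<le> R" "norm h \<le> 2 * R"
      show "- (2 * (b * real CARD('n))) * (norm h)\<^sup>2 \<le> w t (z + h) + w t (z - h) - 2 * w t z"
      proof (rule second_difference_bound[OF W])
        fix s :: real assume s: "\<bar>s\<bar> \<le> 1"
        have "norm (z + s *\<^sub>R h) \<le> norm z + norm (s *\<^sub>R h)" by (rule norm_triangle_ineq)
        also have "\<dots> \<le> R + 1 * (2 * R)" unfolding norm_scaleR using zh s by (intro add_mono mult_mono) auto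
        finally have "norm (H (z + s *\<^sub>R h)) \<le> b" by (intro b) simp
        then show "- (b * real CARD('n)) * (norm h)\<^sup>2 \<le> ((hessian (v1 t) (z + s *\<^sub>R h) - hessian (v2 t) (z + s *\<^sub>R h) - mat (2 * c t)) *v h) \<bullet> h"
          using matrix_form_bound[of "H (z + s *\<^sub>R h)" b h] by (simp add: H_def)
      qed (use t b in auto)
    qed
  next
    fix z :: "real ^ 'n"
    have s1: "set_integrable lborel {0..t} (\<lambda>s. f s z + diffusion_op A Q s (v1 s) z)"
         "v1 t z = (LINT s:{0..t}|lborel. f s z + diffusion_op A Q s (v1 s) z)"
      and s2: "set_integrable lborel {0..t} (\<lambda>s. f s z + diffusion_op A Q s (v2 s) z)"
         "v2 t z = (LINT s:{0..t}|lborel. f s z + diffusion_op A Q s (v2 s) z)" if "t \<in> {0..T}" for t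
      using v1 v2 that by (auto simp: is_solution_def)
    define d where "d = (\<lambda>s. diffusion_op A Q s (v1 s) z - diffusion_op A Q s (v2 s) z)"
    have di: "set_integrable lborel {0..t} d" and dI: "v1 t z - v2 t z = (LINT s:{0..t}|lborel. d s)" if "t \<in> {0..T}" for t
      using set_integral_diff[OF s1(1) s2(1)] s1(2) s2(2) that by (auto simp: d_def)
    have ei: "(\<lambda>s. \<kappa> * c s * (1 + (norm z)\<^sup>2)) absolutely_integrable_on {0..T}"
      unfolding c_def by (intro absolutely_integrable_continuous_real continuous_intros)
    have dabs: "d absolutely_integrable_on {0..t}" if "t \<in> {0..T}" for t
      using di[OF that] unfolding set_integrable_def by (rule integrable_completion[THEN iffD2, rotated]) 
       (use di[OF that] in \<open>auto simp: set_integrable_def\<close>)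
    have Tin: "T \<in> {0..T}" using T by simp
    show "(\<lambda>s. g s z) absolutely_integrable_on {0..T}"
      unfolding g_def using set_integral_diff(1)[OF dabs[OF Tin] ei] by (simp add: d_def)
    fix t assume t: "t \<in> {0..T}"
    have E: "((\<lambda>s. \<kappa> * c s * (1 + (norm z)\<^sup>2)) has_integral (c t * (1 + (norm z)\<^sup>2) - c 0 * (1 + (norm z)\<^sup>2))) {0..t}"
      by (rule fundamental_theorem_of_calculus)
        (use t in \<open>auto simp: c_def has_real_derivative_iff_has_vector_derivative[symmetric] intro!: derivative_eq_intros\<close>)
    have D: "(d has_integral (v1 t z - v2 t z)) {0..t}"
      using set_borel_integral_eq_integral[OF di[OF t]] dI[OF t] by (simp add: has_integral_iff)
    have "integral {0..t} (\<lambda>s. g s z) = (v1 t z - v2 t z) - (c t * (1 + (norm z)\<^sup>2) - c 0 * (1 + (norm z)\<^sup>2))"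
      using has_integral_diff[OF D E] by (simp add: g_def d_def integral_unique)
    moreover have "v1 0 z = 0" "v2 0 z = 0" using solution_start[OF v1] solution_start[OF v2] T by auto
    ultimately show "w t z = w 0 z + integral {0..t} (\<lambda>s. g s z)" using T cl(2)[OF t] cl(2)[of 0] by (simp add: w_def)
  next
    fix t :: real and z p :: "real ^ 'n" assume t: "t \<in> {0..T}" and pos: "0 < w t z" and p: "norm p \<le> \<rho>"
      and touch: "\<And>y. w t y \<le> w t z + p \<bullet> (y - z)"
    define H where "H = hessian (v1 t) z - hessian (v2 t) z - mat (2 * c t)"
    have G: "gradient (v1 t) z - gradient (v2 t) z = p + (2 * c t) *\<^sub>R z"
      using touching_plane(1)[OF W[OF t] touch] by (simp add: algebra_simps)
    have Hn: "trace (Q t ** H) \<le> 0"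
      unfolding H_def by (intro trace_mult_nonpos Q(2) t touching_plane(2)[OF W[OF t] touch])
    have tr: "trace (Q t ** hessian (v1 t) z) - trace (Q t ** hessian (v2 t) z) = trace (Q t ** H) + 2 * c t * trace (Q t)"
      by (simp add: H_def trace_mult_diff trace_mult_mat)
    have zR: "norm z \<le> R"
    proof (rule ccontr)
      assume "\<not> norm z \<le> R"
      have R2: "R * norm z \<le> (norm z)\<^sup>2" using \<open>\<not> norm z \<le> R\<close> R by (simp add: power2_eq_square mult_right_mono)
      have "R * 1 \<le> R * norm z" using R \<open>\<not> norm z \<le> R\<close> by (intro mult_left_mono) auto
      then have "2 * V / \<epsilon> \<le> (norm z)\<^sup>2" using R2 R(3) by linarith
      then have 2: "2 * V \<le> \<epsilon> * (norm z)\<^sup>2" using eps by (simp add: field_simps)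
      have "w t z \<le> V - c t * (1 + (norm z)\<^sup>2)" using V[of t z] t cl(2)[of t] by (simp add: w_def)
      also have "\<dots> \<le> V - \<epsilon> * (norm z)\<^sup>2"
        using cge[of t] t eps mult_mono[of \<epsilon> "c t" "(norm z)\<^sup>2" "1 + (norm z)\<^sup>2"] cpos[of t] by simp
      finally show False using 2 V0 pos by linarith
    qed
    have dr: "(A *v z) \<bullet> gradient (v1 t) z - (A *v z) \<bullet> gradient (v2 t) z = (A *v z) \<bullet> p + 2 * c t * ((A *v z) \<bullet> z)"
      using G by (simp add: inner_diff_right[symmetric] inner_add_right)
    have "(A *v z) \<bullet> p \<le> norm (A *v z) * norm p" by (rule norm_cauchy_schwarz)
    also have "\<dots> \<le> (a * R) * \<rho>"
      using a(2)[of z] zR p a(1) R rho by (intro mult_mono) (auto intro: order_trans[OF _ mult_left_mono])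
    also have "\<dots> \<le> \<epsilon>" using rho4 by (simp add: mult.commute)
    also have "\<epsilon> \<le> c t" using cge t by simp
    finally have 1: "(A *v z) \<bullet> p \<le> c t" .
    have "(A *v z) \<bullet> z \<le> norm (A *v z) * norm z" by (rule norm_cauchy_schwarz)
    also have "\<dots> \<le> (a * norm z) * norm z" using a(2) by (intro mult_right_mono) auto
    finally have 2: "(A *v z) \<bullet> z \<le> a * (norm z)\<^sup>2" by (simp add: power2_eq_square mult.assoc)
    have 3: "2 * c t * ((A *v z) \<bullet> z) \<le> 2 * c t * (a * (norm z)\<^sup>2)" using 2 cpos[of t] by (intro mult_left_mono) auto
    have 4: "2 * c t * trace (Q t) \<le> 2 * c t * q" using q(2)[OF t] cpos[of t] by (intro mult_left_mono) auto
    have "2 * c t * q + c t + 2 * c t * (a * (norm z)\<^sup>2) \<le> \<kappa> * c t * (1 + (norm z)\<^sup>2)"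
      using q a cpos[of t] by (simp add: \<kappa>_def algebra_simps)
    then show "g t z \<le> 0"
      unfolding g_def diffusion_op_def using tr dr Hn 1 3 4 by linarith
  qed
  have "w t0 z0 \<le> 0" using nonpos t0 by auto
  moreover have "w t0 z0 = (v1 t0 z0 - v2 t0 z0) / 2"
  proof -
    have "c t0 * (1 + (norm z0)\<^sup>2) = \<epsilon> * X" by (simp add: c_def X_def)
    also have "\<dots> = (v1 t0 z0 - v2 t0 z0) / 2" using X by (simp add: \<epsilon>_def)
    finally show ?thesis using cl(2)[OF t0] by (simp add: w_def)
  qed
  ultimately show False using neg by simp
qed

lemma unique_solutionI:
  assumes T: "0 < T" and Q: "continuous_on {0..T} Q" "\<And>t. t \<in> {0..T} \<Longrightarrow> sym_nonneg_matrix (Q t)"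
    and u: "is_solution T (diffusion_op A Q) f u"
  shows "is_unique_solution T (diffusion_op A Q) f u"
  unfolding is_unique_solution_def
  using u solution_le[OF T Q] by (meson order_antisym)

section \<open>Superpositions of plane waves\<close>

text \<open>The parameter space and the frequency map stay abstract: a source slice is a
  superposition over frequencies, a solution one over pairs of time and frequency.\<close>

definition osc_integral :: "'x measure \<Rightarrow> ('x \<Rightarrow> complex) \<Rightarrow> ('x \<Rightarrow> 'a::euclidean_space) \<Rightarrow> 'a \<Rightarrow> real" where
  "osc_integral M a \<theta> z = (\<integral>x. Re (a x * cis (z \<bullet> \<theta> x)) \<partial>M)"

text \<open>The exponent \<open>m\<close> is a budget: a multiplier that grows like the
  \<open>j\<close>-th power of the frequency spends \<open>j\<close> of it.\<close>

definition amplitude :: "'x measure \<Rightarrow> nat \<Rightarrow> ('x \<Rightarrow> complex) \<Rightarrow> ('x \<Rightarrow> 'a::euclidean_space) \<Rightarrow> bool" where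
  "amplitude M m a \<theta> \<longleftrightarrow> a \<in> borel_measurable M \<and> \<theta> \<in> borel_measurable M \<and>
     integrable M (\<lambda>x. (1 + norm (\<theta> x)) ^ m * norm (a x))"

lemma cis_measurable [measurable]: "cis \<in> borel_measurable borel"
  by (intro borel_measurable_continuous_onI continuous_intros)

lemma amplitude_D:
  assumes "amplitude M m a \<theta>"
  shows "a \<in> borel_measurable M" "\<theta> \<in> borel_measurable M" "integrable M (\<lambda>x. (1 + norm (\<theta> x)) ^ m * norm (a x))"
  using assms by (auto simp: amplitude_def)

lemma amplitude_multiply:
  assumes a: "amplitude M m a \<theta>" and c: "c \<in> borel_measurable M" and mj: "m = l + j"
    and b: "\<And>x. norm (c x) \<le> C * (1 + norm (\<theta> x)) ^ j"
  shows "amplitude M l (\<lambda>x. c x * a x) \<theta>"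
proof -
  note [measurable] = amplitude_D(1,2)[OF a] c
  have "integrable M (\<lambda>x. (1 + norm (\<theta> x)) ^ l * norm (c x * a x))"
  proof (rule Bochner_Integration.integrable_bound)
    show "integrable M (\<lambda>x. C * ((1 + norm (\<theta> x)) ^ m * norm (a x)))"
      using amplitude_D(3)[OF a] by (rule integrable_mult_right)
    show "AE x in M. norm ((1 + norm (\<theta> x)) ^ l * norm (c x * a x)) \<le> norm (C * ((1 + norm (\<theta> x)) ^ m * norm (a x)))"
    proof (intro AE_I2)
      fix x
      have "(1 + norm (\<theta> x)) ^ l * norm (c x * a x) = ((1 + norm (\<theta> x)) ^ l * norm (a x)) * norm (c x)"
        by (simp add: norm_mult)
      also have "\<dots> \<le> ((1 + norm (\<theta> x)) ^ l * norm (a x)) * (C * (1 + norm (\<theta> x)) ^ j)"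
        by (intro mult_left_mono b) auto
      also have "\<dots> = C * ((1 + norm (\<theta> x)) ^ m * norm (a x))" by (simp add: mj power_add)
      finally have "(1 + norm (\<theta> x)) ^ l * norm (c x * a x) \<le> C * ((1 + norm (\<theta> x)) ^ m * norm (a x))" .
      moreover have "0 \<le> (1 + norm (\<theta> x)) ^ l * norm (c x * a x)" by simp
      ultimately show "norm ((1 + norm (\<theta> x)) ^ l * norm (c x * a x)) \<le> norm (C * ((1 + norm (\<theta> x)) ^ m * norm (a x)))"
        unfolding real_norm_def by (metis abs_ge_self abs_of_nonneg order_trans)
    qed
  qed measurable
  then show ?thesis by (simp add: amplitude_def)
qed

lemma amplitude_mono: assumes "amplitude M m a \<theta>" "l \<le> m" shows "amplitude M l a \<theta>"
  using amplitude_multiply[OF assms(1), of "\<lambda>_. 1" l "m - l" 1] assms(2) by simp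

lemma amplitude_component:
  assumes a: "amplitude M (Suc m) a \<theta>"
  shows "amplitude M m (\<lambda>x. \<i> * of_real (h \<bullet> \<theta> x) * a x) \<theta>"
proof (rule amplitude_multiply[OF a, of _ _ 1 "norm h"])
  note [measurable] = amplitude_D(1,2)[OF a]
  show "(\<lambda>x. \<i> * complex_of_real (h \<bullet> \<theta> x)) \<in> borel_measurable M" by measurable
  show "norm (\<i> * complex_of_real (h \<bullet> \<theta> x)) \<le> norm h * (1 + norm (\<theta> x)) ^ 1" for x
    using Cauchy_Schwarz_ineq2[of h "\<theta> x"] by (simp add: norm_mult distrib_left) (smt (verit) norm_ge_zero)
qed simp

lemma osc_integrand_integrable:
  assumes a: "amplitude M m a \<theta>" shows "integrable M (\<lambda>x. Re (a x * cis (z \<bullet> \<theta> x)))"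
proof -
  note [measurable] = amplitude_D(1,2)[OF a]
  have "integrable M (\<lambda>x. (1 + norm (\<theta> x)) ^ 0 * norm (a x))"
    using amplitude_mono[OF a, of 0] by (simp add: amplitude_def)
  then have "integrable M a" by (subst (asm) power_0, subst (asm) mult_1_left, subst (asm) integrable_norm_iff) auto
  then show ?thesis
  proof (rule Bochner_Integration.integrable_bound)
    show "AE x in M. norm (Re (a x * cis (z \<bullet> \<theta> x))) \<le> norm (a x)"
    proof (rule AE_I2)
      fix x show "norm (Re (a x * cis (z \<bullet> \<theta> x))) \<le> norm (a x)"
        using abs_Re_le_cmod[of "a x * cis (z \<bullet> \<theta> x)"] by (simp only: norm_mult norm_cis real_norm_def mult_1_right)
    qed
  qed measurable
qed

lemma osc_integral_add:
  assumes "amplitude M m a \<theta>" "amplitude M l b \<theta>"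
  shows "osc_integral M (\<lambda>x. a x + b x) \<theta> z = osc_integral M a \<theta> z + osc_integral M b \<theta> z"
  unfolding osc_integral_def
  using Bochner_Integration.integral_add[OF osc_integrand_integrable[OF assms(1)] osc_integrand_integrable[OF assms(2)], of z z]
  by (simp add: distrib_right)

lemma osc_integral_scale: "osc_integral M (\<lambda>x. complex_of_real c * a x) \<theta> z = c * osc_integral M a \<theta> z"
  unfolding osc_integral_def by (simp add: mult.assoc flip: integral_mult_right_zero)

lemma amplitude_sum:
  assumes "finite I" "\<And>i. i \<in> I \<Longrightarrow> amplitude M m (a i) \<theta>" "I \<noteq> {}"
  shows "amplitude M m (\<lambda>x. \<Sum>i\<in>I. a i x) \<theta>"
proof -
  have [measurable]: "\<theta> \<in> borel_measurable M" "\<And>i. i \<in> I \<Longrightarrow> a i \<in> borel_measurable M"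
    using assms(2,3) by (auto simp: amplitude_def)
  have "integrable M (\<lambda>x. (1 + norm (\<theta> x)) ^ m * norm (\<Sum>i\<in>I. a i x))"
  proof (rule Bochner_Integration.integrable_bound)
    show "integrable M (\<lambda>x. \<Sum>i\<in>I. (1 + norm (\<theta> x)) ^ m * norm (a i x))"
    proof (rule Bochner_Integration.integrable_sum)
      fix i assume "i \<in> I"
      from amplitude_D(3)[OF assms(2)[OF this]] show "integrable M (\<lambda>x. (1 + norm (\<theta> x)) ^ m * norm (a i x))" .
    qed
    show "AE x in M. norm ((1 + norm (\<theta> x)) ^ m * norm (\<Sum>i\<in>I. a i x)) \<le> norm (\<Sum>i\<in>I. (1 + norm (\<theta> x)) ^ m * norm (a i x))"
      by (intro AE_I2) (auto simp: sum_distrib_left[symmetric] norm_mult abs_mult sum_nonneg intro!: mult_left_mono norm_sum)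
  qed measurable
  then show ?thesis by (simp add: amplitude_def)
qed

lemma osc_integral_sum:
  assumes "finite I" "\<And>i. i \<in> I \<Longrightarrow> amplitude M m (a i) \<theta>"
  shows "osc_integral M (\<lambda>x. \<Sum>i\<in>I. a i x) \<theta> z = (\<Sum>i\<in>I. osc_integral M (a i) \<theta> z)"
  unfolding osc_integral_def
  using Bochner_Integration.integral_sum[of I M "\<lambda>i x. Re (a i x * cis (z \<bullet> \<theta> x))"] osc_integrand_integrable[OF assms(2)]
  by (simp add: sum_distrib_right)

text \<open>The first-order remainder of the phase factor is bounded by the square of the phase, so
  weight 2 gives a quadratic error bound for the superposition.\<close>

lemma osc_integral_has_derivative:
  assumes a: "amplitude M 2 a \<theta>"
  shows "(osc_integral M a \<theta> has_derivative (\<lambda>h. osc_integral M (\<lambda>x. \<i> * of_real (h \<bullet> \<theta> x) * a x) \<theta> z)) (at z)"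
proof -
  note [measurable] = amplitude_D(1,2)[OF a]
  have a1: "amplitude M 1 (\<lambda>x. \<i> * of_real (h \<bullet> \<theta> x) * a x) \<theta>" for h
    using amplitude_component[of M 1 a \<theta> h] a by (simp add: numeral_2_eq_2)
  define B where "B = (\<integral>x. (1 + norm (\<theta> x)) ^ 2 * norm (a x) \<partial>M)"
  note i1 = osc_integrand_integrable[OF a] and i2 = osc_integrand_integrable[OF a, of z] and i3 = osc_integrand_integrable[OF a1, of _ z]
  have rem: "\<bar>osc_integral M a \<theta> (z + h) - osc_integral M a \<theta> z - osc_integral M (\<lambda>x. \<i> * of_real (h \<bullet> \<theta> x) * a x) \<theta> z\<bar> \<le> (norm h)\<^sup>2 * B" for h
  proof -
    have "osc_integral M a \<theta> (z + h) - osc_integral M a \<theta> z - osc_integral M (\<lambda>x. \<i> * of_real (h \<bullet> \<theta> x) * a x) \<theta> z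
      = (\<integral>x. Re (a x * cis ((z + h) \<bullet> \<theta> x)) - Re (a x * cis (z \<bullet> \<theta> x)) - Re (\<i> * of_real (h \<bullet> \<theta> x) * a x * cis (z \<bullet> \<theta> x)) \<partial>M)"
      unfolding osc_integral_def
      by (simp only: Bochner_Integration.integral_diff[OF i1 i2] Bochner_Integration.integral_diff[OF Bochner_Integration.integrable_diff[OF i1 i2] i3])
    also have "\<bar>\<dots>\<bar> \<le> (\<integral>x. (norm h)\<^sup>2 * ((1 + norm (\<theta> x)) ^ 2 * norm (a x)) \<partial>M)"
    proof (rule order_trans[OF integral_abs_bound integral_mono])
      show "integrable M (\<lambda>x. \<bar>Re (a x * cis ((z + h) \<bullet> \<theta> x)) - Re (a x * cis (z \<bullet> \<theta> x)) - Re (\<i> * of_real (h \<bullet> \<theta> x) * a x * cis (z \<bullet> \<theta> x))\<bar>)"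
        by (intro integrable_abs Bochner_Integration.integrable_diff osc_integrand_integrable[OF a] osc_integrand_integrable[OF a1])
      show "integrable M (\<lambda>x. (norm h)\<^sup>2 * ((1 + norm (\<theta> x)) ^ 2 * norm (a x)))"
        using amplitude_D(3)[OF a] by (rule integrable_mult_right)
      fix x
      define d where "d = h \<bullet> \<theta> x"
      have c: "cis ((z + h) \<bullet> \<theta> x) = cis (z \<bullet> \<theta> x) * cis d" by (simp add: inner_add_left cis_mult d_def)
      have "Re (a x * cis ((z + h) \<bullet> \<theta> x)) - Re (a x * cis (z \<bullet> \<theta> x)) - Re (\<i> * of_real (h \<bullet> \<theta> x) * a x * cis (z \<bullet> \<theta> x))
         = Re (a x * cis (z \<bullet> \<theta> x) * (cis d - (1 + \<i> * of_real d)))"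
        by (simp only: c d_def[symmetric] minus_complex.sel[symmetric]) (simp add: algebra_simps)
      also have "\<bar>\<dots>\<bar> \<le> norm (a x * cis (z \<bullet> \<theta> x) * (cis d - (1 + \<i> * of_real d)))" by (rule abs_Re_le_cmod)
      also have "\<dots> = norm (a x) * norm (cis d - (1 + \<i> * of_real d))" by (simp add: norm_mult)
      also have "\<dots> \<le> norm (a x) * d\<^sup>2"
      proof (rule mult_left_mono)
        have "norm (cis d - (1 + \<i> * of_real d)) \<le> \<bar>d\<bar> ^ Suc 1 / fact (Suc 1)"
          using iexp_approx1[of d 1] by (simp add: cis_conv_exp)
        also have "\<dots> \<le> d\<^sup>2" by (simp add: numeral_2_eq_2 power2_eq_square)
        finally show "norm (cis d - (1 + \<i> * of_real d)) \<le> d\<^sup>2" .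
      qed simp
      also have "\<dots> \<le> norm (a x) * ((norm h)\<^sup>2 * (1 + norm (\<theta> x)) ^ 2)"
      proof (intro mult_left_mono)
        have "\<bar>d\<bar> \<le> norm h * (1 + norm (\<theta> x))"
          using Cauchy_Schwarz_ineq2[of h "\<theta> x"] by (simp add: d_def distrib_left) (smt (verit) norm_ge_zero)
        then have "\<bar>d\<bar>\<^sup>2 \<le> (norm h * (1 + norm (\<theta> x)))\<^sup>2" by (intro power_mono) auto
        then show "d\<^sup>2 \<le> (norm h)\<^sup>2 * (1 + norm (\<theta> x)) ^ 2" by (simp add: power_mult_distrib)
      qed simp
      finally show "\<bar>Re (a x * cis ((z + h) \<bullet> \<theta> x)) - Re (a x * cis (z \<bullet> \<theta> x)) - Re (\<i> * of_real (h \<bullet> \<theta> x) * a x * cis (z \<bullet> \<theta> x))\<bar>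
          \<le> (norm h)\<^sup>2 * ((1 + norm (\<theta> x)) ^ 2 * norm (a x))" by (simp only: mult_ac)
    qed
    also have "\<dots> = (norm h)\<^sup>2 * B" by (simp add: B_def)
    finally show ?thesis .
  qed
  have B0: "0 \<le> B" unfolding B_def by (intro integral_nonneg_AE) auto
  have lin: "linear (\<lambda>h. osc_integral M (\<lambda>x. \<i> * of_real (h \<bullet> \<theta> x) * a x) \<theta> z)"
  proof (rule linearI)
    fix h h' show "osc_integral M (\<lambda>x. \<i> * of_real ((h + h') \<bullet> \<theta> x) * a x) \<theta> z =
      osc_integral M (\<lambda>x. \<i> * of_real (h \<bullet> \<theta> x) * a x) \<theta> z + osc_integral M (\<lambda>x. \<i> * of_real (h' \<bullet> \<theta> x) * a x) \<theta> z"
      using osc_integral_add[OF a1 a1, of h h' z] by (simp add: inner_add_left algebra_simps)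
  next
    fix c :: real and h show "osc_integral M (\<lambda>x. \<i> * of_real ((c *\<^sub>R h) \<bullet> \<theta> x) * a x) \<theta> z =
      c *\<^sub>R osc_integral M (\<lambda>x. \<i> * of_real (h \<bullet> \<theta> x) * a x) \<theta> z"
      using osc_integral_scale[of M c "\<lambda>x. \<i> * of_real (h \<bullet> \<theta> x) * a x" \<theta> z] by (simp add: mult_ac)
  qed
  show ?thesis
  proof (rule has_derivativeI_sandwich[where e=1 and H="\<lambda>y. norm (y - z) * B"])
    show "bounded_linear (\<lambda>h. osc_integral M (\<lambda>x. \<i> * of_real (h \<bullet> \<theta> x) * a x) \<theta> z)"
      using lin by (simp add: linear_conv_bounded_linear)
    show "((\<lambda>y. norm (y - z) * B) \<longlongrightarrow> 0) (at z)"
      by (rule tendsto_eq_intros refl | simp)+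
    fix y assume "y \<noteq> z"
    then have p: "0 < norm (y - z)" by simp
    have "\<bar>osc_integral M a \<theta> y - osc_integral M a \<theta> z - osc_integral M (\<lambda>x. \<i> * of_real ((y - z) \<bullet> \<theta> x) * a x) \<theta> z\<bar>
        \<le> (norm (y - z) * B) * norm (y - z)"
      using rem[of "y - z"] by (simp add: power2_eq_square mult_ac)
    then show "norm (osc_integral M a \<theta> y - osc_integral M a \<theta> z - osc_integral M (\<lambda>x. \<i> * of_real ((y - z) \<bullet> \<theta> x) * a x) \<theta> z) / norm (y - z)
        \<le> norm (y - z) * B" using p by (simp add: pos_divide_le_eq)
  qed simp
qed

lemma pderiv_osc_integral:
  fixes \<theta> :: "'x \<Rightarrow> real ^ 'n::finite"
  assumes a: "amplitude M 2 a \<theta>"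
  shows "pderiv_at j (osc_integral M a \<theta>) = osc_integral M (\<lambda>x. \<i> * of_real (\<theta> x $ j) * a x) \<theta>"
proof
  fix z
  show "pderiv_at j (osc_integral M a \<theta>) z = osc_integral M (\<lambda>x. \<i> * of_real (\<theta> x $ j) * a x) \<theta> z"
    unfolding pderiv_at_def using frechet_derivative_at[OF osc_integral_has_derivative[OF a, of z], symmetric]
    by (simp add: inner_axis' )
qed

text \<open>After \<open>m\<close> derivatives a weight of 2 is left, which is what
  differentiability of the last one consumes.\<close>

lemma osc_integral_C_class:
  fixes \<theta> :: "'x \<Rightarrow> real ^ 'n::finite"
  assumes a: "amplitude M (m + 2) a \<theta>"
  shows "C_class m (osc_integral M a \<theta>)"
proof -
  have *: "\<exists>c. iter_pderiv js (osc_integral M a \<theta>) = osc_integral M c \<theta> \<and> amplitude M (m + 2 - length js) c \<theta>"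
    if js: "length js \<le> m" for js
    using js
  proof (induction js)
    case Nil
    then show ?case using a by (auto simp: iter_pderiv_def)
  next
    case (Cons j js)
    then obtain c where c: "iter_pderiv js (osc_integral M a \<theta>) = osc_integral M c \<theta>" "amplitude M (m + 2 - length js) c \<theta>"
      by auto
    have "amplitude M (Suc (m + 2 - length (j # js))) c \<theta>" using c(2) Cons.prems by (simp add: Suc_diff_le)
    from amplitude_component[OF this, of "axis j 1"]
    have "amplitude M (m + 2 - length (j # js)) (\<lambda>x. \<i> * of_real (\<theta> x $ j) * c x) \<theta>" by (simp add: inner_axis')
    moreover have "iter_pderiv (j # js) (osc_integral M a \<theta>) = osc_integral M (\<lambda>x. \<i> * of_real (\<theta> x $ j) * c x) \<theta>"
      using pderiv_osc_integral[of M c \<theta> j] amplitude_mono[OF c(2), of 2] c(1) Cons.prems by (simp add: iter_pderiv_def)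
    ultimately show ?case by blast
  qed
  have d: "iter_pderiv js (osc_integral M a \<theta>) differentiable (at z)" if js: "length js \<le> m" for js z
  proof -
    obtain c where c: "iter_pderiv js (osc_integral M a \<theta>) = osc_integral M c \<theta>" "amplitude M (m + 2 - length js) c \<theta>"
      using *[OF js] by blast
    have "amplitude M 2 c \<theta>" using amplitude_mono[OF c(2)] js by simp
    then show ?thesis unfolding c(1) using osc_integral_has_derivative differentiableI by blast
  qed
  then show ?thesis unfolding C_class_def
    by (auto intro!: continuous_at_imp_continuous_on differentiable_imp_continuous_within)
qed

text \<open>Second derivatives of a plane wave give minus the outer square of its frequency, so the
  trace collapses to the quadratic form of \<open>Q\<close>.\<close>

lemma trace_hessian_osc_integral:
  fixes \<theta> :: "'x \<Rightarrow> real ^ 'n::finite" and Q :: "real ^ 'n ^ 'n"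
  assumes a: "amplitude M 4 a \<theta>"
  shows "trace (Q ** hessian (osc_integral M a \<theta>) z) = osc_integral M (\<lambda>x. - of_real ((Q *v \<theta> x) \<bullet> \<theta> x) * a x) \<theta> z"
proof -
  have c1: "amplitude M 3 (\<lambda>x. \<i> * of_real (\<theta> x $ j) * a x) \<theta>" for j
    using amplitude_component[of M 3 a \<theta> "axis j 1"] a by (simp add: inner_axis' numeral_eq_Suc)
  have c2: "amplitude M 2 (\<lambda>x. \<i> * of_real (\<theta> x $ i) * (\<i> * of_real (\<theta> x $ j) * a x)) \<theta>" for i j
    using amplitude_component[of M 2 "\<lambda>x. \<i> * of_real (\<theta> x $ j) * a x" \<theta> "axis i 1"] c1[of j] by (simp add: inner_axis' numeral_eq_Suc)
  have h: "hessian (osc_integral M a \<theta>) z $ i $ j = osc_integral M (\<lambda>x. \<i> * of_real (\<theta> x $ i) * (\<i> * of_real (\<theta> x $ j) * a x)) \<theta> z" for i j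
    by (simp add: hessian_def pderiv_osc_integral[OF amplitude_mono[OF a]] pderiv_osc_integral[OF amplitude_mono[OF c1]])
  have "trace (Q ** hessian (osc_integral M a \<theta>) z) = 
     (\<Sum>i\<in>UNIV. \<Sum>j\<in>UNIV. osc_integral M (\<lambda>x. of_real (Q $ i $ j) * (\<i> * of_real (\<theta> x $ j) * (\<i> * of_real (\<theta> x $ i) * a x))) \<theta> z)"
    by (simp add: trace_def matrix_matrix_mult_def h osc_integral_scale)
  also have "\<dots> = osc_integral M (\<lambda>x. \<Sum>i\<in>UNIV. \<Sum>j\<in>UNIV. of_real (Q $ i $ j) * (\<i> * of_real (\<theta> x $ j) * (\<i> * of_real (\<theta> x $ i) * a x))) \<theta> z"
  proof -
    have c3: "amplitude M 2 (\<lambda>x. of_real (Q $ i $ j) * (\<i> * of_real (\<theta> x $ j) * (\<i> * of_real (\<theta> x $ i) * a x))) \<theta>" for i j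
      by (rule amplitude_multiply[OF c2, of _ _ 0 "\<bar>Q $ i $ j\<bar>"]) auto
    have c4: "amplitude M 2 (\<lambda>x. \<Sum>j\<in>UNIV. of_real (Q $ i $ j) * (\<i> * of_real (\<theta> x $ j) * (\<i> * of_real (\<theta> x $ i) * a x))) \<theta>" for i
      by (rule amplitude_sum[OF _ c3]) auto
    show ?thesis by (simp add: osc_integral_sum[OF _ c3] osc_integral_sum[OF _ c4])
  qed
  also have "(\<lambda>x. \<Sum>i\<in>UNIV. \<Sum>j\<in>UNIV. of_real (Q $ i $ j) * (\<i> * of_real (\<theta> x $ j) * (\<i> * of_real (\<theta> x $ i) * a x)))
     = (\<lambda>x. - of_real ((Q *v \<theta> x) \<bullet> \<theta> x) * a x)"
    by (simp add: fun_eq_iff inner_vec_def matrix_vector_mult_def sum_distrib_left sum_distrib_right mult_ac sum_negf)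
  finally show ?thesis .
qed

lemma drift_osc_integral:
  fixes \<theta> :: "'x \<Rightarrow> real ^ 'n::finite"
  assumes a: "amplitude M 3 a \<theta>"
  shows "v \<bullet> gradient (osc_integral M a \<theta>) z = osc_integral M (\<lambda>x. \<i> * of_real (v \<bullet> \<theta> x) * a x) \<theta> z"
proof -
  have c1: "amplitude M 2 (\<lambda>x. \<i> * of_real (\<theta> x $ j) * a x) \<theta>" for j
    using amplitude_component[of M 2 a \<theta> "axis j 1"] a by (simp add: inner_axis' numeral_eq_Suc)
  have c3: "amplitude M 2 (\<lambda>x. of_real (v $ j) * (\<i> * of_real (\<theta> x $ j) * a x)) \<theta>" for j
    by (rule amplitude_multiply[OF c1, of _ _ 0 "\<bar>v $ j\<bar>"]) auto
  have "v \<bullet> gradient (osc_integral M a \<theta>) z = (\<Sum>j\<in>UNIV. osc_integral M (\<lambda>x. of_real (v $ j) * (\<i> * of_real (\<theta> x $ j) * a x)) \<theta> z)"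
    by (simp add: inner_vec_def gradient_def pderiv_osc_integral[OF amplitude_mono[OF a]] osc_integral_scale)
  also have "\<dots> = osc_integral M (\<lambda>x. \<Sum>j\<in>UNIV. of_real (v $ j) * (\<i> * of_real (\<theta> x $ j) * a x)) \<theta> z"
    by (simp add: osc_integral_sum[OF _ c3])
  also have "(\<lambda>x. \<Sum>j\<in>UNIV. of_real (v $ j) * (\<i> * of_real (\<theta> x $ j) * a x)) = (\<lambda>x. \<i> * of_real (v \<bullet> \<theta> x) * a x)"
    by (simp add: fun_eq_iff inner_vec_def sum_distrib_left sum_distrib_right mult_ac)
  finally show ?thesis .
qed

section \<open>Mild solutions in Fourier variables\<close>

lemma bounded_bilinear_matrix_mult: "bounded_bilinear ((**) :: real ^ 'n ^ 'm \<Rightarrow> real ^ 'p ^ 'n \<Rightarrow> real ^ 'p ^ 'm)"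
  unfolding bilinear_conv_bounded_bilinear[symmetric] bilinear_def
  by (auto intro!: linearI simp: vec_eq_iff matrix_matrix_mult_def sum.distrib sum_distrib_left algebra_simps)

lemma bounded_bilinear_matrix_vector_mult: "bounded_bilinear ((*v) :: real ^ 'n ^ 'm \<Rightarrow> real ^ 'n \<Rightarrow> real ^ 'm)"
  unfolding bilinear_conv_bounded_bilinear[symmetric] bilinear_def
  by (auto intro!: linearI simp: vec_eq_iff matrix_vector_mult_def sum.distrib sum_distrib_left algebra_simps)

lemmas continuous_on_matrix_mult [continuous_intros] = bounded_bilinear.continuous_on[OF bounded_bilinear_matrix_mult]
lemmas continuous_on_matrix_vector_mult [continuous_intros] = bounded_bilinear.continuous_on[OF bounded_bilinear_matrix_vector_mult]

lemma continuous_on_transpose [continuous_intros]: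
  fixes f :: "'a::topological_space \<Rightarrow> real ^ 'n ^ 'm"
  shows "continuous_on S f \<Longrightarrow> continuous_on S (\<lambda>x. transpose (f x))"
  unfolding transpose_def by (intro continuous_on_vec_lambda continuous_on_component)

primrec matrix_power :: "real ^ 'n ^ 'n \<Rightarrow> nat \<Rightarrow> real ^ 'n ^ 'n" where
  "matrix_power N 0 = mat 1"
| "matrix_power N (Suc m) = N ** matrix_power N m"

lemma matrix_power_commute: "matrix_power N m ** N = N ** matrix_power N m"
  by (induction m) (simp_all add: matrix_mul_assoc[symmetric])

text \<open>The exponential of \<open>t N\<close> when \<open>N\<close> is nilpotent of order \<open>k + 1\<close>.\<close>

definition flow :: "nat \<Rightarrow> real ^ 'n ^ 'n \<Rightarrow> real \<Rightarrow> real ^ 'n ^ 'n" where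
  "flow k N t = (\<Sum>m\<le>k. (t ^ m / fact m) *\<^sub>R matrix_power N m)"

lemma flow_commute: "flow k N t ** N = N ** flow k N t"
proof -
  interpret m: bounded_bilinear "(**) :: real ^ 'n ^ 'n \<Rightarrow> real ^ 'n ^ 'n \<Rightarrow> real ^ 'n ^ 'n"
    by (rule bounded_bilinear_matrix_mult)
  show ?thesis unfolding flow_def m.sum_left m.sum_right m.scaleR_left m.scaleR_right matrix_power_commute ..
qed

lemma flow_has_vector_derivative:
  assumes "matrix_power N (Suc k) = 0"
  shows "(flow k N has_vector_derivative N ** flow k N t) (at t)"
proof -
  interpret m: bounded_bilinear "(**) :: real ^ 'n ^ 'n \<Rightarrow> real ^ 'n ^ 'n \<Rightarrow> real ^ 'n ^ 'n"
    by (rule bounded_bilinear_matrix_mult)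
  have "((\<lambda>t. \<Sum>m\<le>k. (t ^ m / fact m) *\<^sub>R matrix_power N m) has_vector_derivative
      (\<Sum>m\<le>k. (real m * t ^ (m - 1) / fact m) *\<^sub>R matrix_power N m)) (at t)"
    by (intro has_vector_derivative_sum)
      (auto simp: has_real_derivative_iff_has_vector_derivative[symmetric] intro!: derivative_eq_intros)
  also have "(\<Sum>m\<le>k. (real m * t ^ (m - 1) / fact m) *\<^sub>R matrix_power N m) = (\<Sum>m<k. (t ^ m / fact m) *\<^sub>R matrix_power N (Suc m))"
    by (subst sum.atMost_shift) (auto intro!: sum.cong simp del: matrix_power.simps(2))
  also have "\<dots> = (\<Sum>m\<le>k. (t ^ m / fact m) *\<^sub>R matrix_power N (Suc m))"
    using assms by (simp add: lessThan_Suc_atMost[symmetric] del: matrix_power.simps(2))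
  also have "\<dots> = N ** flow k N t" by (simp add: flow_def m.sum_right m.scaleR_right)
  finally show ?thesis unfolding flow_def .
qed

text \<open>The product has derivative zero because the exponential commutes with \<open>N\<close>,
  and it is the identity at time 0.\<close>

lemma flow_inverse:
  assumes "matrix_power N (Suc k) = 0" shows "flow k N (- t) ** flow k N t = mat 1"
proof -
  interpret m: bounded_bilinear "(**) :: real ^ 'n ^ 'n \<Rightarrow> real ^ 'n ^ 'n \<Rightarrow> real ^ 'n ^ 'n"
    by (rule bounded_bilinear_matrix_mult)
  define h where "h t = flow k N (- t) ** flow k N t" for t
  have "((\<lambda>t. flow k N (- t)) has_vector_derivative (- 1) *\<^sub>R (N ** flow k N (- t))) (at t)" for t
    using vector_diff_chain_at[of uminus "-1" t "flow k N" "N ** flow k N (- t)"] flow_has_vector_derivative[OF assms, of "- t"]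
    using has_vector_derivative_minus[OF has_vector_derivative_id, of "at t"] by (simp add: o_def)
  from m.has_vector_derivative[OF this flow_has_vector_derivative[OF assms]]
  have "(h has_vector_derivative 0) (at t)" for t
    unfolding h_def by (rule has_vector_derivative_eq_rhs) (simp add: matrix_mul_assoc flow_commute m.minus_left)
  then have "h t = h 0"
    using has_derivative_zero_unique_connected[of UNIV h t 0] by (auto simp: has_vector_derivative_def)
  also have "h 0 = mat 1"
  proof -
    have "flow k N 0 = mat 1" unfolding flow_def by (subst sum.atMost_shift) simp
    then show ?thesis by (simp add: h_def)
  qed
  finally show ?thesis by (simp add: h_def)
qed

lemma integrable_product:
  fixes f :: "'a::euclidean_space \<Rightarrow> real" and g :: "'b::euclidean_space \<Rightarrow> real"
  assumes f: "integrable lborel f" and g: "integrable lborel g"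
  shows "integrable lborel (\<lambda>x. f (fst x) * g (snd x))"
proof -
  have [measurable]: "f \<in> borel_measurable borel" "g \<in> borel_measurable borel"
    using f g borel_measurable_integrable by auto
  have "integrable (lborel \<Otimes>\<^sub>M lborel) (\<lambda>x. f (fst x) * g (snd x))"
  proof (rule lborel_pair.Fubini_integrable)
    show "integrable lborel (\<lambda>x. \<integral>y. norm (f (fst (x, y)) * g (snd (x, y))) \<partial>lborel)"
      using f by (simp add: abs_mult)
    show "AE x in lborel. integrable lborel (\<lambda>y. f (fst (x, y)) * g (snd (x, y)))"
      using g by simp
  qed simp
  then show ?thesis by (simp add: lborel_prod)
qed

lemma integrable_indicator_Icc: "integrable lborel (indicator {a..b::real} :: real \<Rightarrow> real)"
  by (rule integrable_real_indicator) (auto simp: emeasure_lborel_Icc_eq)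

lemma AE_lborel_fst_neq: "AE x in (lborel :: ('a::euclidean_space \<times> 'b::euclidean_space) measure). fst x \<noteq> c"
proof (rule AE_I[where N="{c} \<times> UNIV"])
  have "emeasure (lborel \<Otimes>\<^sub>M lborel) ({c} \<times> (UNIV :: 'b set)) = 0"
    by (subst lborel.emeasure_pair_measure_Times) auto
  then show "emeasure lborel ({c} \<times> (UNIV :: 'b set)) = 0" by (simp add: lborel_prod)
qed (auto intro!: borel_closed closed_Times)

section \<open>Duhamel's formula in Fourier variables\<close>

text \<open>Accumulated diffusion, pulled back to time 0 along the drift. The clamp to
  \<open>{0..T}\<close> makes it continuous on the whole line of times.\<close>

definition cumulated :: "real \<Rightarrow> (real \<Rightarrow> real ^ 'n ^ 'n) \<Rightarrow> (real \<Rightarrow> real ^ 'n ^ 'n) \<Rightarrow> real \<Rightarrow> real ^ 'n ^ 'n" where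
  "cumulated T E Q t = integral {0..max 0 (min T t)} (\<lambda>r. transpose (E r) ** Q r ** E r)"

definition damping :: "real \<Rightarrow> (real \<Rightarrow> real ^ 'n ^ 'n) \<Rightarrow> (real \<Rightarrow> real ^ 'n ^ 'n) \<Rightarrow> real \<Rightarrow> real ^ 'n \<Rightarrow> real" where
  "damping T E Q t \<zeta> = (cumulated T E Q t *v \<zeta>) \<bullet> \<zeta>"

text \<open>A point \<open>x = (s, \<xi>)\<close> of the parameter space stands for the source at time \<open>s\<close> and frequency \<open>\<xi>\<close>;
  \<open>label E x\<close> is that frequency transported back to time \<open>0\<close> along the drift.\<close>

definition label :: "(real \<Rightarrow> real ^ 'n ^ 'n) \<Rightarrow> real \<times> (real ^ 'n) \<Rightarrow> real ^ 'n" where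
  "label E x = E (- fst x) *v snd x"

text \<open>Duhamel weight of the source at time \<open>fst x\<close> in the solution at time
  \<open>t\<close>. Since the label of a wave is constant along the drift, the dissipation between
  the two times is a difference of two values of \<open>damping\<close>.\<close>

definition kernel :: "real \<Rightarrow> (real \<Rightarrow> real ^ 'n ^ 'n) \<Rightarrow> (real \<Rightarrow> real ^ 'n ^ 'n) \<Rightarrow> real \<Rightarrow> real \<times> (real ^ 'n) \<Rightarrow> real" where
  "kernel T E Q t x = indicator {0..t} (fst x) * exp (- (damping T E Q t (label E x) - damping T E Q (fst x) (label E x)))"

text \<open>The majorant \<open>D\<close> depends on the frequency only and so bounds all times at
  once. The exponent 4 is the budget for two spatial derivatives together with the margin of 2 in
  \<open>osc_integral_C_class\<close>.\<close>

definition spectral :: "real \<Rightarrow> (real \<times> (real ^ 'n) \<Rightarrow> complex) \<Rightarrow> (real ^ 'n \<Rightarrow> real) \<Rightarrow> bool" where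
  "spectral T F D \<longleftrightarrow> F \<in> borel_measurable borel \<and> (\<forall>x. norm (F x) \<le> D (snd x)) \<and>
     integrable lborel (\<lambda>\<xi>. (1 + norm \<xi>) ^ 4 * D \<xi>)"

definition represents :: "real \<Rightarrow> (real \<times> (real ^ 'n) \<Rightarrow> complex) \<Rightarrow> (real \<Rightarrow> real ^ 'n \<Rightarrow> real) \<Rightarrow> bool" where
  "represents T F f \<longleftrightarrow> (\<forall>s\<in>{0..T}. \<forall>z. f s z = osc_integral lborel (\<lambda>\<xi>. F (s, \<xi>)) (\<lambda>\<xi>. \<xi>) z)"

definition mild :: "real \<Rightarrow> (real \<Rightarrow> real ^ 'n ^ 'n) \<Rightarrow> (real \<Rightarrow> real ^ 'n ^ 'n) \<Rightarrow> (real \<times> (real ^ 'n) \<Rightarrow> complex) \<Rightarrow> real \<Rightarrow> real ^ 'n \<Rightarrow> real" where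
  "mild T E Q F t = osc_integral lborel (\<lambda>x. of_real (kernel T E Q t x) * F x) (\<lambda>x. E t *v label E x)"

locale drift_flow =
  fixes T :: real and A :: "real ^ 'n ^ 'n" and E :: "real \<Rightarrow> real ^ 'n ^ 'n"
  assumes T: "0 < T"
    and E_deriv: "\<And>t. (E has_vector_derivative transpose A ** E t) (at t)"
    and E_inverse: "\<And>t. E (- t) ** E t = mat 1"
begin

lemma E_cont: "continuous_on UNIV E"
  using has_vector_derivative_continuous[OF E_deriv] by (auto intro: continuous_at_imp_continuous_on)

lemma E_cont' [continuous_intros]: "continuous_on S f \<Longrightarrow> continuous_on S (\<lambda>x. E (f x))"
  using continuous_on_compose2[OF E_cont] by auto

lemma E_inverse': "E t ** E (- t) = mat 1" using E_inverse[of "- t"] by simp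

lemma E_label: "E (fst x) *v label E x = snd x"
  by (simp add: label_def matrix_vector_mul_assoc E_inverse')

lemma label_cont [continuous_intros]: "continuous_on S f \<Longrightarrow> continuous_on S (\<lambda>x. label E (f x))"
  unfolding label_def by (intro continuous_intros)

lemma freq_bound: "\<exists>C\<ge>1. \<forall>t\<in>{0..T}. \<forall>x. fst x \<in> {0..T} \<longrightarrow> norm (E t *v label E x) \<le> C * norm (snd x)"
proof -
  obtain K where K: "0 < K" "\<And>(M :: real ^ 'n ^ 'n) v. norm (M *v v) \<le> norm M * norm v * K"
    using bounded_bilinear.pos_bounded[OF bounded_bilinear_matrix_vector_mult] by blast
  have "compact (E ` {-T..T})" by (intro compact_continuous_image continuous_intros) auto
  then obtain c where c: "0 < c" "\<And>t. t \<in> {-T..T} \<Longrightarrow> norm (E t) \<le> c"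
    using compact_imp_bounded bounded_pos by (metis imageI)
  have "norm (E t *v label E x) \<le> max 1 (c * K * (c * K)) * norm (snd x)" if t: "t \<in> {0..T}" "fst x \<in> {0..T}" for t x
  proof -
    have "norm (label E x) \<le> norm (E (- fst x)) * norm (snd x) * K" unfolding label_def by (rule K)
    also have "\<dots> \<le> c * norm (snd x) * K" using c(2)[of "- fst x"] t K by (intro mult_right_mono) auto
    finally have 1: "norm (label E x) \<le> c * norm (snd x) * K" .
    have "norm (E t *v label E x) \<le> norm (E t) * norm (label E x) * K" by (rule K)
    also have "\<dots> \<le> c * (c * norm (snd x) * K) * K" using c(1) c(2)[of t] t K 1 by (intro mult_mono) auto
    also have "\<dots> = (c * K * (c * K)) * norm (snd x)" by simp
    also have "\<dots> \<le> max 1 (c * K * (c * K)) * norm (snd x)" by (intro mult_right_mono) auto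
    finally show ?thesis .
  qed
  then show ?thesis by (intro exI[of _ "max 1 (c * K * (c * K))"]) auto
qed

definition freq_const :: real where
  "freq_const = (SOME C. C \<ge> 1 \<and> (\<forall>t\<in>{0..T}. \<forall>x. fst x \<in> {0..T} \<longrightarrow> norm (E t *v label E x) \<le> C * norm (snd x)))"

lemma freq_const: "1 \<le> freq_const" "t \<in> {0..T} \<Longrightarrow> fst x \<in> {0..T} \<Longrightarrow> norm (E t *v label E x) \<le> freq_const * norm (snd x)"
proof -
  have *: "1 \<le> freq_const \<and> (\<forall>t\<in>{0..T}. \<forall>x. fst x \<in> {0..T} \<longrightarrow> norm (E t *v label E x) \<le> freq_const * norm (snd x))"
    unfolding freq_const_def by (rule someI_ex) (use freq_bound in blast)
  then show "1 \<le> freq_const" by blast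
  show "t \<in> {0..T} \<Longrightarrow> fst x \<in> {0..T} \<Longrightarrow> norm (E t *v label E x) \<le> freq_const * norm (snd x)"
    using * by blast
qed

definition majorant :: "(real ^ 'n \<Rightarrow> real) \<Rightarrow> real \<times> (real ^ 'n) \<Rightarrow> real" where
  "majorant D x = freq_const ^ 4 * (indicator {0..T} (fst x) * ((1 + norm (snd x)) ^ 4 * D (snd x)))"

lemma majorant_integrable: "spectral T F D \<Longrightarrow> integrable lborel (majorant D)"
  unfolding majorant_def spectral_def
  by (intro integrable_mult_right integrable_product[where f="indicator {0..T}" and g="\<lambda>\<xi>. (1 + norm \<xi>) ^ 4 * D \<xi>"])
    (auto intro: integrable_indicator_Icc)

lemma spectral_nonneg: "spectral T F D \<Longrightarrow> 0 \<le> D \<xi>"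
  unfolding spectral_def by (metis norm_ge_zero order_trans snd_conv)

text \<open>Over \<open>{0..T}\<close> the drift enlarges frequencies by at most the factor
  \<open>freq_const\<close>, so one integrable function dominates the weighted amplitudes at all
  times.\<close>

lemma majorant_bound:
  assumes F: "spectral T F D" and t: "t \<in> {0..T}" and a: "norm a \<le> indicator {0..T} (fst x) * D (snd x)"
  shows "(1 + norm (E t *v label E x)) ^ 4 * norm a \<le> majorant D x"
proof (cases "fst x \<in> {0..T}")
  case True
  have "1 + norm (E t *v label E x) \<le> freq_const * (1 + norm (snd x))"
    using freq_const(1) freq_const(2)[OF t True] by (simp add: distrib_left)
  then have "(1 + norm (E t *v label E x)) ^ 4 \<le> (freq_const * (1 + norm (snd x))) ^ 4" by (intro power_mono) auto
  then have "(1 + norm (E t *v label E x)) ^ 4 * norm a \<le> (freq_const * (1 + norm (snd x))) ^ 4 * D (snd x)"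
    using a True freq_const(1) by (intro mult_mono) auto
  then show ?thesis using True by (simp add: majorant_def power_mult_distrib mult.assoc)
qed (use a in \<open>auto simp: majorant_def\<close>)

lemma amplitude_freq:
  assumes F: "spectral T F D" and t: "t \<in> {0..T}" and a [measurable]: "a \<in> borel_measurable borel"
    and b: "\<And>x. norm (a x) \<le> indicator {0..T} (fst x) * D (snd x)"
  shows "amplitude lborel 4 a (\<lambda>x. E t *v label E x)"
  unfolding amplitude_def
proof (intro conjI)
  show m [measurable]: "(\<lambda>x. E t *v label E x) \<in> borel_measurable lborel"
    by (simp, intro borel_measurable_continuous_onI continuous_intros)
  show "integrable lborel (\<lambda>x. (1 + norm (E t *v label E x)) ^ 4 * norm (a x))"
  proof (rule Bochner_Integration.integrable_bound[OF majorant_integrable[OF F]])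
    show "AE x in lborel. norm ((1 + norm (E t *v label E x)) ^ 4 * norm (a x)) \<le> norm (majorant D x)"
    proof (rule AE_I2)
      fix x have "0 \<le> (1 + norm (E t *v label E x)) ^ 4 * norm (a x)" by simp
      then show "norm ((1 + norm (E t *v label E x)) ^ 4 * norm (a x)) \<le> norm (majorant D x)"
        using majorant_bound[OF F t b[of x]] by (metis abs_of_nonneg order_trans real_norm_def)
    qed
  qed (use m in measurable)
qed simp

end

locale kolmogorov = drift_flow T A E for T A and E :: "real \<Rightarrow> real ^ 'n ^ 'n" +
  fixes Q :: "real \<Rightarrow> real ^ 'n ^ 'n"
  assumes Q_cont: "continuous_on {0..T} Q" and Q_psd: "\<And>t. t \<in> {0..T} \<Longrightarrow> sym_nonneg_matrix (Q t)"
begin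

lemma integrand_cont: "continuous_on {0..T} (\<lambda>r. transpose (E r) ** Q r ** E r)"
  by (intro continuous_intros Q_cont)

lemma cumulated_deriv:
  assumes "t \<in> {0..T}"
  shows "(cumulated T E Q has_vector_derivative transpose (E t) ** Q t ** E t) (at t within {0..T})"
proof -
  have "((\<lambda>u. integral {0..u} (\<lambda>r. transpose (E r) ** Q r ** E r)) has_vector_derivative transpose (E t) ** Q t ** E t) (at t within {0..T})"
    by (rule integral_has_vector_derivative[OF integrand_cont assms])
  then show ?thesis
    by (rule has_vector_derivative_transform[OF assms, rotated]) (auto simp: cumulated_def)
qed

lemma cumulated_cont: "continuous_on UNIV (cumulated T E Q)"
proof -
  have c: "continuous_on {0..T} (cumulated T E Q)"
    using has_vector_derivative_continuous[OF cumulated_deriv] by (auto simp: continuous_on_eq_continuous_within)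
  have "continuous_on UNIV (\<lambda>t. cumulated T E Q (max 0 (min T t)))"
    by (rule continuous_on_compose2[OF c]) (use T in \<open>auto intro!: continuous_intros\<close>)
  then show ?thesis using T by (simp add: cumulated_def)
qed

lemma damping_cont [continuous_intros]:
  "continuous_on S f \<Longrightarrow> continuous_on S g \<Longrightarrow> continuous_on S (\<lambda>x. damping T E Q (f x) (g x))"
  unfolding damping_def
  by (intro continuous_intros continuous_on_compose2[OF cumulated_cont]) auto

lemma quadratic_form: "((transpose (E t) ** Q t ** E t) *v \<zeta>) \<bullet> \<zeta> = (Q t *v (E t *v \<zeta>)) \<bullet> (E t *v \<zeta>)"
  by (simp add: matrix_vector_mul_assoc[symmetric] transpose_matrix_vector dot_lmul_matrix)

lemma damping_deriv:
  assumes "t \<in> {0..T}"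
  shows "((\<lambda>t. damping T E Q t \<zeta>) has_real_derivative (Q t *v (E t *v \<zeta>)) \<bullet> (E t *v \<zeta>)) (at t within {0..T})"
proof -
  have bl: "bounded_linear (\<lambda>M :: real ^ 'n ^ 'n. (M *v \<zeta>) \<bullet> \<zeta>)"
    by (intro bounded_linear_compose[OF bounded_linear_inner_left] bounded_bilinear.bounded_linear_left[OF bounded_bilinear_matrix_vector_mult])
  from bounded_linear.has_vector_derivative[OF bl cumulated_deriv[OF assms]]
  show ?thesis unfolding damping_def quadratic_form has_real_derivative_iff_has_vector_derivative .
qed

lemma damping_mono:
  assumes "0 \<le> s" "s \<le> t" "t \<le> T" shows "damping T E Q s \<zeta> \<le> damping T E Q t \<zeta>"
proof (rule DERIV_nonneg_imp_increasing_open[OF assms(2)])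
  fix r assume r: "s < r" "r < t"
  have "at r within {0..T} = at r" using r assms by (intro at_within_interior) auto
  then have "((\<lambda>t. damping T E Q t \<zeta>) has_real_derivative (Q r *v (E r *v \<zeta>)) \<bullet> (E r *v \<zeta>)) (at r)"
    using damping_deriv[of r \<zeta>] r assms by simp
  moreover have "0 \<le> (Q r *v (E r *v \<zeta>)) \<bullet> (E r *v \<zeta>)" using Q_psd[of r] r assms by (auto simp: sym_nonneg_matrix_def)
  ultimately show "\<exists>y. ((\<lambda>t. damping T E Q t \<zeta>) has_real_derivative y) (at r) \<and> 0 \<le> y" by blast
next
  show "continuous_on {s..t} (\<lambda>t. damping T E Q t \<zeta>)" by (intro continuous_intros)
qed

lemma kernel_bounds:
  assumes "t \<in> {0..T}" shows "0 \<le> kernel T E Q t x" "kernel T E Q t x \<le> indicator {0..T} (fst x)"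
  using damping_mono[of "fst x" t "label E x"] assms by (auto simp: kernel_def indicator_def)

lemma kernel_measurable [measurable]: "(\<lambda>x. kernel T E Q (fst x) (snd x)) \<in> borel_measurable borel"
proof -
  have "(\<lambda>x. exp (- (damping T E Q (fst x) (label E (snd x)) - damping T E Q (fst (snd x)) (label E (snd x))))) \<in> borel_measurable borel"
    by (intro borel_measurable_continuous_onI continuous_intros)
  moreover have "(\<lambda>x :: real \<times> real \<times> (real ^ 'n). indicator {0..fst x} (fst (snd x)) :: real) \<in> borel_measurable borel"
  proof -
    have eq: "(\<lambda>x :: real \<times> real \<times> (real ^ 'n). indicator {0..fst x} (fst (snd x)) :: real) = 
       indicator ({x. 0 \<le> fst (snd x)} \<inter> {x. fst (snd x) \<le> fst x})"
      by (auto simp: indicator_def fun_eq_iff)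
    show ?thesis unfolding eq
      by (intro borel_measurable_indicator sets.Int borel_closed closed_Collect_le continuous_intros)
  qed
  ultimately show ?thesis unfolding kernel_def by (rule borel_measurable_times[rotated])
qed

lemma kernel_measurable' [measurable]: "kernel T E Q t \<in> borel_measurable borel"
  using measurable_compose[OF _ kernel_measurable, of "\<lambda>x. (t, x)" borel] by simp


text \<open>For fixed \<open>x\<close> the wave solves a linear ordinary differential equation in
  time whose coefficient is the symbol of the operator: the derivative of the phase gives the drift,
  that of the damping the diffusion. The fundamental theorem of calculus yields the identity for one
  wave, and Fubini's theorem integrates it over all waves.\<close>

theorem mild_is_solution:
  assumes F: "spectral T F D" and f: "represents T F f"
  shows "is_solution T (diffusion_op A Q) f (mild T E Q F)"
proof -
  have F_meas [measurable]: "F \<in> borel_measurable borel" and FD: "\<And>x. norm (F x) \<le> D (snd x)"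
    using F by (auto simp: spectral_def)
  define fr where "fr t x = E t *v label E x" for t x
  define amp where "amp t x = of_real (kernel T E Q t x) * F x" for t x
  have mild: "mild T E Q F t = osc_integral lborel (amp t) (fr t)" for t
    by (simp add: mild_def amp_def[abs_def] fr_def[abs_def])
  have ampb: "norm (amp t x) \<le> indicator {0..T} (fst x) * D (snd x)" if "t \<in> {0..T}" for t x
    using kernel_bounds[OF that, of x] FD[of x] by (auto simp: amp_def norm_mult intro!: mult_mono)
  have ampm [measurable]: "amp t \<in> borel_measurable borel" for t unfolding amp_def by measurable
  have A4: "amplitude lborel 4 (amp t) (fr t)" if "t \<in> {0..T}" for t
    unfolding fr_def by (rule amplitude_freq[OF F that ampm ampb[OF that]])
  have maj: "(1 + norm (fr t x)) ^ 4 * norm (amp t x) \<le> majorant D x" if "t \<in> {0..T}" for t x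
    unfolding fr_def by (rule majorant_bound[OF F that ampb[OF that]])
  have frm: "(\<lambda>y. fr (fst y) (snd y)) \<in> borel_measurable borel"
    unfolding fr_def by (intro borel_measurable_continuous_onI continuous_intros)
  have maj0: "norm (amp t x) \<le> majorant D x" if "t \<in> {0..T}" for t x
  proof -
    have "1 * norm (amp t x) \<le> (1 + norm (fr t x)) ^ 4 * norm (amp t x)" by (intro mult_right_mono one_le_power) auto
    then show ?thesis using maj[OF that, of x] by simp
  qed
  have reb: "\<bar>Re (amp t x * cis (z \<bullet> fr t x))\<bar> \<le> majorant D x" if "t \<in> {0..T}" for t x z
  proof -
    have "norm (amp t x * cis (z \<bullet> fr t x)) = norm (amp t x)" by (simp add: norm_mult)
    then show ?thesis using abs_Re_le_cmod[of "amp t x * cis (z \<bullet> fr t x)"] maj0[OF that, of x] by linarith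
  qed
  have bnd: "\<bar>mild T E Q F t z\<bar> \<le> integral\<^sup>L lborel (majorant D)" if "t \<in> {0..T}" for t z
    unfolding mild osc_integral_def
    by (rule order_trans[OF integral_abs_bound integral_mono[OF integrable_abs[OF osc_integrand_integrable[OF A4[OF that]]] majorant_integrable[OF F] reb[OF that]]])
  show ?thesis
    unfolding is_solution_def
  proof (intro conjI ballI allI)
    show "bounded ((\<lambda>(t, z). mild T E Q F t z) ` ({0..T} \<times> UNIV))"
      unfolding bounded_iff by (intro exI[of _ "integral\<^sup>L lborel (majorant D)"]) (use bnd in auto)
  next
    show "continuous_on ({0..T} \<times> UNIV) (\<lambda>(t, z). mild T E Q F t z)"
    proof (rule continuous_on_sequentiallyI)
      fix u :: "nat \<Rightarrow> real \<times> (real ^ 'n)" and a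
      assume u: "\<forall>n. u n \<in> {0..T} \<times> UNIV" and a: "a \<in> {0..T} \<times> UNIV" and lim: "u \<longlonglongrightarrow> a"
      have l1: "(\<lambda>n. fst (u n)) \<longlonglongrightarrow> fst a" and l2: "(\<lambda>n. snd (u n)) \<longlonglongrightarrow> snd a"
        using lim by (auto intro: tendsto_fst tendsto_snd)
      have "(\<lambda>n. \<integral>x. Re (amp (fst (u n)) x * cis (snd (u n) \<bullet> fr (fst (u n)) x)) \<partial>lborel)
         \<longlonglongrightarrow> (\<integral>x. Re (amp (fst a) x * cis (snd a \<bullet> fr (fst a) x)) \<partial>lborel)"
      proof (rule integral_dominated_convergence[where w="majorant D"])
        show "(\<lambda>x. Re (amp (fst a) x * cis (snd a \<bullet> fr (fst a) x))) \<in> borel_measurable lborel"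
          using borel_measurable_integrable[OF osc_integrand_integrable[OF A4]] a by auto
        show "(\<lambda>x. Re (amp (fst (u n)) x * cis (snd (u n) \<bullet> fr (fst (u n)) x))) \<in> borel_measurable lborel" for n
          using borel_measurable_integrable[OF osc_integrand_integrable[OF A4]] u by (auto simp: mem_Times_iff)
        show "AE x in lborel. norm (Re (amp (fst (u n)) x * cis (snd (u n) \<bullet> fr (fst (u n)) x))) \<le> majorant D x" for n
          using reb[of "fst (u n)"] u by (intro AE_I2) (auto simp: mem_Times_iff simp del: minus_complex.sel times_complex.sel)
        show "AE x in lborel. (\<lambda>n. Re (amp (fst (u n)) x * cis (snd (u n) \<bullet> fr (fst (u n)) x))) \<longlonglongrightarrow> Re (amp (fst a) x * cis (snd a \<bullet> fr (fst a) x))"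
          \<comment> \<open>The kernel jumps in \<open>t\<close> only when \<open>t\<close> passes
            the source time, so convergence can fail only on the null set
            \<open>fst x = fst a\<close>.\<close>
          using AE_lborel_fst_neq[of "fst a"]
        proof eventually_elim
          fix x :: "real \<times> (real ^ 'n)" assume x: "fst x \<noteq> fst a"
          have i: "(\<lambda>n. indicator {0..fst (u n)} (fst x) :: real) \<longlonglongrightarrow> indicator {0..fst a} (fst x)"
          proof (rule tendsto_eventually)
            show "\<forall>\<^sub>F n in sequentially. (indicator {0..fst (u n)} (fst x) :: real) = indicator {0..fst a} (fst x)"
            proof (cases "fst x < fst a")
              case True
              then show ?thesis using order_tendstoD(1)[OF l1 True] by (auto elim!: eventually_mono simp: indicator_def)
            next
              case False
              then have "fst a < fst x" using x by simp
              then show ?thesis using order_tendstoD(2)[OF l1, of "fst x"] by (auto elim!: eventually_mono simp: indicator_def)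
            qed
          qed
          have c: "continuous_on UNIV (\<lambda>y. damping T E Q (fst y) (label E x))"
            "continuous_on UNIV (\<lambda>y. snd y \<bullet> fr (fst y) x)"
            unfolding fr_def by (intro continuous_intros)+
          have d: "(\<lambda>n. damping T E Q (fst (u n)) (label E x)) \<longlonglongrightarrow> damping T E Q (fst a) (label E x)"
            "(\<lambda>n. snd (u n) \<bullet> fr (fst (u n)) x) \<longlonglongrightarrow> snd a \<bullet> fr (fst a) x"
            using continuous_on_tendsto_compose[OF c(1) lim] continuous_on_tendsto_compose[OF c(2) lim] by auto
          have e: "(\<lambda>n. cis (snd (u n) \<bullet> fr (fst (u n)) x)) \<longlonglongrightarrow> cis (snd a \<bullet> fr (fst a) x)"
            by (intro continuous_on_tendsto_compose[OF _ d(2), of UNIV cis] continuous_intros) auto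
          show "(\<lambda>n. Re (amp (fst (u n)) x * cis (snd (u n) \<bullet> fr (fst (u n)) x))) \<longlonglongrightarrow> Re (amp (fst a) x * cis (snd a \<bullet> fr (fst a) x))"
            unfolding amp_def kernel_def by (intro tendsto_intros i d e)
        qed
      qed (rule majorant_integrable[OF F])
      then show "(\<lambda>n. case u n of (t, z) \<Rightarrow> mild T E Q F t z) \<longlonglongrightarrow> (case a of (t, z) \<Rightarrow> mild T E Q F t z)"
        by (simp only: split_beta mild osc_integral_def)
    qed
  next
    fix t assume "t \<in> {0..T}"
    then show "C_class 2 (mild T E Q F t)" unfolding mild using osc_integral_C_class[of lborel 2 "amp t" "fr t"] A4 by simp
  next
    fix t z assume t: "t \<in> {0..T}"
    \<comment> \<open>A continuous extension of \<open>Q\<close> to all times makes the integrand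
      measurable on the whole product space.\<close>
    define Qe where "Qe r = Q (max 0 (min T r))" for r
    have Qe_cont: "continuous_on UNIV Qe" unfolding Qe_def
      by (rule continuous_on_compose2[OF Q_cont]) (use T in \<open>auto intro!: continuous_intros\<close>)
    have Qe: "Qe r = Q r" if "r \<in> {0..T}" for r using that by (simp add: Qe_def)
    define c where "c r x = \<i> * of_real ((A *v z) \<bullet> fr r x) + - of_real ((Qe r *v fr r x) \<bullet> fr r x)" for r x
    have c_cont: "continuous_on UNIV (\<lambda>y. c (fst y) (snd y))"
      unfolding c_def fr_def by (intro continuous_intros continuous_on_compose2[OF Qe_cont]) auto
    obtain K where K: "0 < K" "\<And>(M :: real ^ 'n ^ 'n) v. norm (M *v v) \<le> norm M * norm v * K"
      using bounded_bilinear.pos_bounded[OF bounded_bilinear_matrix_vector_mult] by blast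
    have "compact (Q ` {0..T})" by (intro compact_continuous_image Q_cont) auto
    then obtain q where q: "0 < q" "\<And>t. t \<in> {0..T} \<Longrightarrow> norm (Q t) \<le> q"
      using compact_imp_bounded bounded_pos by (metis imageI)
    define C where "C = norm (A *v z) + q * K"
    have C0: "0 \<le> C" using q K by (simp add: C_def)
    have cb: "norm (c r x) \<le> C * (1 + norm (fr r x)) ^ 2" if r: "r \<in> {0..T}" for r x
    proof -
      define y where "y = norm (fr r x)"
      have y0: "0 \<le> y" by (simp add: y_def)
      have "norm (c r x) \<le> \<bar>(A *v z) \<bullet> fr r x\<bar> + \<bar>(Qe r *v fr r x) \<bullet> fr r x\<bar>"
        unfolding c_def by (rule order_trans[OF norm_triangle_ineq]) (simp add: norm_mult)
      also have "\<dots> \<le> norm (A *v z) * y + (q * y * K) * y"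
      proof (intro add_mono)
        show "\<bar>(A *v z) \<bullet> fr r x\<bar> \<le> norm (A *v z) * y" unfolding y_def by (rule Cauchy_Schwarz_ineq2)
        have "\<bar>(Qe r *v fr r x) \<bullet> fr r x\<bar> \<le> norm (Qe r *v fr r x) * y" unfolding y_def by (rule Cauchy_Schwarz_ineq2)
        also have "norm (Qe r *v fr r x) \<le> norm (Qe r) * y * K" unfolding y_def by (rule K)
        also have "\<dots> \<le> q * y * K" using q(2)[OF r] Qe[OF r] y0 K by (intro mult_right_mono) auto
        finally show "\<bar>(Qe r *v fr r x) \<bullet> fr r x\<bar> \<le> (q * y * K) * y" using y0 by (simp add: mult_right_mono)
      qed
      also have "\<dots> \<le> norm (A *v z) * (1 + y) ^ 2 + (q * K) * (1 + y) ^ 2"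
      proof (intro add_mono)
        show "norm (A *v z) * y \<le> norm (A *v z) * (1 + y) ^ 2"
          using y0 by (intro mult_left_mono) (auto simp: power2_eq_square algebra_simps)
        have "y * y \<le> (1 + y) ^ 2" using y0 by (simp add: power2_eq_square algebra_simps)
        then show "(q * y * K) * y \<le> (q * K) * (1 + y) ^ 2"
          using q K mult_left_mono[of "y * y" "(1 + y) ^ 2" "q * K"] by (simp add: mult_ac)
      qed
      finally show ?thesis by (simp add: C_def y_def distrib_right)
    qed
    have A2: "amplitude lborel 2 (\<lambda>x. c r x * amp r x) (fr r)" if r: "r \<in> {0..T}" for r
    proof (rule amplitude_multiply[OF A4[OF r], of _ _ 2 C])
      show "c r \<in> borel_measurable lborel"
        using measurable_compose[OF _ borel_measurable_continuous_onI[OF c_cont], of "\<lambda>x. (r, x)" borel] by simp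
    qed (use cb[OF r] in auto)
    have op: "diffusion_op A Q r (mild T E Q F r) z = osc_integral lborel (\<lambda>x. c r x * amp r x) (fr r) z" if r: "r \<in> {0..T}" for r
    proof -
      have a1: "amplitude lborel 3 (\<lambda>x. \<i> * of_real ((A *v z) \<bullet> fr r x) * amp r x) (fr r)"
        using amplitude_component[of lborel 3 "amp r" "fr r" "A *v z"] A4[OF r] by simp
      have frr: "fr r \<in> borel_measurable borel" using measurable_compose[OF _ frm, of "\<lambda>x. (r, x)" borel] by simp
      have a2: "amplitude lborel 2 (\<lambda>x. - of_real ((Qe r *v fr r x) \<bullet> fr r x) * amp r x) (fr r)"
      proof (rule amplitude_multiply[OF A4[OF r], of _ _ 2 "q * K"])
        have "continuous_on UNIV (\<lambda>x. complex_of_real (- ((Qe r *v fr r x) \<bullet> fr r x)))"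
          unfolding fr_def by (intro continuous_intros)
        from borel_measurable_continuous_onI[OF this] show "(\<lambda>x. - complex_of_real ((Qe r *v fr r x) \<bullet> fr r x)) \<in> borel_measurable lborel"
          by simp
        fix x
        have "\<bar>(Qe r *v fr r x) \<bullet> fr r x\<bar> \<le> norm (Qe r *v fr r x) * norm (fr r x)" by (rule Cauchy_Schwarz_ineq2)
        also have "norm (Qe r *v fr r x) \<le> norm (Qe r) * norm (fr r x) * K" by (rule K)
        also have "\<dots> \<le> q * norm (fr r x) * K" using q(2)[OF r] Qe[OF r] K by (intro mult_right_mono) auto
        finally have "\<bar>(Qe r *v fr r x) \<bullet> fr r x\<bar> \<le> (q * K) * (norm (fr r x) * norm (fr r x))"
          by (simp add: mult_right_mono mult_ac)
        also have "\<dots> \<le> (q * K) * (1 + norm (fr r x)) ^ 2"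
          using q K by (intro mult_left_mono) (auto simp: power2_eq_square algebra_simps)
        finally show "norm (- complex_of_real ((Qe r *v fr r x) \<bullet> fr r x)) \<le> (q * K) * (1 + norm (fr r x)) ^ 2" by simp
      qed simp
      have "diffusion_op A Q r (mild T E Q F r) z
        = osc_integral lborel (\<lambda>x. - of_real ((Qe r *v fr r x) \<bullet> fr r x) * amp r x) (fr r) z
        + osc_integral lborel (\<lambda>x. \<i> * of_real ((A *v z) \<bullet> fr r x) * amp r x) (fr r) z"
        unfolding diffusion_op_def mild Qe[OF r]
        using trace_hessian_osc_integral[OF A4[OF r]] drift_osc_integral[OF amplitude_mono[OF A4[OF r]], where v="A *v z" and z=z] by simp
      also have "\<dots> = osc_integral lborel (\<lambda>x. c r x * amp r x) (fr r) z"
      proof -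
        have "(\<lambda>x. c r x * amp r x) = (\<lambda>x. \<i> * of_real ((A *v z) \<bullet> fr r x) * amp r x + - of_real ((Qe r *v fr r x) \<bullet> fr r x) * amp r x)"
          by (simp only: c_def distrib_right)
        then show ?thesis by (simp only: osc_integral_add[OF a1 a2] add.commute)
      qed
      finally show ?thesis .
    qed
    define \<Phi> where "\<Phi> r x = indicator {0..t} r * Re (c r x * amp r x * cis (z \<bullet> fr r x))" for r x
    have \<Phi>_meas: "(\<lambda>(r, x). \<Phi> r x) \<in> borel_measurable (lborel \<Otimes>\<^sub>M lborel)"
    proof -
      have sn: "snd \<in> borel_measurable (borel :: (real \<times> real \<times> (real ^ 'n)) measure)"
        "fst \<in> borel_measurable (borel :: (real \<times> real \<times> (real ^ 'n)) measure)"
        by (intro borel_measurable_continuous_onI continuous_intros)+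
      have [measurable]: "(\<lambda>y :: real \<times> real \<times> (real ^ 'n). F (snd y)) \<in> borel_measurable borel"
        using measurable_compose[OF sn(1) F_meas] .
      have [measurable]: "(\<lambda>y :: real \<times> real \<times> (real ^ 'n). indicator {0..t} (fst y) :: real) \<in> borel_measurable borel"
        using measurable_compose[OF sn(2), of "indicator {0..t} :: real \<Rightarrow> real" borel] by simp
      note [measurable] = borel_measurable_continuous_onI[OF c_cont] frm kernel_measurable
      have "(\<lambda>y. \<Phi> (fst y) (snd y)) \<in> borel_measurable borel"
        unfolding \<Phi>_def amp_def by measurable
      then show ?thesis by (simp add: split_beta' lborel_prod)
    qed
    have \<Phi>_bound: "\<bar>\<Phi> r x\<bar> \<le> indicator {0..t} r * (C * majorant D x)" for r x
    proof (cases "r \<in> {0..t}")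
      case True
      then have r: "r \<in> {0..T}" using t by auto
      have "\<bar>Re (c r x * amp r x * cis (z \<bullet> fr r x))\<bar> \<le> norm (c r x) * norm (amp r x)"
        using abs_Re_le_cmod[of "c r x * amp r x * cis (z \<bullet> fr r x)"] by (simp only: norm_mult norm_cis mult_1_right)
      also have "\<dots> \<le> (C * (1 + norm (fr r x)) ^ 2) * norm (amp r x)" using cb[OF r] by (intro mult_right_mono) auto
      also have "\<dots> \<le> (C * (1 + norm (fr r x)) ^ 4) * norm (amp r x)"
        using C0 by (intro mult_right_mono mult_left_mono power_increasing) auto
      also have "\<dots> \<le> C * majorant D x" using maj[OF r, of x] C0 by (simp add: mult.assoc mult_left_mono)
      finally show ?thesis using True by (simp add: \<Phi>_def)
    qed (simp add: \<Phi>_def)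
    have \<Phi>_int: "integrable (lborel \<Otimes>\<^sub>M lborel) (\<lambda>(r, x). \<Phi> r x)"
    proof (rule Bochner_Integration.integrable_bound[OF _ \<Phi>_meas])
      show "integrable (lborel \<Otimes>\<^sub>M lborel) (\<lambda>y. indicator {0..t} (fst y) * (C * majorant D (snd y)))"
        unfolding lborel_prod
        by (intro integrable_product[where f="indicator {0..t}"] integrable_mult_right majorant_integrable[OF F])
          (auto intro: integrable_indicator_Icc)
      show "AE y in lborel \<Otimes>\<^sub>M lborel. norm (case y of (r, x) \<Rightarrow> \<Phi> r x) \<le> norm (indicator {0..t} (fst y) * (C * majorant D (snd y)))"
        using \<Phi>_bound by (intro AE_I2) (auto simp: split_beta intro: order_trans[OF _ abs_ge_self])
    qed
    \<comment> \<open>The wave starts at time \<open>fst x\<close> with the value of the source; if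
      that time lies outside \<open>{0..t}\<close>, both sides vanish.\<close>
    have in_r: "(\<integral>r. \<Phi> r x \<partial>lborel) = Re (amp t x * cis (z \<bullet> fr t x)) - indicator {0..t} (fst x) * Re (F x * cis (z \<bullet> snd x))" for x
    proof (cases "fst x \<in> {0..t}")
      case False
      have a0: "amp r x = 0" if "r \<le> t" for r using False that by (auto simp: amp_def kernel_def indicator_def)
      have "\<Phi> r x = 0" for r using a0[of r] by (cases "r \<in> {0..t}") (simp_all add: \<Phi>_def)
      then show ?thesis using False a0[of t] by simp
    next
      case True
      define s where "s = fst x"
      have s: "0 \<le> s" "s \<le> t" "t \<le> T" using True t by (auto simp: s_def)
      define y where "y r = exp (- (damping T E Q r (label E x) - damping T E Q s (label E x))) *
          (Re (F x) * cos (z \<bullet> fr r x) - Im (F x) * sin (z \<bullet> fr r x))" for r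
      define y' where "y' r = exp (- (damping T E Q r (label E x) - damping T E Q s (label E x))) * Re (c r x * F x * cis (z \<bullet> fr r x))" for r
      have dy: "(y has_vector_derivative y' r) (at r within {s..t})" if r: "s \<le> r" "r \<le> t" for r
      proof -
        have 1: "((\<lambda>r. damping T E Q r (label E x)) has_real_derivative (Q r *v fr r x) \<bullet> fr r x) (at r within {s..t})"
          using damping_deriv[of r "label E x"] r s unfolding fr_def
          by (auto intro: DERIV_subset)
        have "((\<lambda>r. E r *v label E x) has_vector_derivative (transpose A ** E r) *v label E x) (at r)"
          by (rule bounded_linear.has_vector_derivative[OF bounded_bilinear.bounded_linear_left[OF bounded_bilinear_matrix_vector_mult] E_deriv])
        from bounded_linear.has_vector_derivative[OF bounded_linear_inner_right[of z] this]
        have "((\<lambda>r. z \<bullet> fr r x) has_real_derivative z \<bullet> ((transpose A ** E r) *v label E x)) (at r)"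
          unfolding fr_def has_real_derivative_iff_has_vector_derivative .
        also have "z \<bullet> ((transpose A ** E r) *v label E x) = (A *v z) \<bullet> fr r x"
          by (simp add: fr_def matrix_vector_mul_assoc[symmetric] transpose_matrix_vector) (metis dot_lmul_matrix inner_commute)
        finally have 2: "((\<lambda>r. z \<bullet> fr r x) has_real_derivative (A *v z) \<bullet> fr r x) (at r within {s..t})"
          by (rule has_field_derivative_at_within)
        have Qr: "Qe r = Q r" using r s by (intro Qe) auto
        show ?thesis unfolding y_def y'_def has_real_derivative_iff_has_vector_derivative[symmetric] c_def Qr
          by (rule derivative_eq_intros 1 2 refl)+ (simp add: algebra_simps)
      qed
      have cy': "continuous_on {s..t} y'"
        unfolding y'_def
        by (intro continuous_intros continuous_on_compose2[OF c_cont, of _ "\<lambda>r. (r, x)", simplified]) (auto simp: fr_def intro!: continuous_intros)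
      have "(\<integral>r. \<Phi> r x \<partial>lborel) = (\<integral>r. indicator {s..t} r *\<^sub>R y' r \<partial>lborel)"
      proof (rule Bochner_Integration.integral_cong[OF refl])
        fix r show "\<Phi> r x = indicator {s..t} r *\<^sub>R y' r"
          using s by (auto simp: \<Phi>_def y'_def amp_def kernel_def indicator_def s_def[symmetric] algebra_simps)
      qed
      also have "\<dots> = y t - y s" by (rule integral_FTC_atLeastAtMost[OF s(2) dy cy'])
      also have "y s = Re (F x * cis (z \<bullet> snd x))" using E_label[of x] by (simp add: y_def fr_def s_def)
      also have "y t = Re (amp t x * cis (z \<bullet> fr t x))"
        using True by (simp add: y_def amp_def kernel_def s_def[symmetric] algebra_simps)
      finally show ?thesis using True by simp
    qed
    have src_int: "integrable (lborel \<Otimes>\<^sub>M lborel) (\<lambda>x. indicator {0..t} (fst x) * Re (F x * cis (z \<bullet> snd x)))"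
      unfolding lborel_prod
    proof (rule Bochner_Integration.integrable_bound[OF majorant_integrable[OF F]])
      show "AE x in lborel. norm (indicator {0..t} (fst x) * Re (F x * cis (z \<bullet> snd x))) \<le> norm (majorant D x)"
      proof (rule AE_I2)
        fix x
        have "\<bar>indicator {0..t} (fst x) * Re (F x * cis (z \<bullet> snd x))\<bar> \<le> indicator {0..T} (fst x) * D (snd x)"
          using abs_Re_le_cmod[of "F x * cis (z \<bullet> snd x)"] FD[of x] t
          unfolding norm_mult norm_cis mult_1_right by (auto simp: indicator_def simp del: times_complex.sel)
        also have "\<dots> \<le> majorant D x"
        proof -
          have n: "norm (complex_of_real (indicator {0..T} (fst x) * D (snd x))) = indicator {0..T} (fst x) * D (snd x)"
            unfolding norm_of_real using spectral_nonneg[OF F] by (intro abs_of_nonneg mult_nonneg_nonneg) auto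
          from majorant_bound[OF F t, of "complex_of_real (indicator {0..T} (fst x) * D (snd x))", unfolded n]
          have "(1 + norm (E t *v label E x)) ^ 4 * (indicator {0..T} (fst x) * D (snd x)) \<le> majorant D x" by simp
          moreover have "1 * (indicator {0..T} (fst x) * D (snd x)) \<le> (1 + norm (E t *v label E x)) ^ 4 * (indicator {0..T} (fst x) * D (snd x))"
            using spectral_nonneg[OF F] by (intro mult_right_mono one_le_power) auto
          ultimately show ?thesis by simp
        qed
        finally show "norm (indicator {0..t} (fst x) * Re (F x * cis (z \<bullet> snd x))) \<le> norm (majorant D x)" by simp
      qed
    next
      have [measurable]: "(\<lambda>x :: real \<times> (real ^ 'n). cis (z \<bullet> snd x)) \<in> borel_measurable borel"
        by (intro borel_measurable_continuous_onI continuous_intros)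
      have f1: "fst \<in> borel_measurable (borel :: (real \<times> (real ^ 'n)) measure)"
        by (intro borel_measurable_continuous_onI continuous_intros)
      have [measurable]: "(\<lambda>x :: real \<times> (real ^ 'n). indicator {0..t} (fst x) :: real) \<in> borel_measurable borel"
        using measurable_compose[OF f1, of "indicator {0..t} :: real \<Rightarrow> real" borel] by simp
      show "(\<lambda>x. indicator {0..t} (fst x) * Re (F x * cis (z \<bullet> snd x))) \<in> borel_measurable lborel"
        by measurable
    qed
    have src: "indicator {0..t} s * f s z = (\<integral>\<xi>. indicator {0..t} s * Re (F (s, \<xi>) * cis (z \<bullet> \<xi>)) \<partial>lborel)" for s
    proof (cases "s \<in> {0..t}")
      case True
      then have "f s z = osc_integral lborel (\<lambda>\<xi>. F (s, \<xi>)) (\<lambda>\<xi>. \<xi>) z" using f t by (auto simp: represents_def)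
      then show ?thesis using True by (simp add: osc_integral_def)
    qed simp
    have opi: "indicator {0..t} r * diffusion_op A Q r (mild T E Q F r) z = (\<integral>x. \<Phi> r x \<partial>lborel)" for r
      using op[of r] t by (cases "r \<in> {0..t}") (auto simp: \<Phi>_def osc_integral_def)
    have i1: "integrable lborel (\<lambda>s. indicator {0..t} s * f s z)"
      unfolding src using lborel_pair.integrable_fst'[OF src_int] by simp
    have I1: "(\<integral>s. indicator {0..t} s * f s z \<partial>lborel) = (\<integral>x. indicator {0..t} (fst x) * Re (F x * cis (z \<bullet> snd x)) \<partial>lborel)"
      unfolding src using lborel_pair.integral_fst'[OF src_int] by (simp add: lborel_prod)
    have i2: "integrable lborel (\<lambda>r. indicator {0..t} r * diffusion_op A Q r (mild T E Q F r) z)"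
      unfolding opi using lborel_pair.integrable_fst'[OF \<Phi>_int] by simp
    have I2: "(\<integral>r. indicator {0..t} r * diffusion_op A Q r (mild T E Q F r) z \<partial>lborel) = (\<integral>x. (\<integral>r. \<Phi> r x \<partial>lborel) \<partial>lborel)"
      unfolding opi using lborel_pair.Fubini_integral[OF \<Phi>_int] by simp
    have si: "integrable lborel (\<lambda>x. indicator {0..t} (fst x) * Re (F x * cis (z \<bullet> snd x)))"
      using src_int by (simp only: lborel_prod)
    have "(\<integral>r. indicator {0..t} r * diffusion_op A Q r (mild T E Q F r) z \<partial>lborel)
       = mild T E Q F t z - (\<integral>x. indicator {0..t} (fst x) * Re (F x * cis (z \<bullet> snd x)) \<partial>lborel)"
    proof -
      have "mild T E Q F t z = (\<integral>x. Re (amp t x * cis (z \<bullet> fr t x)) \<partial>lborel)" by (simp only: mild osc_integral_def)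
      then show ?thesis unfolding I2 in_r
        by (simp only: Bochner_Integration.integral_diff[OF osc_integrand_integrable[OF A4[OF t]] si])
    qed
    then have main: "mild T E Q F t z = (\<integral>s. indicator {0..t} s * f s z + indicator {0..t} s * diffusion_op A Q s (mild T E Q F s) z \<partial>lborel)"
      using I1 by (simp add: Bochner_Integration.integral_add[OF i1 i2])
    show "set_integrable lborel {0..t} (\<lambda>s. f s z + diffusion_op A Q s (mild T E Q F s) z)"
      using Bochner_Integration.integrable_add[OF i1 i2] by (simp add: set_integrable_def distrib_left)
    show "mild T E Q F t z = (LINT s:{0..t}|lborel. f s z + diffusion_op A Q s (mild T E Q F s) z)"
      unfolding main by (simp add: set_lebesgue_integral_def distrib_left)
  qed
qed

end

section \<open>Fourier inversion for the source term\<close>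

lemma lborel_integral_product:
  fixes f :: "'a::euclidean_space \<Rightarrow> real \<Rightarrow> 'c::{real_normed_field, banach, second_countable_topology}"
  assumes f: "\<And>b. b \<in> Basis \<Longrightarrow> integrable lborel (f b)"
  shows "integrable lborel (\<lambda>x::'a. \<Prod>b\<in>Basis. f b (x \<bullet> b))"
    and "(\<integral>x. (\<Prod>b\<in>Basis. f b ((x::'a) \<bullet> b)) \<partial>lborel) = (\<Prod>b\<in>Basis. integral\<^sup>L lborel (f b))"
proof -
  interpret product_sigma_finite "\<lambda>_::'a. lborel :: real measure" by unfold_locales
  have m [measurable]: "f b \<in> borel_measurable borel" if "b \<in> Basis" for b
    using borel_measurable_integrable[OF f[OF that]] by simp
  have meas: "(\<lambda>x::'a. \<Prod>b\<in>Basis. f b (x \<bullet> b)) \<in> borel_measurable borel"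
    using m by (intro borel_measurable_prod) (auto intro: measurable_compose[OF borel_measurable_inner[OF measurable_ident borel_measurable_const]])
  have T: "(\<lambda>f. \<Sum>b\<in>Basis. f b *\<^sub>R b) \<in> measurable (\<Pi>\<^sub>M b\<in>Basis. lborel) (borel :: 'a measure)"
    by measurable
  have L: "(lborel :: 'a measure) = distr (\<Pi>\<^sub>M b\<in>Basis. lborel) borel (\<lambda>f. \<Sum>b\<in>Basis. f b *\<^sub>R b)"
    by (rule lborel_eq)
  have eq: "(\<Prod>b\<in>Basis. f b ((\<Sum>b\<in>Basis. g b *\<^sub>R b) \<bullet> b)) = (\<Prod>b\<in>(Basis :: 'a set). f b (g b))" for g :: "'a \<Rightarrow> real"
    by (intro prod.cong refl) (simp add: inner_sum_left_Basis)
  show "integrable lborel (\<lambda>x::'a. \<Prod>b\<in>Basis. f b (x \<bullet> b))"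
    using product_integrable_prod[of Basis f] f
    by (subst L, subst integrable_distr_eq[OF T meas]) (simp add: eq)
  show "(\<integral>x. (\<Prod>b\<in>Basis. f b ((x::'a) \<bullet> b)) \<partial>lborel) = (\<Prod>b\<in>Basis. integral\<^sup>L lborel (f b))"
    using product_integral_prod[of Basis f] f
    by (subst L, subst integral_distr[OF T meas]) (simp add: eq)
qed

lemma lborel_integral_affine:
  fixes f :: "'a::euclidean_space \<Rightarrow> 'c::{banach, second_countable_topology}"
  assumes c: "c \<noteq> 0" and [measurable]: "f \<in> borel_measurable borel"
  shows "(\<integral>x. f x \<partial>lborel) = \<bar>c\<bar> ^ DIM('a) *\<^sub>R (\<integral>x. f (t + c *\<^sub>R x) \<partial>lborel)"
proof -
  have "(\<integral>x. f x \<partial>lborel) = (\<integral>x. f x \<partial>density (distr lborel borel (\<lambda>x. t + c *\<^sub>R x)) (\<lambda>_. ennreal (\<bar>c\<bar> ^ DIM('a))))"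
    using lborel_affine[OF c, of t] by simp
  also have "\<dots> = (\<integral>x. \<bar>c\<bar> ^ DIM('a) *\<^sub>R f x \<partial>distr lborel borel (\<lambda>x. t + c *\<^sub>R x))"
    by (subst integral_density) auto
  also have "\<dots> = (\<integral>x. \<bar>c\<bar> ^ DIM('a) *\<^sub>R f (t + c *\<^sub>R x) \<partial>lborel)"
    by (subst integral_distr) auto
  finally show ?thesis by simp
qed

definition gaussian :: "'a::euclidean_space \<Rightarrow> real" where
  "gaussian u = (\<Prod>b\<in>Basis. std_normal_density (u \<bullet> b))"

lemma integrable_std_normal_density: "integrable lborel std_normal_density"
  using integrable_std_normal_moment[of 0] by simp

lemma gaussian_integral: "integrable lborel (gaussian :: 'a::euclidean_space \<Rightarrow> real)" "integral\<^sup>L lborel (gaussian :: 'a \<Rightarrow> real) = 1"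
  unfolding gaussian_def[abs_def]
  using lborel_integral_product[of "\<lambda>_. std_normal_density"] integrable_std_normal_density integral_std_normal_moment_even[of 0]
  by auto

lemma gaussian_nonneg: "0 \<le> gaussian u" by (simp add: gaussian_def prod_nonneg)

lemma gaussian_eq: "gaussian (u::'a::euclidean_space) = (1 / sqrt (2 * pi)) ^ DIM('a) * exp (- (u \<bullet> u) / 2)"
proof -
  have "gaussian u = (\<Prod>b\<in>Basis. (1 / sqrt (2 * pi)) * exp (- (u \<bullet> b)\<^sup>2 / 2))"
    by (simp add: gaussian_def std_normal_density_def)
  also have "\<dots> = (1 / sqrt (2 * pi)) ^ DIM('a) * exp (\<Sum>b\<in>Basis. - (u \<bullet> b)\<^sup>2 / 2)"
    by (simp only: prod.distrib prod_constant exp_sum[OF finite_Basis])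
  also have "(\<Sum>b\<in>Basis. - (u \<bullet> b)\<^sup>2 / 2) = - (u \<bullet> u) / 2"
    by (simp add: euclidean_inner[of u u] power2_eq_square sum_negf sum_divide_distrib)
  finally show ?thesis .
qed

lemma gaussian_cont: "continuous_on UNIV (gaussian :: 'a::euclidean_space \<Rightarrow> real)"
  unfolding gaussian_eq[abs_def] by (intro continuous_intros) auto

lemma gaussian_measurable [measurable]: "gaussian \<in> borel_measurable borel"
  by (rule borel_measurable_continuous_onI[OF gaussian_cont])

text \<open>The integral factorises into characteristic functions of the one-dimensional standard
  normal law, so the Gaussian reproduces itself up to a constant.\<close>

lemma gaussian_fourier:
  fixes a :: "'a::euclidean_space"
  shows "(\<integral>u. of_real (gaussian u) * cis (a \<bullet> u) \<partial>lborel) = complex_of_real (sqrt (2 * pi) ^ DIM('a) * gaussian a)"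
proof -
  have i: "integrable lborel (\<lambda>x. complex_of_real (std_normal_density x) * cis (c * x))" for c
  proof (rule Bochner_Integration.integrable_bound[OF integrable_std_normal_density])
    have [measurable]: "(\<lambda>x. cis (c * x)) \<in> borel_measurable borel" by (intro borel_measurable_continuous_onI continuous_intros)
    show "(\<lambda>x. complex_of_real (std_normal_density x) * cis (c * x)) \<in> borel_measurable lborel" by measurable
  qed (simp add: norm_mult)
  have one: "(\<integral>x. complex_of_real (std_normal_density x) * cis (c * x) \<partial>lborel) = of_real (exp (- c\<^sup>2 / 2))" for c
  proof -
    have "char std_normal_distribution c = (\<integral>x. std_normal_density x *\<^sub>R iexp (c * x) \<partial>lborel)"
      unfolding char_def by (subst integral_density) auto
    then show ?thesis
      by (simp add: char_std_normal_distribution cis_conv_exp scaleR_conv_of_real)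
  qed
  have "(\<integral>u. of_real (gaussian u) * cis (a \<bullet> u) \<partial>lborel) =
     (\<integral>u. (\<Prod>b\<in>Basis. complex_of_real (std_normal_density (u \<bullet> b)) * cis ((a \<bullet> b) * (u \<bullet> b))) \<partial>lborel)"
  proof (rule Bochner_Integration.integral_cong[OF refl])
    fix u :: 'a
    have "cis (a \<bullet> u) = (\<Prod>b\<in>Basis. cis ((a \<bullet> b) * (u \<bullet> b)))"
      by (simp add: euclidean_inner[of a u] cis_conv_exp sum_distrib_left exp_sum)
    then show "of_real (gaussian u) * cis (a \<bullet> u) = (\<Prod>b\<in>Basis. complex_of_real (std_normal_density (u \<bullet> b)) * cis ((a \<bullet> b) * (u \<bullet> b)))"
      by (simp add: gaussian_def prod.distrib)
  qed
  also have "\<dots> = (\<Prod>b\<in>(Basis::'a set). complex_of_real (exp (- (a \<bullet> b)\<^sup>2 / 2)))"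
    using lborel_integral_product(2)[of "\<lambda>b x. complex_of_real (std_normal_density x) * cis ((a \<bullet> b) * x)"] i one by simp
  also have "\<dots> = complex_of_real (exp (\<Sum>b\<in>Basis. - (a \<bullet> b)\<^sup>2 / 2))"
    by (simp only: exp_sum[OF finite_Basis] of_real_prod)
  also have "(\<Sum>b\<in>Basis. - (a \<bullet> b)\<^sup>2 / 2) = - (a \<bullet> a) / 2"
    by (simp add: euclidean_inner[of a a] power2_eq_square sum_negf sum_divide_distrib)
  also have "exp (- (a \<bullet> a) / 2) = sqrt (2 * pi) ^ DIM('a) * gaussian a"
    by (simp add: gaussian_eq power_divide)
  finally show ?thesis .
qed

section \<open>Fourier inversion by Gaussian averages\<close>

definition fourier :: "('a::euclidean_space \<Rightarrow> real) \<Rightarrow> 'a \<Rightarrow> complex" where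
  "fourier g \<xi> = (\<integral>y. of_real (g y) * cis (- (y \<bullet> \<xi>)) \<partial>lborel)"

lemma fourier_cis_integrable:
  assumes "integrable lborel (g :: 'a::euclidean_space \<Rightarrow> real)"
  shows "integrable lborel (\<lambda>y. complex_of_real (g y) * cis (c + y \<bullet> \<xi>))"
proof (rule Bochner_Integration.integrable_bound[OF assms])
  have [measurable]: "(\<lambda>y. cis (c + y \<bullet> \<xi>)) \<in> borel_measurable borel" by (intro borel_measurable_continuous_onI continuous_intros)
  have [measurable]: "g \<in> borel_measurable borel" using borel_measurable_integrable[OF assms] by simp
  show "(\<lambda>y. complex_of_real (g y) * cis (c + y \<bullet> \<xi>)) \<in> borel_measurable lborel" by measurable
qed (simp add: norm_mult)

text \<open>The average of \<open>g\<close> around \<open>x\<close> over a Gaussian of width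
  \<open>e\<close> becomes, once the Gaussian is written as its own transform and the integrals are
  exchanged, the inversion integral damped by \<open>gaussian (e *\<^sub>R \<xi>)\<close>. As
  \<open>e\<close> tends to 0 the left side converges by continuity and boundedness of
  \<open>g\<close>, the right side by integrability of the transform.\<close>

lemma fourier_inversion:
  fixes g :: "'a::euclidean_space \<Rightarrow> real"
  assumes g: "continuous_on UNIV g" "integrable lborel g" and gb: "\<And>y. \<bar>g y\<bar> \<le> C"
    and ig: "integrable lborel (fourier g)"
  shows "complex_of_real (g x) = of_real ((1 / (2 * pi)) ^ DIM('a)) * (\<integral>\<xi>. fourier g \<xi> * cis (x \<bullet> \<xi>) \<partial>lborel)"
proof -
  have [measurable]: "g \<in> borel_measurable borel" using g by (simp add: borel_measurable_continuous_onI)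
  have [measurable]: "fourier g \<in> borel_measurable borel" using borel_measurable_integrable[OF ig] by simp
  have cm: "(\<lambda>\<xi>::'a. cis (x \<bullet> \<xi>)) \<in> borel_measurable borel" for x by (intro borel_measurable_continuous_onI continuous_intros)
  define d where "d = sqrt (2 * pi) ^ DIM('a)"
  have d0: "0 < d" by (simp add: d_def)
  have step: "(\<integral>u. of_real (g (x + e *\<^sub>R u) * gaussian u) \<partial>lborel)
     = of_real (1 / d) * (\<integral>\<xi>. of_real (gaussian (e *\<^sub>R \<xi>)) * (fourier g \<xi> * cis (x \<bullet> \<xi>)) \<partial>lborel)" if e: "0 < e" for e
  proof -
    have gi: "integrable lborel (\<lambda>u. g (x + e *\<^sub>R u))"
    proof -
      have "integrable (density (distr lborel borel (\<lambda>u. x + e *\<^sub>R u)) (\<lambda>_. ennreal (\<bar>e\<bar> ^ DIM('a)))) g"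
        using g(2) lborel_affine[of e x] e by simp
      then have "integrable lborel (\<lambda>u. \<bar>e\<bar> ^ DIM('a) *\<^sub>R g (x + e *\<^sub>R u))"
        by (subst (asm) integrable_density; (subst (asm) integrable_distr_eq)?) auto
      then show ?thesis using e by simp
    qed
    have gau: "complex_of_real (gaussian u) = of_real (1 / d) * (\<integral>v. of_real (gaussian v) * cis (u \<bullet> v) \<partial>lborel)" for u :: 'a
      unfolding gaussian_fourier using d0 by (simp add: d_def)
    define K where "K u v = complex_of_real (g (x + e *\<^sub>R u)) * (of_real (gaussian v) * cis (u \<bullet> v))" for u v
    have Km: "(\<lambda>(u, v). K u v) \<in> borel_measurable (lborel \<Otimes>\<^sub>M lborel)"
    proof -
      have 1: "(\<lambda>p::'a \<times> 'a. g (x + e *\<^sub>R fst p)) \<in> borel_measurable borel"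
        by (rule borel_measurable_continuous_onI, rule continuous_on_compose2[OF g(1)]) (auto intro!: continuous_intros)
      have 2: "(\<lambda>p::'a \<times> 'a. gaussian (snd p)) \<in> borel_measurable borel"
        by (rule borel_measurable_continuous_onI, rule continuous_on_compose2[OF gaussian_cont]) (auto intro!: continuous_intros)
      have 3: "(\<lambda>p::'a \<times> 'a. cis (fst p \<bullet> snd p)) \<in> borel_measurable borel"
        by (intro borel_measurable_continuous_onI continuous_intros)
      have "(\<lambda>p. K (fst p) (snd p)) \<in> borel_measurable borel" unfolding K_def using 1 2 3 by measurable
      then show ?thesis by (simp add: split_beta' lborel_prod)
    qed
    have Ki: "integrable (lborel \<Otimes>\<^sub>M lborel) (\<lambda>(u, v). K u v)"
    proof (rule Bochner_Integration.integrable_bound[OF _ Km])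
      show "integrable (lborel \<Otimes>\<^sub>M lborel) (\<lambda>p. g (x + e *\<^sub>R fst p) * gaussian (snd p))"
        unfolding lborel_prod by (rule integrable_product[OF gi gaussian_integral(1)])
    qed (auto simp: K_def norm_mult abs_mult)
    have inner: "(\<integral>u. K u v \<partial>lborel) = of_real ((1 / e) ^ DIM('a)) * (of_real (gaussian v) * (cis (- (x \<bullet> v) / e) * fourier g ((- 1 / e) *\<^sub>R v)))" for v
    proof -
      have [measurable]: "(\<lambda>y. cis ((y - x) \<bullet> v / e)) \<in> borel_measurable borel"
        by (intro borel_measurable_continuous_onI continuous_intros) (use e in auto)
      have "(\<integral>y. of_real (g y) * (of_real (gaussian v) * cis ((y - x) \<bullet> v / e)) \<partial>lborel)
          = \<bar>e\<bar> ^ DIM('a) *\<^sub>R (\<integral>u. of_real (g (x + e *\<^sub>R u)) * (of_real (gaussian v) * cis (((x + e *\<^sub>R u) - x) \<bullet> v / e)) \<partial>lborel)"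
        by (rule lborel_integral_affine) (use e in auto)
      also have "(\<integral>u. of_real (g (x + e *\<^sub>R u)) * (of_real (gaussian v) * cis (((x + e *\<^sub>R u) - x) \<bullet> v / e)) \<partial>lborel) = (\<integral>u. K u v \<partial>lborel)"
        using e by (simp add: K_def)
      finally have "(\<integral>u. K u v \<partial>lborel) = of_real ((1 / e) ^ DIM('a)) * (\<integral>y. of_real (g y) * (of_real (gaussian v) * cis ((y - x) \<bullet> v / e)) \<partial>lborel)"
        using e by (simp add: scaleR_conv_of_real power_divide)
      also have "(\<integral>y. of_real (g y) * (of_real (gaussian v) * cis ((y - x) \<bullet> v / e)) \<partial>lborel)
         = (\<integral>y. (of_real (gaussian v) * cis (- (x \<bullet> v) / e)) * (of_real (g y) * cis (- (y \<bullet> ((- 1 / e) *\<^sub>R v)))) \<partial>lborel)"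
      proof (rule Bochner_Integration.integral_cong[OF refl])
        fix y
        have "cis ((y - x) \<bullet> v / e) = cis (- (x \<bullet> v) / e) * cis (- (y \<bullet> ((- 1 / e) *\<^sub>R v)))"
          unfolding cis_mult by (simp add: inner_diff_left diff_divide_distrib)
        then show "of_real (g y) * (of_real (gaussian v) * cis ((y - x) \<bullet> v / e)) =
          (of_real (gaussian v) * cis (- (x \<bullet> v) / e)) * (of_real (g y) * cis (- (y \<bullet> ((- 1 / e) *\<^sub>R v))))" by (simp only: mult_ac)
      qed
      also have "\<dots> = (of_real (gaussian v) * cis (- (x \<bullet> v) / e)) * fourier g ((- 1 / e) *\<^sub>R v)"
        unfolding fourier_def by (rule integral_mult_right_zero)
      finally show ?thesis by (simp only: mult.assoc)
    qed
    have "(\<integral>u. of_real (g (x + e *\<^sub>R u) * gaussian u) \<partial>lborel) = (\<integral>u. of_real (1 / d) * (\<integral>v. K u v \<partial>lborel) \<partial>lborel)"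
    proof (rule Bochner_Integration.integral_cong[OF refl])
      fix u
      have "(\<integral>v. K u v \<partial>lborel) = of_real (g (x + e *\<^sub>R u)) * (\<integral>v. of_real (gaussian v) * cis (u \<bullet> v) \<partial>lborel)"
        unfolding K_def by (rule integral_mult_right_zero)
      then show "of_real (g (x + e *\<^sub>R u) * gaussian u) = of_real (1 / d) * (\<integral>v. K u v \<partial>lborel)"
        unfolding of_real_mult by (subst gau) (simp only: mult_ac)
    qed
    also have "\<dots> = of_real (1 / d) * (\<integral>v. (\<integral>u. K u v \<partial>lborel) \<partial>lborel)"
      using lborel_pair.Fubini_integral[OF Ki] by simp
    also have "(\<integral>v. (\<integral>u. K u v \<partial>lborel) \<partial>lborel) = (\<integral>v. of_real ((1 / e) ^ DIM('a)) * (of_real (gaussian v) * (cis (- (x \<bullet> v) / e) * fourier g ((- 1 / e) *\<^sub>R v))) \<partial>lborel)"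
      by (simp only: inner)
    also have "(\<integral>v. of_real ((1 / e) ^ DIM('a)) * (of_real (gaussian v) * (cis (- (x \<bullet> v) / e) * fourier g ((- 1 / e) *\<^sub>R v))) \<partial>lborel)
      = (\<integral>\<xi>. of_real (gaussian (e *\<^sub>R \<xi>)) * (fourier g \<xi> * cis (x \<bullet> \<xi>)) \<partial>lborel)"
    proof -
      have [measurable]: "(\<lambda>v. cis (- (x \<bullet> v) / e)) \<in> borel_measurable borel" by (intro borel_measurable_continuous_onI continuous_intros) (use e in auto)
      \<comment> \<open>Scaling by \<open>- e\<close> turns the argument of the transform into
        \<open>\<xi>\<close>; evenness of the Gaussian absorbs the sign.\<close>
      have "(\<integral>v. of_real (gaussian v) * (cis (- (x \<bullet> v) / e) * fourier g ((- 1 / e) *\<^sub>R v)) \<partial>lborel)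
         = \<bar>- e\<bar> ^ DIM('a) *\<^sub>R (\<integral>\<xi>. of_real (gaussian (0 + (- e) *\<^sub>R \<xi>)) * (cis (- (x \<bullet> (0 + (- e) *\<^sub>R \<xi>)) / e) * fourier g ((- 1 / e) *\<^sub>R (0 + (- e) *\<^sub>R \<xi>))) \<partial>lborel)"
        by (rule lborel_integral_affine) (use e in auto)
      also have "(\<integral>\<xi>. of_real (gaussian (0 + (- e) *\<^sub>R \<xi>)) * (cis (- (x \<bullet> (0 + (- e) *\<^sub>R \<xi>)) / e) * fourier g ((- 1 / e) *\<^sub>R (0 + (- e) *\<^sub>R \<xi>))) \<partial>lborel)
         = (\<integral>\<xi>. of_real (gaussian (e *\<^sub>R \<xi>)) * (fourier g \<xi> * cis (x \<bullet> \<xi>)) \<partial>lborel)"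
        using e by (intro Bochner_Integration.integral_cong[OF refl]) (simp add: gaussian_eq mult_ac)
      finally show ?thesis using e by (simp add: scaleR_conv_of_real power_divide)
    qed
    finally show ?thesis .
  qed
  define en where "en n = 1 / real (Suc n)" for n
  have en: "0 < en n" for n by (simp add: en_def)
  have en0: "en \<longlonglongrightarrow> 0" unfolding en_def by (rule LIMSEQ_Suc) (rule lim_const_over_n)
  have L1: "(\<lambda>n. \<integral>u. complex_of_real (g (x + en n *\<^sub>R u) * gaussian u) \<partial>lborel) \<longlonglongrightarrow> (\<integral>u. complex_of_real (g x * gaussian (u::'a)) \<partial>lborel)"
  proof (rule integral_dominated_convergence[where w="\<lambda>u::'a. C * gaussian u"])
    show "integrable lborel (\<lambda>u. C * gaussian u)" using gaussian_integral(1) by (rule integrable_mult_right)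
    show "AE u in lborel. (\<lambda>n. complex_of_real (g (x + en n *\<^sub>R u) * gaussian u)) \<longlonglongrightarrow> complex_of_real (g x * gaussian u)"
    proof (rule AE_I2)
      fix u
      have "(\<lambda>n. x + en n *\<^sub>R u) \<longlonglongrightarrow> x + 0 *\<^sub>R u" by (intro tendsto_intros en0)
      then have "(\<lambda>n. g (x + en n *\<^sub>R u)) \<longlonglongrightarrow> g x" using continuous_on_tendsto_compose[OF g(1)] by fastforce
      then show "(\<lambda>n. complex_of_real (g (x + en n *\<^sub>R u) * gaussian u)) \<longlonglongrightarrow> complex_of_real (g x * gaussian u)"
        by (intro tendsto_intros)
    qed
    show "AE u in lborel. norm (complex_of_real (g (x + en n *\<^sub>R u) * gaussian u)) \<le> C * gaussian u" for n
      by (intro AE_I2) (auto simp: norm_mult abs_mult gaussian_nonneg intro!: mult_right_mono gb)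
  qed measurable
  have L2: "(\<lambda>n. \<integral>\<xi>. of_real (gaussian (en n *\<^sub>R \<xi>)) * (fourier g \<xi> * cis (x \<bullet> \<xi>)) \<partial>lborel) \<longlonglongrightarrow> (\<integral>\<xi>. of_real (gaussian (0::'a)) * (fourier g \<xi> * cis (x \<bullet> \<xi>)) \<partial>lborel)"
  proof (rule integral_dominated_convergence[where w="\<lambda>\<xi>. gaussian (0::'a) * norm (fourier g \<xi>)"])
    note [measurable] = cm
    show "integrable lborel (\<lambda>\<xi>. gaussian (0::'a) * norm (fourier g \<xi>))" using ig by simp
    show "AE \<xi> in lborel. (\<lambda>n. of_real (gaussian (en n *\<^sub>R \<xi>)) * (fourier g \<xi> * cis (x \<bullet> \<xi>))) \<longlonglongrightarrow> of_real (gaussian (0::'a)) * (fourier g \<xi> * cis (x \<bullet> \<xi>))"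
    proof (rule AE_I2)
      fix \<xi> :: 'a
      have "(\<lambda>n. en n *\<^sub>R \<xi>) \<longlonglongrightarrow> 0 *\<^sub>R \<xi>" by (intro tendsto_intros en0)
      then have "(\<lambda>n. gaussian (en n *\<^sub>R \<xi>)) \<longlonglongrightarrow> gaussian (0::'a)" using continuous_on_tendsto_compose[OF gaussian_cont] by fastforce
      then show "(\<lambda>n. of_real (gaussian (en n *\<^sub>R \<xi>)) * (fourier g \<xi> * cis (x \<bullet> \<xi>))) \<longlonglongrightarrow> of_real (gaussian (0::'a)) * (fourier g \<xi> * cis (x \<bullet> \<xi>))"
        by (intro tendsto_intros)
    qed
    show "AE \<xi> in lborel. norm (of_real (gaussian (en n *\<^sub>R \<xi>)) * (fourier g \<xi> * cis (x \<bullet> \<xi>))) \<le> gaussian (0::'a) * norm (fourier g \<xi>)" for n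
    proof (rule AE_I2)
      fix \<xi> :: 'a
      have "norm (of_real (gaussian (en n *\<^sub>R \<xi>)) * (fourier g \<xi> * cis (x \<bullet> \<xi>))) = gaussian (en n *\<^sub>R \<xi>) * norm (fourier g \<xi>)"
        by (simp only: norm_mult norm_cis norm_of_real abs_of_nonneg[OF gaussian_nonneg] mult_1_right)
      also have "\<dots> \<le> gaussian (0::'a) * norm (fourier g \<xi>)"
        unfolding gaussian_eq using less_imp_le[OF en[of n]]
        by (intro mult_right_mono mult_left_mono) (auto intro!: mult_nonneg_nonneg)
      finally show "norm (of_real (gaussian (en n *\<^sub>R \<xi>)) * (fourier g \<xi> * cis (x \<bullet> \<xi>))) \<le> gaussian (0::'a) * norm (fourier g \<xi>)" .
    qed
    show "(\<lambda>\<xi>. of_real (gaussian (en n *\<^sub>R \<xi>)) * (fourier g \<xi> * cis (x \<bullet> \<xi>))) \<in> borel_measurable lborel" for n by measurable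
    show "(\<lambda>\<xi>. of_real (gaussian (0::'a)) * (fourier g \<xi> * cis (x \<bullet> \<xi>))) \<in> borel_measurable lborel" by measurable
  qed
  have eq: "(\<integral>u. complex_of_real (g x * gaussian (u::'a)) \<partial>lborel) = of_real (1 / d) * (\<integral>\<xi>. of_real (gaussian (0::'a)) * (fourier g \<xi> * cis (x \<bullet> \<xi>)) \<partial>lborel)"
  proof (rule LIMSEQ_unique[OF L1])
    show "(\<lambda>n. \<integral>u. complex_of_real (g (x + en n *\<^sub>R u) * gaussian u) \<partial>lborel)
      \<longlonglongrightarrow> of_real (1 / d) * (\<integral>\<xi>. of_real (gaussian (0::'a)) * (fourier g \<xi> * cis (x \<bullet> \<xi>)) \<partial>lborel)"
      unfolding step[OF en] by (intro tendsto_intros L2)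
  qed

  \<comment> \<open>One factor \<open>1 / d\<close> comes from the transform of the Gaussian, the
    other from its value at 0; together they give the power of \<open>1 / (2 * pi)\<close>.\<close>
  have dd: "d * d = (2 * pi) ^ DIM('a)" unfolding d_def power_mult_distrib[symmetric] by simp
  have g0: "gaussian (0::'a) = 1 / d" by (simp add: gaussian_eq d_def power_divide)
  have "complex_of_real (g x) = (\<integral>u. complex_of_real (g x * gaussian (u::'a)) \<partial>lborel)"
  proof -
    have "(\<integral>u. complex_of_real (g x * gaussian (u::'a)) \<partial>lborel) = complex_of_real (\<integral>u. g x * gaussian (u::'a) \<partial>lborel)"
      by (rule integral_of_real[OF integrable_mult_right[OF gaussian_integral(1)]])
    also have "(\<integral>u. g x * gaussian (u::'a) \<partial>lborel) = g x * 1"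
      unfolding integral_mult_right_zero gaussian_integral(2) ..
    finally show ?thesis by simp
  qed
  also note eq
  also have "(\<integral>\<xi>. of_real (gaussian (0::'a)) * (fourier g \<xi> * cis (x \<bullet> \<xi>)) \<partial>lborel) = of_real (1 / d) * (\<integral>\<xi>. fourier g \<xi> * cis (x \<bullet> \<xi>) \<partial>lborel)"
    unfolding g0 by (rule integral_mult_right_zero)
  also have "of_real (1 / d) * (of_real (1 / d) * (\<integral>\<xi>. fourier g \<xi> * cis (x \<bullet> \<xi>) \<partial>lborel))
     = of_real ((1 / d) * (1 / d)) * (\<integral>\<xi>. fourier g \<xi> * cis (x \<bullet> \<xi>) \<partial>lborel)"
    by (simp only: of_real_mult mult.assoc)
  also have "(1 / d) * (1 / d) = (1 / (2 * pi)) ^ DIM('a)"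
    using dd by (simp add: power_one_over)
  finally show ?thesis .
qed

section \<open>Decay of the transform of a smooth compactly supported function\<close>

lemma vanishing_pderiv:
  fixes g :: "real ^ 'n::finite \<Rightarrow> real"
  assumes "\<And>y. R < norm y \<Longrightarrow> g y = 0" "R < norm y"
  shows "pderiv_at j g y = 0"
proof -
  have "open {y :: real ^ 'n. R < norm y}" by (intro open_Collect_less continuous_intros)
  then have "(g has_derivative (\<lambda>_. 0)) (at y)"
    by (rule has_derivative_transform_within_open[OF has_derivative_const[of 0]]) (use assms in auto)
  then show ?thesis unfolding pderiv_at_def using frechet_derivative_at by metis
qed

lemma integrable_indicator_cball: "integrable lborel (indicator (cball c r) :: 'a::euclidean_space \<Rightarrow> real)"
  by (rule integrable_real_indicator) (simp_all only: emeasure_bounded_finite[OF bounded_cball] sets_lborel borel_closed[OF closed_cball])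

lemma cis_approx: "norm (cis d - (1 + \<i> * of_real d)) \<le> d\<^sup>2"
proof -
  have "norm (cis d - (1 + \<i> * of_real d)) \<le> \<bar>d\<bar> ^ Suc 1 / fact (Suc 1)"
    using iexp_approx1[of d 1] by (simp add: cis_conv_exp)
  also have "\<dots> \<le> d\<^sup>2" by (simp add: numeral_2_eq_2 power2_eq_square)
  finally show ?thesis .
qed

lemma integrable_bounded_support:
  fixes g :: "'a::euclidean_space \<Rightarrow> real"
  assumes "g \<in> borel_measurable borel" "\<And>y. \<bar>g y\<bar> \<le> M" "\<And>y. R < norm y \<Longrightarrow> g y = 0"
  shows "integrable lborel g"
proof (rule Bochner_Integration.integrable_bound)
  show "integrable lborel (\<lambda>y. indicator (cball 0 R) y * M)"
    by (intro integrable_mult_left integrable_indicator_cball)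
  show "AE y in lborel. norm (g y) \<le> norm (indicator (cball 0 R) y * M)"
    using assms(2,3) by (intro AE_I2) (auto simp: indicator_def not_le intro: order_trans[OF _ abs_ge_self])
qed (use assms in simp)

text \<open>Integration by parts, obtained by differentiating the translation identity
  \<open>\<integral> g (y + h e\<^sub>j) cis (- y \<bullet> \<xi>) dy = cis (h \<xi>\<^sub>j) * fourier g \<xi>\<close> at \<open>h = 0\<close>.\<close>

lemma fourier_pderiv:
  fixes g :: "real ^ 'n::finite \<Rightarrow> real"
  assumes d: "\<And>y. g differentiable (at y)" and c: "continuous_on UNIV (pderiv_at j g)"
    and b: "\<And>y. \<bar>g y\<bar> \<le> M" "\<And>y. \<bar>pderiv_at j g y\<bar> \<le> M" and v: "\<And>y. R < norm y \<Longrightarrow> g y = 0"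
  shows "fourier (pderiv_at j g) \<xi> = \<i> * of_real (\<xi> $ j) * fourier g \<xi>"
proof -
  have gc: "continuous_on UNIV g" using d by (auto intro: continuous_at_imp_continuous_on differentiable_imp_continuous_within)
  have gm [measurable]: "g \<in> borel_measurable borel" "pderiv_at j g \<in> borel_measurable borel"
    using gc c by (auto intro: borel_measurable_continuous_onI)
  have gi: "integrable lborel g" by (rule integrable_bounded_support[OF gm(1) b(1) v])
  have M0: "0 \<le> M" using b(1)[of 0] by linarith
  define e where "e = (axis j 1 :: real ^ 'n)"
  have ne: "norm e = 1" by (simp add: e_def)
  define h where "h n = 1 / real (Suc n)" for n
  have h: "0 < h n" "h n \<le> 1" for n by (auto simp: h_def)
  have h0: "h \<longlonglongrightarrow> 0" unfolding h_def by (rule LIMSEQ_Suc) (rule lim_const_over_n)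
  have hf: "filterlim h (at 0) sequentially" using h0 h(1) by (auto simp: filterlim_at intro!: always_eventually) (metis less_irrefl)
  have ld: "((\<lambda>s. g (y + s *\<^sub>R e)) has_real_derivative pderiv_at j g (y + s *\<^sub>R e)) (at s)" for y s
    using line_deriv[OF d, of y e s] by (simp add: e_def axis_def if_distrib[of "\<lambda>x. x * _"] cong: if_cong)
  have cm [measurable]: "(\<lambda>y. cis (- (y \<bullet> \<xi>))) \<in> borel_measurable borel" by (intro borel_measurable_continuous_onI continuous_intros)
  have shm [measurable]: "(\<lambda>y. g (y + s *\<^sub>R e)) \<in> borel_measurable borel" for s
    by (rule borel_measurable_continuous_onI, rule continuous_on_compose2[OF gc]) (auto intro!: continuous_intros)
  have shi: "integrable lborel (\<lambda>y. g (y + s *\<^sub>R e))" if "0 \<le> s" "s \<le> 1" for s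
  proof (rule integrable_bounded_support[OF shm b(1)])
    fix y :: "real ^ 'n" assume "R + 1 < norm y"
    moreover have "norm y \<le> norm (y + s *\<^sub>R e) + norm (s *\<^sub>R e)" using norm_triangle_ineq4[of "y + s *\<^sub>R e" "s *\<^sub>R e"] by simp
    ultimately show "g (y + s *\<^sub>R e) = 0" using that ne by (intro v) auto
  qed
  have sh: "(\<integral>y. of_real (g (y + s *\<^sub>R e)) * cis (- (y \<bullet> \<xi>)) \<partial>lborel) = cis (s * \<xi> $ j) * fourier g \<xi>" for s
  proof -
    have "(\<integral>y. of_real (g y) * cis (- ((y - s *\<^sub>R e) \<bullet> \<xi>)) \<partial>lborel)
       = \<bar>1\<bar> ^ DIM(real ^ 'n) *\<^sub>R (\<integral>y. of_real (g (s *\<^sub>R e + 1 *\<^sub>R y)) * cis (- ((s *\<^sub>R e + 1 *\<^sub>R y - s *\<^sub>R e) \<bullet> \<xi>)) \<partial>lborel)"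
    proof (rule lborel_integral_affine)
      have [measurable]: "(\<lambda>y. cis (- ((y - s *\<^sub>R e) \<bullet> \<xi>))) \<in> borel_measurable borel" by (intro borel_measurable_continuous_onI continuous_intros)
      show "(\<lambda>y. complex_of_real (g y) * cis (- ((y - s *\<^sub>R e) \<bullet> \<xi>))) \<in> borel_measurable borel" by measurable
    qed simp
    then have "(\<integral>y. of_real (g (y + s *\<^sub>R e)) * cis (- (y \<bullet> \<xi>)) \<partial>lborel) = (\<integral>y. of_real (g y) * cis (- ((y - s *\<^sub>R e) \<bullet> \<xi>)) \<partial>lborel)"
      by (simp add: add.commute)
    also have "\<dots> = (\<integral>y. cis (s * \<xi> $ j) * (of_real (g y) * cis (- (y \<bullet> \<xi>))) \<partial>lborel)"
    proof (rule Bochner_Integration.integral_cong[OF refl])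
      fix y
      have "cis (- ((y - s *\<^sub>R e) \<bullet> \<xi>)) = cis (s * \<xi> $ j) * cis (- (y \<bullet> \<xi>))"
        unfolding cis_mult by (simp add: inner_diff_left e_def inner_axis')
      then show "complex_of_real (g y) * cis (- ((y - s *\<^sub>R e) \<bullet> \<xi>)) = cis (s * \<xi> $ j) * (complex_of_real (g y) * cis (- (y \<bullet> \<xi>)))"
        by (simp only: mult_ac)
    qed
    also have "\<dots> = cis (s * \<xi> $ j) * fourier g \<xi>" unfolding fourier_def by (rule integral_mult_right_zero)
    finally show ?thesis .
  qed
  have dq: "(\<integral>y. of_real ((g (y + h n *\<^sub>R e) - g y) / h n) * cis (- (y \<bullet> \<xi>)) \<partial>lborel) = ((cis (h n * \<xi> $ j) - 1) / of_real (h n)) * fourier g \<xi>" for n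
  proof -
    have i1: "integrable lborel (\<lambda>y. of_real (g (y + h n *\<^sub>R e)) * cis (0 + y \<bullet> (- \<xi>)))"
      using h[of n] by (intro fourier_cis_integrable shi) auto
    have i2: "integrable lborel (\<lambda>y. of_real (g y) * cis (0 + y \<bullet> (- \<xi>)))" by (intro fourier_cis_integrable gi)
    have "(\<integral>y. of_real ((g (y + h n *\<^sub>R e) - g y) / h n) * cis (- (y \<bullet> \<xi>)) \<partial>lborel)
       = (\<integral>y. (1 / of_real (h n)) * (of_real (g (y + h n *\<^sub>R e)) * cis (0 + y \<bullet> (- \<xi>)) - of_real (g y) * cis (0 + y \<bullet> (- \<xi>))) \<partial>lborel)"
      by (intro Bochner_Integration.integral_cong[OF refl]) (simp add: diff_divide_distrib left_diff_distrib)
    also have "\<dots> = (1 / of_real (h n)) * ((\<integral>y. of_real (g (y + h n *\<^sub>R e)) * cis (0 + y \<bullet> (- \<xi>)) \<partial>lborel) - (\<integral>y. of_real (g y) * cis (0 + y \<bullet> (- \<xi>)) \<partial>lborel))"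
      unfolding integral_mult_right_zero Bochner_Integration.integral_diff[OF i1 i2] ..
    also have "(\<integral>y. of_real (g (y + h n *\<^sub>R e)) * cis (0 + y \<bullet> (- \<xi>)) \<partial>lborel) = cis (h n * \<xi> $ j) * fourier g \<xi>" using sh[of "h n"] by simp
    also have "(\<integral>y. of_real (g y) * cis (0 + y \<bullet> (- \<xi>)) \<partial>lborel) = fourier g \<xi>" by (simp add: fourier_def)
    also have "1 / of_real (h n) * (cis (h n * \<xi> $ j) * fourier g \<xi> - fourier g \<xi>) = ((cis (h n * \<xi> $ j) - 1) / of_real (h n)) * fourier g \<xi>"
      by (simp add: left_diff_distrib diff_divide_distrib)
    finally show ?thesis .
  qed
  have L1: "(\<lambda>n. \<integral>y. of_real ((g (y + h n *\<^sub>R e) - g y) / h n) * cis (- (y \<bullet> \<xi>)) \<partial>lborel) \<longlonglongrightarrow> (\<integral>y. of_real (pderiv_at j g y) * cis (- (y \<bullet> \<xi>)) \<partial>lborel)"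
  proof (rule integral_dominated_convergence[where w="\<lambda>y. indicator (cball 0 (R + 1)) y * M"])
    show "integrable lborel (\<lambda>y. indicator (cball 0 (R + 1)) y * M)"
      by (intro integrable_mult_left integrable_indicator_cball)
    show "AE y in lborel. (\<lambda>n. complex_of_real ((g (y + h n *\<^sub>R e) - g y) / h n) * cis (- (y \<bullet> \<xi>))) \<longlonglongrightarrow> of_real (pderiv_at j g y) * cis (- (y \<bullet> \<xi>))"
    proof (rule AE_I2)
      fix y
      have "((\<lambda>s. (g (y + s *\<^sub>R e) - g y) / s) \<longlongrightarrow> pderiv_at j g y) (at 0)" using ld[of y 0] by (simp add: DERIV_def)
      from filterlim_compose[OF this hf] show "(\<lambda>n. complex_of_real ((g (y + h n *\<^sub>R e) - g y) / h n) * cis (- (y \<bullet> \<xi>))) \<longlonglongrightarrow> of_real (pderiv_at j g y) * cis (- (y \<bullet> \<xi>))"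
        by (intro tendsto_intros)
    qed
    show "AE y in lborel. norm (complex_of_real ((g (y + h n *\<^sub>R e) - g y) / h n) * cis (- (y \<bullet> \<xi>))) \<le> indicator (cball 0 (R + 1)) y * M" for n
    proof (rule AE_I2)
      fix y
      obtain s where s: "0 < s" "s < h n" "g (y + h n *\<^sub>R e) - g (y + 0 *\<^sub>R e) = (h n - 0) * pderiv_at j g (y + s *\<^sub>R e)"
        using MVT2[OF h(1), where f="\<lambda>s. g (y + s *\<^sub>R e)" and f'="\<lambda>s. pderiv_at j g (y + s *\<^sub>R e)"] ld by blast
      have q: "(g (y + h n *\<^sub>R e) - g y) / h n = pderiv_at j g (y + s *\<^sub>R e)" using s(3) h(1)[of n] by simp
      have "pderiv_at j g (y + s *\<^sub>R e) = 0" if "y \<notin> cball 0 (R + 1)"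
      proof (rule vanishing_pderiv[OF v])
        have "norm y \<le> norm (y + s *\<^sub>R e) + norm (s *\<^sub>R e)" using norm_triangle_ineq4[of "y + s *\<^sub>R e" "s *\<^sub>R e"] by simp
        then show "R < norm (y + s *\<^sub>R e)" using that s h(2)[of n] ne by auto
      qed
      then show "norm (complex_of_real ((g (y + h n *\<^sub>R e) - g y) / h n) * cis (- (y \<bullet> \<xi>))) \<le> indicator (cball 0 (R + 1)) y * M"
        unfolding q using b(2)[of "y + s *\<^sub>R e"] by (cases "y \<in> cball 0 (R + 1)") (auto simp: norm_mult)
    qed
  qed measurable
  have "((\<lambda>s. (cis (s * \<xi> $ j) - 1) / of_real s) \<longlongrightarrow> \<i> * of_real (\<xi> $ j)) (at 0)"
  proof (rule LIM_zero_cancel, rule Lim_null_comparison[where g="\<lambda>s. (\<xi> $ j)\<^sup>2 * \<bar>s\<bar>"])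
    show "((\<lambda>s. (\<xi> $ j)\<^sup>2 * \<bar>s\<bar>) \<longlongrightarrow> 0) (at 0)" by (rule tendsto_eq_intros refl | simp)+
    show "\<forall>\<^sub>F s in at 0. norm ((cis (s * \<xi> $ j) - 1) / of_real s - \<i> * of_real (\<xi> $ j)) \<le> (\<xi> $ j)\<^sup>2 * \<bar>s\<bar>"
      unfolding eventually_at_filter
    proof (intro always_eventually allI impI)
      fix s :: real assume s: "s \<noteq> 0"
      have "(cis (s * \<xi> $ j) - 1) / of_real s - \<i> * of_real (\<xi> $ j) = (cis (s * \<xi> $ j) - (1 + \<i> * of_real (s * \<xi> $ j))) / of_real s"
        using s by (simp add: field_simps)
      then have "norm ((cis (s * \<xi> $ j) - 1) / of_real s - \<i> * of_real (\<xi> $ j)) = norm (cis (s * \<xi> $ j) - (1 + \<i> * of_real (s * \<xi> $ j))) / \<bar>s\<bar>"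
        by (simp add: norm_divide)
      also have "\<dots> \<le> (s * \<xi> $ j)\<^sup>2 / \<bar>s\<bar>" by (intro divide_right_mono cis_approx) simp
      also have "\<dots> = (\<xi> $ j)\<^sup>2 * (s\<^sup>2 / \<bar>s\<bar>)" by (simp add: power_mult_distrib)
      also have "s\<^sup>2 / \<bar>s\<bar> = \<bar>s\<bar>" using s by (simp add: power2_eq_square abs_if)
      finally show "norm ((cis (s * \<xi> $ j) - 1) / of_real s - \<i> * of_real (\<xi> $ j)) \<le> (\<xi> $ j)\<^sup>2 * \<bar>s\<bar>" .
    qed
  qed
  from filterlim_compose[OF this hf]
  have L2: "(\<lambda>n. ((cis (h n * \<xi> $ j) - 1) / of_real (h n)) * fourier g \<xi>) \<longlonglongrightarrow> \<i> * of_real (\<xi> $ j) * fourier g \<xi>"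
    by (intro tendsto_intros)
  show ?thesis
    using LIMSEQ_unique[OF L1[unfolded dq] L2] by (simp add: fourier_def)
qed

lemma fourier_bound:
  fixes g :: "'a::euclidean_space \<Rightarrow> real"
  assumes "g \<in> borel_measurable borel" "\<And>y. \<bar>g y\<bar> \<le> M" "\<And>y. R < norm y \<Longrightarrow> g y = 0"
  shows "norm (fourier g \<xi>) \<le> M * measure lborel (cball (0::'a) R)"
proof -
  have M0: "0 \<le> M" using assms(2)[of 0] by linarith
  have gi: "integrable lborel g" by (rule integrable_bounded_support[OF assms])
  have "norm (fourier g \<xi>) \<le> (\<integral>y. norm (of_real (g y) * cis (- (y \<bullet> \<xi>))) \<partial>lborel)"
    unfolding fourier_def by (rule integral_norm_bound)
  also have "\<dots> = (\<integral>y. \<bar>g y\<bar> \<partial>lborel)" by (simp add: norm_mult)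
  also have "\<dots> \<le> (\<integral>y. M * indicator (cball (0::'a) R) y \<partial>lborel)"
  proof (rule integral_mono)
    show "integrable lborel (\<lambda>y. M * indicator (cball (0::'a) R) y)"
      by (intro integrable_mult_right integrable_indicator_cball)
  qed (use gi assms(2,3) M0 in \<open>auto simp: indicator_def not_le\<close>)
  also have "\<dots> = M * measure lborel (cball (0::'a) R)" by simp
  finally show ?thesis .
qed

text \<open>Differentiating up to \<open>m\<close> times in one direction bounds the
  \<open>m\<close>-th power of that coordinate of \<open>\<xi>\<close> times the transform. The
  direction of the largest coordinate, chosen for each \<open>\<xi>\<close>, controls the full norm
  up to the factor \<open>CARD('n)\<close>.\<close>

lemma fourier_decay:
  fixes g :: "real ^ 'n::finite \<Rightarrow> real"
  assumes C: "\<And>m. C_class m g" and b: "\<And>js y. length js \<le> m \<Longrightarrow> \<bar>iter_pderiv js g y\<bar> \<le> M"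
    and v: "\<And>y. R < norm y \<Longrightarrow> g y = 0"
  shows "(1 + norm \<xi>) ^ m * norm (fourier g \<xi>) \<le> 2 ^ m * (1 + real CARD('n) ^ m) * (M * measure lborel (cball (0 :: real ^ 'n) R))"
proof -
  define V where "V = M * measure lborel (cball (0 :: real ^ 'n) R)"
  have it: "iter_pderiv (j # js) g = pderiv_at j (iter_pderiv js g)" for j js by (simp add: iter_pderiv_def)
  have van: "iter_pderiv js g y = 0" if "R < norm y" for js y
    using that by (induction js arbitrary: y) (auto simp: it v iter_pderiv_def[of "[]"] intro: vanishing_pderiv)
  have df: "iter_pderiv js g differentiable (at y)" and ct: "continuous_on UNIV (iter_pderiv js g)" for js y
    using C[of "Suc (length js)"] by (auto simp: C_class_def)
  have ms: "iter_pderiv js g \<in> borel_measurable borel" for js by (rule borel_measurable_continuous_onI[OF ct])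
  have rep: "fourier (iter_pderiv (replicate l j) g) \<xi> = (\<i> * of_real (\<xi> $ j)) ^ l * fourier g \<xi>" if "l \<le> m" for l j
    using that
  proof (induction l)
    case 0
    then show ?case by (simp add: iter_pderiv_def)
  next
    case (Suc l)
    have "fourier (iter_pderiv (replicate (Suc l) j) g) \<xi> = \<i> * of_real (\<xi> $ j) * fourier (iter_pderiv (replicate l j) g) \<xi>"
      unfolding replicate_Suc it
    proof (rule fourier_pderiv[OF df _ _ _ van])
      show "continuous_on UNIV (pderiv_at j (iter_pderiv (replicate l j) g))" using ct[of "j # replicate l j"] by (simp only: it)
      show "\<bar>iter_pderiv (replicate l j) g y\<bar> \<le> M" for y using Suc.prems by (intro b) simp
      show "\<bar>pderiv_at j (iter_pderiv (replicate l j) g) y\<bar> \<le> M" for y using b[of "j # replicate l j" y] Suc.prems by (simp add: it)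
    qed
    then show ?case using Suc by simp
  qed
  have V: "norm (fourier (iter_pderiv (replicate l j) g) \<xi>) \<le> V" if "l \<le> m" for l j
    unfolding V_def by (rule fourier_bound[OF ms b van]) (use that in auto)
  have V0: "norm (fourier g \<xi>) \<le> V" using V[of 0] by (simp add: iter_pderiv_def)
  have Vj: "\<bar>\<xi> $ j\<bar> ^ m * norm (fourier g \<xi>) \<le> V" for j
    using V[of m j] rep[of m j] by (simp add: norm_mult norm_power)
  obtain j where j: "\<And>i. \<bar>\<xi> $ i\<bar> \<le> \<bar>\<xi> $ j\<bar>"
  proof -
    have "finite (range (\<lambda>i. \<bar>\<xi> $ i\<bar>))" "range (\<lambda>i. \<bar>\<xi> $ i\<bar>) \<noteq> {}" by auto
    from Max_in[OF this] obtain j where "Max (range (\<lambda>i. \<bar>\<xi> $ i\<bar>)) = \<bar>\<xi> $ j\<bar>" unfolding image_iff by blast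
    then have "\<bar>\<xi> $ i\<bar> \<le> \<bar>\<xi> $ j\<bar>" for i using Max_ge[of "range (\<lambda>i. \<bar>\<xi> $ i\<bar>)" "\<bar>\<xi> $ i\<bar>"] by auto
    then show ?thesis by (rule that)
  qed
  have "norm \<xi> \<le> (\<Sum>i\<in>UNIV. \<bar>\<xi> $ i\<bar>)" by (rule norm_le_l1_cart)
  also have "\<dots> \<le> real CARD('n) * \<bar>\<xi> $ j\<bar>" using sum_mono[of UNIV "\<lambda>i. \<bar>\<xi> $ i\<bar>" "\<lambda>_. \<bar>\<xi> $ j\<bar>"] j by simp
  finally have nx: "norm \<xi> ^ m \<le> real CARD('n) ^ m * \<bar>\<xi> $ j\<bar> ^ m"
    by (metis norm_ge_zero power_mono power_mult_distrib)
  have "(1 + norm \<xi>) ^ m \<le> (2 * max 1 (norm \<xi>)) ^ m" by (intro power_mono) auto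
  also have "\<dots> \<le> 2 ^ m * (1 + norm \<xi> ^ m)" by (simp add: power_mult_distrib max_def)
  also have "\<dots> \<le> 2 ^ m * (1 + real CARD('n) ^ m * \<bar>\<xi> $ j\<bar> ^ m)" using nx by simp
  finally have "(1 + norm \<xi>) ^ m * norm (fourier g \<xi>) \<le> (2 ^ m * (1 + real CARD('n) ^ m * \<bar>\<xi> $ j\<bar> ^ m)) * norm (fourier g \<xi>)"
    by (rule mult_right_mono) simp
  also have "\<dots> = 2 ^ m * (norm (fourier g \<xi>) + real CARD('n) ^ m * (\<bar>\<xi> $ j\<bar> ^ m * norm (fourier g \<xi>)))"
    by (simp add: algebra_simps)
  also have "\<dots> \<le> 2 ^ m * (V + real CARD('n) ^ m * V)"
    using V0 Vj[of j] by (intro mult_left_mono add_mono) auto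
  finally show ?thesis by (simp add: V_def algebra_simps)
qed

text \<open>Since \<open>1 + (x \<bullet> b)\<^sup>2 \<le> (1 + norm x)\<^sup>2\<close> for every
  basis vector, the function is dominated by a product of integrable functions of one coordinate
  each.\<close>

lemma integrable_inverse_power:
  "integrable lborel (\<lambda>x::'a::euclidean_space. 1 / (1 + norm x) ^ (2 * DIM('a)))"
proof -
  have "integrable lborel (\<lambda>x::real. inverse (1 + x\<^sup>2))"
    using integrable_inverse_1_plus_square by (simp add: set_integrable_def einterval_def)
  then have i: "integrable lborel (\<lambda>x::'a. \<Prod>b\<in>Basis. inverse (1 + (x \<bullet> b)\<^sup>2))"
    by (rule lborel_integral_product(1))
  show ?thesis
  proof (rule Bochner_Integration.integrable_bound[OF i])
    show "(\<lambda>x::'a. 1 / (1 + norm x) ^ (2 * DIM('a))) \<in> borel_measurable lborel" by measurable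
    show "AE x in lborel. norm (1 / (1 + norm x) ^ (2 * DIM('a))) \<le> norm (\<Prod>b\<in>Basis. inverse (1 + ((x::'a) \<bullet> b)\<^sup>2))"
    proof (rule AE_I2)
      fix x :: 'a
      have "(\<Prod>b\<in>(Basis::'a set). inverse ((1 + norm x)\<^sup>2)) \<le> (\<Prod>b\<in>Basis. inverse (1 + (x \<bullet> b)\<^sup>2))"
      proof (rule prod_mono)
        fix b :: 'a assume "b \<in> Basis"
        then have "(x \<bullet> b)\<^sup>2 \<le> (norm x)\<^sup>2" using Basis_le_norm[of b x] by (metis abs_ge_zero power2_abs power_mono)
        then have "1 + (x \<bullet> b)\<^sup>2 \<le> (1 + norm x)\<^sup>2" by (simp add: power2_sum)
          (smt (verit) norm_ge_zero)
        then show "0 \<le> inverse ((1 + norm x)\<^sup>2) \<and> inverse ((1 + norm x)\<^sup>2) \<le> inverse (1 + (x \<bullet> b)\<^sup>2)"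
          by (intro conjI le_imp_inverse_le) (auto intro: add_pos_nonneg)
      qed
      also have "(\<Prod>b\<in>(Basis::'a set). inverse ((1 + norm x)\<^sup>2)) = 1 / (1 + norm x) ^ (2 * DIM('a))"
        by (simp add: power_mult power_inverse[symmetric] inverse_eq_divide power_one_over)
      finally have "1 / (1 + norm x) ^ (2 * DIM('a)) \<le> (\<Prod>b\<in>Basis. inverse (1 + (x \<bullet> b)\<^sup>2))" .
      moreover have "0 \<le> 1 / (1 + norm x) ^ (2 * DIM('a))" by simp
      ultimately show "norm (1 / (1 + norm x) ^ (2 * DIM('a))) \<le> norm (\<Prod>b\<in>Basis. inverse (1 + (x \<bullet> b)\<^sup>2))"
        unfolding real_norm_def by linarith
    qed
  qed
qed

section \<open>The spectrum of an admissible source\<close>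

text \<open>The inversion constant is absorbed here. The indicator cuts off times where the source
  is unspecified, which makes the function measurable on the whole parameter space.\<close>

definition spectrum :: "real \<Rightarrow> (real \<Rightarrow> real ^ 'n::finite \<Rightarrow> real) \<Rightarrow> real \<times> (real ^ 'n) \<Rightarrow> complex" where
  "spectrum T f x = of_real ((1 / (2 * pi)) ^ CARD('n)) *
     (\<integral>y. of_real (indicator {0..T} (fst x) * f (fst x) y) * cis (- (y \<bullet> snd x)) \<partial>lborel)"

lemma spectrum_eq: "s \<in> {0..T} \<Longrightarrow> spectrum T f (s, \<xi>) = of_real ((1 / (2 * pi)) ^ CARD('n)) * fourier (f s) (\<xi> :: real ^ 'n::finite)"
  "s \<notin> {0..T} \<Longrightarrow> spectrum T f (s, \<xi>) = 0"
  by (auto simp: spectrum_def fourier_def)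

lemma Bb_D:
  assumes "f \<in> Bb_space T"
  shows "(\<lambda>x. indicator {0..T} (fst x) * f (fst x) (snd x)) \<in> borel_measurable borel"
    and "\<And>t m. t \<in> {0..T} \<Longrightarrow> C_class m (f t)"
    and "\<exists>M. \<forall>t\<in>{0..T}. \<forall>js. length js \<le> m \<longrightarrow> (\<forall>z. \<bar>iter_pderiv js (f t) z\<bar> \<le> M)"
    and "\<exists>R. \<forall>t\<in>{0..T}. \<forall>y. R < norm y \<longrightarrow> f t y = 0"
    and "\<exists>F. finite F \<and> (\<forall>t\<in>{0..T} - F. continuous (at t within {0..T}) (\<lambda>s. f s z))"
proof -
  have "(\<lambda>(t, z). f t z) \<in> borel_measurable (restrict_space borel ({0..T} \<times> UNIV))" using assms by (simp add: Bb_space_def)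
  then have "(\<lambda>x. indicator ({0..T} \<times> UNIV) x *\<^sub>R (case x of (t, z) \<Rightarrow> f t z)) \<in> borel_measurable borel"
    by (subst (asm) borel_measurable_restrict_space_iff) (auto intro!: borel_closed closed_Times)
  then show "(\<lambda>x. indicator {0..T} (fst x) * f (fst x) (snd x)) \<in> borel_measurable borel"
    by (rule measurable_cong[THEN iffD1, rotated]) (auto simp: indicator_def)
  show "\<And>t m. t \<in> {0..T} \<Longrightarrow> C_class m (f t)" using assms by (simp add: Bb_space_def)
  show "\<exists>M. \<forall>t\<in>{0..T}. \<forall>js. length js \<le> m \<longrightarrow> (\<forall>z. \<bar>iter_pderiv js (f t) z\<bar> \<le> M)" using assms by (simp add: Bb_space_def)
  show "\<exists>F. finite F \<and> (\<forall>t\<in>{0..T} - F. continuous (at t within {0..T}) (\<lambda>s. f s z))" using assms by (simp add: Bb_space_def)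
  have "\<exists>R. \<forall>t\<in>{0..T}. closure {z. f t z \<noteq> 0} \<subseteq> cball 0 R" using assms by (simp add: Bb_space_def)
  then obtain R where R: "\<And>t. t \<in> {0..T} \<Longrightarrow> closure {z. f t z \<noteq> 0} \<subseteq> cball 0 R" by blast
  have "f t y = 0" if "t \<in> {0..T}" "R < norm y" for t y
  proof (rule ccontr)
    assume "f t y \<noteq> 0"
    then have "y \<in> closure {z. f t z \<noteq> 0}" by (auto intro: subsetD[OF closure_subset])
    then show False using R[OF that(1)] that(2) by auto
  qed
  then show "\<exists>R. \<forall>t\<in>{0..T}. \<forall>y. R < norm y \<longrightarrow> f t y = 0" by blast
qed

theorem spectral_spectrum:
  fixes f :: "real \<Rightarrow> real ^ 'n::finite \<Rightarrow> real"
  assumes f: "f \<in> Bb_space T"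
  shows "\<exists>D. spectral T (spectrum T f) D"
proof -
  \<comment> \<open>Twice the dimension gives an integrable tail; the remaining 4 is the weight
    demanded by \<open>spectral\<close>.\<close>
  define m where "m = 2 * CARD('n) + 4"
  obtain M where M: "\<And>t js z. t \<in> {0..T} \<Longrightarrow> length js \<le> m \<Longrightarrow> \<bar>iter_pderiv js (f t) z\<bar> \<le> M" using Bb_D(3)[OF f] by metis
  obtain R where R: "\<And>t y. t \<in> {0..T} \<Longrightarrow> R < norm y \<Longrightarrow> f t y = 0" using Bb_D(4)[OF f] by metis
  define K where "K = (1 / (2 * pi)) ^ CARD('n) * (2 ^ m * (1 + real CARD('n) ^ m) * (\<bar>M\<bar> * measure lborel (cball (0 :: real ^ 'n) R)))"
  have K: "0 \<le> K" by (simp add: K_def)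
  define D where "D \<xi> = K * (1 / (1 + norm \<xi>) ^ m)" for \<xi> :: "real ^ 'n"
  have "norm (spectrum T f x) \<le> D (snd x)" for x
  proof (cases "fst x \<in> {0..T}")
    case True
    have "(1 + norm (snd x)) ^ m * norm (fourier (f (fst x)) (snd x)) \<le> 2 ^ m * (1 + real CARD('n) ^ m) * (\<bar>M\<bar> * measure lborel (cball (0 :: real ^ 'n) R))"
      by (rule fourier_decay) (use Bb_D(2)[OF f True] R[OF True] in \<open>auto intro: order_trans[OF M[OF True] abs_ge_self]\<close>)
    then have "(1 / (2 * pi)) ^ CARD('n) * ((1 + norm (snd x)) ^ m * norm (fourier (f (fst x)) (snd x))) \<le> K"
      unfolding K_def by (intro mult_left_mono) auto
    then have "(1 + norm (snd x)) ^ m * norm (spectrum T f x) \<le> K"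
      using spectrum_eq(1)[OF True, of f "snd x"] by (simp add: norm_mult norm_power norm_divide mult_ac)
    moreover have "0 < (1 + norm (snd x)) ^ m" by (intro zero_less_power add_pos_nonneg) auto
    ultimately show ?thesis by (simp add: D_def pos_le_divide_eq mult.commute)
  next
    case False
    then show ?thesis using spectrum_eq(2)[OF False, of f "snd x"] K by (simp add: D_def)
  qed
  moreover have "spectrum T f \<in> borel_measurable borel"
  proof -
    have 1: "(\<lambda>p :: (real \<times> (real ^ 'n)) \<times> (real ^ 'n). indicator {0..T} (fst (fst p)) * f (fst (fst p)) (snd p)) \<in> borel_measurable borel"
    proof -
      have "(\<lambda>p :: (real \<times> (real ^ 'n)) \<times> (real ^ 'n). (fst (fst p), snd p)) \<in> measurable borel borel"
        by (intro borel_measurable_continuous_onI continuous_intros)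
      from measurable_compose[OF this Bb_D(1)[OF f]] show ?thesis by simp
    qed
    have 2: "(\<lambda>p :: (real \<times> (real ^ 'n)) \<times> (real ^ 'n). cis (- (snd p \<bullet> snd (fst p)))) \<in> borel_measurable borel"
      by (intro borel_measurable_continuous_onI continuous_intros)
    have "(\<lambda>p :: (real \<times> (real ^ 'n)) \<times> (real ^ 'n). complex_of_real (indicator {0..T} (fst (fst p)) * f (fst (fst p)) (snd p)) * cis (- (snd p \<bullet> snd (fst p)))) \<in> borel_measurable (borel \<Otimes>\<^sub>M lborel)"
    proof -
      have eq: "sets ((borel :: (real \<times> (real ^ 'n)) measure) \<Otimes>\<^sub>M (lborel :: (real ^ 'n) measure)) = sets borel"
        by (subst sets_pair_measure_cong[OF refl sets_lborel]) (simp only: borel_prod)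
      show ?thesis unfolding measurable_cong_sets[OF eq refl] using 1 2 by measurable
    qed
    then have "(\<lambda>x. \<integral>y. of_real (indicator {0..T} (fst x) * f (fst x) y) * cis (- (y \<bullet> snd x)) \<partial>lborel) \<in> borel_measurable borel"
      by (intro lborel.borel_measurable_lebesgue_integral) (simp add: split_beta')
    then show ?thesis unfolding spectrum_def[abs_def] by measurable
  qed
  moreover have "integrable lborel (\<lambda>\<xi>. (1 + norm \<xi>) ^ 4 * D \<xi>)"
  proof -
    have "(\<lambda>\<xi> :: real ^ 'n. (1 + norm \<xi>) ^ 4 * D \<xi>) = (\<lambda>\<xi>. K * (1 / (1 + norm \<xi>) ^ (2 * DIM(real ^ 'n))))"
    proof
      fix \<xi> :: "real ^ 'n"
      have "(1 + norm \<xi>) \<noteq> 0" by (smt (verit) norm_ge_zero)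
      then show "(1 + norm \<xi>) ^ 4 * D \<xi> = K * (1 / (1 + norm \<xi>) ^ (2 * DIM(real ^ 'n)))"
        by (simp add: D_def m_def power_add)
    qed
    then show ?thesis by (simp only: integrable_mult_right[OF integrable_inverse_power])
  qed
  ultimately show ?thesis unfolding spectral_def by blast
qed

theorem represents_spectrum:
  fixes f :: "real \<Rightarrow> real ^ 'n::finite \<Rightarrow> real"
  assumes f: "f \<in> Bb_space T"
  shows "represents T (spectrum T f) f"
  unfolding represents_def
proof (intro ballI allI)
  fix s z assume s: "s \<in> {0..T}"
  obtain D where D: "spectral T (spectrum T f) D" using spectral_spectrum[OF f] by blast
  obtain M where M: "\<And>t js z. t \<in> {0..T} \<Longrightarrow> length js \<le> 0 \<Longrightarrow> \<bar>iter_pderiv js (f t) z\<bar> \<le> M" using Bb_D(3)[OF f, of 0] by metis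
  obtain R where R: "\<And>t y. t \<in> {0..T} \<Longrightarrow> R < norm y \<Longrightarrow> f t y = 0" using Bb_D(4)[OF f] by metis
  have c: "continuous_on UNIV (f s)" using Bb_D(2)[OF f s, of 0] by (force simp: C_class_def iter_pderiv_def)
  have b: "\<bar>f s y\<bar> \<le> M" for y using M[OF s, of "[]" y] by (simp add: iter_pderiv_def)
  have gi: "integrable lborel (f s)"
    by (rule integrable_bounded_support[OF borel_measurable_continuous_onI[OF c] b R[OF s]])
  define k where "k = (1 / (2 * pi)) ^ CARD('n)"
  have k: "0 < k" by (simp add: k_def)
  have "integrable lborel (\<lambda>\<xi>. spectrum T f (s, \<xi>))"
  proof (rule Bochner_Integration.integrable_bound)
    show "integrable lborel (\<lambda>\<xi>. (1 + norm \<xi>) ^ 4 * D \<xi>)" using D by (simp add: spectral_def)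
    show "AE \<xi> in lborel. norm (spectrum T f (s, \<xi>)) \<le> norm ((1 + norm \<xi>) ^ 4 * D \<xi>)"
    proof (rule AE_I2)
      fix \<xi> :: "real ^ 'n"
      have d: "norm (spectrum T f (s, \<xi>)) \<le> D \<xi>" using D by (auto simp: spectral_def)
      then have "0 \<le> D \<xi>" by (rule order_trans[OF norm_ge_zero])
      then have "1 * D \<xi> \<le> (1 + norm \<xi>) ^ 4 * D \<xi>" by (intro mult_right_mono one_le_power) auto
      then show "norm (spectrum T f (s, \<xi>)) \<le> norm ((1 + norm \<xi>) ^ 4 * D \<xi>)" using d by simp
    qed
    have "spectrum T f \<in> borel_measurable borel" using D by (simp add: spectral_def)
    from measurable_compose[OF _ this, of "\<lambda>\<xi>. (s, \<xi>)" borel] show "(\<lambda>\<xi>. spectrum T f (s, \<xi>)) \<in> borel_measurable lborel" by simp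
  qed
  then have "integrable lborel (\<lambda>\<xi>. of_real (1 / k) * (of_real k * fourier (f s) \<xi>))"
    unfolding spectrum_eq(1)[OF s] k_def by (rule integrable_mult_right)
  then have ig: "integrable lborel (fourier (f s))" using k by (simp add: mult.assoc[symmetric] flip: of_real_mult)
  have ii: "integrable lborel (\<lambda>\<xi>. of_real k * (fourier (f s) \<xi> * cis (z \<bullet> \<xi>)))"
  proof (rule integrable_mult_right, rule Bochner_Integration.integrable_bound[OF ig])
    have [measurable]: "(\<lambda>\<xi>. cis (z \<bullet> \<xi>)) \<in> borel_measurable borel" by (intro borel_measurable_continuous_onI continuous_intros)
    have [measurable]: "fourier (f s) \<in> borel_measurable borel" using borel_measurable_integrable[OF ig] by simp
    show "(\<lambda>\<xi>. fourier (f s) \<xi> * cis (z \<bullet> \<xi>)) \<in> borel_measurable lborel" by measurable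
  qed (simp add: norm_mult)
  have "complex_of_real (f s z) = of_real k * (\<integral>\<xi>. fourier (f s) \<xi> * cis (z \<bullet> \<xi>) \<partial>lborel)"
    using fourier_inversion[OF c gi b ig, of z] by (simp add: k_def)
  also have "\<dots> = (\<integral>\<xi>. of_real k * (fourier (f s) \<xi> * cis (z \<bullet> \<xi>)) \<partial>lborel)" by (rule integral_mult_right_zero[symmetric])
  finally have "f s z = Re (\<integral>\<xi>. of_real k * (fourier (f s) \<xi> * cis (z \<bullet> \<xi>)) \<partial>lborel)" by (metis Re_complex_of_real)
  also have "\<dots> = (\<integral>\<xi>. Re (of_real k * (fourier (f s) \<xi> * cis (z \<bullet> \<xi>))) \<partial>lborel)" by (rule integral_Re[OF ii, symmetric])
  finally show "f s z = osc_integral lborel (\<lambda>\<xi>. spectrum T f (s, \<xi>)) (\<lambda>\<xi>. \<xi>) z"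
    unfolding osc_integral_def spectrum_eq(1)[OF s] k_def by (simp only: mult.assoc)
qed

section \<open>The fractional Laplacian of a block as a multiplier\<close>

text \<open>\<open>levy_bound e r = min 1 r / r powr e\<close> for \<open>r > 0\<close>; this form shows that it decreases.\<close>

definition levy_bound :: "real \<Rightarrow> real \<Rightarrow> real" where
  "levy_bound e r = min (r powr (- e)) (r powr (1 - e))"

lemma levy_bound_pos: "0 < r \<Longrightarrow> 0 < levy_bound e r" by (simp add: levy_bound_def)

lemma levy_bound_nonneg: "0 \<le> levy_bound e r" by (simp add: levy_bound_def)

lemma levy_bound_antimono: "0 < r \<Longrightarrow> r \<le> s \<Longrightarrow> 1 < e \<Longrightarrow> levy_bound e s \<le> levy_bound e r"
  unfolding levy_bound_def by (intro min.mono powr_mono2') auto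

lemma levy_bound_measurable [measurable]: "levy_bound e \<in> borel_measurable borel"
  unfolding levy_bound_def[abs_def] by measurable

lemma levy_bound_eq: "0 < r \<Longrightarrow> levy_bound e r = min 1 r / r powr e"
  by (auto simp: levy_bound_def min_def powr_minus powr_diff divide_simps)

text \<open>The radial bound in dimension \<open>d\<close> will be dominated by a product of
  \<open>d\<close>-th roots, one per coordinate. The root is integrable near 0 because
  \<open>e < d + 1\<close> and at infinity because \<open>d < e\<close>. The value \<infinity> at 0
  covers vectors with a vanishing coordinate.\<close>

lemma one_dim_finite:
  fixes d :: nat and e :: real
  assumes d: "0 < d" and e: "real d < e" "e < real d + 1"
  shows "(\<integral>\<^sup>+x. (if x = 0 then \<infinity> else ennreal (levy_bound e \<bar>x\<bar> powr (1 / d))) \<partial>lborel) < \<infinity>"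
proof -
  define p where "p = (1 - e) / d"
  define q where "q = - e / d"
  have p: "- 1 < p" using d e by (simp add: p_def field_simps)
  have q: "q < - 1" using d e by (simp add: q_def field_simps)
  define G where "G x = ennreal (indicator {0..1} x * x powr p) + ennreal (indicator {1..} x * x powr q)" for x :: real
  have Gm [measurable]: "G \<in> borel_measurable borel" unfolding G_def by measurable
  have G1: "(\<integral>\<^sup>+x. ennreal (indicator {0..1} x * x powr p) \<partial>lborel) < \<infinity>"
    using nn_integral_has_integral_lebesgue[OF _ has_integral_powr_from_0[OF p, of 1]] by (simp add: mult.commute)
  have G2: "(\<integral>\<^sup>+x. ennreal (indicator {1..} x * x powr q) \<partial>lborel) < \<infinity>"
    using nn_integral_has_integral_lebesgue[OF _ has_integral_powr_to_inf[OF q, of 1]] by (simp add: mult.commute)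
  have GI: "integral\<^sup>N lborel G < \<infinity>"
    unfolding G_def using G1 G2 by (subst nn_integral_add) (auto simp: less_top[symmetric])
  have "(\<integral>\<^sup>+x. G (- x) \<partial>lborel) = integral\<^sup>N lborel G"
    using nn_integral_real_affine[of G "-1" 0] by simp
  then have GI': "(\<integral>\<^sup>+x. G x + G (- x) \<partial>lborel) < \<infinity>"
    using GI by (subst nn_integral_add) (auto simp: less_top[symmetric])
  have "(\<integral>\<^sup>+x. (if x = 0 then \<infinity> else ennreal (levy_bound e \<bar>x\<bar> powr (1 / d))) \<partial>lborel) \<le> (\<integral>\<^sup>+x. G x + G (- x) \<partial>lborel)"
  proof (rule nn_integral_mono_AE)
    show "AE x in lborel. (if x = 0 then \<infinity> else ennreal (levy_bound e \<bar>x\<bar> powr (1 / d))) \<le> G x + G (- x)"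
      using AE_lborel_singleton[of "0::real"]
    proof eventually_elim
      fix x :: real assume x: "x \<noteq> 0"
      define r where "r = \<bar>x\<bar>"
      have r: "0 < r" using x by (simp add: r_def)
      have "ennreal (levy_bound e r powr (1 / d)) \<le> G r"
      proof (cases "r \<le> 1")
        case True
        have "levy_bound e r powr (1 / d) \<le> (r powr (1 - e)) powr (1 / d)"
          using r d by (intro powr_mono2) (auto simp: levy_bound_def)
        also have "\<dots> = r powr p" by (simp add: powr_powr p_def)
        finally have "ennreal (levy_bound e r powr (1 / d)) \<le> ennreal (indicator {0..1} r * r powr p)"
          using True r by (intro ennreal_leI) auto
        then show ?thesis unfolding G_def by (rule order_trans) simp
      next
        case False
        have "levy_bound e r powr (1 / d) \<le> (r powr (- e)) powr (1 / d)"
          using r d by (intro powr_mono2) (auto simp: levy_bound_def)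
        also have "\<dots> = r powr q" by (simp add: powr_powr q_def)
        finally have "ennreal (levy_bound e r powr (1 / d)) \<le> ennreal (indicator {1..} r * r powr q)"
          using False r by (intro ennreal_leI) auto
        then show ?thesis unfolding G_def by (rule order_trans) simp
      qed
      also have "G r \<le> G x + G (- x)" by (cases "0 \<le> x") (auto simp: r_def)
      finally show "(if x = 0 then \<infinity> else ennreal (levy_bound e \<bar>x\<bar> powr (1 / d))) \<le> G x + G (- x)"
        using x by (simp add: r_def)
    qed
  qed
  then show ?thesis using GI' by (rule le_less_trans)
qed

lemma (in pair_sigma_finite) integrable_pair_product:
  fixes f :: "'a \<Rightarrow> real" and g :: "'b \<Rightarrow> real"
  assumes f: "integrable M1 f" and g: "integrable M2 g"
  shows "integrable (M1 \<Otimes>\<^sub>M M2) (\<lambda>x. f (fst x) * g (snd x))"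
proof -
  have [measurable]: "f \<in> borel_measurable M1" "g \<in> borel_measurable M2"
    using f g borel_measurable_integrable by auto
  show ?thesis
  proof (rule Fubini_integrable)
    show "integrable M1 (\<lambda>x. \<integral>y. norm (f (fst (x, y)) * g (snd (x, y))) \<partial>M2)"
      using f by (simp add: abs_mult)
    show "AE x in M1. integrable M2 (\<lambda>y. f (fst (x, y)) * g (snd (x, y)))"
      using g by simp
  qed simp
qed

text \<open>The orders \<open>1 / (1 + 2 * i)\<close> with \<open>i \<ge> 1\<close> are at most 1/3.
  Below 1/2, first differences of a bounded Lipschitz function are absolutely integrable against the
  kernel, so the principal value is an ordinary integral.\<close>

locale fractional_block =
  fixes b :: "'n::finite \<Rightarrow> nat" and i :: nat and \<beta> :: real
  assumes nonempty: "block b i \<noteq> {}" and \<beta>: "0 < \<beta>" "\<beta> < 1 / 2"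
begin

abbreviation P :: "('n \<Rightarrow> real) measure" where "P \<equiv> \<Pi>\<^sub>M j\<in>block b i. lborel"

definition e :: real where "e = real (block_dim b i) + 2 * \<beta>"

lemma dim_pos: "0 < block_dim b i" using nonempty by (simp add: block_dim_def card_gt_0_iff)

lemma e_bounds: "real (block_dim b i) < e" "e < real (block_dim b i) + 1" "1 < e" using \<beta> dim_pos by (auto simp: e_def)

lemma sigma_finite_P: "sigma_finite_measure P"
proof -
  interpret product_sigma_finite "\<lambda>_::'n. lborel :: real measure" by unfold_locales
  show ?thesis by (rule sigma_finite) simp
qed

lemma embed_measurable [measurable]: "block_embed b i \<in> borel_measurable P"
proof -
  have "(\<lambda>w. block_embed b i w $ j) \<in> borel_measurable P" for j
    unfolding block_embed_def by (cases "j \<in> block b i") (auto intro: measurable_component_singleton)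
  then have "(\<lambda>w. block_embed b i w \<bullet> k) \<in> borel_measurable P" if "k \<in> Basis" for k
    using that by (auto simp: Basis_vec_def inner_axis)
  then show ?thesis by (subst borel_measurable_euclidean_space) auto
qed

lemma component_le: "j \<in> block b i \<Longrightarrow> \<bar>w j\<bar> \<le> norm (block_embed b i w)"
  using component_le_norm_cart[of "block_embed b i w" j] by (simp add: block_embed_def)

text \<open>Majorant for first differences: a displacement of length \<open>n\<close> contributes at
  most a multiple of \<open>min 1 n\<close>.\<close>

definition \<kappa> :: "('n \<Rightarrow> real) \<Rightarrow> real" where
  "\<kappa> w = min 1 (norm (block_embed b i w)) / norm (block_embed b i w) powr e"

lemma \<kappa>_nonneg: "0 \<le> \<kappa> w" by (simp add: \<kappa>_def)

lemma \<kappa>_measurable [measurable]: "\<kappa> \<in> borel_measurable P" unfolding \<kappa>_def[abs_def] by measurable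

text \<open>The norm dominates every coordinate and \<open>levy_bound\<close> decreases, so
  \<open>\<kappa>\<close> is at most the product over the block of \<open>d\<close>-th roots taken
  at the coordinates; the product measure then leaves a power of a one-dimensional integral.\<close>

lemma \<kappa>_integrable: "integrable P \<kappa>"
proof -
  interpret product_sigma_finite "\<lambda>_::'n. lborel :: real measure" by unfold_locales
  define d where "d = block_dim b i"
  have d: "0 < d" using dim_pos by (simp add: d_def)
  define k where "k x = (if x = 0 then \<infinity> else ennreal (levy_bound e \<bar>x\<bar> powr (1 / d)))" for x :: real
  have km [measurable]: "k \<in> borel_measurable borel" unfolding k_def[abs_def] by measurable
  have kne: "k x \<noteq> 0" for x using levy_bound_pos[of "\<bar>x\<bar>" e] by (auto simp: k_def)
  have le: "ennreal (\<kappa> w) \<le> (\<Prod>j\<in>block b i. k (w j))" for w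
  proof (cases "norm (block_embed b i w) = 0")
    case True
    then show ?thesis by (simp add: \<kappa>_def)
  next
    case False
    define n where "n = norm (block_embed b i w)"
    have n: "0 < n" using False by (simp add: n_def)
    show ?thesis
    proof (cases "\<exists>j\<in>block b i. w j = 0")
      case True
      then obtain j where j: "j \<in> block b i" "w j = 0" by blast
      \<comment> \<open>A vanishing coordinate makes the product infinite, since no other factor is
        0.\<close>
      have "(\<Prod>j\<in>block b i. k (w j)) = k (w j) * (\<Prod>j\<in>block b i - {j}. k (w j))"
        using j by (simp add: prod.remove)
      also have "\<dots> = \<infinity>" using j kne by (simp add: k_def[of "0::real"] ennreal_top_mult)
      finally show ?thesis by simp
    next
      case False
      have "\<kappa> w = levy_bound e n" using levy_bound_eq[OF n, of e] by (simp add: \<kappa>_def n_def)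
      also have "\<dots> = (\<Prod>j\<in>block b i. levy_bound e n powr (1 / d))"
        using d levy_bound_pos[OF n, of e] by (simp add: d_def block_dim_def powr_realpow[symmetric] powr_powr nonempty)
      also have "ennreal \<dots> \<le> ennreal (\<Prod>j\<in>block b i. levy_bound e \<bar>w j\<bar> powr (1 / d))"
      proof (intro ennreal_leI prod_mono conjI)
        fix j assume j: "j \<in> block b i"
        have "levy_bound e n \<le> levy_bound e \<bar>w j\<bar>"
          using component_le[OF j, of w] j False e_bounds(3) by (intro levy_bound_antimono) (auto simp: n_def)
        then show "levy_bound e n powr (1 / d) \<le> levy_bound e \<bar>w j\<bar> powr (1 / d)"
          using levy_bound_nonneg by (intro powr_mono2) auto
      qed simp
      also have "\<dots> = (\<Prod>j\<in>block b i. ennreal (levy_bound e \<bar>w j\<bar> powr (1 / d)))"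
        by (rule prod_ennreal[symmetric]) simp
      also have "\<dots> = (\<Prod>j\<in>block b i. k (w j))" using False by (intro prod.cong) (auto simp: k_def)
      finally show ?thesis .
    qed
  qed
  have "(\<integral>\<^sup>+w. ennreal (\<kappa> w) \<partial>P) \<le> (\<integral>\<^sup>+w. (\<Prod>j\<in>block b i. k (w j)) \<partial>P)"
    by (intro nn_integral_mono le)
  also have "\<dots> = (\<Prod>j\<in>block b i. integral\<^sup>N lborel k)" by (subst product_nn_integral_prod) auto
  also have "\<dots> < \<infinity>"
  proof -
    have "integral\<^sup>N lborel k < \<infinity>"
      using one_dim_finite[OF d, of e] e_bounds unfolding k_def[abs_def] d_def[symmetric] by simp
    then obtain c where "integral\<^sup>N lborel k = ennreal c" "0 \<le> c"
      by (metis infinity_ennreal_def less_top_ennreal)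
    then show ?thesis by (simp add: ennreal_power)
  qed
  finally show ?thesis by (intro integrableI_bounded) (auto simp: \<kappa>_nonneg)
qed

text \<open>Levy-Khintchine exponent of the block, without a compensating linear term because
  \<open>2 * \<beta> < 1\<close>.\<close>

definition symbol :: "real ^ 'n \<Rightarrow> complex" where
  "symbol \<eta> = (\<integral>w. (cis (block_embed b i w \<bullet> \<eta>) - 1) / of_real (norm (block_embed b i w) powr e) \<partial>P)"

lemma increment_bound:
  "norm ((cis (block_embed b i w \<bullet> \<eta>) - 1) / of_real (norm (block_embed b i w) powr e)) \<le> (2 + norm \<eta>) * \<kappa> w"
proof -
  define n where "n = norm (block_embed b i w)"
  define t where "t = block_embed b i w \<bullet> \<eta>"
  have t: "\<bar>t\<bar> \<le> n * norm \<eta>" unfolding t_def n_def by (rule Cauchy_Schwarz_ineq2)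
  have c: "norm (cis t - 1) \<le> \<bar>t\<bar>" using iexp_approx1[of t 0] by (simp add: cis_conv_exp)
  have c2: "norm (cis t - 1) \<le> 2" using norm_triangle_ineq4[of "cis t" 1] by simp
  have n0: "0 \<le> n" by (simp add: n_def)
  have "norm (cis t - 1) \<le> (2 + norm \<eta>) * min 1 n"
  proof (cases "n \<le> 1")
    case True
    have "norm (cis t - 1) \<le> n * norm \<eta>" using c t by linarith
    also have "\<dots> \<le> (2 + norm \<eta>) * n" using n0 by (simp add: algebra_simps)
    finally show ?thesis using True by simp
  next
    case False
    then have "min 1 n = 1" by simp
    moreover have "norm (cis t - 1) \<le> 2 + norm \<eta>" using c2 norm_ge_zero[of \<eta>] by linarith
    ultimately show ?thesis by simp
  qed
  then have "norm (cis t - 1) / n powr e \<le> (2 + norm \<eta>) * min 1 n / n powr e" by (rule divide_right_mono) simp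
  then show ?thesis by (simp add: norm_divide \<kappa>_def n_def t_def)
qed

lemma increment_measurable [measurable]:
  "(\<lambda>w. (cis (block_embed b i w \<bullet> \<eta>) - 1) / of_real (norm (block_embed b i w) powr e)) \<in> borel_measurable P"
  by measurable

lemma increment_integrable: "integrable P (\<lambda>w. (cis (block_embed b i w \<bullet> \<eta>) - 1) / of_real (norm (block_embed b i w) powr e))"
proof (rule Bochner_Integration.integrable_bound)
  show "integrable P (\<lambda>w. (2 + norm \<eta>) * \<kappa> w)" by (rule integrable_mult_right[OF \<kappa>_integrable])
qed (use increment_bound in \<open>auto intro!: AE_I2 order_trans[OF _ abs_ge_self]\<close>)

lemma symbol_bound: "norm (symbol \<eta>) \<le> (2 * integral\<^sup>L P \<kappa>) * (1 + norm \<eta>)"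
proof -
  have K: "0 \<le> integral\<^sup>L P \<kappa>" by (intro integral_nonneg_AE AE_I2 \<kappa>_nonneg)
  have "norm (symbol \<eta>) \<le> (\<integral>w. norm ((cis (block_embed b i w \<bullet> \<eta>) - 1) / of_real (norm (block_embed b i w) powr e)) \<partial>P)"
    unfolding symbol_def by (rule integral_norm_bound)
  also have "\<dots> \<le> (\<integral>w. (2 + norm \<eta>) * \<kappa> w \<partial>P)"
    by (rule integral_mono[OF integrable_norm[OF increment_integrable] integrable_mult_right[OF \<kappa>_integrable] increment_bound])
  also have "\<dots> = (2 + norm \<eta>) * integral\<^sup>L P \<kappa>" by simp
  also have "\<dots> \<le> (2 * integral\<^sup>L P \<kappa>) * (1 + norm \<eta>)" using K by (simp add: algebra_simps)
  finally show ?thesis .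
qed

lemma symbol_measurable [measurable]: "symbol \<in> borel_measurable borel"
proof -
  interpret P: sigma_finite_measure P by (rule sigma_finite_P)
  have "(\<lambda>(\<eta>, w). (cis (block_embed b i w \<bullet> \<eta>) - 1) / of_real (norm (block_embed b i w) powr e)) \<in> borel_measurable (borel \<Otimes>\<^sub>M P)"
    by measurable
  then show ?thesis unfolding symbol_def[abs_def] by (rule P.borel_measurable_lebesgue_integral)
qed

text \<open>The truncated integrals converge to the full one by dominated convergence, and Fubini's
  theorem moves the integral over displacements onto each plane wave, where it becomes the symbol.
  Weight 1 suffices because the difference quotient is bounded by \<open>\<kappa>\<close> times a
  linear function of the frequency.\<close>

theorem frac_laplacian_osc_integral:
  assumes M: "sigma_finite_measure M" and a: "amplitude M 1 a \<theta>"
  shows "frac_laplacian b i \<beta> (osc_integral M a \<theta>) z = osc_integral M (\<lambda>x. symbol (\<theta> x) * a x) \<theta> z"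
proof -
  interpret P: sigma_finite_measure P by (rule sigma_finite_P)
  interpret M: sigma_finite_measure M by (rule M)
  interpret PM: pair_sigma_finite P M ..
  note [measurable] = amplitude_D(1,2)[OF a]
  define g where "g = osc_integral M a \<theta>"
  define n where "n w = norm (block_embed b i w)" for w
  define J where "J w = (g (z + block_embed b i w) - g z) / n w powr e" for w
  define I where "I w x = Re (a x * cis (z \<bullet> \<theta> x) * ((cis (block_embed b i w \<bullet> \<theta> x) - 1) / of_real (n w powr e)))" for w x
  have Im: "(\<lambda>(w, x). I w x) \<in> borel_measurable (P \<Otimes>\<^sub>M M)" unfolding I_def n_def by measurable
  have ai: "integrable M (\<lambda>x. 2 * ((1 + norm (\<theta> x)) ^ 1 * norm (a x)))"
    using amplitude_D(3)[OF a] by (rule integrable_mult_right)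
  have Ib: "\<bar>I w x\<bar> \<le> \<kappa> w * (2 * ((1 + norm (\<theta> x)) ^ 1 * norm (a x)))" for w x
  proof -
    have "\<bar>I w x\<bar> \<le> norm (a x * cis (z \<bullet> \<theta> x) * ((cis (block_embed b i w \<bullet> \<theta> x) - 1) / of_real (n w powr e)))"
      unfolding I_def by (rule abs_Re_le_cmod)
    also have "\<dots> = norm (a x) * norm ((cis (block_embed b i w \<bullet> \<theta> x) - 1) / of_real (n w powr e))"
      by (simp only: norm_mult norm_cis mult_1_right)
    also have "\<dots> \<le> norm (a x) * ((2 + norm (\<theta> x)) * \<kappa> w)"
      unfolding n_def by (intro mult_left_mono increment_bound) simp
    also have "\<dots> \<le> norm (a x) * ((2 * (1 + norm (\<theta> x))) * \<kappa> w)"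
      by (intro mult_left_mono mult_right_mono \<kappa>_nonneg) auto
    finally show ?thesis by (simp add: algebra_simps)
  qed
  have Ii: "integrable (P \<Otimes>\<^sub>M M) (\<lambda>(w, x). I w x)"
  proof (rule Bochner_Integration.integrable_bound[OF PM.integrable_pair_product[OF \<kappa>_integrable ai] Im])
    show "AE y in P \<Otimes>\<^sub>M M. norm (case y of (w, x) \<Rightarrow> I w x) \<le> norm (\<kappa> (fst y) * (2 * ((1 + norm (\<theta> (snd y))) ^ 1 * norm (a (snd y)))))"
    proof (rule AE_I2)
      fix y show "norm (case y of (w, x) \<Rightarrow> I w x) \<le> norm (\<kappa> (fst y) * (2 * ((1 + norm (\<theta> (snd y))) ^ 1 * norm (a (snd y)))))"
        unfolding split_beta real_norm_def by (rule order_trans[OF Ib abs_ge_self])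
    qed
  qed
  have JI: "J w = (\<integral>x. I w x \<partial>M)" for w
  proof -
    have "J w = (1 / n w powr e) * ((\<integral>x. Re (a x * cis ((z + block_embed b i w) \<bullet> \<theta> x)) \<partial>M) - (\<integral>x. Re (a x * cis (z \<bullet> \<theta> x)) \<partial>M))"
      by (simp add: J_def g_def osc_integral_def)
    also have "\<dots> = (\<integral>x. (1 / n w powr e) * (Re (a x * cis ((z + block_embed b i w) \<bullet> \<theta> x)) - Re (a x * cis (z \<bullet> \<theta> x))) \<partial>M)"
      by (simp only: Bochner_Integration.integral_diff[OF osc_integrand_integrable[OF a] osc_integrand_integrable[OF a]] integral_mult_right_zero)
    also have "\<dots> = (\<integral>x. I w x \<partial>M)"
    proof (rule Bochner_Integration.integral_cong[OF refl])
      fix x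
      have 1: "a x * cis (z \<bullet> \<theta> x) * ((cis (block_embed b i w \<bullet> \<theta> x) - 1) / of_real (n w powr e))
        = of_real (1 / n w powr e) * (a x * cis ((z + block_embed b i w) \<bullet> \<theta> x) - a x * cis (z \<bullet> \<theta> x))"
        by (simp add: inner_add_left cis_mult[symmetric] right_diff_distrib diff_divide_distrib)
      show "(1 / n w powr e) * (Re (a x * cis ((z + block_embed b i w) \<bullet> \<theta> x)) - Re (a x * cis (z \<bullet> \<theta> x))) = I w x"
        unfolding I_def 1 by (simp only: Re_complex_of_real times_complex.sel minus_complex.sel Im_complex_of_real mult_zero_left diff_zero)
    qed
    finally show ?thesis .
  qed
  have Ji: "integrable P J"
    using PM.integrable_fst'[OF Ii] by (simp add: JI[abs_def])
  have lim: "((\<lambda>\<epsilon>. LINT w:{w. \<epsilon> < n w}|P. J w) \<longlongrightarrow> integral\<^sup>L P J) (at_right 0)"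
    unfolding tendsto_at_iff_sequentially
  proof (intro allI impI)
    fix X :: "nat \<Rightarrow> real" assume X: "\<forall>k. X k \<in> {0<..} - {0}" "X \<longlonglongrightarrow> 0"
    have "(\<lambda>k. \<integral>w. indicator {w. X k < n w} w *\<^sub>R J w \<partial>P) \<longlonglongrightarrow> integral\<^sup>L P J"
    proof (rule integral_dominated_convergence[where w="\<lambda>w. \<bar>J w\<bar>"])
      show "J \<in> borel_measurable P" using Ji by simp
      then show "(\<lambda>w. indicator {w. X k < n w} w *\<^sub>R J w) \<in> borel_measurable P" for k
        unfolding n_def by measurable
      show "integrable P (\<lambda>w. \<bar>J w\<bar>)" using Ji by simp
      show "AE w in P. (\<lambda>k. indicator {w. X k < n w} w *\<^sub>R J w) \<longlonglongrightarrow> J w"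
      proof (rule AE_I2)
        fix w
        show "(\<lambda>k. indicator {w. X k < n w} w *\<^sub>R J w) \<longlonglongrightarrow> J w"
        proof (cases "n w = 0")
          case True
          then show ?thesis by (simp add: J_def)
        next
          case False
          then have "0 < n w" by (simp add: n_def)
          from order_tendstoD(2)[OF X(2) this] show ?thesis
            by (intro tendsto_eventually) (auto elim!: eventually_mono simp: indicator_def)
        qed
      qed
    qed (auto simp: indicator_def)
    then show "((\<lambda>\<epsilon>. LINT w:{w. \<epsilon> < n w}|P. J w) \<circ> X) \<longlonglongrightarrow> integral\<^sup>L P J"
      by (simp add: o_def set_lebesgue_integral_def)
  qed
  have "frac_laplacian b i \<beta> g z = integral\<^sup>L P J"
    unfolding frac_laplacian_def
    using tendsto_Lim[OF _ lim] by (simp add: J_def n_def e_def)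
  also have "\<dots> = (\<integral>x. (\<integral>w. I w x \<partial>P) \<partial>M)" unfolding JI using PM.Fubini_integral[OF Ii] by simp
  also have "\<dots> = osc_integral M (\<lambda>x. symbol (\<theta> x) * a x) \<theta> z"
    unfolding osc_integral_def
  proof (rule Bochner_Integration.integral_cong[OF refl])
    fix x
    have "(\<integral>w. I w x \<partial>P) = Re (\<integral>w. a x * cis (z \<bullet> \<theta> x) * ((cis (block_embed b i w \<bullet> \<theta> x) - 1) / of_real (n w powr e)) \<partial>P)"
      unfolding I_def n_def by (rule integral_Re[OF integrable_mult_right[OF increment_integrable]])
    also have "\<dots> = Re (a x * cis (z \<bullet> \<theta> x) * symbol (\<theta> x))"
      unfolding symbol_def n_def by (subst integral_mult_right_zero) (rule refl)
    finally show "(\<integral>w. I w x \<partial>P) = Re (symbol (\<theta> x) * a x * cis (z \<bullet> \<theta> x))" by (simp only: mult_ac)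
  qed
  finally show ?thesis by (simp only: g_def)
qed

end

section \<open>Freezing the time variable\<close>

lemma has_derivative_shift:
  fixes g :: "'a::real_normed_vector \<Rightarrow> 'b::real_normed_vector"
  shows "((\<lambda>z. g (z - c)) has_derivative D) (at z) \<longleftrightarrow> (g has_derivative D) (at (z - c))"
proof
  assume *: "((\<lambda>z. g (z - c)) has_derivative D) (at z)"
  have s: "((\<lambda>y. y + c) has_derivative (\<lambda>h. h)) (at (z - c))" by (auto intro!: derivative_eq_intros)
  have "((\<lambda>y. g ((y + c) - c)) has_derivative (\<lambda>h. D h)) (at (z - c))"
    by (rule has_derivative_compose[OF s, where g="\<lambda>z. g (z - c)"]) (use * in simp)
  then show "(g has_derivative D) (at (z - c))" by simp
next
  assume *: "(g has_derivative D) (at (z - c))"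
  have s: "((\<lambda>y. y - c) has_derivative (\<lambda>h. h)) (at z)" by (auto intro!: derivative_eq_intros)
  show "((\<lambda>z. g (z - c)) has_derivative D) (at z)" using has_derivative_compose[OF s *] by simp
qed

lemma pderiv_shift: "pderiv_at j (\<lambda>z. g (z - c)) = (\<lambda>z. pderiv_at j g (z - c))"
  by (simp add: fun_eq_iff pderiv_at_def frechet_derivative_def has_derivative_shift)

lemma iter_pderiv_shift: "iter_pderiv js (\<lambda>z. g (z - c)) = (\<lambda>z. iter_pderiv js g (z - c))"
proof (induction js)
  case Nil
  then show ?case by (simp add: iter_pderiv_def)
next
  case (Cons j js)
  have "iter_pderiv (j # js) (\<lambda>z. g (z - c)) = pderiv_at j (iter_pderiv js (\<lambda>z. g (z - c)))" by (simp add: iter_pderiv_def)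
  also have "\<dots> = (\<lambda>z. pderiv_at j (iter_pderiv js g) (z - c))" unfolding Cons by (rule pderiv_shift)
  finally show ?case by (simp add: iter_pderiv_def)
qed

lemma C_class_shift: assumes "C_class m g" shows "C_class m (\<lambda>z. g (z - c))"
proof -
  have "(\<lambda>z. iter_pderiv js g (z - c)) differentiable (at z)" if "length js < m" for js z
  proof -
    have "iter_pderiv js g differentiable (at (z - c))" using assms that by (auto simp: C_class_def)
    then show ?thesis unfolding differentiable_def has_derivative_shift .
  qed
  moreover have "continuous_on UNIV (\<lambda>z. iter_pderiv js g (z - c))" if "length js \<le> m" for js
    by (rule continuous_on_compose2[of UNIV "iter_pderiv js g"]) (use assms that in \<open>auto simp: C_class_def intro!: continuous_intros\<close>)
  ultimately show ?thesis by (auto simp: C_class_def iter_pderiv_shift)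
qed

text \<open>Serves freezing alone (\<open>c = 0\<close>) and freezing followed by translation. Where
  \<open>\<rho>\<close> is locally constant, the source is a single smooth slice moved along a
  continuous curve, so the exceptional times \<open>G\<close> do not depend on the point.\<close>

lemma Bb_compose:
  fixes f :: "real \<Rightarrow> real ^ 'n::finite \<Rightarrow> real"
  assumes f: "f \<in> Bb_space T" and \<rho>: "\<And>t. t \<in> {0..T} \<Longrightarrow> \<rho> t \<in> {0..T}" and \<rho>m: "\<rho> \<in> borel_measurable borel"
    and cm: "c \<in> borel_measurable borel" and ck: "\<And>t. t \<in> {0..T} \<Longrightarrow> norm (c t) \<le> K"
    and G: "finite G" "\<And>t. t \<in> {0..T} - G \<Longrightarrow> \<forall>\<^sub>F s in at t within {0..T}. \<rho> s = \<rho> t"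
       "\<And>t. t \<in> {0..T} - G \<Longrightarrow> continuous (at t within {0..T}) c"
  shows "(\<lambda>t z. f (\<rho> t) (z - c t)) \<in> Bb_space T"
proof -
  obtain R where R: "\<And>t y. t \<in> {0..T} \<Longrightarrow> R < norm y \<Longrightarrow> f t y = 0" using Bb_D(4)[OF f] by metis
  obtain M where M: "\<And>t js z. t \<in> {0..T} \<Longrightarrow> length js \<le> 0 \<Longrightarrow> \<bar>iter_pderiv js (f t) z\<bar> \<le> M" using Bb_D(3)[OF f, of 0] by metis
  have fb: "\<bar>f t z\<bar> \<le> M" if "t \<in> {0..T}" for t z using M[OF that, of "[]" z] by (simp add: iter_pderiv_def)
  have supp: "{z. f (\<rho> t) (z - c t) \<noteq> 0} \<subseteq> cball 0 (R + K)" if t: "t \<in> {0..T}" for t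
  proof
    fix z assume "z \<in> {z. f (\<rho> t) (z - c t) \<noteq> 0}"
    then have "norm (z - c t) \<le> R" using R[OF \<rho>[OF t], of "z - c t"] by force
    then show "z \<in> cball 0 (R + K)" using ck[OF t] norm_triangle_ineq[of "z - c t" "c t"] by simp
  qed
  have supp': "closure {z. f (\<rho> t) (z - c t) \<noteq> 0} \<subseteq> cball 0 (R + K)" if t: "t \<in> {0..T}" for t
    using supp[OF t] by (intro closure_minimal) auto
  have meas: "(\<lambda>(t, z). f (\<rho> t) (z - c t)) \<in> borel_measurable (restrict_space borel ({0..T} \<times> UNIV))"
  proof (subst borel_measurable_restrict_space_iff)
    have fs: "(fst :: real \<times> (real ^ 'n) \<Rightarrow> real) \<in> borel_measurable borel" "(snd :: real \<times> (real ^ 'n) \<Rightarrow> (real ^ 'n)) \<in> borel_measurable borel"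
      by (intro borel_measurable_continuous_onI continuous_intros)+
    have m1: "(\<lambda>x :: real \<times> (real ^ 'n). (\<rho> (fst x), snd x - c (fst x))) \<in> measurable borel (borel \<Otimes>\<^sub>M borel)"
      by (intro measurable_Pair measurable_compose[OF fs(1) \<rho>m] borel_measurable_diff fs measurable_compose[OF fs(1) cm])
    have m2: "(\<lambda>x :: real \<times> (real ^ 'n). indicator {0..T} (fst x) :: real) \<in> borel_measurable borel"
      using measurable_compose[OF fs(1), of "indicator {0..T} :: real \<Rightarrow> real" borel] by simp
    have "(\<lambda>x. indicator {0..T} (fst x) * (indicator {0..T} (\<rho> (fst x)) * f (\<rho> (fst x)) (snd x - c (fst x)))) \<in> borel_measurable borel"
      using borel_measurable_times[OF m2 measurable_compose[OF m1, unfolded borel_prod, OF Bb_D(1)[OF f]]] by simp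
    moreover have "indicator {0..T} (fst x) * (indicator {0..T} (\<rho> (fst x)) * f (\<rho> (fst x)) (snd x - c (fst x)))
        = indicator ({0..T} \<times> UNIV) x *\<^sub>R (case x of (t, z) \<Rightarrow> f (\<rho> t) (z - c t))" for x
      using \<rho>[of "fst x"] by (cases x, cases "fst x \<in> {0..T}") (simp_all add: indicator_def)
    ultimately show "(\<lambda>x. indicator ({0..T} \<times> UNIV) x *\<^sub>R (case x of (t, z) \<Rightarrow> f (\<rho> t) (z - c t))) \<in> borel_measurable borel"
      by simp
  qed (auto intro!: borel_closed closed_Times)
  show ?thesis
    unfolding Bb_space_def
  proof (intro CollectI conjI)
    show "bounded ((\<lambda>(t, z). f (\<rho> t) (z - c t)) ` ({0..T} \<times> UNIV))"
      unfolding bounded_iff by (intro exI[of _ M]) (use fb \<rho> in auto)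
    show "\<forall>t\<in>{0..T}. (\<forall>m. C_class m (\<lambda>z. f (\<rho> t) (z - c t))) \<and> compact (closure {z. f (\<rho> t) (z - c t) \<noteq> 0})"
    proof (intro ballI conjI allI)
      fix t m assume t: "t \<in> {0..T}"
      show "C_class m (\<lambda>z. f (\<rho> t) (z - c t))" by (rule C_class_shift[OF Bb_D(2)[OF f \<rho>[OF t]]])
      show "compact (closure {z. f (\<rho> t) (z - c t) \<noteq> 0})"
        unfolding compact_closure by (rule bounded_subset[OF bounded_cball supp[OF t]])
    qed
    show "\<forall>m. \<exists>M. \<forall>t\<in>{0..T}. \<forall>js. length js \<le> m \<longrightarrow> (\<forall>z. \<bar>iter_pderiv js (\<lambda>z. f (\<rho> t) (z - c t)) z\<bar> \<le> M)"
    proof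
      fix m
      obtain M where "\<forall>t\<in>{0..T}. \<forall>js. length js \<le> m \<longrightarrow> (\<forall>z. \<bar>iter_pderiv js (f t) z\<bar> \<le> M)" using Bb_D(3)[OF f] by blast
      then show "\<exists>M. \<forall>t\<in>{0..T}. \<forall>js. length js \<le> m \<longrightarrow> (\<forall>z. \<bar>iter_pderiv js (\<lambda>z. f (\<rho> t) (z - c t)) z\<bar> \<le> M)"
        unfolding iter_pderiv_shift using \<rho> by blast
    qed
    show "\<exists>R. \<forall>t\<in>{0..T}. closure {z. f (\<rho> t) (z - c t) \<noteq> 0} \<subseteq> cball 0 R" using supp' by blast
    show "\<forall>z. \<exists>F. finite F \<and> (\<forall>t\<in>{0..T} - F. continuous (at t within {0..T}) (\<lambda>s. f (\<rho> s) (z - c s)))"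
    proof (intro allI exI[of _ G] conjI ballI G(1))
      fix z t assume t: "t \<in> {0..T} - G"
      have "continuous_on UNIV (f (\<rho> t))" using Bb_D(2)[OF f \<rho>, of t 0] t by (force simp: C_class_def iter_pderiv_def)
      then have "isCont (f (\<rho> t)) (z - c t)" by (simp add: continuous_on_eq_continuous_at)
      moreover have "((\<lambda>s. z - c s) \<longlongrightarrow> z - c t) (at t within {0..T})"
        using G(3)[OF t] by (intro tendsto_intros) (simp add: continuous_within)
      ultimately have "((\<lambda>s. f (\<rho> t) (z - c s)) \<longlongrightarrow> f (\<rho> t) (z - c t)) (at t within {0..T})"
        by (rule isCont_tendsto_compose)
      moreover have "\<forall>\<^sub>F s in at t within {0..T}. f (\<rho> t) (z - c s) = f (\<rho> s) (z - c s)"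
        using G(2)[OF t] by eventually_elim simp
      ultimately show "continuous (at t within {0..T}) (\<lambda>s. f (\<rho> s) (z - c s))"
        unfolding continuous_within by (rule Lim_transform_eventually)
    qed
  qed (rule meas)
qed

section \<open>Rounding times down to a grid\<close>

definition mesh :: "real \<Rightarrow> nat \<Rightarrow> real" where "mesh T n = T / real (Suc n)"

definition snap :: "real \<Rightarrow> nat \<Rightarrow> real \<Rightarrow> real" where "snap T n t = mesh T n * of_int \<lfloor>t / mesh T n\<rfloor>"

context fixes T :: real assumes T: "0 < T" begin

lemma mesh_pos: "0 < mesh T n" using T by (simp add: mesh_def)

lemma mesh_lim: "mesh T \<longlonglongrightarrow> 0" unfolding mesh_def[abs_def] by (rule LIMSEQ_Suc) (rule lim_const_over_n)

lemma snap_le: "snap T n t \<le> t" "t - mesh T n \<le> snap T n t"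
proof -
  have f: "of_int \<lfloor>t / mesh T n\<rfloor> \<le> t / mesh T n" "t / mesh T n - 1 \<le> of_int \<lfloor>t / mesh T n\<rfloor>"
    using floor_correct[of "t / mesh T n"] by auto
  have "mesh T n * of_int \<lfloor>t / mesh T n\<rfloor> \<le> mesh T n * (t / mesh T n)" using f(1) mesh_pos[of n] by (intro mult_left_mono) auto
  then show "snap T n t \<le> t" using mesh_pos[of n] by (simp add: snap_def)
  have "mesh T n * (t / mesh T n - 1) \<le> mesh T n * of_int \<lfloor>t / mesh T n\<rfloor>" using f(2) mesh_pos[of n] by (intro mult_left_mono) auto
  then show "t - mesh T n \<le> snap T n t" using mesh_pos[of n] by (simp add: snap_def right_diff_distrib)
qed

lemma snap_range: "t \<in> {0..T} \<Longrightarrow> snap T n t \<in> {0..T}"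
  using snap_le(1)[of n t] mesh_pos[of n] by (auto simp: snap_def intro!: mult_nonneg_nonneg)

lemma snap_lim: "(\<lambda>n. snap T n t) \<longlonglongrightarrow> t"
proof (rule tendsto_sandwich[where f="\<lambda>n. t - mesh T n" and h="\<lambda>n. t"])
  show "(\<lambda>n. t - mesh T n) \<longlonglongrightarrow> t" using tendsto_diff[OF tendsto_const mesh_lim, of t] by simp
qed (use snap_le in auto)

lemma snap_measurable [measurable]: "snap T n \<in> borel_measurable borel"
  unfolding snap_def[abs_def] by measurable

definition nodes :: "nat \<Rightarrow> real set" where "nodes n = (\<lambda>j. mesh T n * real j) ` {0..Suc n}"

lemma snap_locally_constant:
  assumes "t \<in> {0..T} - nodes n" shows "\<forall>\<^sub>F s in at t within {0..T}. snap T n s = snap T n t"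
proof -
  have "t / mesh T n \<notin> \<int>"
  proof
    assume "t / mesh T n \<in> \<int>"
    then obtain m :: int where m: "t / mesh T n = of_int m" by (auto elim: Ints_cases)
    then have tm: "t = mesh T n * of_int m" using mesh_pos[of n] by (simp add: field_simps)
    have "0 \<le> m" using assms m mesh_pos[of n] by (metis DiffD1 atLeastAtMost_iff divide_nonneg_pos of_int_0_le_iff)
    moreover have "m \<le> int (Suc n)"
    proof -
      have "mesh T n * of_int m \<le> mesh T n * real (Suc n)" using assms tm T by (simp add: mesh_def)
      then have "real_of_int m \<le> real (Suc n)" using mult_le_cancel_left_pos[OF mesh_pos] by blast
      then show ?thesis by linarith
    qed
    ultimately have "t = mesh T n * real (nat m)" "nat m \<in> {0..Suc n}" using tm by auto
    then show False using assms by (auto simp: nodes_def)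
  qed
  moreover have "((\<lambda>s. s / mesh T n) \<longlongrightarrow> t / mesh T n) (at t within {0..T})"
    using mesh_pos[of n] by (intro tendsto_intros) auto
  ultimately have "\<forall>\<^sub>F s in at t within {0..T}. \<lfloor>s / mesh T n\<rfloor> = \<lfloor>t / mesh T n\<rfloor>" by (rule eventually_floor_eq[rotated])
  then show ?thesis by eventually_elim (simp add: snap_def)
qed

context
  fixes f :: "real \<Rightarrow> real ^ 'n::finite \<Rightarrow> real"
  assumes f: "f \<in> Bb_space T"
begin

lemma snap_pointwise:
  "\<exists>F. finite F \<and> (\<forall>t\<in>{0..T} - F. (\<lambda>n. f (snap T n t) y) \<longlonglongrightarrow> f t y)"
proof -
  obtain F where F: "finite F" "\<forall>t\<in>{0..T} - F. continuous (at t within {0..T}) (\<lambda>s. f s y)" using Bb_D(5)[OF f, of y] by blast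
  have "(\<lambda>n. f (snap T n t) y) \<longlonglongrightarrow> f t y" if t: "t \<in> {0..T} - F" for t
    by (rule continuous_within_tendsto_compose[OF bspec[OF F(2) t] _ snap_lim]) (use t snap_range in auto)
  then show ?thesis using F(1) by blast
qed

text \<open>At a fixed point convergence holds at all but finitely many times, but these times
  depend on the point. The set of convergence is measurable in both variables, so Tonelli's theorem
  gives convergence for almost every time and almost every point.\<close>

lemma
  shows AE_snap_pair: "AE x in lborel. fst x \<in> {0..T} \<longrightarrow> (\<lambda>n. f (snap T n (fst x)) (snd x)) \<longlonglongrightarrow> f (fst x) (snd x)"
    and AE_snap_iterated: "AE t in lborel. AE y in lborel. t \<in> {0..T} \<longrightarrow> (\<lambda>n. f (snap T n t) y) \<longlonglongrightarrow> f t y"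
proof -
  define g where "g x = indicator {0..T} (fst x) * f (fst x) (snd x)" for x
  define gn where "gn n x = indicator {0..T} (fst x) * g (snap T n (fst x), snd x)" for n x
  have gm: "g \<in> borel_measurable borel" unfolding g_def[abs_def] by (rule Bb_D(1)[OF f])
  have fs: "(fst :: real \<times> (real ^ 'n) \<Rightarrow> real) \<in> borel_measurable borel" "(snd :: real \<times> (real ^ 'n) \<Rightarrow> (real ^ 'n)) \<in> borel_measurable borel"
    by (intro borel_measurable_continuous_onI continuous_intros)+
  have gnm: "gn n \<in> borel_measurable borel" for n
  proof -
    have m1: "(\<lambda>x :: real \<times> (real ^ 'n). (snap T n (fst x), snd x)) \<in> measurable borel (borel \<Otimes>\<^sub>M borel)"
      by (intro measurable_Pair measurable_compose[OF fs(1) snap_measurable] fs)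
    have m2: "(\<lambda>x :: real \<times> (real ^ 'n). indicator {0..T} (fst x) :: real) \<in> borel_measurable borel"
      using measurable_compose[OF fs(1), of "indicator {0..T} :: real \<Rightarrow> real" borel] by simp
    show ?thesis unfolding gn_def[abs_def]
      by (rule borel_measurable_times[OF m2 measurable_compose[OF m1, unfolded borel_prod, OF gm]])
  qed
  define P where "P x \<longleftrightarrow> (\<lambda>n. gn n x) \<longlonglongrightarrow> g x" for x
  \<comment> \<open>Expressing convergence by a limsup of nonnegative measurable functions makes the
    set of convergence measurable.\<close>
  have Pe: "P x \<longleftrightarrow> limsup (\<lambda>n. ennreal \<bar>gn n x - g x\<bar>) = 0" for x
  proof
    assume "P x"
    then have "(\<lambda>n. \<bar>gn n x - g x\<bar>) \<longlonglongrightarrow> 0" unfolding P_def by (simp add: LIM_zero tendsto_rabs_zero)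
    then have "(\<lambda>n. ennreal \<bar>gn n x - g x\<bar>) \<longlonglongrightarrow> ennreal 0" by (rule tendsto_ennrealI)
    then show "limsup (\<lambda>n. ennreal \<bar>gn n x - g x\<bar>) = 0" by (simp add: lim_imp_Limsup)
  next
    assume "limsup (\<lambda>n. ennreal \<bar>gn n x - g x\<bar>) = 0"
    then have "(\<lambda>n. ennreal \<bar>gn n x - g x\<bar>) \<longlonglongrightarrow> 0" by (rule tendsto_0_if_Limsup_eq_0_ennreal)
    then have "(\<lambda>n. \<bar>gn n x - g x\<bar>) \<longlonglongrightarrow> 0" by (subst (asm) ennreal_tendsto_0_iff) auto
    then show "P x" unfolding P_def by (simp add: LIM_zero_iff tendsto_rabs_zero_iff)
  qed
  have Pm: "{x. P x} \<in> sets borel"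
  proof -
    have "(\<lambda>x. limsup (\<lambda>n. ennreal \<bar>gn n x - g x\<bar>)) \<in> borel_measurable borel" using gm gnm by measurable
    then have "{x \<in> space borel. limsup (\<lambda>n. ennreal \<bar>gn n x - g x\<bar>) = 0} \<in> sets borel" by measurable
    then show ?thesis by (simp add: Pe)
  qed
  have Peq: "P (t, y) \<longleftrightarrow> (t \<in> {0..T} \<longrightarrow> (\<lambda>n. f (snap T n t) y) \<longlonglongrightarrow> f t y)" for t y
    using snap_range[of t] by (cases "t \<in> {0..T}") (auto simp: P_def gn_def g_def)
  have y: "AE t in lborel. P (t, y)" for y
  proof -
    obtain F where F: "finite F" "\<forall>t\<in>{0..T} - F. (\<lambda>n. f (snap T n t) y) \<longlonglongrightarrow> f t y" using snap_pointwise[of y] by blast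
    have "AE t in lborel. t \<notin> F" using F(1) by (intro AE_not_in finite_imp_null_set_lborel)
    then show ?thesis unfolding Peq by eventually_elim (use F(2) in blast)
  qed
  have Pm': "{x \<in> space (lborel \<Otimes>\<^sub>M lborel). P x} \<in> sets (lborel \<Otimes>\<^sub>M (lborel :: (real ^ 'n) measure))"
    unfolding lborel_prod using Pm by simp
  have it: "AE t in lborel. AE y in lborel. P (t, y)"
    using lborel_pair.AE_commute[of "\<lambda>t y. P (t, y)"] Pm' y by simp
  then show "AE t in lborel. AE y in lborel. t \<in> {0..T} \<longrightarrow> (\<lambda>n. f (snap T n t) y) \<longlonglongrightarrow> f t y" by (simp only: Peq)
  have "AE x in lborel \<Otimes>\<^sub>M lborel. P x" by (rule lborel_pair.AE_pair_measure[OF Pm' it])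
  then show "AE x in lborel. fst x \<in> {0..T} \<longrightarrow> (\<lambda>n. f (snap T n (fst x)) (snd x)) \<longlonglongrightarrow> f (fst x) (snd x)"
    unfolding lborel_prod by (rule AE_mp) (use Peq in \<open>auto intro!: AE_I2\<close>)
qed

lemma AE_lborel_fst:
  assumes "AE t in (lborel :: 'a::euclidean_space measure). Q t" shows "AE x in (lborel :: ('a \<times> 'b::euclidean_space) measure). Q (fst x)"
proof -
  obtain N where N: "{t \<in> space lborel. \<not> Q t} \<subseteq> N" "emeasure lborel N = 0" "N \<in> sets lborel" using AE_E[OF assms] by blast
  show ?thesis
  proof (rule AE_I[where N="N \<times> UNIV"])
    have "emeasure (lborel \<Otimes>\<^sub>M lborel) (N \<times> (UNIV :: 'b set)) = 0"
      using N by (subst lborel.emeasure_pair_measure_Times) auto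
    then show "emeasure lborel (N \<times> (UNIV :: 'b set)) = 0" by (simp add: lborel_prod)
    have "N \<times> (UNIV :: 'b set) \<in> sets (lborel \<Otimes>\<^sub>M lborel)" using N by (intro pair_measureI) auto
    then show "N \<times> UNIV \<in> sets (lborel :: ('a \<times> 'b) measure)" by (simp only: lborel_prod)
  qed (use N in auto)
qed

lemma AE_spectrum_snap: "AE x in lborel. (\<lambda>n. spectrum T (\<lambda>t. f (snap T n t)) x) \<longlonglongrightarrow> spectrum T f x"
proof -
  obtain R where R: "\<And>t y. t \<in> {0..T} \<Longrightarrow> R < norm y \<Longrightarrow> f t y = 0" using Bb_D(4)[OF f] by metis
  obtain M where M: "\<And>t js z. t \<in> {0..T} \<Longrightarrow> length js \<le> 0 \<Longrightarrow> \<bar>iter_pderiv js (f t) z\<bar> \<le> M" using Bb_D(3)[OF f, of 0] by metis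
  have fb: "\<bar>f t z\<bar> \<le> M" if "t \<in> {0..T}" for t z using M[OF that, of "[]" z] by (simp add: iter_pderiv_def)
  have fc: "continuous_on UNIV (f t)" if "t \<in> {0..T}" for t using Bb_D(2)[OF f that, of 0] by (force simp: C_class_def iter_pderiv_def)
  have "AE x :: real \<times> (real ^ 'n) in lborel. AE y in lborel. fst x \<in> {0..T} \<longrightarrow> (\<lambda>n. f (snap T n (fst x)) y) \<longlonglongrightarrow> f (fst x) y"
    by (rule AE_lborel_fst[OF AE_snap_iterated])
  then show ?thesis
  proof eventually_elim
    fix x :: "real \<times> (real ^ 'n)"
    assume ae: "AE y in lborel. fst x \<in> {0..T} \<longrightarrow> (\<lambda>n. f (snap T n (fst x)) y) \<longlonglongrightarrow> f (fst x) y"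
    obtain t \<xi> where x: "x = (t, \<xi>)" by force
    show "(\<lambda>n. spectrum T (\<lambda>t. f (snap T n t)) x) \<longlonglongrightarrow> spectrum T f x"
    proof (cases "t \<in> {0..T}")
      case False
      then show ?thesis by (simp add: x spectrum_eq(2))
    next
      case True
      have cm: "(\<lambda>y. cis (- (y \<bullet> \<xi>))) \<in> borel_measurable borel" by (intro borel_measurable_continuous_onI continuous_intros)
      have fm: "f s \<in> borel_measurable borel" if "s \<in> {0..T}" for s by (rule borel_measurable_continuous_onI[OF fc[OF that]])
      have "(\<lambda>n. fourier (f (snap T n t)) \<xi>) \<longlonglongrightarrow> fourier (f t) \<xi>"
        unfolding fourier_def
      proof (rule integral_dominated_convergence[where w="\<lambda>y. indicator (cball 0 R) y * M"])
        show "integrable lborel (\<lambda>y. indicator (cball (0 :: real ^ 'n) R) y * M)" by (intro integrable_mult_left integrable_indicator_cball)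
        show "(\<lambda>y. complex_of_real (f t y) * cis (- (y \<bullet> \<xi>))) \<in> borel_measurable lborel" using cm fm[OF True] by measurable
        show "(\<lambda>y. complex_of_real (f (snap T n t) y) * cis (- (y \<bullet> \<xi>))) \<in> borel_measurable lborel" for n
          using cm fm[OF snap_range[OF True]] by measurable
        show "AE y in lborel. (\<lambda>n. complex_of_real (f (snap T n t) y) * cis (- (y \<bullet> \<xi>))) \<longlonglongrightarrow> complex_of_real (f t y) * cis (- (y \<bullet> \<xi>))"
          using ae by eventually_elim (use True x in \<open>auto intro!: tendsto_intros\<close>)
        show "AE y in lborel. norm (complex_of_real (f (snap T n t) y) * cis (- (y \<bullet> \<xi>))) \<le> indicator (cball 0 R) y * M" for n
          using fb[OF snap_range[OF True], of n] R[OF snap_range[OF True], of _ n]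
          by (intro AE_I2) (auto simp: norm_mult indicator_def not_le)
      qed
      then show ?thesis unfolding x spectrum_eq(1)[OF True] by (intro tendsto_intros)
    qed
  qed
qed

lemma Lp_snap:
  assumes p: "0 < p"
  shows "(\<lambda>n. Lp_integral T p (\<lambda>t. f (snap T n t))) \<longlonglongrightarrow> Lp_integral T p f"
proof -
  obtain R where R: "\<And>t y. t \<in> {0..T} \<Longrightarrow> R < norm y \<Longrightarrow> f t y = 0" using Bb_D(4)[OF f] by metis
  obtain M where M: "\<And>t js z. t \<in> {0..T} \<Longrightarrow> length js \<le> 0 \<Longrightarrow> \<bar>iter_pderiv js (f t) z\<bar> \<le> M" using Bb_D(3)[OF f, of 0] by metis
  have fb: "\<bar>f t z\<bar> \<le> M" if "t \<in> {0..T}" for t z using M[OF that, of "[]" z] by (simp add: iter_pderiv_def)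
  have M0: "0 \<le> M" using fb[of 0 0] T by force
  have meas: "(\<lambda>x. ennreal (\<bar>g (fst x) (snd x)\<bar> powr p) * indicator ({0<..<T} \<times> UNIV) x) \<in> borel_measurable lborel"
    if g: "g \<in> Bb_space T" for g :: "real \<Rightarrow> real ^ 'n \<Rightarrow> real"
  proof -
    have [measurable]: "(\<lambda>x. indicator {0..T} (fst x) * g (fst x) (snd x)) \<in> borel_measurable borel" by (rule Bb_D(1)[OF g])
    have [measurable]: "{0<..<T} \<times> (UNIV :: (real ^ 'n) set) \<in> sets borel" by (intro borel_open open_Times) auto
    have "(\<lambda>x. ennreal (\<bar>indicator {0..T} (fst x) * g (fst x) (snd x)\<bar> powr p) * indicator ({0<..<T} \<times> UNIV) x) \<in> borel_measurable lborel"
      by measurable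
    moreover have "ennreal (\<bar>indicator {0..T} (fst x) * g (fst x) (snd x)\<bar> powr p) * indicator ({0<..<T} \<times> UNIV) x
       = ennreal (\<bar>g (fst x) (snd x)\<bar> powr p) * indicator ({0<..<T} \<times> UNIV) x" for x
      by (cases x, cases "fst x \<in> {0<..<T}") (simp_all add: indicator_def)
    ultimately show ?thesis by simp
  qed
  have sn: "(\<lambda>t. f (snap T n t)) \<in> Bb_space T" for n
    using Bb_compose[OF f snap_range snap_measurable, where c="\<lambda>_. 0" and K=0 and G="nodes n"] snap_locally_constant
    by (auto simp: nodes_def)
  show ?thesis
    unfolding Lp_integral_def
  proof (rule nn_integral_dominated_convergence[where w="\<lambda>x. ennreal (M powr p) * indicator ({0..T} \<times> cball 0 R) x"])
    show "(\<lambda>x. ennreal (\<bar>f (snap T n (fst x)) (snd x)\<bar> powr p) * indicator ({0<..<T} \<times> UNIV) x) \<in> borel_measurable lborel" for n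
      using meas[OF sn] by simp
    show "(\<lambda>x. ennreal (\<bar>f (fst x) (snd x)\<bar> powr p) * indicator ({0<..<T} \<times> UNIV) x) \<in> borel_measurable lborel" by (rule meas[OF f])
    have K: "{0..T} \<times> cball (0 :: real ^ 'n) R \<in> sets borel" by (intro borel_closed closed_Times) auto
    then show "(\<lambda>x. ennreal (M powr p) * indicator ({0..T} \<times> cball 0 R) x) \<in> borel_measurable (lborel :: (real \<times> (real ^ 'n)) measure)" by measurable
    have "emeasure lborel ({0..T} \<times> cball (0 :: real ^ 'n) R) < \<infinity>"
      by (intro emeasure_bounded_finite bounded_Times) auto
    then show "(\<integral>\<^sup>+x. ennreal (M powr p) * indicator ({0..T} \<times> cball (0 :: real ^ 'n) R) x \<partial>lborel) < \<infinity>"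
      using K by (subst nn_integral_cmult_indicator) (auto simp: ennreal_mult_less_top)
    show "AE x in lborel. ennreal (\<bar>f (snap T n (fst x)) (snd x)\<bar> powr p) * indicator ({0<..<T} \<times> UNIV) x \<le> ennreal (M powr p) * indicator ({0..T} \<times> cball 0 R) x" for n
    proof (rule AE_I2)
      fix x :: "real \<times> (real ^ 'n)"
      show "ennreal (\<bar>f (snap T n (fst x)) (snd x)\<bar> powr p) * indicator ({0<..<T} \<times> UNIV) x \<le> ennreal (M powr p) * indicator ({0..T} \<times> cball 0 R) x"
      proof (cases "fst x \<in> {0<..<T}")
        case True
        then have s: "snap T n (fst x) \<in> {0..T}" by (intro snap_range) auto
        show ?thesis
        proof (cases "norm (snd x) \<le> R")
          case True
          then show ?thesis using fb[OF s, of "snd x"] p \<open>fst x \<in> _\<close>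
            by (cases x) (auto simp: indicator_def intro!: ennreal_leI powr_mono2)
        next
          case False
          then show ?thesis using R[OF s, of "snd x"] p by simp
        qed
      qed (auto simp: indicator_def mem_Times_iff)
    qed
    show "AE x in lborel. (\<lambda>n. ennreal (\<bar>f (snap T n (fst x)) (snd x)\<bar> powr p) * indicator ({0<..<T} \<times> UNIV) x)
        \<longlonglongrightarrow> ennreal (\<bar>f (fst x) (snd x)\<bar> powr p) * indicator ({0<..<T} \<times> UNIV) x"
      using AE_snap_pair
    proof eventually_elim
      fix x :: "real \<times> (real ^ 'n)"
      assume l: "fst x \<in> {0..T} \<longrightarrow> (\<lambda>n. f (snap T n (fst x)) (snd x)) \<longlonglongrightarrow> f (fst x) (snd x)"
      show "(\<lambda>n. ennreal (\<bar>f (snap T n (fst x)) (snd x)\<bar> powr p) * indicator ({0<..<T} \<times> UNIV) x)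
        \<longlonglongrightarrow> ennreal (\<bar>f (fst x) (snd x)\<bar> powr p) * indicator ({0<..<T} \<times> UNIV) x"
      proof (cases "fst x \<in> {0<..<T}")
        case True
        then have "(\<lambda>n. \<bar>f (snap T n (fst x)) (snd x)\<bar> powr p) \<longlonglongrightarrow> \<bar>f (fst x) (snd x)\<bar> powr p"
          using l p by (intro tendsto_powr' tendsto_rabs tendsto_const) auto
        then show ?thesis using True by (cases x) (auto intro!: tendsto_ennrealI)
      qed (auto simp: indicator_def mem_Times_iff)
    qed
  qed
qed

end

end

section \<open>Energies of amplitudes\<close>

text \<open>Index 0 stands for the Laplacian in \<open>x\<close>, so that all operators of the norm
  form one family over \<open>i \<le> k\<close>.\<close>

definition op_symbol :: "('n::finite \<Rightarrow> nat) \<Rightarrow> nat \<Rightarrow> real ^ 'n \<Rightarrow> complex" where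
  "op_symbol b i \<eta> = (if i = 0 then - of_real (\<Sum>j\<in>block b 0. (\<eta> $ j)\<^sup>2)
     else fractional_block.symbol b i (1 / (1 + 2 * real i)) \<eta>)"

definition W_op :: "('n::finite \<Rightarrow> nat) \<Rightarrow> nat \<Rightarrow> (real ^ 'n \<Rightarrow> real) \<Rightarrow> real ^ 'n \<Rightarrow> real" where
  "W_op b i g = (if i = 0 then laplacian_x b g else frac_laplacian b i (1 / (1 + 2 * real i)) g)"

lemma fractional_block_alpha: "block b i \<noteq> {} \<Longrightarrow> i \<noteq> 0 \<Longrightarrow> fractional_block b i (1 / (1 + 2 * real i))"
  by unfold_locales (auto simp: field_simps)

lemma op_symbol_measurable:
  assumes "block b i \<noteq> {}" shows "op_symbol b i \<in> borel_measurable borel"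
proof (cases "i = 0")
  case True
  have "(\<lambda>\<eta> :: real ^ 'a. - complex_of_real (\<Sum>j\<in>block b 0. (\<eta> $ j)\<^sup>2)) \<in> borel_measurable borel"
    by (intro borel_measurable_continuous_onI continuous_intros)
  then show ?thesis using True by (simp add: op_symbol_def[abs_def])
next
  case False
  then show ?thesis using fractional_block.symbol_measurable[OF fractional_block_alpha[OF assms False]]
    by (simp add: op_symbol_def[abs_def])
qed

lemma op_symbol_bound:
  fixes b :: "'n::finite \<Rightarrow> nat"
  assumes "block b i \<noteq> {}" shows "\<exists>K\<ge>0. \<forall>\<eta>. norm (op_symbol b i \<eta>) \<le> K * (1 + norm \<eta>) ^ 2"
proof (cases "i = 0")
  case True
  have "norm (op_symbol b i \<eta>) \<le> real CARD('n) * (1 + norm \<eta>) ^ 2" for \<eta>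
  proof -
    have "norm (op_symbol b i \<eta>) = (\<Sum>j\<in>block b 0. (\<eta> $ j)\<^sup>2)"
    proof -
      have "norm (op_symbol b i \<eta>) = \<bar>\<Sum>j\<in>block b 0. (\<eta> $ j)\<^sup>2\<bar>"
        unfolding op_symbol_def by (simp only: True refl if_True norm_minus_cancel norm_of_real)
      then show ?thesis by (simp only: abs_of_nonneg[OF sum_nonneg[OF zero_le_power2]])
    qed
    also have "\<dots> \<le> (\<Sum>j\<in>block b 0. (1 + norm \<eta>) ^ 2)"
    proof (rule sum_mono)
      fix j
      have "\<bar>\<eta> $ j\<bar> \<le> 1 + norm \<eta>" using component_le_norm_cart[of \<eta> j] by linarith
      then show "(\<eta> $ j)\<^sup>2 \<le> (1 + norm \<eta>) ^ 2" by (metis abs_ge_zero power2_abs power_mono)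
    qed
    also have "\<dots> = real (card (block b 0)) * (1 + norm \<eta>) ^ 2" by simp
    also have "\<dots> \<le> real CARD('n) * (1 + norm \<eta>) ^ 2" by (intro mult_right_mono) (auto intro: card_mono)
    finally show ?thesis .
  qed
  then show ?thesis by (intro exI[of _ "real CARD('n)"]) simp
next
  case False
  interpret fractional_block b i "1 / (1 + 2 * real i)" by (rule fractional_block_alpha[OF assms False])
  define K where "K = 2 * integral\<^sup>L P \<kappa>"
  have K: "0 \<le> K" unfolding K_def by (intro mult_nonneg_nonneg integral_nonneg_AE AE_I2 \<kappa>_nonneg) auto
  have "norm (op_symbol b i \<eta>) \<le> K * (1 + norm \<eta>) ^ 2" for \<eta>
  proof -
    have "norm (op_symbol b i \<eta>) \<le> K * (1 + norm \<eta>)" using symbol_bound[of \<eta>] False by (simp add: op_symbol_def K_def)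
    also have "\<dots> \<le> K * (1 + norm \<eta>) ^ 2" using K by (intro mult_left_mono) (auto simp: power2_eq_square algebra_simps)
    finally show ?thesis .
  qed
  then show ?thesis using K by blast
qed

lemma W_op_osc_integral:
  fixes \<theta> :: "'x \<Rightarrow> real ^ 'n::finite"
  assumes M: "sigma_finite_measure M" and a: "amplitude M 4 a \<theta>" and b: "block b i \<noteq> {}"
  shows "W_op b i (osc_integral M a \<theta>) z = osc_integral M (\<lambda>x. op_symbol b i (\<theta> x) * a x) \<theta> z"
proof (cases "i = 0")
  case True
  have c1: "amplitude M 3 (\<lambda>x. \<i> * of_real (\<theta> x $ j) * a x) \<theta>" for j
    using amplitude_component[of M 3 a \<theta> "axis j 1"] a by (simp add: inner_axis' numeral_eq_Suc)
  have c2: "amplitude M 2 (\<lambda>x. \<i> * of_real (\<theta> x $ j) * (\<i> * of_real (\<theta> x $ j) * a x)) \<theta>" for j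
    using amplitude_component[of M 2 "\<lambda>x. \<i> * of_real (\<theta> x $ j) * a x" \<theta> "axis j 1"] c1[of j] by (simp add: inner_axis' numeral_eq_Suc)
  have "W_op b i (osc_integral M a \<theta>) z = (\<Sum>j\<in>block b 0. osc_integral M (\<lambda>x. \<i> * of_real (\<theta> x $ j) * (\<i> * of_real (\<theta> x $ j) * a x)) \<theta> z)"
    using True by (simp add: W_op_def laplacian_x_def pderiv_osc_integral[OF amplitude_mono[OF a]] pderiv_osc_integral[OF amplitude_mono[OF c1]])
  also have "\<dots> = osc_integral M (\<lambda>x. \<Sum>j\<in>block b 0. \<i> * of_real (\<theta> x $ j) * (\<i> * of_real (\<theta> x $ j) * a x)) \<theta> z"
    by (rule osc_integral_sum[OF _ c2, symmetric]) simp
  also have "(\<lambda>x. \<Sum>j\<in>block b 0. \<i> * of_real (\<theta> x $ j) * (\<i> * of_real (\<theta> x $ j) * a x)) = (\<lambda>x. op_symbol b i (\<theta> x) * a x)"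
    using True by (simp add: fun_eq_iff op_symbol_def sum_distrib_right sum_distrib_left sum_negf power2_eq_square mult_ac)
  finally show ?thesis .
next
  case False
  then show ?thesis
    using fractional_block.frac_laplacian_osc_integral[OF fractional_block_alpha[OF b False] M amplitude_mono[OF a], where z = z]
    by (simp add: W_op_def op_symbol_def)
qed

lemma W_norm_eq: "W_norm T p k b \<phi> = ennreal_root p (\<Sum>i\<le>k. Lp_integral T p (\<lambda>t. W_op b i (\<phi> t)))"
proof -
  have "(\<Sum>i\<le>k. Lp_integral T p (\<lambda>t. W_op b i (\<phi> t))) = Lp_integral T p (\<lambda>t. W_op b 0 (\<phi> t)) + (\<Sum>i=1..k. Lp_integral T p (\<lambda>t. W_op b i (\<phi> t)))"
    unfolding atMost_atLeast0 by (subst sum.atLeast_Suc_atMost) auto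
  also have "(\<Sum>i=1..k. Lp_integral T p (\<lambda>t. W_op b i (\<phi> t))) = (\<Sum>i=1..k. Lp_integral T p (\<lambda>t. frac_laplacian b i (1 / (1 + 2 * real i)) (\<phi> t)))"
    by (intro sum.cong) (auto simp: W_op_def)
  finally show ?thesis by (simp add: W_norm_def W_op_def)
qed

text \<open>Removes the \<open>p\<close>-th roots, so that convexity and Fatou's lemma can act on
  integrals. Positivity of \<open>C\<close> matters when \<open>Y\<close> is infinite.\<close>

lemma ennreal_root_le_iff:
  assumes p: "0 < p" and C: "0 < C"
  shows "ennreal_root p X \<le> ennreal C * ennreal_root p Y \<longleftrightarrow> X \<le> ennreal (C powr p) * Y"
proof (cases "Y = \<infinity>")
  case True
  then show ?thesis using C by (simp add: ennreal_root_def ennreal_mult_top)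
next
  case False
  then obtain y where y: "Y = ennreal y" "0 \<le> y" by (metis infinity_ennreal_def ennreal_cases)
  show ?thesis
  proof (cases "X = \<infinity>")
    case True
    then show ?thesis using y by (simp add: ennreal_root_def top_unique ennreal_mult_eq_top_iff)
  next
    case False
    then obtain x where x: "X = ennreal x" "0 \<le> x" by (metis infinity_ennreal_def ennreal_cases)
    have "ennreal_root p X \<le> ennreal C * ennreal_root p Y \<longleftrightarrow> x powr (1 / p) \<le> C * y powr (1 / p)"
      using x y C by (simp add: ennreal_root_def ennreal_mult[symmetric])
    also have "\<dots> \<longleftrightarrow> x \<le> C powr p * y"
    proof
      assume "x powr (1 / p) \<le> C * y powr (1 / p)"
      then have "(x powr (1 / p)) powr p \<le> (C * y powr (1 / p)) powr p" using p by (intro powr_mono2) auto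
      then show "x \<le> C powr p * y" using p x y C by (simp add: powr_powr powr_mult)
    next
      assume "x \<le> C powr p * y"
      then have "x powr (1 / p) \<le> (C powr p * y) powr (1 / p)" using p x by (intro powr_mono2) auto
      then show "x powr (1 / p) \<le> C * y powr (1 / p)" using p y C by (simp add: powr_powr powr_mult)
    qed
    also have "\<dots> \<longleftrightarrow> X \<le> ennreal (C powr p) * Y" using x y by (simp add: ennreal_mult[symmetric])
    finally show ?thesis .
  qed
qed

section \<open>Translation invariance and convexity\<close>

text \<open>Each time slice is translated by its own vector, which Lebesgue measure on the slice
  does not see; Tonelli's theorem combines the slices.\<close>

lemma nn_integral_shift_snd:
  fixes G :: "real \<times> 'a::euclidean_space \<Rightarrow> ennreal"
  assumes G: "G \<in> borel_measurable borel" and c: "c \<in> borel_measurable borel"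
  shows "(\<integral>\<^sup>+x. G (fst x, snd x + c (fst x)) \<partial>lborel) = (\<integral>\<^sup>+x. G x \<partial>lborel)"
proof -
  have fs: "(fst :: real \<times> 'a \<Rightarrow> real) \<in> borel_measurable borel" "(snd :: real \<times> 'a \<Rightarrow> 'a) \<in> borel_measurable borel"
    by (intro borel_measurable_continuous_onI continuous_intros)+
  have m1: "(\<lambda>x :: real \<times> 'a. (fst x, snd x + c (fst x))) \<in> measurable borel (borel \<Otimes>\<^sub>M borel)"
    by (intro measurable_Pair borel_measurable_add fs measurable_compose[OF fs(1) c])
  have G1: "(\<lambda>x. G (fst x, snd x + c (fst x))) \<in> borel_measurable (lborel \<Otimes>\<^sub>M lborel)"
    unfolding lborel_prod using measurable_compose[OF m1, unfolded borel_prod, OF G] by simp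
  have G2: "G \<in> borel_measurable (lborel \<Otimes>\<^sub>M lborel)" unfolding lborel_prod using G by simp
  have "(\<integral>\<^sup>+x. G (fst x, snd x + c (fst x)) \<partial>lborel) = (\<integral>\<^sup>+t. \<integral>\<^sup>+z. G (t, z + c t) \<partial>lborel \<partial>lborel)"
    using lborel.nn_integral_fst[OF G1] by (simp add: lborel_prod)
  also have "\<dots> = (\<integral>\<^sup>+t. \<integral>\<^sup>+z. G (t, z) \<partial>lborel \<partial>lborel)"
  proof (rule nn_integral_cong)
    fix t
    have Gt: "(\<lambda>z. G (t, z)) \<in> borel_measurable borel" using measurable_compose[OF _ G, of "\<lambda>z. (t, z)" borel] by simp
    have "(\<integral>\<^sup>+z. G (t, z) \<partial>lborel) = (\<integral>\<^sup>+z. G (t, z) \<partial>distr lborel borel ((+) (c t)))" by (simp add: lborel_distr_plus)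
    also have "\<dots> = (\<integral>\<^sup>+z. G (t, c t + z) \<partial>lborel)" using Gt by (subst nn_integral_distr) auto
    finally show "(\<integral>\<^sup>+z. G (t, z + c t) \<partial>lborel) = (\<integral>\<^sup>+z. G (t, z) \<partial>lborel)" by (simp add: add.commute)
  qed
  also have "\<dots> = (\<integral>\<^sup>+x. G x \<partial>lborel)" using lborel.nn_integral_fst[OF G2] by (simp add: lborel_prod)
  finally show ?thesis .
qed

lemma Lp_integral_shift:
  fixes f :: "real \<Rightarrow> real ^ 'n::finite \<Rightarrow> real"
  assumes f: "f \<in> Bb_space T" and c: "c \<in> borel_measurable borel"
  shows "Lp_integral T p (\<lambda>t z. f t (z - c t)) = Lp_integral T p f"
proof -
  define g where "g x = indicator {0..T} (fst x) * f (fst x) (snd x)" for x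
  have gm: "g \<in> borel_measurable borel" unfolding g_def[abs_def] by (rule Bb_D(1)[OF f])
  define G where "G x = ennreal (\<bar>g x\<bar> powr p) * indicator ({0<..<T} \<times> UNIV) x" for x
  have op: "{0<..<T} \<times> (UNIV :: (real ^ 'n) set) \<in> sets borel" by (intro borel_open open_Times) auto
  have Gm: "G \<in> borel_measurable borel" unfolding G_def[abs_def] using gm op by measurable
  have "Lp_integral T p (\<lambda>t z. f t (z - c t)) = (\<integral>\<^sup>+x. G (fst x, snd x + - c (fst x)) \<partial>lborel)"
    unfolding Lp_integral_def by (intro nn_integral_cong) (auto simp: G_def g_def indicator_def)
  also have "\<dots> = (\<integral>\<^sup>+x. G x \<partial>lborel)" by (rule nn_integral_shift_snd[OF Gm]) (use c in measurable)
  also have "\<dots> = Lp_integral T p f"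
    unfolding Lp_integral_def by (intro nn_integral_cong) (auto simp: G_def g_def indicator_def)
  finally show ?thesis .
qed

text \<open>Convexity of the power is used on positive numbers; if one of the values vanishes, the
  claim reduces to \<open>(1/2) powr p \<le> 1/2\<close>.\<close>

lemma powr_midpoint:
  fixes x y p :: real
  assumes "1 \<le> p" shows "\<bar>(x + y) / 2\<bar> powr p \<le> (\<bar>x\<bar> powr p + \<bar>y\<bar> powr p) / 2"
proof -
  have "\<bar>(x + y) / 2\<bar> powr p \<le> ((\<bar>x\<bar> + \<bar>y\<bar>) / 2) powr p" using assms by (intro powr_mono2) auto
  also have "\<dots> \<le> (\<bar>x\<bar> powr p + \<bar>y\<bar> powr p) / 2"
  proof (cases "x = 0 \<or> y = 0")
    case True
    have h: "(1 / 2 :: real) powr p \<le> 1 / 2" using powr_mono'[of 1 p "1/2"] assms by simp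
    have "(\<bar>u\<bar> / 2) powr p \<le> \<bar>u\<bar> powr p / 2" for u :: real
      using mult_left_mono[OF h, of "\<bar>u\<bar> powr p"] powr_mult[of "\<bar>u\<bar>" "1/2" p] by simp
    then show ?thesis using True by auto
  next
    case False
    then show ?thesis using convex_onD[OF powr_convex[OF assms], of "1/2" "\<bar>x\<bar>" "\<bar>y\<bar>"] by (simp add: add_divide_distrib)
  qed
  finally show ?thesis .
qed

section \<open>Energies as functionals of the amplitude\<close>

context drift_flow
begin

text \<open>Exact, frozen, translated and averaged data will all share one \<open>D\<close>, which
  supplies a common dominating function for the limits.\<close>

definition dominated :: "(real ^ 'n \<Rightarrow> real) \<Rightarrow> (real \<Rightarrow> real \<times> (real ^ 'n) \<Rightarrow> complex) \<Rightarrow> bool" where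
  "dominated D a \<longleftrightarrow> (\<lambda>y. a (fst y) (snd y)) \<in> borel_measurable borel \<and>
     (\<forall>t\<in>{0..T}. \<forall>x. norm (a t x) \<le> indicator {0..T} (fst x) * D (snd x))"

definition multiplied :: "('n \<Rightarrow> nat) \<Rightarrow> nat \<Rightarrow> (real \<Rightarrow> real \<times> (real ^ 'n) \<Rightarrow> complex) \<Rightarrow> real \<Rightarrow> real ^ 'n \<Rightarrow> real" where
  "multiplied b i a t = osc_integral lborel (\<lambda>x. op_symbol b i (E t *v label E x) * a t x) (\<lambda>x. E t *v label E x)"

text \<open>The \<open>p\<close>-th power of the norm. The sum over the operators stands inside the
  integral, so that convexity and Fatou's lemma are applied only once.\<close>

definition energy :: "real \<Rightarrow> nat \<Rightarrow> ('n \<Rightarrow> nat) \<Rightarrow> (real \<Rightarrow> real \<times> (real ^ 'n) \<Rightarrow> complex) \<Rightarrow> ennreal" where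
  "energy p k b a = (\<integral>\<^sup>+y. (\<Sum>i\<le>k. ennreal (\<bar>multiplied b i a (fst y) (snd y)\<bar> powr p)) * indicator ({0<..<T} \<times> UNIV) y \<partial>lborel)"

lemma slice_measurable: "dominated D a \<Longrightarrow> a t \<in> borel_measurable borel"
  unfolding dominated_def using measurable_compose[of "\<lambda>x. (t, x)" borel borel "\<lambda>y. a (fst y) (snd y)" borel] by simp

lemma dominated_amplitude:
  assumes "spectral T F D" "dominated D a" "t \<in> {0..T}"
  shows "amplitude lborel 4 (a t) (\<lambda>x. E t *v label E x)"
  using amplitude_freq[OF assms(1,3) slice_measurable[OF assms(2)]] assms(2,3) by (auto simp: dominated_def)

lemma multiplied_amplitude:
  assumes "spectral T F D" "dominated D a" "t \<in> {0..T}" "block b i \<noteq> {}"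
  shows "amplitude lborel 2 (\<lambda>x. op_symbol b i (E t *v label E x) * a t x) (\<lambda>x. E t *v label E x)"
proof -
  obtain K where K: "\<And>\<eta>. norm (op_symbol b i \<eta>) \<le> K * (1 + norm \<eta>) ^ 2" using op_symbol_bound[OF assms(4)] by blast
  have A: "amplitude lborel 4 (a t) (\<lambda>x. E t *v label E x)" by (rule dominated_amplitude[OF assms(1-3)])
  have "(\<lambda>x. op_symbol b i (E t *v label E x)) \<in> borel_measurable lborel"
    using measurable_compose[OF amplitude_D(2)[OF A] op_symbol_measurable[OF assms(4)]] .
  from amplitude_multiply[OF A this _ K] show ?thesis by simp
qed

lemma multiplied_eq:
  assumes "spectral T F D" "dominated D a" "t \<in> {0..T}" "block b i \<noteq> {}"
  shows "multiplied b i a t z = W_op b i (osc_integral lborel (a t) (\<lambda>x. E t *v label E x)) z"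
  unfolding multiplied_def
  by (rule W_op_osc_integral[OF _ dominated_amplitude[OF assms(1-3)] assms(4), symmetric]) (rule sigma_finite_lborel)

lemma multiplied_measurable:
  assumes "dominated D a" "block b i \<noteq> {}"
  shows "(\<lambda>y. multiplied b i a (fst y) (snd y)) \<in> borel_measurable borel"
proof -
  have fr: "(\<lambda>p :: ((real \<times> (real ^ 'n)) \<times> (real \<times> (real ^ 'n))). E (fst (fst p)) *v label E (snd p)) \<in> borel_measurable borel"
    by (intro borel_measurable_continuous_onI continuous_intros)
  have s: "(\<lambda>p :: ((real \<times> (real ^ 'n)) \<times> (real \<times> (real ^ 'n))). op_symbol b i (E (fst (fst p)) *v label E (snd p))) \<in> borel_measurable borel"
    by (rule measurable_compose[OF fr op_symbol_measurable[OF assms(2)]])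
  have "(\<lambda>p :: ((real \<times> (real ^ 'n)) \<times> (real \<times> (real ^ 'n))). (fst (fst p), snd p)) \<in> measurable borel borel"
    by (intro borel_measurable_continuous_onI continuous_intros)
  from measurable_compose[OF this, of "\<lambda>y. a (fst y) (snd y)"]
  have a: "(\<lambda>p :: ((real \<times> (real ^ 'n)) \<times> (real \<times> (real ^ 'n))). a (fst (fst p)) (snd p)) \<in> borel_measurable borel" using assms(1) by (simp add: dominated_def)
  have c: "(\<lambda>p :: ((real \<times> (real ^ 'n)) \<times> (real \<times> (real ^ 'n))). cis (snd (fst p) \<bullet> (E (fst (fst p)) *v label E (snd p)))) \<in> borel_measurable borel"
    by (intro borel_measurable_continuous_onI continuous_intros)
  have eq: "sets ((borel :: (real \<times> (real ^ 'n)) measure) \<Otimes>\<^sub>M (lborel :: (real \<times> (real ^ 'n)) measure)) = sets borel"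
    by (subst sets_pair_measure_cong[OF refl sets_lborel]) (simp only: borel_prod)
  have "(\<lambda>p :: ((real \<times> (real ^ 'n)) \<times> (real \<times> (real ^ 'n))). Re (op_symbol b i (E (fst (fst p)) *v label E (snd p)) * a (fst (fst p)) (snd p) *
      cis (snd (fst p) \<bullet> (E (fst (fst p)) *v label E (snd p))))) \<in> borel_measurable (borel \<Otimes>\<^sub>M lborel)"
    unfolding measurable_cong_sets[OF eq refl] using s a c by measurable
  then show ?thesis unfolding multiplied_def osc_integral_def
    by (intro lborel.borel_measurable_lebesgue_integral) (simp add: split_beta')
qed

lemma strip_sets: "{0<..<T} \<times> (UNIV :: (real ^ 'n) set) \<in> sets borel" by (intro borel_open open_Times) auto

lemma energy_integrand_measurable:
  assumes "dominated D a" "\<And>i. i \<le> k \<Longrightarrow> block b i \<noteq> {}"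
  shows "(\<lambda>y. (\<Sum>i\<le>k. ennreal (\<bar>multiplied b i a (fst y) (snd y)\<bar> powr p)) * indicator ({0<..<T} \<times> UNIV) y) \<in> borel_measurable borel"
  unfolding sum_distrib_right
proof (rule borel_measurable_sum)
  fix i assume "i \<in> {..k}"
  then have "(\<lambda>y. multiplied b i a (fst y) (snd y)) \<in> borel_measurable borel"
    by (intro multiplied_measurable[OF assms(1) assms(2)]) simp
  then show "(\<lambda>y. ennreal (\<bar>multiplied b i a (fst y) (snd y)\<bar> powr p) * indicator ({0<..<T} \<times> UNIV) y) \<in> borel_measurable borel"
    using strip_sets by measurable
qed

lemma energy_eq:
  assumes "dominated D a" "\<And>i. i \<le> k \<Longrightarrow> block b i \<noteq> {}"
  shows "energy p k b a = (\<Sum>i\<le>k. Lp_integral T p (multiplied b i a))"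
proof -
  have m: "(\<lambda>y. ennreal (\<bar>multiplied b i a (fst y) (snd y)\<bar> powr p) * indicator ({0<..<T} \<times> UNIV) y) \<in> borel_measurable lborel" if "i \<le> k" for i
    using multiplied_measurable[OF assms(1) assms(2)[OF that]] strip_sets by measurable
  show ?thesis unfolding energy_def Lp_integral_def sum_distrib_right
    by (rule nn_integral_sum) (use m in auto)
qed

text \<open>A phase linear in the transported frequency translates the slice at time
  \<open>t\<close> by \<open>c t\<close>, and such translations preserve the integral.\<close>

lemma energy_shift:
  assumes a: "dominated D a" and c: "c \<in> borel_measurable borel" and b: "\<And>i. i \<le> k \<Longrightarrow> block b i \<noteq> {}"
  shows "energy p k b (\<lambda>t x. cis (c t \<bullet> (E t *v label E x)) * a t x) = energy p k b a"
proof -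
  have sh: "multiplied b i (\<lambda>t x. cis (c t \<bullet> (E t *v label E x)) * a t x) t z = multiplied b i a t (z + c t)" for i t z
    unfolding multiplied_def osc_integral_def
    by (intro Bochner_Integration.integral_cong[OF refl]) (simp only: inner_add_left cis_mult[symmetric] mult_ac)
  define G where "G y = (\<Sum>i\<le>k. ennreal (\<bar>multiplied b i a (fst y) (snd y)\<bar> powr p)) * indicator ({0<..<T} \<times> UNIV) y" for y
  have "G \<in> borel_measurable borel" unfolding G_def[abs_def]
    by (rule energy_integrand_measurable[OF a b])
  from nn_integral_shift_snd[OF this c]
  show ?thesis unfolding energy_def sh G_def by (simp add: indicator_def mem_Times_iff)
qed

text \<open>The operators are linear in the amplitude and the \<open>p\<close>-th power is midpoint
  convex, so an average obeys the common bound \<open>R\<close> without loss.\<close>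

lemma energy_midpoint:
  assumes F: "spectral T F D" and a: "dominated D a1" "dominated D a2" and b: "\<And>i. i \<le> k \<Longrightarrow> block b i \<noteq> {}" and p: "1 \<le> p"
    and R: "energy p k b a1 \<le> R" "energy p k b a2 \<le> R"
  shows "energy p k b (\<lambda>t x. (a1 t x + a2 t x) / 2) \<le> R"
proof -
  have lin: "multiplied b i (\<lambda>t x. (a1 t x + a2 t x) / 2) t z = (multiplied b i a1 t z + multiplied b i a2 t z) / 2"
    if "t \<in> {0..T}" "i \<le> k" for i t z
  proof -
    have "multiplied b i (\<lambda>t x. (a1 t x + a2 t x) / 2) t z = osc_integral lborel (\<lambda>x. of_real (1/2) *
       (op_symbol b i (E t *v label E x) * a1 t x + op_symbol b i (E t *v label E x) * a2 t x)) (\<lambda>x. E t *v label E x) z"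
      unfolding multiplied_def by (simp add: add_divide_distrib algebra_simps)
    also have "\<dots> = (1/2) * (multiplied b i a1 t z + multiplied b i a2 t z)"
      unfolding osc_integral_scale multiplied_def
      using osc_integral_add[OF multiplied_amplitude[OF F a(1) that(1) b[OF that(2)]] multiplied_amplitude[OF F a(2) that(1) b[OF that(2)]], of z] by simp
    finally show ?thesis by simp
  qed
  define G where "G a y = (\<Sum>i\<le>k. ennreal (\<bar>multiplied b i a (fst y) (snd y)\<bar> powr p)) * indicator ({0<..<T} \<times> UNIV) y" for a y
  have Gm: "G a \<in> borel_measurable lborel" if "dominated D a" for a unfolding G_def[abs_def] measurable_lborel2
    by (rule energy_integrand_measurable[OF that b])
  have "energy p k b (\<lambda>t x. (a1 t x + a2 t x) / 2) \<le> (\<integral>\<^sup>+y. ennreal (1/2) * (G a1 y + G a2 y) \<partial>lborel)"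
    unfolding energy_def
  proof (rule nn_integral_mono)
    fix y :: "real \<times> (real ^ 'n)"
    show "(\<Sum>i\<le>k. ennreal (\<bar>multiplied b i (\<lambda>t x. (a1 t x + a2 t x) / 2) (fst y) (snd y)\<bar> powr p)) * indicator ({0<..<T} \<times> UNIV) y
       \<le> ennreal (1/2) * (G a1 y + G a2 y)"
    proof (cases "fst y \<in> {0<..<T}")
      case True
      then have t: "fst y \<in> {0..T}" by auto
      have "(\<Sum>i\<le>k. ennreal (\<bar>multiplied b i (\<lambda>t x. (a1 t x + a2 t x) / 2) (fst y) (snd y)\<bar> powr p))
         \<le> (\<Sum>i\<le>k. ennreal (1/2) * (ennreal (\<bar>multiplied b i a1 (fst y) (snd y)\<bar> powr p) + ennreal (\<bar>multiplied b i a2 (fst y) (snd y)\<bar> powr p)))"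
      proof (rule sum_mono)
        fix i assume "i \<in> {..k}"
        then show "ennreal (\<bar>multiplied b i (\<lambda>t x. (a1 t x + a2 t x) / 2) (fst y) (snd y)\<bar> powr p)
          \<le> ennreal (1/2) * (ennreal (\<bar>multiplied b i a1 (fst y) (snd y)\<bar> powr p) + ennreal (\<bar>multiplied b i a2 (fst y) (snd y)\<bar> powr p))"
          using powr_midpoint[OF p, of "multiplied b i a1 (fst y) (snd y)" "multiplied b i a2 (fst y) (snd y)"]
          by (simp only: lin[OF t] atMost_iff ennreal_plus[symmetric] powr_ge_zero ennreal_mult'[symmetric] add_nonneg_nonneg) (simp add: ennreal_leI)
      qed
      also have "\<dots> = ennreal (1/2) * ((\<Sum>i\<le>k. ennreal (\<bar>multiplied b i a1 (fst y) (snd y)\<bar> powr p)) + (\<Sum>i\<le>k. ennreal (\<bar>multiplied b i a2 (fst y) (snd y)\<bar> powr p)))"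
        by (simp only: sum_distrib_left[symmetric] sum.distrib)
      finally show ?thesis using True by (cases y) (simp add: G_def)
    qed (auto simp: indicator_def mem_Times_iff)
  qed
  also have "\<dots> = ennreal (1/2) * (energy p k b a1 + energy p k b a2)"
  proof -
    have e: "energy p k b a = (\<integral>\<^sup>+y. G a y \<partial>lborel)" for a by (simp only: energy_def G_def)
    show ?thesis unfolding e using Gm[OF a(1)] Gm[OF a(2)]
      by (subst nn_integral_cmult) (simp_all only: nn_integral_add borel_measurable_add)
  qed
  also have "\<dots> \<le> ennreal (1/2) * (R + R)" by (intro mult_left_mono add_mono R) auto
  also have "\<dots> = R"
  proof -
    have "R + R = ennreal 2 * R" using mult_2[of R] by simp
    then have "ennreal (1/2) * (R + R) = (ennreal (1/2) * ennreal 2) * R" by (simp only: mult.assoc)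
    also have "ennreal (1/2) * ennreal 2 = 1" by (subst ennreal_mult[symmetric]) auto
    finally show ?thesis by simp
  qed
  finally show ?thesis .
qed

text \<open>Convergence of the amplitudes for almost every parameter gives convergence of all
  operator values at every point, dominated through the symbol bound and \<open>majorant\<close>;
  Fatou's lemma then acts on the integral over \<open>(t, z)\<close>.\<close>

lemma energy_fatou:
  assumes F: "spectral T F D" and a: "\<And>n. dominated D (a n)" "dominated D a'" and b: "\<And>i. i \<le> k \<Longrightarrow> block b i \<noteq> {}" and p: "0 < p"
    and lim: "\<And>t. t \<in> {0..T} \<Longrightarrow> AE x in lborel. (\<lambda>n. a n t x) \<longlonglongrightarrow> a' t x"
  shows "energy p k b a' \<le> liminf (\<lambda>n. energy p k b (a n))"
proof -
  have conv: "(\<lambda>n. multiplied b i (a n) t z) \<longlonglongrightarrow> multiplied b i a' t z" if t: "t \<in> {0..T}" and i: "i \<le> k" for i t z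
  proof -
    obtain K where K: "0 \<le> K" "\<And>\<eta>. norm (op_symbol b i \<eta>) \<le> K * (1 + norm \<eta>) ^ 2" using op_symbol_bound[OF b[OF i]] by blast
    note A = multiplied_amplitude[OF F _ t b[OF i]]
    show ?thesis unfolding multiplied_def osc_integral_def
    proof (rule integral_dominated_convergence[where w="\<lambda>x. K * majorant D x"])
      show "integrable lborel (\<lambda>x. K * majorant D x)" by (rule integrable_mult_right[OF majorant_integrable[OF F]])
      show "(\<lambda>x. Re (op_symbol b i (E t *v label E x) * a' t x * cis (z \<bullet> (E t *v label E x)))) \<in> borel_measurable lborel"
        by (rule borel_measurable_integrable[OF osc_integrand_integrable[OF A[OF a(2)]]])
      show "(\<lambda>x. Re (op_symbol b i (E t *v label E x) * a n t x * cis (z \<bullet> (E t *v label E x)))) \<in> borel_measurable lborel" for n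
        by (rule borel_measurable_integrable[OF osc_integrand_integrable[OF A[OF a(1)]]])
      show "AE x in lborel. (\<lambda>n. Re (op_symbol b i (E t *v label E x) * a n t x * cis (z \<bullet> (E t *v label E x)))) \<longlonglongrightarrow>
         Re (op_symbol b i (E t *v label E x) * a' t x * cis (z \<bullet> (E t *v label E x)))"
        using lim[OF t] by eventually_elim (intro tendsto_intros)
      show "AE x in lborel. norm (Re (op_symbol b i (E t *v label E x) * a n t x * cis (z \<bullet> (E t *v label E x)))) \<le> K * majorant D x" for n
      proof (rule AE_I2)
        fix x
        define y where "y = E t *v label E x"
        have "\<bar>Re (op_symbol b i y * a n t x * cis (z \<bullet> y))\<bar> \<le> norm (op_symbol b i y) * norm (a n t x)"
          using abs_Re_le_cmod[of "op_symbol b i y * a n t x * cis (z \<bullet> y)"] by (simp only: norm_mult norm_cis mult_1_right)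
        also have "\<dots> \<le> (K * (1 + norm y) ^ 4) * norm (a n t x)"
        proof (intro mult_right_mono)
          have "K * (1 + norm y) ^ 2 \<le> K * (1 + norm y) ^ 4" using K(1) by (intro mult_left_mono power_increasing) auto
          then show "norm (op_symbol b i y) \<le> K * (1 + norm y) ^ 4" using K(2)[of y] by linarith
        qed simp
        also have "\<dots> = K * ((1 + norm y) ^ 4 * norm (a n t x))" by simp
        also have "\<dots> \<le> K * majorant D x"
        proof -
          have "norm (a n t x) \<le> indicator {0..T} (fst x) * D (snd x)" using a(1)[of n] t unfolding dominated_def by blast
          then show ?thesis unfolding y_def using K(1) by (intro mult_left_mono majorant_bound[OF F t])
        qed
        finally show "norm (Re (op_symbol b i (E t *v label E x) * a n t x * cis (z \<bullet> (E t *v label E x)))) \<le> K * majorant D x"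
          by (simp only: y_def real_norm_def)
      qed
    qed
  qed
  define G where "G a y = (\<Sum>i\<le>k. ennreal (\<bar>multiplied b i a (fst y) (snd y)\<bar> powr p)) * indicator ({0<..<T} \<times> UNIV) y" for a y
  have Gm: "G a \<in> borel_measurable lborel" if "dominated D a" for a unfolding G_def[abs_def] measurable_lborel2
    by (rule energy_integrand_measurable[OF that b])
  have Gl: "(\<lambda>n. G (a n) y) \<longlonglongrightarrow> G a' y" for y
  proof (cases "fst y \<in> {0<..<T}")
    case True
    have "(\<lambda>n. \<Sum>i\<le>k. ennreal (\<bar>multiplied b i (a n) (fst y) (snd y)\<bar> powr p)) \<longlonglongrightarrow> (\<Sum>i\<le>k. ennreal (\<bar>multiplied b i a' (fst y) (snd y)\<bar> powr p))"
    proof (intro tendsto_sum tendsto_ennrealI tendsto_powr' tendsto_rabs tendsto_const)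
      fix i assume "i \<in> {..k}"
      then show "(\<lambda>n. multiplied b i (a n) (fst y) (snd y)) \<longlonglongrightarrow> multiplied b i a' (fst y) (snd y)" using True by (intro conv) auto
    qed (use p in auto)
    then show ?thesis using True by (cases y) (simp add: G_def)
  qed (auto simp: G_def indicator_def mem_Times_iff)
  have "energy p k b a' = (\<integral>\<^sup>+y. liminf (\<lambda>n. G (a n) y) \<partial>lborel)"
    unfolding energy_def using lim_imp_Liminf[OF sequentially_bot Gl] by (simp add: G_def)
  also have "\<dots> \<le> liminf (\<lambda>n. \<integral>\<^sup>+y. G (a n) y \<partial>lborel)" by (rule nn_integral_liminf) (rule Gm[OF a(1)])
  finally show ?thesis by (simp add: energy_def G_def)
qed

end

section \<open>Translations at finitely many times\<close>

text \<open>Each pair is a jump time and a jump vector, the vector being measured in the frame of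
  time 0. The sum is right continuous in \<open>t\<close>.\<close>

primrec jump_sum :: "(real \<times> (real ^ 'n)) list \<Rightarrow> real \<Rightarrow> real ^ 'n" where
  "jump_sum [] t = 0"
| "jump_sum (j # js) t = (if fst j \<le> t then snd j else 0) + jump_sum js t"

lemma jump_sum_measurable: "jump_sum js \<in> borel_measurable borel"
proof (induction js)
  case (Cons j js)
  have "(\<lambda>t. if fst j \<le> t then snd j else 0) \<in> borel_measurable borel" by measurable
  from borel_measurable_add[OF this Cons.IH] show ?case by simp
qed simp

lemma jump_sum_bounded: "\<exists>K. \<forall>t. norm (jump_sum js t) \<le> K"
proof (induction js)
  case (Cons j js)
  then obtain K where K: "\<And>t. norm (jump_sum js t) \<le> K" by blast
  have "norm (jump_sum (j # js) t) \<le> norm (snd j) + K" for t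
  proof -
    have "norm (if fst j \<le> t then snd j else 0) \<le> norm (snd j)" by simp
    then show ?thesis using norm_triangle_ineq[of "if fst j \<le> t then snd j else 0" "jump_sum js t"] K[of t] by simp
  qed
  then show ?case by blast
qed auto

lemma jump_sum_locally_constant:
  assumes "t \<notin> fst ` set js" shows "\<forall>\<^sub>F s in at t within X. jump_sum js s = jump_sum js t"
  using assms
proof (induction js)
  case (Cons j js)
  have "\<forall>\<^sub>F s in at t within X. (fst j \<le> s) = (fst j \<le> t)"
  proof (cases "fst j < t")
    case True
    then have "\<forall>\<^sub>F s in at t within X. fst j < s" by (intro order_tendstoD(1)[OF tendsto_ident_at])
    then show ?thesis by eventually_elim (use True in auto)
  next
    case False
    then have "t < fst j" using Cons.prems by auto
    then have "\<forall>\<^sub>F s in at t within X. s < fst j" by (intro order_tendstoD(2)[OF tendsto_ident_at])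
    then show ?thesis by eventually_elim (use \<open>t < fst j\<close> in auto)
  qed
  moreover have "\<forall>\<^sub>F s in at t within X. jump_sum js s = jump_sum js t" using Cons by simp
  ultimately show ?case by eventually_elim simp
qed simp

text \<open>For \<open>s \<le> t\<close> this is 1 exactly when \<open>s < \<tau> \<le> t\<close>,
  and 0 otherwise.\<close>

definition crossed :: "real \<Rightarrow> real \<Rightarrow> real \<Rightarrow> real" where
  "crossed \<tau> t s = (if \<tau> \<le> t then 1 else 0) - (if \<tau> \<le> s then 1 else 0)"

definition cosines :: "(real \<Rightarrow> real ^ 'n ^ 'n) \<Rightarrow> (real \<times> (real ^ 'n)) list \<Rightarrow> real \<Rightarrow> real \<times> (real ^ 'n) \<Rightarrow> real" where
  "cosines E ks t x = (\<Prod>j\<leftarrow>ks. cos (crossed (fst j) t (fst x) * (snd j \<bullet> label E x)))"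

context kolmogorov
begin

lemma dominated_kernel:
  assumes F: "spectral T F D" shows "dominated D (\<lambda>t x. of_real (kernel T E Q t x) * F x)"
  unfolding dominated_def
proof (intro conjI ballI allI)
  have "F \<in> borel_measurable borel" using F by (simp add: spectral_def)
  from measurable_compose[OF _ this, of "snd :: real \<times> real \<times> (real ^ 'n) \<Rightarrow> _"]
  have [measurable]: "(\<lambda>y :: real \<times> real \<times> (real ^ 'n). F (snd y)) \<in> borel_measurable borel"
    by (simp add: borel_measurable_continuous_onI continuous_intros)
  show "(\<lambda>y. complex_of_real (kernel T E Q (fst y) (snd y)) * F (snd y)) \<in> borel_measurable borel"
    using kernel_measurable by measurable
  fix t x assume "t \<in> {0..T}"
  then show "norm (of_real (kernel T E Q t x) * F x) \<le> indicator {0..T} (fst x) * D (snd x)"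
    using kernel_bounds[of t x] F by (cases x) (auto simp: norm_mult spectral_def intro!: mult_mono)
qed

lemma W_norm_mild:
  assumes F: "spectral T F D" and b: "\<And>i. i \<le> k \<Longrightarrow> block b i \<noteq> {}"
  shows "W_norm T p k b (mild T E Q F) = ennreal_root p (energy p k b (\<lambda>t x. of_real (kernel T E Q t x) * F x))"
proof -
  let ?a = "\<lambda>t x. of_real (kernel T E Q t x) * F x"
  have "(\<Sum>i\<le>k. Lp_integral T p (\<lambda>t. W_op b i (mild T E Q F t))) = (\<Sum>i\<le>k. Lp_integral T p (multiplied b i ?a))"
  proof (rule sum.cong[OF refl])
    fix i assume i: "i \<in> {..k}"
    have "W_op b i (mild T E Q F t) z = multiplied b i ?a t z" if "t \<in> {0<..<T}" for t z
      using multiplied_eq[OF F dominated_kernel[OF F], of t b i z] that b[of i] i by (simp add: mild_def)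
    then show "Lp_integral T p (\<lambda>t. W_op b i (mild T E Q F t)) = Lp_integral T p (multiplied b i ?a)"
      unfolding Lp_integral_def by (intro nn_integral_cong) (auto simp: indicator_def)
  qed
  also have "\<dots> = energy p k b ?a" by (rule energy_eq[OF dominated_kernel[OF F] b, symmetric])
  finally show ?thesis unfolding W_norm_eq by simp
qed

end

lemma Bb_snap:
  fixes g :: "real \<Rightarrow> real ^ 'n::finite \<Rightarrow> real"
  assumes T: "0 < T" and g: "g \<in> Bb_space T" shows "(\<lambda>t. g (snap T n t)) \<in> Bb_space T"
proof -
  have "(\<lambda>t z. g (snap T n t) (z - 0)) \<in> Bb_space T"
    by (rule Bb_compose[where K=0 and G="nodes T n" and f=g])
      (use g snap_locally_constant[OF T] snap_range[OF T] snap_measurable[OF T] in \<open>auto simp: nodes_def[OF T]\<close>)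
  then show ?thesis by simp
qed

locale unperturbed_problem = drift_flow T A E for T and A :: "real ^ 'n ^ 'n" and E +
  fixes B :: "real ^ 'n ^ 'n" and p C :: real and k :: nat and b :: "'n \<Rightarrow> nat"
  assumes B: "sym_nonneg_matrix B" and p: "1 < p" and C: "0 < C"
    and blocks: "\<And>i. i \<le> k \<Longrightarrow> block b i \<noteq> {}"
    and unperturbed_estimate: "\<And>f u. f \<in> Bb_space T \<Longrightarrow> is_unique_solution T (diffusion_op A (\<lambda>_. B)) f u \<Longrightarrow>
           W_norm T p k b u \<le> ennreal C * Lp_norm T p f"
begin

sublocale kolmogorov T A E "\<lambda>_. B"
  by unfold_locales (auto intro: B)

text \<open>The mild solution is the unique one, so the assumed estimate applies to it and turns
  into an inequality between \<open>p\<close>-th powers.\<close>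

lemma energy_mild:
  assumes f: "f \<in> Bb_space T" and F: "spectral T F D" and r: "represents T F f"
  shows "energy p k b (\<lambda>t x. of_real (kernel T E (\<lambda>_. B) t x) * F x) \<le> ennreal (C powr p) * Lp_integral T p f"
proof -
  have "is_unique_solution T (diffusion_op A (\<lambda>_. B)) f (mild T E (\<lambda>_. B) F)"
    by (rule unique_solutionI[OF T _ _ mild_is_solution[OF F r]]) (auto intro: B)
  from unperturbed_estimate[OF f this] show ?thesis
    using ennreal_root_le_iff[of p C] p C by (simp add: W_norm_mild[OF F blocks] Lp_norm_def)
qed

text \<open>The accumulated jump carried from the frame of time 0 to time \<open>t\<close> by the
  drift; paired with a transported frequency it returns the pairing at time 0.\<close>

definition jump_shift :: "(real \<times> (real ^ 'n)) list \<Rightarrow> real \<Rightarrow> real ^ 'n" where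
  "jump_shift js t = transpose (E (- t)) *v jump_sum js t"

lemma jump_shift_inner: "jump_shift js t \<bullet> (E t *v \<zeta>) = jump_sum js t \<bullet> \<zeta>"
  by (simp add: jump_shift_def transpose_matrix_vector dot_lmul_matrix matrix_vector_mul_assoc E_inverse)

lemma jump_shift_measurable: "jump_shift js \<in> borel_measurable borel"
proof -
  have "continuous_on UNIV (\<lambda>y. transpose (E (- fst y)) *v snd y)" by (intro continuous_intros)
  from measurable_compose[OF _ borel_measurable_continuous_onI[OF this], of "\<lambda>t. (t, jump_sum js t)" borel]
  show ?thesis unfolding jump_shift_def[abs_def] using jump_sum_measurable[of js] borel_prod by (simp add: borel_prod[symmetric])
qed

lemma jump_shift_bounded: "\<exists>K. \<forall>t\<in>{0..T}. norm (jump_shift js t) \<le> K"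
proof -
  obtain c where c: "0 < c" "\<And>(M :: real ^ 'n ^ 'n) v. norm (M *v v) \<le> norm M * norm v * c"
    using bounded_bilinear.pos_bounded[OF bounded_bilinear_matrix_vector_mult] by blast
  have "compact ((\<lambda>t. transpose (E (- t))) ` {0..T})" by (intro compact_continuous_image continuous_intros) auto
  then obtain e where e: "\<And>t. t \<in> {0..T} \<Longrightarrow> norm (transpose (E (- t))) \<le> e"
    using compact_imp_bounded bounded_iff by (metis imageI)
  obtain K where K: "\<And>t. norm (jump_sum js t) \<le> K" using jump_sum_bounded by blast
  have "norm (jump_shift js t) \<le> e * K * c" if "t \<in> {0..T}" for t
    unfolding jump_shift_def
    by (rule order_trans[OF c(2)] mult_right_mono mult_mono)+ (use e[OF that] K[of t] c(1) order_trans[OF norm_ge_zero e[OF that]] in auto)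
  then show ?thesis by blast
qed

lemma jump_shift_continuous:
  assumes "t \<notin> fst ` set js" shows "continuous (at t within X) (jump_shift js)"
proof -
  have "(\<lambda>s. transpose (E (- s)) *v jump_sum js t) \<midarrow>t\<rightarrow> jump_shift js t"
  proof -
    have "continuous_on UNIV (\<lambda>s. transpose (E (- s)) *v jump_sum js t)" by (intro continuous_intros)
    then show ?thesis unfolding jump_shift_def using continuous_on_eq_continuous_at[OF open_UNIV] by (metis isCont_def UNIV_I)
  qed
  then have "((\<lambda>s. transpose (E (- s)) *v jump_sum js t) \<longlongrightarrow> jump_shift js t) (at t within X)" by (rule tendsto_within_subset) simp
  then show ?thesis unfolding continuous_within
    by (rule Lim_transform_eventually)
      (use jump_sum_locally_constant[OF assms, of X] in \<open>auto elim!: eventually_mono simp: jump_shift_def\<close>)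
qed

lemma energy_jumps:
  assumes g: "g \<in> Bb_space T" and F: "spectral T (spectrum T (\<lambda>t. g (snap T n t))) D"
  shows "energy p k b (\<lambda>t x. cis ((jump_sum js t - jump_sum js (fst x)) \<bullet> label E x) *
      (of_real (kernel T E (\<lambda>_. B) t x) * spectrum T (\<lambda>t. g (snap T n t)) x))
    \<le> ennreal (C powr p) * Lp_integral T p (\<lambda>t. g (snap T n t))"
proof -
  define f where "f t = g (snap T n t)" for t
  define c where "c = jump_shift js"
  have cm: "c \<in> borel_measurable borel" unfolding c_def by (rule jump_shift_measurable)
  define F' where "F' x = cis (- (c (fst x) \<bullet> snd x)) * spectrum T f x" for x
  note F = F[folded f_def]
  have lc: "\<forall>\<^sub>F s in at t within {0..T}. snap T n s = snap T n t" if "t \<in> {0..T} - nodes T n" for t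
    by (rule snap_locally_constant[OF T that])
  have fn: "finite (nodes T n)" by (simp add: nodes_def[OF T])
  have f: "f \<in> Bb_space T" using Bb_snap[OF T g] by (simp add: f_def[abs_def])
  obtain K where K: "\<And>t. t \<in> {0..T} \<Longrightarrow> norm (c t) \<le> K" using jump_shift_bounded unfolding c_def by blast
  have "(\<lambda>t z. g (snap T n t) (z - c t)) \<in> Bb_space T"
  proof (rule Bb_compose[where G="nodes T n \<union> fst ` set js" and f=g and K=K])
    show "continuous (at t within {0..T}) c" if "t \<in> {0..T} - (nodes T n \<union> fst ` set js)" for t
      unfolding c_def by (rule jump_shift_continuous) (use that in auto)
  qed (use g lc fn snap_range[OF T] snap_measurable[OF T] cm K in auto)
  then have f': "(\<lambda>t z. f t (z - c t)) \<in> Bb_space T" by (simp add: f_def)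
  have F': "spectral T F' D"
  proof -
    have fs: "(fst :: real \<times> (real ^ 'n) \<Rightarrow> real) \<in> borel_measurable borel" "(snd :: real \<times> (real ^ 'n) \<Rightarrow> real ^ 'n) \<in> borel_measurable borel"
      by (intro borel_measurable_continuous_onI continuous_intros)+
    have "(\<lambda>x. c (fst x) \<bullet> snd x) \<in> borel_measurable borel" by (intro borel_measurable_inner measurable_compose[OF fs(1) cm] fs)
    then have "(\<lambda>x. cis (- (c (fst x) \<bullet> snd x))) \<in> borel_measurable borel"
      by (intro measurable_compose[OF _ cis_measurable]) simp
    then show ?thesis using F unfolding F'_def spectral_def by (auto simp: norm_mult)
  qed
  have r': "represents T F' (\<lambda>t z. f t (z - c t))"
    unfolding represents_def
  proof (intro ballI allI)
    fix s z assume s: "s \<in> {0..T}"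
    have "f s (z - c s) = osc_integral lborel (\<lambda>\<xi>. spectrum T f (s, \<xi>)) (\<lambda>\<xi>. \<xi>) (z - c s)"
      using represents_spectrum[OF f] s by (simp add: represents_def)
    also have "\<dots> = osc_integral lborel (\<lambda>\<xi>. F' (s, \<xi>)) (\<lambda>\<xi>. \<xi>) z"
      unfolding osc_integral_def F'_def
      by (intro Bochner_Integration.integral_cong[OF refl])
        (simp only: inner_diff_left diff_conv_add_uminus[of "inner z _"] cis_mult[symmetric] mult_ac fst_conv snd_conv)
    finally show "f s (z - c s) = osc_integral lborel (\<lambda>\<xi>. F' (s, \<xi>)) (\<lambda>\<xi>. \<xi>) z" .
  qed
  have eq: "cis ((jump_sum js t - jump_sum js (fst x)) \<bullet> label E x) * (of_real (kernel T E (\<lambda>_. B) t x) * spectrum T f x)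
      = cis (c t \<bullet> (E t *v label E x)) * (of_real (kernel T E (\<lambda>_. B) t x) * F' x)" for t x
  proof -
    have "c (fst x) \<bullet> snd x = jump_sum js (fst x) \<bullet> label E x"
      using jump_shift_inner[of js "fst x" "label E x"] by (simp only: c_def E_label)
    then show ?thesis
      unfolding F'_def c_def jump_shift_inner
      by (simp only: inner_diff_left diff_conv_add_uminus[of "inner (jump_sum js t) _"] cis_mult[symmetric] mult_ac c_def)
  qed
  have "energy p k b (\<lambda>t x. cis ((jump_sum js t - jump_sum js (fst x)) \<bullet> label E x) * (of_real (kernel T E (\<lambda>_. B) t x) * spectrum T f x))
      = energy p k b (\<lambda>t x. of_real (kernel T E (\<lambda>_. B) t x) * F' x)"
    unfolding eq by (rule energy_shift[OF dominated_kernel[OF F'] cm blocks])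
  also have "\<dots> \<le> ennreal (C powr p) * Lp_integral T p (\<lambda>t z. f t (z - c t))" by (rule energy_mild[OF f' F' r'])
  also have "Lp_integral T p (\<lambda>t z. f t (z - c t)) = Lp_integral T p f" by (rule Lp_integral_shift[OF f cm])
  finally show ?thesis by (simp add: f_def[abs_def])
qed

lemma cosines_measurable: "(\<lambda>y. cosines E ks (fst y) (snd y)) \<in> borel_measurable borel"
proof (induction ks)
  case (Cons j ks)
  have m: "(\<lambda>y :: real \<times> real \<times> (real ^ 'n). fst y) \<in> borel_measurable borel" "(\<lambda>y :: real \<times> real \<times> (real ^ 'n). fst (snd y)) \<in> borel_measurable borel"
    "(\<lambda>y :: real \<times> real \<times> (real ^ 'n). snd j \<bullet> label E (snd y)) \<in> borel_measurable borel"
    by (intro borel_measurable_continuous_onI continuous_intros)+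
  have "(\<lambda>y :: real \<times> real \<times> (real ^ 'n). cos (crossed (fst j) (fst y) (fst (snd y)) * (snd j \<bullet> label E (snd y)))) \<in> borel_measurable borel"
    unfolding crossed_def using m by measurable
  from borel_measurable_times[OF this Cons.IH] show ?case by (simp add: cosines_def)
qed (simp add: cosines_def)

lemma cosines_le: "\<bar>cosines E ks t x\<bar> \<le> 1"
proof (induction ks)
  case (Cons j ks)
  have "\<bar>cosines E (j # ks) t x\<bar> = \<bar>cos (crossed (fst j) t (fst x) * (snd j \<bullet> label E x))\<bar> * \<bar>cosines E ks t x\<bar>"
    by (simp add: cosines_def abs_mult)
  also have "\<dots> \<le> 1 * 1" by (intro mult_mono Cons.IH abs_cos_le_one) auto
  finally show ?case by simp
qed (simp add: cosines_def)

lemma dominated_multiply: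
  assumes a: "dominated D a" and m: "(\<lambda>y. m (fst y) (snd y)) \<in> borel_measurable borel" and b: "\<And>t x. norm (m t x) \<le> 1"
  shows "dominated D (\<lambda>t x. m t x * a t x)"
  unfolding dominated_def
proof (intro conjI ballI allI)
  show "(\<lambda>y. m (fst y) (snd y) * a (fst y) (snd y)) \<in> borel_measurable borel"
    using a m unfolding dominated_def by (intro borel_measurable_times) auto
  fix t x assume "t \<in> {0..T}"
  then have "norm (a t x) \<le> indicator {0..T} (fst x) * D (snd x)" using a unfolding dominated_def by blast
  moreover have "norm (m t x * a t x) \<le> 1 * norm (a t x)" unfolding norm_mult by (intro mult_right_mono b) auto
  ultimately show "norm (m t x * a t x) \<le> indicator {0..T} (fst x) * D (snd x)" by simp
qed

lemma dominated_cosines: "dominated D a \<Longrightarrow> dominated D (\<lambda>t x. of_real (cosines E ks t x) * a t x)"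
  by (rule dominated_multiply) (use cosines_measurable[of ks] cosines_le in auto)

lemma dominated_jump:
  assumes "dominated D a" shows "dominated D (\<lambda>t x. cis ((jump_sum js t - jump_sum js (fst x)) \<bullet> label E x) * a t x)"
proof (rule dominated_multiply[OF assms])
  have m: "(\<lambda>y :: real \<times> real \<times> (real ^ 'n). fst y) \<in> borel_measurable borel" "(\<lambda>y :: real \<times> real \<times> (real ^ 'n). fst (snd y)) \<in> borel_measurable borel"
    "(\<lambda>y :: real \<times> real \<times> (real ^ 'n). label E (snd y)) \<in> borel_measurable borel"
    by (intro borel_measurable_continuous_onI continuous_intros)+
  show "(\<lambda>y :: real \<times> real \<times> (real ^ 'n). cis ((jump_sum js (fst y) - jump_sum js (fst (snd y))) \<bullet> label E (snd y))) \<in> borel_measurable borel"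
    by (intro measurable_compose[OF _ cis_measurable] borel_measurable_inner borel_measurable_diff
      measurable_compose[OF m(1) jump_sum_measurable] measurable_compose[OF m(2) jump_sum_measurable] m(3))
qed simp

text \<open>The average of the two translations by \<open>v\<close> and \<open>- v\<close> at time \<open>\<tau>\<close> multiplies the amplitude by a cosine,
  and convexity of the \<open>p\<close>-th power keeps the bound.\<close>

lemma energy_cosines:
  assumes F: "spectral T F D" and a: "dominated D a"
    and R: "\<And>js. energy p k b (\<lambda>t x. cis ((jump_sum js t - jump_sum js (fst x)) \<bullet> label E x) * a t x) \<le> R"
  shows "energy p k b (\<lambda>t x. of_real (cosines E ks t x) * a t x) \<le> R"
proof -
  \<comment> \<open>Strengthened by an arbitrary list \<open>js\<close> of deterministic jumps: one
    more cosine means averaging over two longer lists.\<close>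
  have "energy p k b (\<lambda>t x. cis ((jump_sum js t - jump_sum js (fst x)) \<bullet> label E x) * (of_real (cosines E ks t x) * a t x)) \<le> R" for js
  proof (induction ks arbitrary: js)
    case Nil
    then show ?case using R[of js] by (simp add: cosines_def)
  next
    case (Cons j ks)
    obtain \<tau> v where j: "j = (\<tau>, v)" by force
    let ?a = "\<lambda>js t x. cis ((jump_sum js t - jump_sum js (fst x)) \<bullet> label E x) * (of_real (cosines E ks t x) * a t x)"
    have "energy p k b (\<lambda>t x. (?a ((\<tau>, v) # js) t x + ?a ((\<tau>, - v) # js) t x) / 2) \<le> R"
      using p by (intro energy_midpoint[OF F dominated_jump dominated_jump blocks _ Cons.IH Cons.IH] dominated_cosines a) auto
    moreover have "(?a ((\<tau>, v) # js) t x + ?a ((\<tau>, - v) # js) t x) / 2 =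
        cis ((jump_sum js t - jump_sum js (fst x)) \<bullet> label E x) * (of_real (cosines E (j # ks) t x) * a t x)" for t x
    proof -
      define y where "y = crossed \<tau> t (fst x) * (v \<bullet> label E x)"
      define J where "J = (jump_sum js t - jump_sum js (fst x)) \<bullet> label E x"
      have 1: "(jump_sum ((\<tau>, v) # js) t - jump_sum ((\<tau>, v) # js) (fst x)) \<bullet> label E x = J + y"
        "(jump_sum ((\<tau>, - v) # js) t - jump_sum ((\<tau>, - v) # js) (fst x)) \<bullet> label E x = J + - y"
        by (auto simp: J_def y_def crossed_def inner_diff_left inner_add_left)
      have 2: "(cis y + cis (- y)) / 2 = of_real (cos y)" by (simp add: complex_eq_iff)
      have "cis (J + y) * c + cis (J + - y) * c = 2 * (cis J * ((cis y + cis (- y)) / 2 * c))" for c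
        by (simp only: cis_mult[symmetric]) (simp add: algebra_simps)
      then have "(cis (J + y) * c + cis (J + - y) * c) / 2 = cis J * (of_real (cos y) * c)" for c unfolding 2 by simp
      then show ?thesis unfolding 1 by (simp add: cosines_def j J_def[symmetric] y_def[symmetric] mult.assoc)
    qed
    ultimately show ?case by (simp only:)
  qed
  from this[of "[]"] show ?thesis by simp
qed

end

section \<open>Passage to the limit\<close>

text \<open>Both functions agree with \<open>1 - x\<^sup>2 / 2\<close> up to multiples of
  \<open>x ^ 4\<close>: 1/24 from the Taylor expansion of the cosine, and 1/4 from
  \<open>exp (- u) \<le> 1 - u + u\<^sup>2\<close> with \<open>u = x\<^sup>2 / 2\<close>.\<close>

lemma cos_approx_gaussian: "\<bar>cos x - exp (- (x\<^sup>2 / 2))\<bar> \<le> x ^ 4" for x :: real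
proof -
  obtain t where t: "cos x = (\<Sum>m<4. cos_coeff m * x ^ m) + (cos (t + 1/2 * real 4 * pi) / fact 4) * x ^ 4"
    using Maclaurin_cos_expansion[of x 4] by blast
  define c where "c = cos (t + 1/2 * real 4 * pi)"
  have "{..<4 :: nat} = {0, 1, 2, 3}" by auto
  then have "(\<Sum>m<4. cos_coeff m * x ^ m) = 1 - x\<^sup>2 / 2" by (simp add: cos_coeff_def)
  moreover have "fact 4 = (24 :: real)" by (simp add: fact_numeral)
  ultimately have e: "cos x - (1 - x\<^sup>2 / 2) = c * (x ^ 4 / 24)" using t by (simp add: c_def)
  have "\<bar>c * (x ^ 4 / 24)\<bar> \<le> 1 * (x ^ 4 / 24)"
    unfolding abs_mult by (intro mult_mono) (auto simp: c_def)
  then have 1: "\<bar>cos x - (1 - x\<^sup>2 / 2)\<bar> \<le> x ^ 4 / 24" unfolding e by simp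
  define u where "u = x\<^sup>2 / 2"
  have u: "0 \<le> u" "u\<^sup>2 = x ^ 4 / 4" by (auto simp: u_def power_divide simp flip: power_mult)
  have 2: "1 - u \<le> exp (- u)" using exp_ge_add_one_self[of "- u"] by simp
  have 3: "exp (- u) \<le> 1 - u + u\<^sup>2"
  proof -
    have "exp (- u) \<le> 1 / (1 + u)"
      using exp_ge_add_one_self[of u] u(1) by (simp add: exp_minus inverse_eq_divide frac_le)
    also have "\<dots> \<le> 1 - u + u\<^sup>2"
    proof -
      have "(1 - u + u\<^sup>2) * (1 + u) = 1 + u ^ 3" by (simp add: algebra_simps power2_eq_square power3_eq_cube)
      then have "1 \<le> (1 - u + u\<^sup>2) * (1 + u)" using u(1) by simp
      then show ?thesis using u(1) by (simp add: pos_divide_le_eq)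
    qed
    finally show ?thesis .
  qed
  have "0 \<le> x ^ 4" by simp
  then show ?thesis using 1 2 3 unfolding u(2) u_def[symmetric] by arith
qed

text \<open>Products of numbers of modulus at most 1 differ by at most the sum of the differences of
  their factors; each difference is of fourth order, hence at most \<open>e\<close> times the
  square.\<close>

lemma prod_cos_approx_gaussian:
  fixes y :: "'i \<Rightarrow> real"
  assumes e: "\<And>i. i \<in> I \<Longrightarrow> (y i)\<^sup>2 \<le> e"
  shows "\<bar>(\<Prod>i\<in>I. cos (y i)) - exp (- ((\<Sum>i\<in>I. (y i)\<^sup>2) / 2))\<bar> \<le> e * (\<Sum>i\<in>I. (y i)\<^sup>2)"
proof (cases "finite I")
  case True
  have "exp (- ((\<Sum>i\<in>I. (y i)\<^sup>2) / 2)) = (\<Prod>i\<in>I. exp (- ((y i)\<^sup>2 / 2)))"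
    using exp_sum[OF True, of "\<lambda>i. - ((y i)\<^sup>2 / 2)"] by (simp add: sum_divide_distrib sum_negf)
  then have "\<bar>(\<Prod>i\<in>I. cos (y i)) - exp (- ((\<Sum>i\<in>I. (y i)\<^sup>2) / 2))\<bar> \<le> (\<Sum>i\<in>I. \<bar>cos (y i) - exp (- ((y i)\<^sup>2 / 2))\<bar>)"
    using norm_prod_diff[of I "\<lambda>i. cos (y i)" "\<lambda>i. exp (- ((y i)\<^sup>2 / 2))"] by simp
  also have "\<dots> \<le> (\<Sum>i\<in>I. e * (y i)\<^sup>2)"
  proof (rule sum_mono)
    fix i assume i: "i \<in> I"
    have "\<bar>cos (y i) - exp (- ((y i)\<^sup>2 / 2))\<bar> \<le> (y i) ^ 4" by (rule cos_approx_gaussian)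
    also have "\<dots> = (y i)\<^sup>2 * (y i)\<^sup>2" by (simp add: power4_eq_xxxx power2_eq_square)
    also have "\<dots> \<le> e * (y i)\<^sup>2" by (intro mult_right_mono e i) auto
    finally show "\<bar>cos (y i) - exp (- ((y i)\<^sup>2 / 2))\<bar> \<le> e * (y i)\<^sup>2" .
  qed
  finally show ?thesis by (simp add: sum_distrib_left)
qed simp

lemma cosines_enumerate:
  assumes "finite I" shows "\<exists>ks. \<forall>t x. cosines E ks t x = (\<Prod>i\<in>I. cos (crossed (\<tau> i) t (fst x) * (v i \<bullet> label E x)))"
  using assms
proof (induction I)
  case empty
  show ?case by (rule exI[of _ "[]"]) (simp add: cosines_def)
next
  case (insert i I)
  then obtain ks where "\<forall>t x. cosines E ks t x = (\<Prod>i\<in>I. cos (crossed (\<tau> i) t (fst x) * (v i \<bullet> label E x)))" by blast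
  with insert.hyps show ?case by (intro exI[of _ "(\<tau> i, v i) # ks"]) (simp add: cosines_def)
qed

text \<open>The positive grid points not exceeding \<open>t\<close> form an initial segment, and the
  last of them (or 0) is the rounded time, so the sum telescopes.\<close>

lemma snap_telescope:
  fixes \<Phi> :: "real \<Rightarrow> real"
  assumes T: "0 < T" and t: "t \<in> {0..T}"
  shows "(\<Sum>j<Suc n. (if mesh T n * real (Suc j) \<le> t then 1 else 0) * (\<Phi> (mesh T n * real (Suc j)) - \<Phi> (mesh T n * real j))) = \<Phi> (snap T n t) - \<Phi> 0"
proof -
  define h where "h = mesh T n"
  have h: "0 < h" using mesh_pos[OF T] by (simp add: h_def)
  define N where "N = nat \<lfloor>t / h\<rfloor>"
  have fl: "0 \<le> \<lfloor>t / h\<rfloor>" using t h by simp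
  have "t / h \<le> real (Suc n)" using t by (simp add: h_def mesh_def divide_le_eq T pos_le_divide_eq)
  then have "\<lfloor>t / h\<rfloor> \<le> int (Suc n)" by (metis floor_mono floor_of_nat)
  then have N: "N \<le> Suc n" unfolding N_def by (simp only: nat_le_iff)
  have iff: "h * real (Suc j) \<le> t \<longleftrightarrow> j < N" for j
  proof -
    have "h * real (Suc j) \<le> t \<longleftrightarrow> real_of_int (int (Suc j)) \<le> t / h"
      unfolding pos_le_divide_eq[OF h] of_int_of_nat_eq by (simp only: mult.commute)
    also have "\<dots> \<longleftrightarrow> int (Suc j) \<le> \<lfloor>t / h\<rfloor>" by (simp only: le_floor_iff)
    also have "\<dots> \<longleftrightarrow> j < N" unfolding N_def using fl by linarith
    finally show ?thesis .
  qed
  have "(\<Sum>j<Suc n. (if h * real (Suc j) \<le> t then 1 else 0) * (\<Phi> (h * real (Suc j)) - \<Phi> (h * real j)))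
    = (\<Sum>j<Suc n. if j < N then \<Phi> (h * real (Suc j)) - \<Phi> (h * real j) else 0)"
    unfolding iff by (intro sum.cong) auto
  also have "\<dots> = (\<Sum>j<N. \<Phi> (h * real (Suc j)) - \<Phi> (h * real j))"
    by (rule sum.mono_neutral_cong_right) (use N in auto)
  also have "\<dots> = \<Phi> (h * real N) - \<Phi> 0" using sum_lessThan_telescope[of "\<lambda>j. \<Phi> (h * real j)" N] by simp
  also have "h * real N = snap T n t" using fl by (simp add: N_def snap_def h_def)
  finally show ?thesis by (simp only: h_def)
qed

context kolmogorov
begin

text \<open>The increment of \<open>cumulated\<close> is symmetric, as an integral of symmetric
  matrices, and nonnegative by monotonicity of \<open>damping\<close>. The Cholesky vectors serve
  all \<open>\<zeta>\<close> at once.\<close>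

lemma damping_increment_sum_of_squares:
  assumes st: "0 \<le> s" "s \<le> t" "t \<le> T"
  shows "\<exists>\<sigma> :: 'n \<Rightarrow> real ^ 'n. \<forall>\<zeta>. (\<Sum>l\<in>UNIV. (\<sigma> l \<bullet> \<zeta>)\<^sup>2) = damping T E Q t \<zeta> - damping T E Q s \<zeta>"
proof -
  define M where "M = cumulated T E Q t - cumulated T E Q s"
  have form: "(M *v \<zeta>) \<bullet> \<zeta> = damping T E Q t \<zeta> - damping T E Q s \<zeta>" for \<zeta>
    by (simp add: M_def damping_def matrix_vector_mult_diff_rdistrib inner_diff_left)
  have tr: "transpose (cumulated T E Q u) = cumulated T E Q u" for u
  proof -
    let ?I = "{0..max 0 (min T u)}"
    have "linear (transpose :: real ^ 'n ^ 'n \<Rightarrow> real ^ 'n ^ 'n)" by (rule linearI) (simp_all add: transpose_def vec_eq_iff)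
    then have bl: "bounded_linear (transpose :: real ^ 'n ^ 'n \<Rightarrow> real ^ 'n ^ 'n)" by (simp add: linear_conv_bounded_linear)
    have int: "(\<lambda>r. transpose (E r) ** Q r ** E r) integrable_on ?I"
      by (rule integrable_continuous_real[OF continuous_on_subset[OF integrand_cont]]) (use T in auto)
    have "transpose (cumulated T E Q u) = integral ?I (\<lambda>r. transpose (transpose (E r) ** Q r ** E r))"
      using integral_linear[OF int bl] by (simp add: cumulated_def o_def)
    also have "\<dots> = integral ?I (\<lambda>r. transpose (E r) ** Q r ** E r)"
    proof (rule Henstock_Kurzweil_Integration.integral_cong)
      fix r assume "r \<in> ?I"
      then have "transpose (Q r) = Q r" using Q_psd[of r] T by (auto simp: sym_nonneg_matrix_def)
      then show "transpose (transpose (E r) ** Q r ** E r) = transpose (E r) ** Q r ** E r"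
        by (simp add: matrix_transpose_mul matrix_mul_assoc)
    qed
    finally show ?thesis by (simp add: cumulated_def)
  qed
  have "transpose M = M"
  proof -
    have "transpose M = transpose (cumulated T E Q t) - transpose (cumulated T E Q s)" by (simp add: M_def transpose_def vec_eq_iff)
    then show ?thesis by (simp add: tr M_def)
  qed
  moreover have "0 \<le> (M *v \<zeta>) \<bullet> \<zeta>" for \<zeta> unfolding form using damping_mono[OF st, of \<zeta>] by simp
  ultimately obtain \<sigma> :: "'n \<Rightarrow> real ^ 'n" where \<sigma>: "\<forall>i j. M $ i $ j = (\<Sum>l\<in>UNIV. \<sigma> l $ i * \<sigma> l $ j)"
    using psd_sum_of_squares[of M] by (auto simp: sym_nonneg_matrix_def)
  have "(\<Sum>l\<in>UNIV. (\<sigma> l \<bullet> \<zeta>)\<^sup>2) = (M *v \<zeta>) \<bullet> \<zeta>" for \<zeta>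
  proof -
    have "(M *v \<zeta>) \<bullet> \<zeta> = (\<Sum>i\<in>UNIV. \<Sum>j\<in>UNIV. \<Sum>l\<in>UNIV. (\<sigma> l $ i * \<zeta> $ i) * (\<sigma> l $ j * \<zeta> $ j))"
      by (simp add: inner_vec_def matrix_vector_mult_def \<sigma> sum_distrib_right sum_distrib_left mult_ac)
    also have "\<dots> = (\<Sum>l\<in>UNIV. \<Sum>j\<in>UNIV. \<Sum>i\<in>UNIV. (\<sigma> l $ i * \<zeta> $ i) * (\<sigma> l $ j * \<zeta> $ j))"
      by (subst sum.swap, subst (2) sum.swap, subst sum.swap) (rule refl)
    also have "\<dots> = (\<Sum>l\<in>UNIV. (\<sigma> l \<bullet> \<zeta>)\<^sup>2)"
      by (simp add: inner_vec_def power2_eq_square sum_distrib_right sum_distrib_left)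
    finally show ?thesis by simp
  qed
  then show ?thesis using form by auto
qed

text \<open>The diffusion accumulated over a grid cell is split into squares, and each square
  becomes one jump placed at the right end of the cell. A jump counts exactly when it falls after
  the source time and not after \<open>t\<close>, so the squares telescope to the damping between
  the two rounded times.\<close>

lemma cosines_approx_damping:
  "\<exists>ks. \<forall>t\<in>{0..T}. \<forall>x e. fst x \<in> {0..t} \<longrightarrow>
     (\<forall>j<Suc n. damping T E Q (mesh T n * real (Suc j)) (label E x) - damping T E Q (mesh T n * real j) (label E x) \<le> e) \<longrightarrow>
     \<bar>cosines E ks t x - exp (- (damping T E Q (snap T n t) (label E x) - damping T E Q (snap T n (fst x)) (label E x)))\<bar>
       \<le> 4 * e * (damping T E Q T (label E x) - damping T E Q 0 (label E x))"
proof -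
  define h where "h = mesh T n"
  have h: "0 < h" using mesh_pos[OF T] by (simp add: h_def)
  have hT: "h * real (Suc j) \<le> T" if "j < Suc n" for j
  proof -
    have "h * real (Suc j) \<le> h * real (Suc n)" using h that by (intro mult_left_mono) auto
    then show ?thesis by (simp add: h_def mesh_def)
  qed
  have "\<exists>\<sigma> :: 'n \<Rightarrow> real ^ 'n. \<forall>\<zeta>. (\<Sum>l\<in>UNIV. (\<sigma> l \<bullet> \<zeta>)\<^sup>2) = damping T E Q (h * real (Suc j)) \<zeta> - damping T E Q (h * real j) \<zeta>"
    if "j < Suc n" for j
    by (rule damping_increment_sum_of_squares) (use h hT[OF that] in \<open>auto intro: mult_left_mono\<close>)
  then obtain \<sigma> :: "nat \<Rightarrow> 'n \<Rightarrow> real ^ 'n" where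
    \<sigma>: "\<And>j \<zeta>. j < Suc n \<Longrightarrow> (\<Sum>l\<in>UNIV. (\<sigma> j l \<bullet> \<zeta>)\<^sup>2) = damping T E Q (h * real (Suc j)) \<zeta> - damping T E Q (h * real j) \<zeta>"
    by metis
  define I where "I = {..<Suc n} \<times> (UNIV :: 'n set)"
  have "finite I" by (simp add: I_def)
  \<comment> \<open>The factor \<open>sqrt 2\<close> makes \<open>exp (- (y\<^sup>2 / 2))\<close>
    the exponential of minus the plain square, without the half.\<close>
  then obtain ks where ks: "\<And>t x. cosines E ks t x = (\<Prod>i\<in>I. cos (crossed (h * real (Suc (fst i))) t (fst x) * ((sqrt 2 *\<^sub>R \<sigma> (fst i) (snd i)) \<bullet> label E x)))"
    using cosines_enumerate[of I E "\<lambda>i. h * real (Suc (fst i))" "\<lambda>i. sqrt 2 *\<^sub>R \<sigma> (fst i) (snd i)"]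
    by blast
  have "\<bar>cosines E ks t x - exp (- (damping T E Q (snap T n t) (label E x) - damping T E Q (snap T n (fst x)) (label E x)))\<bar>
       \<le> 4 * e * (damping T E Q T (label E x) - damping T E Q 0 (label E x))"
    if t: "t \<in> {0..T}" and s: "fst x \<in> {0..t}"
      and e: "\<forall>j<Suc n. damping T E Q (h * real (Suc j)) (label E x) - damping T E Q (h * real j) (label E x) \<le> e" for t x e
  proof -
    define \<zeta> where "\<zeta> = label E x"
    define d where "d r = damping T E Q r \<zeta>" for r
    define c where "c j = crossed (h * real (Suc j)) t (fst x)" for j
    have s': "fst x \<in> {0..T}" using s t by auto
    have c01: "c j = 0 \<or> c j = 1" for j using s by (auto simp: c_def crossed_def)
    then have csq: "(c j)\<^sup>2 = c j" for j by (metis power_one zero_power2)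
    have c1: "0 \<le> c j" "c j \<le> 1" for j using c01[of j] by auto
    define y where "y i = c (fst i) * ((sqrt 2 *\<^sub>R \<sigma> (fst i) (snd i)) \<bullet> \<zeta>)" for i
    have ysq: "(y (j, l))\<^sup>2 = c j * (2 * (\<sigma> j l \<bullet> \<zeta>)\<^sup>2)" for j l
      by (simp add: y_def power_mult_distrib csq)
    have yb: "(y i)\<^sup>2 \<le> 2 * e" if iI: "i \<in> I" for i
    proof -
      obtain j l where i: "i = (j, l)" "j < Suc n" using iI by (auto simp: I_def)
      have "(\<sigma> j l \<bullet> \<zeta>)\<^sup>2 \<le> (\<Sum>l\<in>UNIV. (\<sigma> j l \<bullet> \<zeta>)\<^sup>2)" by (rule member_le_sum) auto
      also have "\<dots> \<le> e" using e i(2) by (simp add: \<sigma>[OF i(2)] \<zeta>_def)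
      finally have "(\<sigma> j l \<bullet> \<zeta>)\<^sup>2 \<le> e" .
      moreover have "c j * (2 * (\<sigma> j l \<bullet> \<zeta>)\<^sup>2) \<le> 1 * (2 * (\<sigma> j l \<bullet> \<zeta>)\<^sup>2)" by (intro mult_right_mono c1) auto
      ultimately show ?thesis by (simp add: i ysq)
    qed
    have "(\<Sum>i\<in>I. (y i)\<^sup>2) = (\<Sum>j<Suc n. \<Sum>l\<in>UNIV. (y (j, l))\<^sup>2)" unfolding I_def by (simp add: sum.cartesian_product)
    also have "\<dots> = (\<Sum>j<Suc n. 2 * (c j * (d (h * real (Suc j)) - d (h * real j))))"
    proof (rule sum.cong[OF refl])
      fix j assume "j \<in> {..<Suc n}"
      then show "(\<Sum>l\<in>UNIV. (y (j, l))\<^sup>2) = 2 * (c j * (d (h * real (Suc j)) - d (h * real j)))"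
        using \<sigma>[of j \<zeta>] by (simp add: ysq d_def flip: sum_distrib_left)
    qed
    also have "\<dots> = 2 * ((d (snap T n t) - d 0) - (d (snap T n (fst x)) - d 0))"
      unfolding snap_telescope[OF T t, of n d, symmetric] snap_telescope[OF T s', of n d, symmetric] h_def[symmetric]
      by (simp only: sum_distrib_left[symmetric] sum_subtractf[symmetric] c_def crossed_def left_diff_distrib)
    finally have ysum: "(\<Sum>i\<in>I. (y i)\<^sup>2) = 2 * (d (snap T n t) - d (snap T n (fst x)))" by simp
    have e0: "0 \<le> e"
    proof -
      have "damping T E Q (h * real 0) (label E x) \<le> damping T E Q (h * real (Suc 0)) (label E x)"
        using hT[of 0] h by (intro damping_mono) auto
      then show ?thesis using e by force
    qed
    \<comment> \<open>Every squared angle is at most \<open>2 * e\<close> and their sum at most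
      twice the total damping, whence the constant 4.\<close>
    have "\<bar>(\<Prod>i\<in>I. cos (y i)) - exp (- ((\<Sum>i\<in>I. (y i)\<^sup>2) / 2))\<bar> \<le> (2 * e) * (\<Sum>i\<in>I. (y i)\<^sup>2)"
      by (rule prod_cos_approx_gaussian[OF yb])
    also have "(\<Prod>i\<in>I. cos (y i)) = cosines E ks t x" unfolding ks y_def c_def \<zeta>_def ..
    also have "exp (- ((\<Sum>i\<in>I. (y i)\<^sup>2) / 2)) = exp (- (d (snap T n t) - d (snap T n (fst x))))"
    proof -
      have half: "u = 2 * v \<Longrightarrow> u / 2 = v" for u v :: real by simp
      have "(\<Sum>i\<in>I. (y i)\<^sup>2) / 2 = d (snap T n t) - d (snap T n (fst x))" by (rule half[OF ysum])
      then show ?thesis by (simp only:)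
    qed
    also have "(2 * e) * (\<Sum>i\<in>I. (y i)\<^sup>2) \<le> (2 * e) * (2 * (d T - d 0))"
    proof (intro mult_left_mono)
      have "d (snap T n t) \<le> d T" "d 0 \<le> d (snap T n (fst x))"
        using snap_range[OF T t, of n] snap_range[OF T s', of n] unfolding d_def by (auto intro!: damping_mono)
      then show "(\<Sum>i\<in>I. (y i)\<^sup>2) \<le> 2 * (d T - d 0)" by (simp add: ysum)
    qed (use e0 in auto)
    also have "(2 * e) * (2 * (d T - d 0)) = 4 * e * (d T - d 0)" by simp
    finally show ?thesis by (simp only: d_def \<zeta>_def)
  qed
  then show ?thesis unfolding h_def by blast
qed

text \<open>For a fixed wave the damping is uniformly continuous in time, so its increments over the
  cells fall below any \<open>e\<close>, and the rounded times converge to the true ones. The lists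
  of jumps are chosen before \<open>t\<close> and \<open>x\<close>, as one list must serve the whole
  superposition.\<close>

lemma cosines_limit:
  "\<exists>ks. \<forall>t\<in>{0..T}. \<forall>x. fst x \<in> {0..t} \<longrightarrow>
     (\<lambda>n. cosines E (ks n) t x) \<longlonglongrightarrow> exp (- (damping T E Q t (label E x) - damping T E Q (fst x) (label E x)))"
proof -
  obtain ks where ks: "\<And>n t x e. t \<in> {0..T} \<Longrightarrow> fst x \<in> {0..t} \<Longrightarrow>
     (\<forall>j<Suc n. damping T E Q (mesh T n * real (Suc j)) (label E x) - damping T E Q (mesh T n * real j) (label E x) \<le> e) \<Longrightarrow>
     \<bar>cosines E (ks n) t x - exp (- (damping T E Q (snap T n t) (label E x) - damping T E Q (snap T n (fst x)) (label E x)))\<bar>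
       \<le> 4 * e * (damping T E Q T (label E x) - damping T E Q 0 (label E x))"
    using cosines_approx_damping by metis
  have "(\<lambda>n. cosines E (ks n) t x) \<longlonglongrightarrow> exp (- (damping T E Q t (label E x) - damping T E Q (fst x) (label E x)))"
    if t: "t \<in> {0..T}" and s: "fst x \<in> {0..t}" for t x
  proof -
    define d where "d r = damping T E Q r (label E x)" for r
    have dc: "continuous_on UNIV d" unfolding d_def by (intro continuous_intros)
    have K: "0 \<le> d T - d 0" using damping_mono[of 0 T "label E x"] T by (simp add: d_def)
    have dl: "(\<lambda>n. d (snap T n r)) \<longlonglongrightarrow> d r" for r
      using continuous_on_tendsto_compose[OF dc snap_lim[OF T]] by simp
    have z: "(\<lambda>n. cosines E (ks n) t x - exp (- (d (snap T n t) - d (snap T n (fst x))))) \<longlonglongrightarrow> 0"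
    proof (rule LIMSEQ_I)
      fix r :: real assume r: "0 < r"
      define e where "e = r / (4 * (d T - d 0) + 1)"
      have e: "0 < e" using r K by (simp add: e_def)
      have er: "4 * e * (d T - d 0) < r"
      proof -
        have "4 * e * (d T - d 0) < e * (4 * (d T - d 0) + 1)" using e by (simp add: algebra_simps)
        also have "\<dots> = r" using K by (simp add: e_def)
        finally show ?thesis .
      qed
      have "uniformly_continuous_on {0..T} d"
        by (rule compact_uniformly_continuous[OF continuous_on_subset[OF dc]]) auto
      then obtain \<delta> where \<delta>: "0 < \<delta>" "\<And>u v. u \<in> {0..T} \<Longrightarrow> v \<in> {0..T} \<Longrightarrow> dist v u < \<delta> \<Longrightarrow> dist (d v) (d u) < e"
        using e unfolding uniformly_continuous_on_def by metis
      obtain n0 where n0: "\<And>n. n0 \<le> n \<Longrightarrow> mesh T n < \<delta>"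
        using order_tendstoD(2)[OF mesh_lim[OF T] \<delta>(1)] unfolding eventually_sequentially by blast
      have "norm (cosines E (ks n) t x - exp (- (d (snap T n t) - d (snap T n (fst x)))) - 0) < r" if n: "n0 \<le> n" for n
      proof -
        have m: "0 < mesh T n" by (rule mesh_pos[OF T])
        have "d (mesh T n * real (Suc j)) - d (mesh T n * real j) \<le> e" if j: "j < Suc n" for j
        proof -
          have "mesh T n * real (Suc j) \<le> mesh T n * real (Suc n)" using m j by (intro mult_left_mono) auto
          also have "\<dots> = T" by (simp add: mesh_def)
          finally have "mesh T n * real (Suc j) \<in> {0..T}" using m by simp
          moreover have "mesh T n * real (Suc j) = mesh T n * real j + mesh T n" by (simp add: algebra_simps)
          ultimately have "dist (d (mesh T n * real (Suc j))) (d (mesh T n * real j)) < e"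
            using n0[OF n] m by (intro \<delta>(2)) (auto simp: dist_real_def)
          then show ?thesis by (simp add: dist_real_def)
        qed
        then have "\<bar>cosines E (ks n) t x - exp (- (d (snap T n t) - d (snap T n (fst x))))\<bar> \<le> 4 * e * (d T - d 0)"
          using ks[OF t s, of n e] by (simp only: d_def) blast
        then show ?thesis using er by simp
      qed
      then show "\<exists>n0. \<forall>n\<ge>n0. norm (cosines E (ks n) t x - exp (- (d (snap T n t) - d (snap T n (fst x)))) - 0) < r" by blast
    qed
    have "(\<lambda>n. exp (- (d (snap T n t) - d (snap T n (fst x))))) \<longlonglongrightarrow> exp (- (d t - d (fst x)))"
      by (intro tendsto_intros dl)
    from tendsto_add[OF z this] show ?thesis by (simp add: d_def)
  qed
  then show ?thesis by blast
qed

end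

section \<open>The estimate for the perturbed equation\<close>

context unperturbed_problem
begin

theorem perturbed_estimate:
  assumes S: "continuous_on {0..T} S" "\<And>t. t \<in> {0..T} \<Longrightarrow> sym_nonneg_matrix (S t)" and f: "f \<in> Bb_space T"
  shows "\<exists>u. is_unique_solution T (diffusion_op A (\<lambda>t. B + S t)) f u \<and> W_norm T p k b u \<le> ennreal C * Lp_norm T p f"
proof -
  interpret S: kolmogorov T A E S by unfold_locales (use S in auto)
  have BS: "sym_nonneg_matrix (B + S t)" if "t \<in> {0..T}" for t
  proof -
    have "transpose (B + S t) = transpose B + transpose (S t)" by (simp add: transpose_def vec_eq_iff)
    then show ?thesis using B S(2)[OF that] by (simp add: sym_nonneg_matrix_def matrix_vector_mult_add_rdistrib inner_add_left)
  qed
  have BSc: "continuous_on {0..T} (\<lambda>t. B + S t)" by (intro continuous_intros S)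
  interpret BS: kolmogorov T A E "\<lambda>t. B + S t" by unfold_locales (use BS BSc in auto)
  have damp: "damping T E (\<lambda>t. B + S t) t \<zeta> = damping T E (\<lambda>_. B) t \<zeta> + damping T E S t \<zeta>" for t \<zeta>
  proof -
    let ?I = "{0..max 0 (min T t)}"
    have I: "?I \<subseteq> {0..T}" using T by auto
    have "cumulated T E (\<lambda>t. B + S t) t = integral ?I (\<lambda>r. (transpose (E r) ** B ** E r) + (transpose (E r) ** S r ** E r))"
      unfolding cumulated_def
      by (simp only: bounded_bilinear.add_left[OF bounded_bilinear_matrix_mult] bounded_bilinear.add_right[OF bounded_bilinear_matrix_mult])
    also have "\<dots> = cumulated T E (\<lambda>_. B) t + cumulated T E S t"
      unfolding cumulated_def
      by (rule Henstock_Kurzweil_Integration.integral_add)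
        (rule integrable_continuous_real[OF continuous_on_subset[OF integrand_cont I]],
         rule integrable_continuous_real[OF continuous_on_subset[OF S.integrand_cont I]])
    finally show ?thesis by (simp add: damping_def matrix_vector_mult_add_rdistrib inner_add_left)
  qed
  define F where "F = spectrum T f"
  define Fn where "Fn n = spectrum T (\<lambda>t. f (snap T n t))" for n
  obtain D where F: "spectral T F D" unfolding F_def using spectral_spectrum[OF f] by blast
  \<comment> \<open>Freezing evaluates the spectrum at another time, and \<open>D\<close> does not
    depend on time, so the same majorant serves all \<open>n\<close>.\<close>
  have Fn: "spectral T (Fn n) D" for n
  proof -
    have "Fn n \<in> borel_measurable borel" using spectral_spectrum[OF Bb_snap[OF T f, of n]] by (auto simp: Fn_def spectral_def)
    moreover have "norm (Fn n x) \<le> D (snd x)" for x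
    proof -
      obtain s \<xi> where x: "x = (s, \<xi>)" by force
      show ?thesis
      proof (cases "s \<in> {0..T}")
        case True
        then have "Fn n x = F (snap T n s, \<xi>)"
          using snap_range[OF T True, of n] by (simp only: x Fn_def F_def spectrum_eq(1))
        then show ?thesis using F by (auto simp: x spectral_def)
      next
        case False
        then show ?thesis using spectral_nonneg[OF F] by (simp add: x Fn_def spectrum_eq(2))
      qed
    qed
    ultimately show ?thesis using F by (simp add: spectral_def)
  qed
  obtain ks where ks: "\<And>t x. t \<in> {0..T} \<Longrightarrow> fst x \<in> {0..t} \<Longrightarrow>
     (\<lambda>n. cosines E (ks n) t x) \<longlonglongrightarrow> exp (- (damping T E S t (label E x) - damping T E S (fst x) (label E x)))"
    using S.cosines_limit by blast
  let ?a = "\<lambda>n t x. of_real (cosines E (ks n) t x) * (of_real (kernel T E (\<lambda>_. B) t x) * Fn n x)"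
  let ?a' = "\<lambda>t x. of_real (kernel T E (\<lambda>t. B + S t) t x) * F x"
  have "energy p k b ?a' \<le> liminf (\<lambda>n. energy p k b (?a n))"
  proof (rule energy_fatou[OF F])
    show "dominated D (?a n)" for n by (intro dominated_cosines dominated_kernel Fn)
    show "dominated D ?a'" by (rule BS.dominated_kernel[OF F])
    fix t assume t: "t \<in> {0..T}"
    show "AE x in lborel. (\<lambda>n. ?a n t x) \<longlonglongrightarrow> ?a' t x"
      using AE_spectrum_snap[OF T f]
    proof eventually_elim
      case (elim x)
      show ?case
      proof (cases "fst x \<in> {0..t}")
        case True
        have "kernel T E (\<lambda>t. B + S t) t x =
            exp (- (damping T E S t (label E x) - damping T E S (fst x) (label E x))) * kernel T E (\<lambda>_. B) t x"
          using True by (simp add: kernel_def damp exp_add[symmetric])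
        then have "?a' t x = of_real (exp (- (damping T E S t (label E x) - damping T E S (fst x) (label E x)))) * (of_real (kernel T E (\<lambda>_. B) t x) * F x)"
          by (simp only: of_real_mult mult.assoc)
        moreover have "(\<lambda>n. ?a n t x) \<longlonglongrightarrow> of_real (exp (- (damping T E S t (label E x) - damping T E S (fst x) (label E x)))) * (of_real (kernel T E (\<lambda>_. B) t x) * F x)"
          using elim by (intro tendsto_mult tendsto_of_real ks t True tendsto_const) (simp add: Fn_def F_def)
        ultimately show ?thesis by (simp only:)
      qed (simp add: kernel_def)
    qed
  qed (use p blocks in auto)
  also have "\<dots> \<le> liminf (\<lambda>n. ennreal (C powr p) * Lp_integral T p (\<lambda>t. f (snap T n t)))"
  proof (rule Liminf_mono, rule always_eventually, rule allI)
    fix n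
    show "energy p k b (?a n) \<le> ennreal (C powr p) * Lp_integral T p (\<lambda>t. f (snap T n t))"
      by (rule energy_cosines[OF Fn dominated_kernel[OF Fn]])
        (use energy_jumps[OF f Fn[of n, unfolded Fn_def]] in \<open>simp only: Fn_def\<close>)
  qed
  also have "\<dots> = ennreal (C powr p) * Lp_integral T p f"
    using Lp_snap[OF T f] p by (intro lim_imp_Liminf ennreal_tendsto_cmult) auto
  finally have "W_norm T p k b (mild T E (\<lambda>t. B + S t) F) \<le> ennreal C * Lp_norm T p f"
    using ennreal_root_le_iff[of p C] p C by (simp add: BS.W_norm_mild[OF F blocks] Lp_norm_def)
  moreover have "is_unique_solution T (diffusion_op A (\<lambda>t. B + S t)) f (mild T E (\<lambda>t. B + S t) F)"
    unfolding F_def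
    by (rule unique_solutionI[OF T BSc BS BS.mild_is_solution[OF F[unfolded F_def] represents_spectrum[OF f]]])
  ultimately show ?thesis by blast
qed

end

section \<open>Nilpotent drift and nonnegative diffusion\<close>

text \<open>The transposed drift raises the block label by one per factor; with labels bounded by
  \<open>k\<close>, the power of order \<open>k + 1\<close> vanishes.\<close>

lemma drift_matrix_power:
  fixes A :: "real ^ 'n::finite ^ 'n"
  assumes "drift_matrix k b A" "matrix_power (transpose A) m $ i $ j \<noteq> 0" shows "b j = b i + m"
  using assms(2)
proof (induction m arbitrary: i)
  case 0
  then show ?case by (auto simp: mat_def split: if_splits)
next
  case (Suc m)
  then obtain l where "transpose A $ i $ l * matrix_power (transpose A) m $ l $ j \<noteq> 0"
    by (auto simp: matrix_matrix_mult_def elim!: sum.not_neutral_contains_not_neutral)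
  then have "A $ l $ i \<noteq> 0" "matrix_power (transpose A) m $ l $ j \<noteq> 0" by (auto simp: transpose_def)
  then show ?case using Suc.IH[of l] assms(1) by (auto simp: drift_matrix_def)
qed

text \<open>Entries outside block 0 vanish, so the quadratic form sees only the projection of
  \<open>\<xi>\<close> to that block, where ellipticity applies.\<close>

lemma diffusion_matrix_psd:
  fixes B :: "real ^ 'n::finite ^ 'n"
  assumes "0 < \<nu>" "diffusion_matrix \<nu> b B" shows "sym_nonneg_matrix B"
  unfolding sym_nonneg_matrix_def
proof (intro conjI allI)
  show "transpose B = B" using assms(2) by (simp add: diffusion_matrix_def)
  fix \<xi> :: "real ^ 'n"
  define \<eta> where "\<eta> = block_embed b 0 (\<lambda>j. \<xi> $ j)"
  have z: "B $ r $ c = 0" if "\<not> (b r = 0 \<and> b c = 0)" for r c using assms(2) that by (auto simp: diffusion_matrix_def)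
  have "0 \<le> \<nu> * (norm \<eta>)\<^sup>2" using assms(1) by simp
  also have "\<dots> \<le> (B *v \<eta>) \<bullet> \<eta>" using assms(2) unfolding \<eta>_def diffusion_matrix_def by blast
  also have "\<dots> = (B *v \<xi>) \<bullet> \<xi>"
    unfolding inner_vec_def matrix_vector_mult_def
    by (simp, intro sum.cong refl)
       (auto simp: \<eta>_def block_embed_def block_def z intro!: sum.cong)
  finally show "0 \<le> (B *v \<xi>) \<bullet> \<xi>" .
qed

theorem mainTheorem2:
  fixes T \<nu> p C :: real
    and k :: nat
    and b :: "'n::finite \<Rightarrow> nat"
    and A B :: "real ^ 'n ^ 'n"
    and S :: "real \<Rightarrow> real ^ 'n ^ 'n"
  assumes "0 < T"
    and "block_decomposition k b"
    and "0 < \<nu>"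
    and "diffusion_matrix \<nu> b B"
    and "drift_matrix k b A"
    and "1 < p"
    and "0 < C"
    and "\<forall>f\<in>Bb_space T. \<forall>u. is_unique_solution T (\<lambda>t. L_ou A B) f u \<longrightarrow>
           W_norm T p k b u \<le> ennreal C * Lp_norm T p f"
    and "continuous_on {0..T} S"
    and "\<forall>t\<in>{0..T}. sym_nonneg_matrix (S t)"
  shows "\<forall>f\<in>Bb_space T. \<exists>u. is_unique_solution T (L_ou_S A B S) f u \<and>
           W_norm T p k b u \<le> ennreal C * Lp_norm T p f"
proof -
  have op: "(\<lambda>t. L_ou A B) = diffusion_op A (\<lambda>_. B)" by (simp add: fun_eq_iff L_ou_def diffusion_op_def)
  have opS: "L_ou_S A B S = diffusion_op A (\<lambda>t. B + S t)"
    by (simp add: fun_eq_iff L_ou_S_def L_ou_def diffusion_op_def bounded_bilinear.add_left[OF bounded_bilinear_matrix_mult] trace_add)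
  have bk: "b j \<le> k" for j using assms(2) by (auto simp: block_decomposition_def)
  have nil: "matrix_power (transpose A) (Suc k) = 0"
  proof -
    have "matrix_power (transpose A) (Suc k) $ i $ j = 0" for i j
      using drift_matrix_power[OF assms(5), of "Suc k" i j] bk[of j] by force
    then show ?thesis by (simp only: vec_eq_iff zero_index) blast
  qed
  interpret unperturbed_problem T A "flow k (transpose A)" B p C k b
  proof unfold_locales
    show "block b i \<noteq> {}" if "i \<le> k" for i
    proof -
      have "i \<in> range b" using that assms(2) by (simp add: block_decomposition_def)
      then show ?thesis by (auto simp: block_def)
    qed
  qed (use assms flow_has_vector_derivative[OF nil] flow_inverse[OF nil] diffusion_matrix_psd[OF assms(3,4)] op in auto)
  show ?thesis unfolding opS using perturbed_estimate assms(9,10) by blast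
qed

end
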